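(* Let $\mathcal{A}_F$ be the operator on the Hilbert space $\mathcal{H}_F$ defined in the context, and let $(T_F(t))_{t\ge0}$ be the strongly continuous contraction semigroup on $\mathcal{H}_F$ generated by $\mathcal{A}_F$. There exist constants $M>0$ and $\omega>0$ such that for every $U_0\in\mathcal{H}_F$, uniquely decomposed as $U_0=W_0+V_0$ with $W_0\in\ker(\mathcal{A}_F)$ and $V_0\in\operatorname{range}(\mathcal{A}_F)$ (according to the direct sum $\mathcal{H}_F=\ker(\mathcal{A}_F)\oplus\operatorname{range}(\mathcal{A}_F)$), one has $$\|T_F(t)U_0-W_0\|_{\mathcal{H}_F}\le M e^{-\omega t}\|U_0\|_{\mathcal{H}_F}\qquad\text{for all }t\ge0 .$$ The constants $M,\omega$ do not depend on $U_0$.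
   Context: Fix real numbers $0<L_1<L_2<L_3$ and $a,b,m,k>0$. Put $I=(L_1,L_2)$ and $J=(0,L_1)\cup(L_2,L_3)$. All functions are complex valued; $H^s(J)$ consists of functions that are $H^s$ on each of the two components of $J$ separately, and point values of functions on $J$ at $0,L_1,L_2,L_3$ are the one-sided traces from within $J$. State space: $\mathcal{H}_F$ is the set of $[u^1,v^1,\theta,u^2,v^2]'\in H^1(I)\times H^1(J)\times L^2(I)\times L^2(I)\times L^2(J)$ with $v^1(0)=v^1(L_3)=0$ and $u^1(L_i)=v^1(L_i)$ for $i=1,2$, with inner product $$\langle U,\tilde U\rangle_{\mathcal{H}_F}=\int_I\left(a u^1_x\overline{\tilde u^1_x}+u^2\overline{\tilde u^2}+\theta\overline{\tilde\theta}\right)dx+\int_J\left(b v^1_x\overline{\tilde v^1_x}+v^2\overline{\tilde v^2}\right)dx ,$$ which makes it a Hilbert space. Operator: $D(\mathcal{A}_F)$ is the set of $U\in\mathcal{H}_F$ with $u^1\in H^2(I)$, $v^1\in H^2(J)$, $\theta\in H^2(I)$, $u^2\in H^1(I)$, $v^2\in H^1(J)$, $u^2(L_i)=v^2(L_i)$, $v^2(0)=v^2(L_3)=0$, $au^1_x(L_i)-m\theta(L_i)=bv^1_x(L_i)$, $\theta_x(L_i)=0$ for $i=1,2$, and $$\mathcal{A}_FU=\left[u^2,\ v^2,\ k^2\theta_{xx}-mu^2_x,\ au^1_{xx}-m\theta_x,\ bv^1_{xx}\right]'.$$ (This is the first-order form of the transmission problem $u_{tt}-au_{xx}+m\theta_x=0$,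 $\theta_t-k^2\theta_{xx}+mu_{xt}=0$ on $[L_1,L_2]$, $v_{tt}-bv_{xx}=0$ on $[0,L_1]\cup[L_2,L_3]$, with Fourier's law for heat conduction, and with $u^2=u_t$, $v^2=v_t$.) *)

theory Defs
  imports "HOL-Analysis.Analysis"
begin

section \<open>Measurable functions modulo almost everywhere equality\<close>

definition ae_rel :: "(real \<Rightarrow> complex) \<Rightarrow> (real \<Rightarrow> complex) \<Rightarrow> bool" where
  "ae_rel f g \<longleftrightarrow> f \<in> borel_measurable lborel \<and> g \<in> borel_measurable lborel
     \<and> (AE x in lborel. f x = g x)"

lemma part_equivp_ae_rel: "part_equivp ae_rel"
proof (rule part_equivpI)
  show "\<exists>f. ae_rel f f"
    by (rule exI[of _ "\<lambda>_. 0"]) (simp add: ae_rel_def)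
  show "symp ae_rel"
    by (rule sympI) (auto simp: ae_rel_def eq_commute)
  show "transp ae_rel"
    by (rule transpI) (auto simp: ae_rel_def elim: AE_mp)
qed

quotient_type l0 = "real \<Rightarrow> complex" / partial: ae_rel
  by (rule part_equivp_ae_rel)

instantiation l0 :: ab_group_add
begin

lift_definition zero_l0 :: l0 is "\<lambda>_. 0"
  by (simp add: ae_rel_def)

lift_definition plus_l0 :: "l0 \<Rightarrow> l0 \<Rightarrow> l0" is "\<lambda>f g x. f x + g x"
  by (auto simp: ae_rel_def)

lift_definition minus_l0 :: "l0 \<Rightarrow> l0 \<Rightarrow> l0" is "\<lambda>f g x. f x - g x"
  by (auto simp: ae_rel_def)

lift_definition uminus_l0 :: "l0 \<Rightarrow> l0" is "\<lambda>f x. - f x"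
  by (auto simp: ae_rel_def)

instance
  by standard (transfer; auto simp: ae_rel_def algebra_simps)+

end

lift_definition scale_l0 :: "complex \<Rightarrow> l0 \<Rightarrow> l0" is "\<lambda>c f x. c * f x"
  by (auto simp: ae_rel_def)

section \<open>Lebesgue and Sobolev spaces on an open set \<open>S\<close> of the line\<close>

text \<open>Elements of \<open>Lsq S\<close> are extended by zero outside \<open>S\<close>, so that equality of elements is
  equality almost everywhere on \<open>S\<close>.\<close>

lift_definition sq_integrable :: "real set \<Rightarrow> l0 \<Rightarrow> bool" is
  "\<lambda>S f. (AE x in lborel. x \<notin> S \<longrightarrow> f x = 0) \<and> integrable lborel (\<lambda>x. (cmod (f x))\<^sup>2)"
proof -
  fix S :: "real set" and f g :: "real \<Rightarrow> complex"
  assume "ae_rel f g"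
  then have [measurable]: "f \<in> borel_measurable lborel" "g \<in> borel_measurable lborel"
    and ae: "AE x in lborel. f x = g x"
    by (auto simp: ae_rel_def)
  have "integrable lborel (\<lambda>x. (cmod (f x))\<^sup>2) = integrable lborel (\<lambda>x. (cmod (g x))\<^sup>2)"
    by (rule integrable_cong_AE) (use ae in auto)
  moreover have "(AE x in lborel. x \<notin> S \<longrightarrow> f x = 0) = (AE x in lborel. x \<notin> S \<longrightarrow> g x = 0)"
    using ae by (intro iffI; (elim AE_mp)?) auto
  ultimately show "((AE x in lborel. x \<notin> S \<longrightarrow> f x = 0) \<and> integrable lborel (\<lambda>x. (cmod (f x))\<^sup>2))
     = ((AE x in lborel. x \<notin> S \<longrightarrow> g x = 0) \<and> integrable lborel (\<lambda>x. (cmod (g x))\<^sup>2))"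
    by simp
qed

definition Lsq :: "real set \<Rightarrow> l0 set" where
  "Lsq S = {f. sq_integrable S f}"

text \<open>The pairing is over the whole line; for functions in \<open>Lsq S\<close> it is the integral over \<open>S\<close>.\<close>

lift_definition l2_inner :: "l0 \<Rightarrow> l0 \<Rightarrow> complex" is
  "\<lambda>f g. LINT x|lborel. f x * cnj (g x)"
proof -
  fix f f' g g' :: "real \<Rightarrow> complex"
  have cnj_meas: "(\<lambda>x. cnj (h x)) \<in> borel_measurable borel"
    if "h \<in> borel_measurable borel" for h :: "real \<Rightarrow> complex"
    using that by (rule borel_measurable_continuous_on[rotated]) (intro continuous_intros)
  assume "ae_rel f f'" "ae_rel g g'"
  then show "(LINT x|lborel. f x * cnj (g x)) = (LINT x|lborel. f' x * cnj (g' x))"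
    by (intro integral_cong_AE) (auto simp: ae_rel_def intro!: borel_measurable_times cnj_meas)
qed

text \<open>Compactly supported \<open>C\<^sup>1\<close> test functions on \<open>S\<close>, together with their derivative. Testing with
  \<open>C\<^sup>1\<close> or with \<open>C\<^sup>\<infinity>\<close> functions gives the same weak derivatives, and so does testing with real or
  with complex valued functions.\<close>

definition test_function :: "real set \<Rightarrow> (real \<Rightarrow> real) \<Rightarrow> (real \<Rightarrow> real) \<Rightarrow> bool" where
  "test_function S \<phi> \<phi>' \<longleftrightarrow>
     (\<forall>x. (\<phi> has_real_derivative \<phi>' x) (at x)) \<and> continuous_on UNIV \<phi>'
     \<and> (\<exists>K. compact K \<and> K \<subseteq> S \<and> (\<forall>x. x \<notin> K \<longrightarrow> \<phi> x = 0))"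

lemma test_function_measurable:
  assumes "test_function S \<phi> \<phi>'"
  shows "\<phi> \<in> borel_measurable borel" "\<phi>' \<in> borel_measurable borel"
proof -
  have "continuous_on UNIV \<phi>"
    using assms by (auto simp: test_function_def intro!: continuous_at_imp_continuous_on DERIV_isCont)
  then show "\<phi> \<in> borel_measurable borel"
    by (rule borel_measurable_continuous_onI)
  show "\<phi>' \<in> borel_measurable borel"
    using assms by (intro borel_measurable_continuous_onI) (auto simp: test_function_def)
qed

lift_definition weak_derivative_identity :: "real set \<Rightarrow> l0 \<Rightarrow> l0 \<Rightarrow> bool" is
  "\<lambda>S f g. \<forall>\<phi> \<phi>'. test_function S \<phi> \<phi>' \<longrightarrow>
     (LINT x|lborel. \<phi>' x *\<^sub>R f x) = - (LINT x|lborel. \<phi> x *\<^sub>R g x)"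
proof -
  fix S :: "real set" and f f' g g' :: "real \<Rightarrow> complex"
  assume "ae_rel f f'" "ae_rel g g'"
  then have "(LINT x|lborel. \<phi>' x *\<^sub>R f x) = (LINT x|lborel. \<phi>' x *\<^sub>R f' x)"
    and "(LINT x|lborel. \<phi> x *\<^sub>R g x) = (LINT x|lborel. \<phi> x *\<^sub>R g' x)"
    if "test_function S \<phi> \<phi>'" for \<phi> \<phi>'
    using test_function_measurable[OF that]
    by (auto intro!: integral_cong_AE simp: ae_rel_def)
  then show "(\<forall>\<phi> \<phi>'. test_function S \<phi> \<phi>' \<longrightarrow>
      (LINT x|lborel. \<phi>' x *\<^sub>R f x) = - (LINT x|lborel. \<phi> x *\<^sub>R g x))
    = (\<forall>\<phi> \<phi>'. test_function S \<phi> \<phi>' \<longrightarrow>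
      (LINT x|lborel. \<phi>' x *\<^sub>R f' x) = - (LINT x|lborel. \<phi> x *\<^sub>R g' x))"
    by simp
qed

definition has_weak_derivative :: "real set \<Rightarrow> l0 \<Rightarrow> l0 \<Rightarrow> bool" where
  "has_weak_derivative S f g \<longleftrightarrow> f \<in> Lsq S \<and> g \<in> Lsq S \<and> weak_derivative_identity S f g"

text \<open>For a disjoint union \<open>S\<close> of two open intervals the spaces \<open>Sob1 S\<close> and \<open>Sob2 S\<close> consist of the
  functions that are \<open>H\<^sup>1\<close>, respectively \<open>H\<^sup>2\<close>, on each component separately, since a test function
  on \<open>S\<close> is a sum of test functions on the components.\<close>

definition Sob1 :: "real set \<Rightarrow> l0 set" where
  "Sob1 S = {f. \<exists>g. has_weak_derivative S f g}"

definition wderiv :: "real set \<Rightarrow> l0 \<Rightarrow> l0" where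
  "wderiv S f = (THE g. has_weak_derivative S f g)"

definition Sob2 :: "real set \<Rightarrow> l0 set" where
  "Sob2 S = {f \<in> Sob1 S. wderiv S f \<in> Sob1 S}"

text \<open>The trace at a boundary point \<open>p\<close> of \<open>S\<close> is the limit at \<open>p\<close>, from within \<open>S\<close>, of the continuous
  representative on \<open>S\<close>.\<close>

lift_definition has_trace :: "real set \<Rightarrow> l0 \<Rightarrow> real \<Rightarrow> complex \<Rightarrow> bool" is
  "\<lambda>S f p c. \<exists>g. continuous_on S g \<and> (AE x in lborel. x \<in> S \<longrightarrow> f x = g x)
     \<and> (g \<longlongrightarrow> c) (at p within S)"
proof (intro ext)
  fix S :: "real set" and p :: real and c :: complex and f f' :: "real \<Rightarrow> complex"
  assume "ae_rel f f'"
  then have ae: "AE x in lborel. f x = f' x"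
    by (simp add: ae_rel_def)
  have "(AE x in lborel. x \<in> S \<longrightarrow> f x = g x) = (AE x in lborel. x \<in> S \<longrightarrow> f' x = g x)" for g
    using ae by (intro iffI; (elim AE_mp)?) auto
  then show "(\<exists>g. continuous_on S g \<and> (AE x in lborel. x \<in> S \<longrightarrow> f x = g x)
      \<and> (g \<longlongrightarrow> c) (at p within S))
    = (\<exists>g. continuous_on S g \<and> (AE x in lborel. x \<in> S \<longrightarrow> f' x = g x)
      \<and> (g \<longlongrightarrow> c) (at p within S))"
    by simp
qed

definition trace :: "real set \<Rightarrow> l0 \<Rightarrow> real \<Rightarrow> complex" where
  "trace S f p = (THE c. has_trace S f p c)"

section \<open>Strongly continuous contraction semigroups and their generators\<close>

text \<open>\<open>X\<close> is the carrier of a complex normed space with scalar multiplication \<open>sc\<close> and norm \<open>N\<close>.\<close>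

definition contraction_semigroup ::
  "'a::ab_group_add set \<Rightarrow> (complex \<Rightarrow> 'a \<Rightarrow> 'a) \<Rightarrow> ('a \<Rightarrow> real) \<Rightarrow> (real \<Rightarrow> 'a \<Rightarrow> 'a) \<Rightarrow> bool" where
  "contraction_semigroup X sc N T \<longleftrightarrow>
     (\<forall>t\<ge>0. \<forall>x\<in>X. T t x \<in> X) \<and>
     (\<forall>t\<ge>0. \<forall>x\<in>X. \<forall>y\<in>X. T t (x + y) = T t x + T t y) \<and>
     (\<forall>t\<ge>0. \<forall>c. \<forall>x\<in>X. T t (sc c x) = sc c (T t x)) \<and>
     (\<forall>t\<ge>0. \<forall>x\<in>X. N (T t x) \<le> N x) \<and>
     (\<forall>x\<in>X. T 0 x = x) \<and>
     (\<forall>s\<ge>0. \<forall>t\<ge>0. \<forall>x\<in>X. T (s + t) x = T s (T t x)) \<and>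
     (\<forall>x\<in>X. ((\<lambda>t. N (T t x - x)) \<longlongrightarrow> 0) (at_right 0))"

definition generator_graph ::
  "'a::ab_group_add set \<Rightarrow> (complex \<Rightarrow> 'a \<Rightarrow> 'a) \<Rightarrow> ('a \<Rightarrow> real) \<Rightarrow> (real \<Rightarrow> 'a \<Rightarrow> 'a) \<Rightarrow> ('a \<times> 'a) set" where
  "generator_graph X sc N T =
     {(x, y). x \<in> X \<and> y \<in> X \<and>
       ((\<lambda>t. N (sc (complex_of_real (1 / t)) (T t x - x) - y)) \<longlongrightarrow> 0) (at_right 0)}"

definition generates ::
  "'a::ab_group_add set \<Rightarrow> (complex \<Rightarrow> 'a \<Rightarrow> 'a) \<Rightarrow> ('a \<Rightarrow> real) \<Rightarrow> 'a set \<Rightarrow> ('a \<Rightarrow> 'a)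
     \<Rightarrow> (real \<Rightarrow> 'a \<Rightarrow> 'a) \<Rightarrow> bool" where
  "generates X sc N D A T \<longleftrightarrow>
     contraction_semigroup X sc N T \<and> generator_graph X sc N T = {(x, A x) |x. x \<in> D}"

section \<open>The thermoelastic transmission problem with Fourier's law\<close>

text \<open>A state \<open>(u1, v1, \<theta>, u2, v2)\<close> has \<open>u1, \<theta>, u2\<close> living on \<open>I\<close> and \<open>v1, v2\<close> living on \<open>J\<close>; the
  indices are superscripts.\<close>

type_synonym state = "l0 \<times> l0 \<times> l0 \<times> l0 \<times> l0"

fun scale_state :: "complex \<Rightarrow> state \<Rightarrow> state" where
  "scale_state c (u1, v1, \<theta>, u2, v2) =
     (scale_l0 c u1, scale_l0 c v1, scale_l0 c \<theta>, scale_l0 c u2, scale_l0 c v2)"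

definition intI :: "real \<Rightarrow> real \<Rightarrow> real set" where
  "intI L1 L2 = {L1<..<L2}"

definition setJ :: "real \<Rightarrow> real \<Rightarrow> real \<Rightarrow> real set" where
  "setJ L1 L2 L3 = {0<..<L1} \<union> {L2<..<L3}"

definition HF :: "real \<Rightarrow> real \<Rightarrow> real \<Rightarrow> state set" where
  "HF L1 L2 L3 = (let I = intI L1 L2; J = setJ L1 L2 L3 in
     {(u1, v1, \<theta>, u2, v2).
        u1 \<in> Sob1 I \<and> v1 \<in> Sob1 J \<and> \<theta> \<in> Lsq I \<and> u2 \<in> Lsq I \<and> v2 \<in> Lsq J \<and>
        trace J v1 0 = 0 \<and> trace J v1 L3 = 0 \<and>
        (\<forall>p\<in>{L1, L2}. trace I u1 p = trace J v1 p)})"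

fun innerF :: "real \<Rightarrow> real \<Rightarrow> real \<Rightarrow> real \<Rightarrow> real \<Rightarrow> state \<Rightarrow> state \<Rightarrow> complex" where
  "innerF L1 L2 L3 a b (u1, v1, \<theta>, u2, v2) (u1', v1', \<theta>', u2', v2') =
     (let I = intI L1 L2; J = setJ L1 L2 L3 in
        (complex_of_real a * l2_inner (wderiv I u1) (wderiv I u1') + l2_inner u2 u2' + l2_inner \<theta> \<theta>')
      + (complex_of_real b * l2_inner (wderiv J v1) (wderiv J v1') + l2_inner v2 v2'))"

definition normF :: "real \<Rightarrow> real \<Rightarrow> real \<Rightarrow> real \<Rightarrow> real \<Rightarrow> state \<Rightarrow> real" where
  "normF L1 L2 L3 a b U = sqrt (Re (innerF L1 L2 L3 a b U U))"

definition domAF :: "real \<Rightarrow> real \<Rightarrow> real \<Rightarrow> real \<Rightarrow> real \<Rightarrow> real \<Rightarrow> state set" where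
  "domAF L1 L2 L3 a b m = (let I = intI L1 L2; J = setJ L1 L2 L3 in
     {(u1, v1, \<theta>, u2, v2).
        (u1, v1, \<theta>, u2, v2) \<in> HF L1 L2 L3 \<and>
        u1 \<in> Sob2 I \<and> v1 \<in> Sob2 J \<and> \<theta> \<in> Sob2 I \<and> u2 \<in> Sob1 I \<and> v2 \<in> Sob1 J \<and>
        trace J v2 0 = 0 \<and> trace J v2 L3 = 0 \<and>
        (\<forall>p\<in>{L1, L2}.
           trace I u2 p = trace J v2 p \<and>
           complex_of_real a * trace I (wderiv I u1) p - complex_of_real m * trace I \<theta> p
             = complex_of_real b * trace J (wderiv J v1) p \<and>
           trace I (wderiv I \<theta>) p = 0)})"

fun opAF :: "real \<Rightarrow> real \<Rightarrow> real \<Rightarrow> real \<Rightarrow> real \<Rightarrow> real \<Rightarrow> real \<Rightarrow> state \<Rightarrow> state" where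
  "opAF L1 L2 L3 a b m k (u1, v1, \<theta>, u2, v2) =
     (let I = intI L1 L2; J = setJ L1 L2 L3 in
       (u2,
        v2,
        scale_l0 (complex_of_real (k\<^sup>2)) (wderiv I (wderiv I \<theta>))
          - scale_l0 (complex_of_real m) (wderiv I u2),
        scale_l0 (complex_of_real a) (wderiv I (wderiv I u1))
          - scale_l0 (complex_of_real m) (wderiv I \<theta>),
        scale_l0 (complex_of_real b) (wderiv J (wderiv J v1))))"

definition kerAF :: "real \<Rightarrow> real \<Rightarrow> real \<Rightarrow> real \<Rightarrow> real \<Rightarrow> real \<Rightarrow> real \<Rightarrow> state set" where
  "kerAF L1 L2 L3 a b m k = {U \<in> domAF L1 L2 L3 a b m. opAF L1 L2 L3 a b m k U = 0}"

definition rangeAF :: "real \<Rightarrow> real \<Rightarrow> real \<Rightarrow> real \<Rightarrow> real \<Rightarrow> real \<Rightarrow> real \<Rightarrow> state set" where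
  "rangeAF L1 L2 L3 a b m k = opAF L1 L2 L3 a b m k ` domAF L1 L2 L3 a b m"

end

theory Submission
  imports Defs
begin

text \<open>Exponential decay follows from a Lyapunov functional. The range of \<open>A\<close> is the null space of the
  conserved functional \<open>\<integral>\<theta> + m (u(L\<^sub>2) - u(L\<^sub>1))\<close>, and \<open>A\<close> is bounded below there, so a solution in the
  range can be written as \<open>A y\<close>, the time derivative of another solution \<open>y\<close> whose energy is dominated by
  that of \<open>A y\<close>. The energies of \<open>y\<close> and of \<open>A y\<close> decrease at the rates \<open>2 k\<^sup>2 \<parallel>\<theta>\<^sub>x\<parallel>\<^sup>2\<close> of the respective
  solutions.

  Integrating the heat equation of \<open>y\<close> once in space, these two dissipations control the deviation of
  the displacement of \<open>A y\<close> on \<open>I\<close> from its affine interpolant. The two parameters of the interpolant are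
  recovered from moments against a test function \<open>f\<close> and its derivative; the second time derivative of
  the moment against \<open>f\<close> is again controlled, by the wave equation, and hence, up to time derivatives of
  bounded functionals, so is the square of the moment. This bounds the displacement at the interfaces
  without a compactness argument. The multipliers \<open>k\<^sup>2 \<theta>\<^sub>x - m u\<^sub>t\<close> (of \<open>y\<close>), \<open>u\<close> and \<open>(x - x\<^sub>0) u\<^sub>x\<close>, \<open>(x - x\<^sub>0) v\<^sub>x\<close>
  then give the kinetic and the potential energy on \<open>I\<close>, the interface terms, and the energy on \<open>J\<close>.

  The solutions with \<open>y\<close> smooth enough are dense in the range, because \<open>(T(h) y - y) / h\<close> tends to \<open>A y\<close>.\<close>

section \<open>Square integrable functions as a real inner product space\<close>

text \<open>Passing down to \<open>y\<close>, rather than up to \<open>A (A y)\<close>, keeps every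
  functional bounded by the single quantity \<open>(N (A y))^2\<close>, because \<open>A\<close> is
  bounded below on \<open>D0\<close>. No derivative is lost, so the decay is exponential and uniform
  in the energy norm itself. The obstacle is a circle among the estimates: the kinetic and the
  potential energy on \<open>I\<close> need the interface stresses, and these need the energy on
  \<open>I\<close>. It is broken by a calculus with two levels. At first the stresses are merely
  bounded (\<open>bdd\<close>), while the interface displacements and \<theta> are already small
  (\<open>ctrl\<close>). A product of a bounded and a small quantity is small, and this suffices for
  the energy on \<open>I\<close>; afterwards the stresses become small as well. In the final
  functional \<open>M * (E y + (N y)^2) - Q y\<close> a large \<open>M\<close> serves twice: the two
  dissipations absorb the error term, and the functional stays comparable with
  \<open>E y\<close>.\<close>

lemma rep_l0_ae_rel: "ae_rel (rep_l0 f) (rep_l0 f)"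
  using Quotient3_rep_reflp[OF Quotient3_l0] .

lemma rep_l0_measurable [measurable]: "rep_l0 f \<in> borel_measurable borel"
  using rep_l0_ae_rel[of f] by (simp add: ae_rel_def)

lemma abs_rep_l0 [simp]: "abs_l0 (rep_l0 f) = f"
  using Quotient3_abs_rep[OF Quotient3_l0] .

lemma rep_abs_l0:
  assumes "f \<in> borel_measurable borel"
  shows "AE x in lborel. rep_l0 (abs_l0 f) x = f x"
proof -
  have "ae_rel f f" using assms by (simp add: ae_rel_def)
  then have "ae_rel (rep_l0 (abs_l0 f)) f"
    using Quotient3_rep_abs[OF Quotient3_l0] by blast
  then show ?thesis by (simp add: ae_rel_def)
qed

lemma l0_eqI: "AE x in lborel. rep_l0 f x = rep_l0 g x \<Longrightarrow> f = g"
  using Quotient3_rel_rep[OF Quotient3_l0, of f g] by (simp add: ae_rel_def)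

text \<open>The representative chosen for a sum is unrelated to those of the summands, so algebra on
  classes is matched by pointwise algebra only almost everywhere.\<close>

lemma rep_l0_add: "AE x in lborel. rep_l0 (f + g) x = rep_l0 f x + rep_l0 g x"
proof -
  have "f + g = abs_l0 (\<lambda>x. rep_l0 f x + rep_l0 g x)"
    using plus_l0.abs_eq[OF rep_l0_ae_rel rep_l0_ae_rel, of f g] by simp
  then show ?thesis by (simp add: rep_abs_l0)
qed

lemma rep_l0_diff: "AE x in lborel. rep_l0 (f - g) x = rep_l0 f x - rep_l0 g x"
proof -
  have "f - g = abs_l0 (\<lambda>x. rep_l0 f x - rep_l0 g x)"
    using minus_l0.abs_eq[OF rep_l0_ae_rel rep_l0_ae_rel, of f g] by simp
  then show ?thesis by (simp add: rep_abs_l0)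
qed

lemma rep_l0_scale: "AE x in lborel. rep_l0 (scale_l0 c f) x = c * rep_l0 f x"
proof -
  have "scale_l0 c f = abs_l0 (\<lambda>x. c * rep_l0 f x)"
    using scale_l0.abs_eq[OF rep_l0_ae_rel, of c f] by simp
  then show ?thesis by (simp add: rep_abs_l0)
qed

lemma rep_l0_uminus: "AE x in lborel. rep_l0 (- f) x = - rep_l0 f x"
proof -
  have "- f = abs_l0 (\<lambda>x. - rep_l0 f x)"
    using uminus_l0.abs_eq[OF rep_l0_ae_rel, of f] by simp
  then show ?thesis by (simp add: rep_abs_l0)
qed

lemma rep_l0_zero: "AE x in lborel. rep_l0 0 x = 0"
  using rep_abs_l0[of "\<lambda>_. 0"] by (simp add: zero_l0_def)

lemma sq_integrable_rep:
  "sq_integrable S f \<longleftrightarrow> (AE x in lborel. x \<notin> S \<longrightarrow> rep_l0 f x = 0) \<and>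
     integrable lborel (\<lambda>x. (cmod (rep_l0 f x))\<^sup>2)"
  using sq_integrable.abs_eq[OF rep_l0_ae_rel, of S f] by simp

lemma l2_inner_rep: "l2_inner f g = (LINT x|lborel. rep_l0 f x * cnj (rep_l0 g x))"
  using l2_inner.abs_eq[OF rep_l0_ae_rel rep_l0_ae_rel, of f g] by simp

lemma weak_derivative_identity_rep:
  "weak_derivative_identity S f g \<longleftrightarrow> (\<forall>\<phi> \<phi>'. test_function S \<phi> \<phi>' \<longrightarrow>
     (LINT x|lborel. \<phi>' x *\<^sub>R rep_l0 f x) = - (LINT x|lborel. \<phi> x *\<^sub>R rep_l0 g x))"
  using weak_derivative_identity.abs_eq[OF rep_l0_ae_rel rep_l0_ae_rel, of S f g] by simp

lemma has_trace_rep: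
  "has_trace S f p c \<longleftrightarrow> (\<exists>g. continuous_on S g \<and>
     (AE x in lborel. x \<in> S \<longrightarrow> rep_l0 f x = g x) \<and> (g \<longlongrightarrow> c) (at p within S))"
  using has_trace.abs_eq[OF rep_l0_ae_rel, of S f] by (simp add: fun_eq_iff)

lemma borel_measurable_cnj [measurable (raw)]:
  "f \<in> borel_measurable M \<Longrightarrow> (\<lambda>x. cnj (f x)) \<in> borel_measurable M"
  by (rule borel_measurable_continuous_on[of cnj]) (auto intro: continuous_intros)

lemma integrable_mult_cnj:
  fixes f g :: "real \<Rightarrow> complex"
  assumes [measurable]: "f \<in> borel_measurable borel" "g \<in> borel_measurable borel"
    and "integrable lborel (\<lambda>x. (cmod (f x))\<^sup>2)" "integrable lborel (\<lambda>x. (cmod (g x))\<^sup>2)"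
  shows "integrable lborel (\<lambda>x. f x * cnj (g x))"
proof (rule Bochner_Integration.integrable_bound)
  show "integrable lborel (\<lambda>x. (cmod (f x))\<^sup>2 + (cmod (g x))\<^sup>2)" using assms by simp
  show "AE x in lborel. norm (f x * cnj (g x)) \<le> norm ((cmod (f x))\<^sup>2 + (cmod (g x))\<^sup>2)"
  proof (rule AE_I2)
    fix x
    have "2 * (cmod (f x) * cmod (g x)) \<le> (cmod (f x))\<^sup>2 + (cmod (g x))\<^sup>2"
      using sum_squares_bound[of "cmod (f x)" "cmod (g x)"] by (simp add: mult.assoc)
    moreover have "0 \<le> cmod (f x) * cmod (g x)" by simp
    ultimately have "cmod (f x) * cmod (g x) \<le> (cmod (f x))\<^sup>2 + (cmod (g x))\<^sup>2" by linarith
    then show "norm (f x * cnj (g x)) \<le> norm ((cmod (f x))\<^sup>2 + (cmod (g x))\<^sup>2)"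
      by (simp add: norm_mult)
  qed
qed simp

text \<open>A type is introduced so that the theory of real inner product spaces applies. It covers
  the whole line; functions living on an interval are singled out by the predicate
  \<open>supp\<close>, so that all the intervals share one type.\<close>

typedef l2 = "Lsq UNIV"
proof
  have "integrable lborel (\<lambda>x. (cmod (rep_l0 0 x))\<^sup>2)"
  proof (subst integrable_cong_AE)
    show "AE x in lborel. (cmod (rep_l0 0 x))\<^sup>2 = 0" using rep_l0_zero by auto
  qed auto
  then show "0 \<in> Lsq UNIV" by (simp add: Lsq_def sq_integrable_rep)
qed

definition fn :: "l2 \<Rightarrow> real \<Rightarrow> complex" where "fn f = rep_l0 (Rep_l2 f)"

definition sqi :: "(real \<Rightarrow> complex) \<Rightarrow> bool" where
  "sqi f \<longleftrightarrow> f \<in> borel_measurable borel \<and> integrable lborel (\<lambda>x. (cmod (f x))\<^sup>2)"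

definition mk :: "(real \<Rightarrow> complex) \<Rightarrow> l2" where "mk f = Abs_l2 (abs_l0 f)"

text \<open>Meaningful only for square integrable classes; elsewhere the value is unspecified, hence
  the membership premises in the lemmas about \<open>el\<close>.\<close>

definition el :: "l0 \<Rightarrow> l2" where "el f = Abs_l2 f"

lemma fn_measurable [measurable]: "fn f \<in> borel_measurable borel"
  by (simp add: fn_def)

lemma sqi_fn: "sqi (fn f)"
  using Rep_l2[of f] by (simp add: sqi_def fn_def Lsq_def sq_integrable_rep)

lemma sqi_cong:
  assumes "sqi f" "AE x in lborel. f x = g x" "g \<in> borel_measurable borel"
  shows "sqi g"
proof -
  have "integrable lborel (\<lambda>x. (cmod (g x))\<^sup>2) = integrable lborel (\<lambda>x. (cmod (f x))\<^sup>2)"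
    by (rule integrable_cong_AE) (use assms in \<open>auto simp: sqi_def\<close>)
  with assms show ?thesis by (simp add: sqi_def)
qed

lemma sqi_bound:
  assumes "sqi g" "f \<in> borel_measurable borel" "AE x in lborel. cmod (f x) \<le> C * cmod (g x)"
  shows "sqi f"
  unfolding sqi_def
proof
  show "integrable lborel (\<lambda>x. (cmod (f x))\<^sup>2)"
  proof (rule Bochner_Integration.integrable_bound)
    show "integrable lborel (\<lambda>x. C\<^sup>2 * (cmod (g x))\<^sup>2)" using assms by (simp add: sqi_def)
    show "AE x in lborel. norm ((cmod (f x))\<^sup>2) \<le> norm (C\<^sup>2 * (cmod (g x))\<^sup>2)"
      using assms(3) by eventually_elim (simp add: power_mult_distrib[symmetric] power_mono)
  qed (use assms in measurable)
qed fact

lemma sqi_add: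
  assumes "sqi f" "sqi g" shows "sqi (\<lambda>x. f x + g x)"
  unfolding sqi_def
proof
  show "integrable lborel (\<lambda>x. (cmod (f x + g x))\<^sup>2)"
  proof (rule Bochner_Integration.integrable_bound)
    show "integrable lborel (\<lambda>x. 2 * (cmod (f x))\<^sup>2 + 2 * (cmod (g x))\<^sup>2)"
      using assms by (simp add: sqi_def)
    show "AE x in lborel. norm ((cmod (f x + g x))\<^sup>2) \<le> norm (2 * (cmod (f x))\<^sup>2 + 2 * (cmod (g x))\<^sup>2)"
    proof (rule AE_I2)
      fix x
      have "(cmod (f x + g x))\<^sup>2 \<le> (cmod (f x) + cmod (g x))\<^sup>2"
        by (intro power_mono norm_triangle_ineq) simp
      also have "\<dots> \<le> 2 * (cmod (f x))\<^sup>2 + 2 * (cmod (g x))\<^sup>2"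
        using sum_squares_bound[of "cmod (f x)" "cmod (g x)"] by (simp add: power2_sum)
      finally show "norm ((cmod (f x + g x))\<^sup>2) \<le> norm (2 * (cmod (f x))\<^sup>2 + 2 * (cmod (g x))\<^sup>2)" by simp
    qed
  qed (use assms in \<open>auto simp: sqi_def\<close>)
qed (use assms in \<open>auto simp: sqi_def\<close>)

lemma sqi_scale: "sqi f \<Longrightarrow> sqi (\<lambda>x. c * f x)"
  by (auto simp: sqi_def norm_mult power_mult_distrib)

lemma sqi_zero: "sqi (\<lambda>x. 0)" by (simp add: sqi_def)

lemma Lsq_iff_sqi: "f \<in> Lsq S \<longleftrightarrow> sqi (rep_l0 f) \<and> (AE x in lborel. x \<notin> S \<longrightarrow> rep_l0 f x = 0)"
  by (auto simp: Lsq_def sq_integrable_rep sqi_def)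

lemma Lsq_UNIV_iff: "f \<in> Lsq UNIV \<longleftrightarrow> sqi (rep_l0 f)"
  by (simp add: Lsq_iff_sqi)

lemma Lsq_UNIV: "f \<in> Lsq S \<Longrightarrow> f \<in> Lsq UNIV"
  by (simp add: Lsq_iff_sqi)

lemma Rep_el: "f \<in> Lsq S \<Longrightarrow> Rep_l2 (el f) = f"
  by (simp add: el_def Abs_l2_inverse Lsq_UNIV)

lemma fn_el: "f \<in> Lsq S \<Longrightarrow> fn (el f) = rep_l0 f"
  by (simp add: Rep_el fn_def)

lemma el_Rep [simp]: "el (Rep_l2 f) = f"
  by (simp add: el_def Rep_l2_inverse)

lemma abs_l0_Lsq: "sqi f \<Longrightarrow> abs_l0 f \<in> Lsq UNIV"
  unfolding Lsq_UNIV_iff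
  by (rule sqi_cong[of f]) (use rep_abs_l0[of f] in \<open>auto simp: sqi_def\<close>)

lemma fn_mk: "sqi f \<Longrightarrow> AE x in lborel. fn (mk f) x = f x"
  by (simp add: fn_def mk_def Abs_l2_inverse abs_l0_Lsq) (simp add: rep_abs_l0 sqi_def)

lemma l2_eqI: "AE x in lborel. fn f x = fn g x \<Longrightarrow> f = g"
  by (metis Rep_l2_inject fn_def l0_eqI)

lemma l2_eq_iff: "f = g \<longleftrightarrow> (AE x in lborel. fn f x = fn g x)"
  using l2_eqI by auto

lemma LsqI:
  assumes "sqi g" "AE x in lborel. rep_l0 f x = g x" "AE x in lborel. x \<notin> S \<longrightarrow> g x = 0"
  shows "f \<in> Lsq S"
  unfolding Lsq_iff_sqi
proof
  have "AE x in lborel. g x = rep_l0 f x" using assms(2) by eventually_elim simp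
  then show "sqi (rep_l0 f)" by (rule sqi_cong[OF assms(1)]) simp
  show "AE x in lborel. x \<notin> S \<longrightarrow> rep_l0 f x = 0"
    using assms(2,3) by eventually_elim simp
qed

lemma Lsq_add:
  assumes "f \<in> Lsq S" "g \<in> Lsq S" shows "f + g \<in> Lsq S"
proof (rule LsqI[OF sqi_add rep_l0_add])
  have "AE x in lborel. x \<notin> S \<longrightarrow> rep_l0 f x = 0" "AE x in lborel. x \<notin> S \<longrightarrow> rep_l0 g x = 0"
    using assms by (simp_all add: Lsq_iff_sqi)
  then show "AE x in lborel. x \<notin> S \<longrightarrow> rep_l0 f x + rep_l0 g x = 0"
    by eventually_elim simp
qed (use assms in \<open>simp_all add: Lsq_iff_sqi\<close>)

lemma Lsq_scale:
  assumes "f \<in> Lsq S" shows "scale_l0 c f \<in> Lsq S"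
proof (rule LsqI[OF sqi_scale rep_l0_scale])
  have "AE x in lborel. x \<notin> S \<longrightarrow> rep_l0 f x = 0"
    using assms by (simp add: Lsq_iff_sqi)
  then show "AE x in lborel. x \<notin> S \<longrightarrow> c * rep_l0 f x = 0"
    by eventually_elim simp
qed (use assms in \<open>simp add: Lsq_iff_sqi\<close>)

lemma uminus_l0_scale: "- f = scale_l0 (- 1) f"
proof (rule l0_eqI)
  show "AE x in lborel. rep_l0 (- f) x = rep_l0 (scale_l0 (- 1) f) x"
    using rep_l0_scale[of "-1" f] rep_l0_uminus[of f] by eventually_elim simp
qed

lemma Lsq_uminus: "f \<in> Lsq S \<Longrightarrow> - f \<in> Lsq S"
  by (simp add: uminus_l0_scale Lsq_scale)

lemma Lsq_diff: "f \<in> Lsq S \<Longrightarrow> g \<in> Lsq S \<Longrightarrow> f - g \<in> Lsq S"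
  using Lsq_add[OF _ Lsq_uminus, of f S g] by simp

lemma Lsq_zero: "0 \<in> Lsq S"
  by (rule LsqI[OF sqi_zero rep_l0_zero]) simp

instantiation l2 :: real_vector
begin

definition zero_l2_def: "0 = el 0"
definition plus_l2_def: "f + g = el (Rep_l2 f + Rep_l2 g)"
definition minus_l2_def: "f - g = el (Rep_l2 f - Rep_l2 g)"
definition uminus_l2_def: "- f = el (- Rep_l2 f)"
definition scaleR_l2_def: "scaleR c f = el (scale_l0 (complex_of_real c) (Rep_l2 f))"

lemma fn_zero: "AE x in lborel. fn 0 x = 0"
  using rep_l0_zero by (simp add: zero_l2_def fn_el[OF Lsq_zero])

lemma fn_add: "AE x in lborel. fn (f + g) x = fn f x + fn g x"
  by (simp add: plus_l2_def fn_def Rep_el[OF Lsq_add[OF Rep_l2 Rep_l2]] rep_l0_add)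

lemma fn_diff: "AE x in lborel. fn (f - g) x = fn f x - fn g x"
  by (simp add: minus_l2_def fn_def Rep_el[OF Lsq_diff[OF Rep_l2 Rep_l2]] rep_l0_diff)

lemma fn_uminus: "AE x in lborel. fn (- f) x = - fn f x"
  by (simp add: uminus_l2_def fn_def Rep_el[OF Lsq_uminus[OF Rep_l2]] rep_l0_uminus)

lemma fn_scaleR: "AE x in lborel. fn (c *\<^sub>R f) x = c *\<^sub>R fn f x"
  by (simp add: scaleR_l2_def fn_def Rep_el[OF Lsq_scale[OF Rep_l2]] rep_l0_scale scaleR_conv_of_real)

instance
proof
  fix f g h :: l2 and c d :: real
  show "f + g + h = f + (g + h)"
    using fn_add[of f g] fn_add[of "f+g" h] fn_add[of g h] fn_add[of f "g+h"]
    by (intro l2_eqI, eventually_elim) simp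
  show "f + g = g + f"
    using fn_add[of f g] fn_add[of g f] by (intro l2_eqI, eventually_elim) simp
  show "0 + f = f"
    using fn_add[of 0 f] fn_zero by (intro l2_eqI, eventually_elim) simp
  show "- f + f = 0"
    using fn_add[of "-f" f] fn_zero fn_uminus[of f] by (intro l2_eqI, eventually_elim) simp
  show "f - g = f + - g"
    using fn_diff[of f g] fn_add[of f "-g"] fn_uminus[of g] by (intro l2_eqI, eventually_elim) simp
  show "c *\<^sub>R (f + g) = c *\<^sub>R f + c *\<^sub>R g"
    using fn_add[of f g] fn_scaleR[of c "f + g"] fn_add[of "c *\<^sub>R f" "c *\<^sub>R g"]
      fn_scaleR[of c f] fn_scaleR[of c g]
    by (intro l2_eqI, eventually_elim) (simp add: algebra_simps)
  show "(c + d) *\<^sub>R f = c *\<^sub>R f + d *\<^sub>R f"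
    using fn_scaleR[of "c + d" f] fn_add[of "c *\<^sub>R f" "d *\<^sub>R f"]
      fn_scaleR[of c f] fn_scaleR[of d f]
    by (intro l2_eqI, eventually_elim) (simp add: algebra_simps)
  show "c *\<^sub>R d *\<^sub>R f = (c * d) *\<^sub>R f"
    using fn_scaleR[of c "d *\<^sub>R f"] fn_scaleR[of "c*d" f] fn_scaleR[of d f]
    by (intro l2_eqI, eventually_elim) simp
  show "1 *\<^sub>R f = f"
    using fn_scaleR[of 1 f] by (intro l2_eqI, eventually_elim) simp
qed

end

lemma integrable_fn_cnj: "integrable lborel (\<lambda>x. fn f x * cnj (fn g x))"
  using sqi_fn[of f] sqi_fn[of g] by (intro integrable_mult_cnj) (simp_all add: sqi_def)

instantiation l2 :: real_inner
begin

text \<open>The real part is all that energies and multipliers need; the complex pairing returns as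
  \<open>ip\<close>, for moments and for the functional \<open>ell\<close>.\<close>

definition inner_l2_def: "inner f g = Re (l2_inner (Rep_l2 f) (Rep_l2 g))"
definition norm_l2_def: "norm (f::l2) = sqrt (inner f f)"
definition sgn_l2_def: "sgn (f::l2) = inverse (norm f) *\<^sub>R f"
definition dist_l2_def: "dist (f::l2) g = norm (f - g)"
definition uniformity_l2_def: "(uniformity :: (l2 \<times> l2) filter) = (INF e\<in>{0 <..}. principal {(x, y). dist x y < e})"
definition open_l2_def: "open (U :: l2 set) \<longleftrightarrow> (\<forall>x\<in>U. eventually (\<lambda>(x', y). x' = x \<longrightarrow> y \<in> U) uniformity)"

lemma inner_fn: "inner f g = Re (LINT x|lborel. fn f x * cnj (fn g x))"
  by (simp add: inner_l2_def l2_inner_rep fn_def)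

instance
proof
  fix f g h :: l2 and c d :: real
  show "sgn f = f /\<^sub>R norm f" by (simp add: sgn_l2_def)
  show "dist f g = norm (f - g)" by (simp add: dist_l2_def)
  show "(uniformity :: (l2 \<times> l2) filter) = (INF e\<in>{0 <..}. principal {(x, y). dist x y < e})"
    by (rule uniformity_l2_def)
  show "open U \<longleftrightarrow> (\<forall>x\<in>U. eventually (\<lambda>(x', y). x' = x \<longrightarrow> y \<in> U) uniformity)" for U :: "l2 set"
    by (rule open_l2_def)
  show "inner f g = inner g f"
  proof -
    have "(LINT x|lborel. fn f x * cnj (fn g x)) = cnj (LINT x|lborel. fn g x * cnj (fn f x))"
      by (simp add: Bochner_Integration.integral_cnj[symmetric] mult.commute del: Bochner_Integration.integral_cnj)
    then show ?thesis by (simp add: inner_fn)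
  qed
  show "inner (f + g) h = inner f h + inner g h"
  proof -
    have "(LINT x|lborel. fn (f + g) x * cnj (fn h x))
      = (LINT x|lborel. fn f x * cnj (fn h x) + fn g x * cnj (fn h x))"
      using fn_add[of f g] by (intro integral_cong_AE, simp, simp, eventually_elim) (simp add: algebra_simps)
    then show ?thesis by (simp add: inner_fn integrable_fn_cnj)
  qed
  show "inner (c *\<^sub>R f) g = c * inner f g"
  proof -
    have "(LINT x|lborel. fn (c *\<^sub>R f) x * cnj (fn g x))
      = (LINT x|lborel. c *\<^sub>R (fn f x * cnj (fn g x)))"
      using fn_scaleR[of c f] by (intro integral_cong_AE, simp, simp, eventually_elim) (simp add: algebra_simps)
    then show ?thesis by (simp add: inner_fn)
  qed
  have self: "inner f f = (LINT x|lborel. (cmod (fn f x))\<^sup>2)"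
  proof -
    have "(LINT x|lborel. fn f x * cnj (fn f x)) = complex_of_real (LINT x|lborel. (cmod (fn f x))\<^sup>2)"
      by (simp add: complex_norm_square[symmetric] del: of_real_power)
    then show ?thesis by (simp add: inner_fn)
  qed
  show "0 \<le> inner f f" by (simp add: self)
  show "inner f f = 0 \<longleftrightarrow> f = 0"
  proof -
    have "inner f f = 0 \<longleftrightarrow> (AE x in lborel. (cmod (fn f x))\<^sup>2 = 0)"
      unfolding self by (rule integral_nonneg_eq_0_iff_AE) (use sqi_fn[of f] in \<open>auto simp: sqi_def\<close>)
    also have "\<dots> \<longleftrightarrow> (AE x in lborel. fn f x = fn 0 x)"
    proof
      assume "AE x in lborel. (cmod (fn f x))\<^sup>2 = 0"
      then show "AE x in lborel. fn f x = fn 0 x" using fn_zero by eventually_elim simp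
    next
      assume "AE x in lborel. fn f x = fn 0 x"
      then show "AE x in lborel. (cmod (fn f x))\<^sup>2 = 0" using fn_zero by eventually_elim simp
    qed
    finally show ?thesis by (simp add: l2_eq_iff)
  qed
  show "norm f = sqrt (inner f f)" by (simp add: norm_l2_def)
qed

end

section \<open>Indefinite integrals\<close>

text \<open>Integrating from minus infinity avoids a base point: for a function supported in
  (\<alpha>, \<beta>) this is the antiderivative that vanishes at \<alpha>.\<close>

definition cum :: "(real \<Rightarrow> complex) \<Rightarrow> real \<Rightarrow> complex" where
  "cum f x = (LINT s|lborel. indicator {..x} s *\<^sub>R f s)"

text \<open>Prepares Fubini on the half plane below the diagonal, where the product of two
  integrable functions is dominated by its value on the whole plane.\<close>

lemma integrable_triangle:
  fixes F G :: "real \<Rightarrow> complex"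
  assumes "integrable lborel F" "integrable lborel G"
  shows "integrable (lborel \<Otimes>\<^sub>M lborel) (\<lambda>(x, s). indicator {..x} s *\<^sub>R (F x * G s))"
proof -
  have [measurable]: "F \<in> borel_measurable borel" "G \<in> borel_measurable borel"
    using assms by auto
  have [measurable]: "{p::real \<times> real. snd p \<le> fst p} \<in> sets (borel \<Otimes>\<^sub>M borel)"
    unfolding borel_prod by (intro borel_closed closed_Collect_le continuous_intros)
  have eq: "(\<lambda>(x, s). indicator {..x} s *\<^sub>R (F x * G s))
    = (\<lambda>p. indicator {p. snd p \<le> fst p} p *\<^sub>R (F (fst p) * G (snd p)))"
    by (auto simp: fun_eq_iff indicator_def)
  have prod: "integrable (lborel \<Otimes>\<^sub>M lborel) (\<lambda>p. F (fst p) * G (snd p))"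
  proof (rule lborel_pair.Fubini_integrable)
    show "integrable lborel (\<lambda>x. LINT y|lborel. norm (F (fst (x, y)) * G (snd (x, y))))"
      using assms by (simp add: norm_mult)
    show "AE x in lborel. integrable lborel (\<lambda>y. F (fst (x, y)) * G (snd (x, y)))"
      using assms by simp
  qed measurable
  show ?thesis unfolding eq
    by (rule Bochner_Integration.integrable_bound[OF prod]) (measurable, auto simp: indicator_def)
qed

text \<open>Integration by parts without differentiating anything: both integrals on the left are
  integrals of \<open>F x * G s\<close>, one over each side of the diagonal, and together they fill
  the plane. All later calculus with weak derivatives rests on this.\<close>

lemma
  fixes F G :: "real \<Rightarrow> complex"
  assumes F: "integrable lborel F" and G: "integrable lborel G"
  shows integrable_mult_cum: "integrable lborel (\<lambda>x. F x * cum G x)"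
    and integral_mult_cum: "(LINT x|lborel. F x * cum G x) + (LINT x|lborel. cum F x * G x)
      = (LINT x|lborel. F x) * (LINT x|lborel. G x)"
proof -
  have [measurable]: "F \<in> borel_measurable borel" "G \<in> borel_measurable borel"
    using assms by auto
  note 1 = lborel_pair.integrable_fst[OF integrable_triangle[OF F G]]
  have in1: "(LINT s|lborel. indicator {..x} s *\<^sub>R (F x * G s)) = F x * cum G x" for x
    by (simp add: cum_def mult_scaleR_right[symmetric] del: mult_scaleR_right)
  show i1: "integrable lborel (\<lambda>x. F x * cum G x)" using 1 by (simp only: in1)
  have ind: "indicator {s..} x = (indicator {..x} s :: real)" for x s :: real
    by (auto simp: indicator_def)
  \<comment> \<open>The two half-lines overlap only in the point \<open>s\<close>, which is a null
    set.\<close>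
  have split: "(LINT x|lborel. indicator {s..} x *\<^sub>R F x) = (LINT x|lborel. F x) - cum F s" for s
  proof -
    have "(LINT x|lborel. indicator {s..} x *\<^sub>R F x) = (LINT x|lborel. F x - indicator {..s} x *\<^sub>R F x)"
    proof (rule integral_cong_AE)
      show "AE x in lborel. indicator {s..} x *\<^sub>R F x = F x - indicator {..s} x *\<^sub>R F x"
        using AE_lborel_singleton[of s] by eventually_elim (auto simp: indicator_def)
    qed measurable
    also have "\<dots> = (LINT x|lborel. F x) - cum F s"
      unfolding cum_def using F
      by (intro Bochner_Integration.integral_diff) (auto intro: integrable_mult_indicator)
    finally show ?thesis .
  qed
  have in2: "(LINT x|lborel. indicator {..x} s *\<^sub>R (F x * G s)) = ((LINT x|lborel. F x) - cum F s) * G s" for s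
  proof -
    have "(LINT x|lborel. indicator {..x} s *\<^sub>R (F x * G s)) = (LINT x|lborel. (indicator {s..} x *\<^sub>R F x) * G s)"
      by (simp add: ind)
    then show ?thesis by (simp only: integral_mult_left_zero split)
  qed
  have "(LINT s|lborel. ((LINT x|lborel. F x) - cum F s) * G s) = (LINT x|lborel. F x * cum G x)"
    using lborel_pair.integral_fst[OF integrable_triangle[OF F G]]
      lborel_pair.integral_snd[OF integrable_triangle[OF F G]]
    by (simp only: in1 in2)
  moreover have "(LINT s|lborel. ((LINT x|lborel. F x) - cum F s) * G s)
    = (LINT x|lborel. F x) * (LINT x|lborel. G x) - (LINT x|lborel. cum F x * G x)"
  proof -
    have "integrable lborel (\<lambda>s. cum F s * G s)"
    proof -
      have "integrable lborel (\<lambda>x. G x * cum F x)"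
      proof -
        have "(LINT s|lborel. indicator {..x} s *\<^sub>R (G x * F s)) = G x * cum F x" for x
          by (simp add: cum_def mult_scaleR_right[symmetric] del: mult_scaleR_right)
        then show ?thesis using lborel_pair.integrable_fst[OF integrable_triangle[OF G F]] by simp
      qed
      then show ?thesis by (simp add: mult.commute)
    qed
    then show ?thesis using G by (simp add: left_diff_distrib)
  qed
  ultimately show "(LINT x|lborel. F x * cum G x) + (LINT x|lborel. cum F x * G x)
      = (LINT x|lborel. F x) * (LINT x|lborel. G x)" by (metis diff_add_cancel)
qed

lemma cum_cong_AE:
  assumes "AE x in lborel. f x = g x" "f \<in> borel_measurable borel" "g \<in> borel_measurable borel"
  shows "cum f x = cum g x"
  unfolding cum_def
proof (rule integral_cong_AE)
  show "AE s in lborel. indicator {..x} s *\<^sub>R f s = indicator {..x} s *\<^sub>R g s"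
    using assms(1) by eventually_elim simp
qed (use assms in measurable)

text \<open>Half-lines are stable under intersection and generate the Borel sets, so the vanishing
  integral spreads to all Borel sets by induction over the generated sigma-algebra.\<close>

lemma AE_zero_of_cum:
  fixes h :: "real \<Rightarrow> complex"
  assumes h: "integrable lborel h" and z: "\<And>x. cum h x = 0"
  shows "AE x in lborel. h x = 0"
proof (rule sigma_finite_measure.density_zero[OF lborel.sigma_finite_measure_axioms h])
  have [measurable]: "h \<in> borel_measurable borel" using h by auto
  note si = integrable_mult_indicator[OF _ h]
  \<comment> \<open>Complements require the integral over the whole line, which is not a half-line;
    it is reached as a limit of half-lines.\<close>
  have UN: "(LINT x|lborel. h x) = 0"
  proof -
    have "((\<lambda>n. cum h (real n)) \<longlonglongrightarrow> (LINT x|lborel. h x))"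
      unfolding cum_def
    proof (rule integral_dominated_convergence[where w = "\<lambda>x. norm (h x)"])
      show "AE x in lborel. (\<lambda>i. indicat_real {..real i} x *\<^sub>R h x) \<longlonglongrightarrow> h x"
      proof (rule AE_I2)
        fix x
        obtain N where "x \<le> real N" using real_arch_simple by blast
        then have "eventually (\<lambda>i. indicat_real {..real i} x *\<^sub>R h x = h x) sequentially"
          by (intro eventually_sequentiallyI[of N]) (auto simp: indicator_def)
        then show "(\<lambda>i. indicat_real {..real i} x *\<^sub>R h x) \<longlonglongrightarrow> h x"
          by (rule tendsto_eventually)
      qed
      show "\<And>i. AE x in lborel. norm (indicat_real {..real i} x *\<^sub>R h x) \<le> norm (h x)"
        by (auto simp: indicator_def)
    qed (use h in auto)
    then show ?thesis using LIMSEQ_unique z by (simp add: LIMSEQ_const_iff)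
  qed
  fix A :: "real set" assume "A \<in> sets lborel"
  then have A: "A \<in> sigma_sets UNIV (range (\<lambda>a::real. {..a}))"
    by (simp add: borel_eq_atMost)
  have "Int_stable (range (\<lambda>a::real. {..a}))"
    by (auto simp: Int_stable_def)
  moreover have "range (\<lambda>a::real. {..a}) \<subseteq> Pow UNIV" by simp
  ultimately show "set_lebesgue_integral lborel A h = 0"
    using A
  proof (induct rule: sigma_sets_induct_disjoint)
    case (basic A)
    then show ?case using z by (auto simp: set_lebesgue_integral_def cum_def)
  next
    case empty
    then show ?case by (simp add: set_lebesgue_integral_def)
  next
    case (compl A)
    then have A[measurable]: "A \<in> sets borel" by (simp add: borel_eq_atMost)
    have "set_lebesgue_integral lborel (UNIV - A) h = (LINT x|lborel. h x - indicator A x *\<^sub>R h x)"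
      unfolding set_lebesgue_integral_def
      by (rule Bochner_Integration.integral_cong) (auto simp: indicator_def)
    also have "\<dots> = (LINT x|lborel. h x) - (LINT x|lborel. indicator A x *\<^sub>R h x)"
      using h si[of A] by (intro Bochner_Integration.integral_diff) auto
    finally show ?case using compl UN by (simp add: set_lebesgue_integral_def)
  next
    case (union A)
    then have A: "\<And>i. A i \<in> sets borel" by (auto simp: borel_eq_atMost)
    have "set_lebesgue_integral lborel (\<Union>i. A i) h = (\<Sum>i. set_lebesgue_integral lborel (A i) h)"
    proof (rule lebesgue_integral_countable_add)
      show "\<And>i j. i \<noteq> j \<Longrightarrow> A i \<inter> A j = {}"
        using union by (auto simp: disjoint_family_on_def)
      show "set_integrable lborel (\<Union>i. A i) h"
        unfolding set_integrable_def using A by (intro si) auto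
    qed (use A in auto)
    then show ?case using union by simp
  qed
qed

section \<open>The complex structure\<close>

definition ip :: "l2 \<Rightarrow> l2 \<Rightarrow> complex" where
  "ip f g = (LINT x|lborel. fn f x * cnj (fn g x))"

definition csc :: "complex \<Rightarrow> l2 \<Rightarrow> l2" where
  "csc c f = el (scale_l0 c (Rep_l2 f))"

lemma fn_csc: "AE x in lborel. fn (csc c f) x = c * fn f x"
  by (simp add: csc_def fn_def Rep_el[OF Lsq_scale[OF Rep_l2]] rep_l0_scale)

lemma ip_Rep: "ip f g = l2_inner (Rep_l2 f) (Rep_l2 g)"
  by (simp add: ip_def l2_inner_rep fn_def)

lemma inner_ip: "inner f g = Re (ip f g)"
  by (simp add: inner_fn ip_def)

lemma ip_commute: "ip g f = cnj (ip f g)"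
  unfolding ip_def
  by (simp add: Bochner_Integration.integral_cnj[symmetric] mult.commute del: Bochner_Integration.integral_cnj)

lemma ip_add_left: "ip (f + g) h = ip f h + ip g h"
proof -
  have "ip (f + g) h = (LINT x|lborel. fn f x * cnj (fn h x) + fn g x * cnj (fn h x))"
    unfolding ip_def
    using fn_add[of f g] by (intro integral_cong_AE, simp, simp, eventually_elim) (simp add: algebra_simps)
  then show ?thesis by (simp add: ip_def integrable_fn_cnj)
qed

lemma ip_csc_left: "ip (csc c f) g = c * ip f g"
proof -
  have "ip (csc c f) g = (LINT x|lborel. c * (fn f x * cnj (fn g x)))"
    unfolding ip_def
    using fn_csc[of c f] by (intro integral_cong_AE, simp, simp, eventually_elim) (simp add: algebra_simps)
  then show ?thesis by (simp add: ip_def)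
qed

lemma csc_of_real: "csc (complex_of_real r) f = r *\<^sub>R f"
  by (simp add: csc_def scaleR_l2_def)

lemma ip_scaleR_left: "ip (r *\<^sub>R f) g = r *\<^sub>R ip f g"
  by (simp add: csc_of_real[symmetric] ip_csc_left scaleR_conv_of_real)

lemma ip_add_right: "ip f (g + h) = ip f g + ip f h"
  by (metis complex_cnj_add ip_add_left ip_commute)

lemma ip_csc_right: "ip f (csc c g) = cnj c * ip f g"
  by (metis complex_cnj_mult ip_csc_left ip_commute)

lemma ip_scaleR_right: "ip f (r *\<^sub>R g) = r *\<^sub>R ip f g"
  by (simp add: csc_of_real[symmetric] ip_csc_right scaleR_conv_of_real)

lemma ip_self: "ip f f = complex_of_real ((norm f)\<^sup>2)"
proof -
  have "Im (ip f f) = 0"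
    using ip_commute[of f f] by (metis complex_cnj cnj.simps(2) neg_equal_zero)
  then show ?thesis
    by (simp add: complex_eq_iff power2_norm_eq_inner inner_ip)
qed

lemma norm_csc: "norm (csc c f) = cmod c * norm f"
proof -
  have "complex_of_real ((norm (csc c f))\<^sup>2) = complex_of_real ((cmod c * norm f)\<^sup>2)"
  proof -
    have "ip (csc c f) (csc c f) = (c * cnj c) * ip f f"
      by (simp add: ip_csc_left ip_csc_right)
    then show ?thesis by (simp add: ip_self power_mult_distrib flip: complex_norm_square)
  qed
  then have "(norm (csc c f))\<^sup>2 = (cmod c * norm f)\<^sup>2"
    by (simp only: of_real_eq_iff)
  then show ?thesis by simp
qed

text \<open>Rotating \<open>f\<close> by a unimodular scalar makes the pairing real and nonnegative,
  so the real Cauchy-Schwarz inequality applies.\<close>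

lemma norm_ip_le: "cmod (ip f g) \<le> norm f * norm g"
proof (cases "ip f g = 0")
  case False
  define c where "c = cnj (ip f g) / cmod (ip f g)"
  have c: "cmod c = 1" using False by (simp add: c_def norm_divide)
  have "complex_of_real (cmod (ip f g)) = c * ip f g"
    using False by (simp add: c_def mult.commute[of "cnj _"] complex_norm_square[symmetric] power2_eq_square)
  then have "cmod (ip f g) = Re (ip (csc c f) g)"
    by (metis Re_complex_of_real ip_csc_left)
  also have "\<dots> = inner (csc c f) g" by (simp add: inner_ip)
  also have "\<dots> \<le> norm (csc c f) * norm g" by (rule norm_cauchy_schwarz)
  finally show ?thesis by (simp add: norm_csc c)
qed simp

interpretation ip: bounded_bilinear ip
  by standard (auto simp: ip_add_left ip_add_right ip_scaleR_left ip_scaleR_right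
      intro!: exI[of _ 1] norm_ip_le)

lemma csc_add: "csc c (f + g) = csc c f + csc c g"
proof (rule l2_eqI)
  show "AE x in lborel. fn (csc c (f + g)) x = fn (csc c f + csc c g) x"
    using fn_csc[of c "f + g"] fn_csc[of c f] fn_csc[of c g] fn_add[of f g] fn_add[of "csc c f" "csc c g"]
    by eventually_elim (simp add: algebra_simps)
qed

lemma csc_0 [simp]: "csc c 0 = 0"
  using csc_add[of c 0 0] by simp

section \<open>Functions of class \<open>H\<^sup>1\<close> on a bounded interval\<close>

definition supp :: "real set \<Rightarrow> l2 \<Rightarrow> bool" where
  "supp S f \<longleftrightarrow> (AE x in lborel. x \<notin> S \<longrightarrow> fn f x = 0)"

lemma supp_zero: "supp S 0"
  unfolding supp_def using fn_zero by eventually_elim simp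

lemma supp_add: assumes "supp S f" "supp S g" shows "supp S (f + g)"
  using assms fn_add[of f g] unfolding supp_def by eventually_elim simp

lemma supp_csc: assumes "supp S f" shows "supp S (csc c f)"
  using assms fn_csc[of c f] unfolding supp_def by eventually_elim simp

lemma sqi_indicator:
  "bounded S \<Longrightarrow> S \<in> sets borel \<Longrightarrow> sqi (indicator S)"
proof -
  assume "bounded S" "S \<in> sets borel"
  then have "integrable lborel (indicat_real S)"
    using emeasure_bounded_finite[of S] by (simp add: integrable_indicator_iff)
  moreover have "(\<lambda>x. (cmod (indicator S x))\<^sup>2) = indicat_real S"
    by (auto simp: indicator_def fun_eq_iff)
  ultimately show ?thesis using \<open>S \<in> sets borel\<close> by (simp add: sqi_def)
qed

lemma integrable_sqi_bounded:
  assumes "sqi f" "bounded S" "S \<in> sets borel" "AE x in lborel. x \<notin> S \<longrightarrow> f x = 0"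
  shows "integrable lborel f"
proof -
  have m[measurable]: "f \<in> borel_measurable borel" "S \<in> sets borel" using assms by (auto simp: sqi_def)
  have "integrable lborel (\<lambda>x. f x * cnj (indicator S x))"
    using assms(1) sqi_indicator[OF assms(2,3)] by (intro integrable_mult_cnj) (auto simp: sqi_def)
  moreover have "AE x in lborel. f x * cnj (indicator S x) = f x"
    using assms(4) by eventually_elim (auto simp: indicator_def)
  ultimately show ?thesis by (subst integrable_cong_AE[of f _ "\<lambda>x. f x * cnj (indicator S x)"]) auto
qed

lemma integrable_fn_supp: "supp {\<alpha><..<\<beta>} f \<Longrightarrow> integrable lborel (fn f)"
  unfolding supp_def by (rule integrable_sqi_bounded[OF sqi_fn, of "{\<alpha><..<\<beta>}"]) auto

text \<open>\<open>W \<alpha> \<beta> f f' fa fb\<close>: on \<open>(\<alpha>, \<beta>)\<close>, \<open>f\<close> is the \<open>H\<^sup>1\<close> function with weak derivative \<open>f'\<close> and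
  boundary values \<open>fa\<close>, \<open>fb\<close>.\<close>

definition W :: "real \<Rightarrow> real \<Rightarrow> l2 \<Rightarrow> l2 \<Rightarrow> complex \<Rightarrow> complex \<Rightarrow> bool" where
  "W \<alpha> \<beta> f f' fa fb \<longleftrightarrow> supp {\<alpha><..<\<beta>} f \<and> supp {\<alpha><..<\<beta>} f' \<and>
     (AE x in lborel. x \<in> {\<alpha><..<\<beta>} \<longrightarrow> fn f x = fa + cum (fn f') x) \<and> fb = fa + cum (fn f') \<beta>"

lemma W_supp: assumes "W \<alpha> \<beta> f f' fa fb" shows "supp {\<alpha><..<\<beta>} f" "supp {\<alpha><..<\<beta>} f'"
  using assms by (simp_all add: W_def)

lemma cum_add:
  assumes "integrable lborel f" "integrable lborel g"
  shows "cum (\<lambda>x. f x + g x) x = cum f x + cum g x"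
  unfolding cum_def using integrable_mult_indicator[OF _ assms(1), of "{..x}"]
    integrable_mult_indicator[OF _ assms(2), of "{..x}"]
  by (simp add: scaleR_right_distrib)

lemma cum_mult: "cum (\<lambda>x. c * f x) x = c * cum f x"
  by (simp add: cum_def mult_scaleR_right[symmetric] del: mult_scaleR_right)

lemma cum_fn_add:
  assumes "supp {\<alpha><..<\<beta>} f" "supp {\<alpha><..<\<beta>} g"
  shows "cum (fn (f + g)) x = cum (fn f) x + cum (fn g) x"
  using cum_cong_AE[OF fn_add[of f g]] cum_add[OF assms[THEN integrable_fn_supp]] by simp

lemma cum_fn_csc: "cum (fn (csc c f)) x = c * cum (fn f) x"
  using cum_cong_AE[OF fn_csc[of c f]] by (simp add: cum_mult)

lemma W_add:
  assumes "W \<alpha> \<beta> f f' fa fb" "W \<alpha> \<beta> g g' ga gb"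
  shows "W \<alpha> \<beta> (f + g) (f' + g') (fa + ga) (fb + gb)"
proof -
  have s: "supp {\<alpha><..<\<beta>} f'" "supp {\<alpha><..<\<beta>} g'" using assms by (auto simp: W_def)
  have "AE x in lborel. x \<in> {\<alpha><..<\<beta>} \<longrightarrow> fn f x = fa + cum (fn f') x"
    "AE x in lborel. x \<in> {\<alpha><..<\<beta>} \<longrightarrow> fn g x = ga + cum (fn g') x"
    using assms by (simp_all add: W_def)
  with fn_add[of f g]
  have "AE x in lborel. x \<in> {\<alpha><..<\<beta>} \<longrightarrow> fn (f + g) x = (fa + ga) + cum (fn (f' + g')) x"
    by eventually_elim (simp add: cum_fn_add[OF s])
  with assms show ?thesis by (simp add: W_def supp_add cum_fn_add[OF s])
qed

lemma W_csc:
  assumes "W \<alpha> \<beta> f f' fa fb" shows "W \<alpha> \<beta> (csc c f) (csc c f') (c * fa) (c * fb)"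
proof -
  have "AE x in lborel. x \<in> {\<alpha><..<\<beta>} \<longrightarrow> fn f x = fa + cum (fn f') x"
    using assms by (simp_all add: W_def)
  with fn_csc[of c f]
  have "AE x in lborel. x \<in> {\<alpha><..<\<beta>} \<longrightarrow> fn (csc c f) x = c * fa + cum (fn (csc c f')) x"
    by eventually_elim (simp add: cum_fn_csc algebra_simps)
  with assms show ?thesis by (simp add: W_def supp_csc cum_fn_csc algebra_simps)
qed

lemma W_scaleR:
  "W \<alpha> \<beta> f f' fa fb \<Longrightarrow> W \<alpha> \<beta> (r *\<^sub>R f) (r *\<^sub>R f') (r *\<^sub>R fa) (r *\<^sub>R fb)"
  using W_csc[of \<alpha> \<beta> f f' fa fb "complex_of_real r"] by (simp add: csc_of_real scaleR_conv_of_real)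

lemma W_diff:
  assumes "W \<alpha> \<beta> f f' fa fb" "W \<alpha> \<beta> g g' ga gb"
  shows "W \<alpha> \<beta> (f - g) (f' - g') (fa - ga) (fb - gb)"
  using W_add[OF assms(1) W_scaleR[OF assms(2), of "-1"]] by simp

lemma cum_fn_end:
  assumes "supp {\<alpha><..<\<beta>} f"
  shows "cum (fn f) \<beta> = (LINT x|lborel. fn f x)"
  unfolding cum_def
proof (rule integral_cong_AE)
  show "AE x in lborel. indicator {..\<beta>} x *\<^sub>R fn f x = fn f x"
    using assms unfolding supp_def by eventually_elim (auto simp: indicator_def)
qed measurable

lemma cum_fn_start:
  assumes "supp {\<alpha><..<\<beta>} f" "x \<le> \<alpha>"
  shows "cum (fn f) x = 0"
proof -
  have "cum (fn f) x = (LINT x::real|lborel. (0::complex))"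
    unfolding cum_def
  proof (rule integral_cong_AE)
    show "AE s in lborel. indicator {..x} s *\<^sub>R fn f s = 0"
      using assms(1) unfolding supp_def by eventually_elim (use assms(2) in \<open>auto simp: indicator_def\<close>)
  qed measurable
  then show ?thesis by simp
qed

lemma continuous_on_cum:
  fixes f :: "real \<Rightarrow> complex"
  assumes f: "integrable lborel f"
  shows "continuous_on UNIV (cum f)"
proof (rule continuous_at_imp_continuous_on, rule ballI)
  have [measurable]: "f \<in> borel_measurable borel" using f by auto
  fix x :: real
  show "isCont (cum f) x"
    unfolding continuous_at_sequentially comp_def
  proof safe
    fix X :: "nat \<Rightarrow> real" assume X: "X \<longlonglongrightarrow> x"
    show "(\<lambda>n. cum f (X n)) \<longlonglongrightarrow> cum f x"
      unfolding cum_def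
    proof (rule integral_dominated_convergence[where w = "\<lambda>x. norm (f x)"])
      show "AE s in lborel. (\<lambda>n. indicat_real {..X n} s *\<^sub>R f s) \<longlonglongrightarrow> indicat_real {..x} s *\<^sub>R f s"
        using AE_lborel_singleton[of x]
      proof eventually_elim
        fix s assume "s \<noteq> x"
        then consider "s < x" | "x < s" by linarith
        then have "eventually (\<lambda>n. indicat_real {..X n} s *\<^sub>R f s = indicat_real {..x} s *\<^sub>R f s) sequentially"
        proof cases
          case 1
          show ?thesis using order_tendstoD(1)[OF X 1] by eventually_elim (use 1 in \<open>auto simp: indicator_def\<close>)
        next
          case 2
          show ?thesis using order_tendstoD(2)[OF X 2] by eventually_elim (use 2 in \<open>auto simp: indicator_def\<close>)
        qed
        then show "(\<lambda>n. indicat_real {..X n} s *\<^sub>R f s) \<longlonglongrightarrow> indicat_real {..x} s *\<^sub>R f s"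
          by (rule tendsto_eventually)
      qed
      show "\<And>i. AE s in lborel. norm (indicat_real {..X i} s *\<^sub>R f s) \<le> norm (f s)"
        by (auto simp: indicator_def)
    qed (use f in auto)
  qed
qed

lemma cum_cnj: "cum (\<lambda>x. cnj (f x)) x = cnj (cum f x)"
  by (simp add: cum_def Bochner_Integration.integral_cnj[symmetric] del: Bochner_Integration.integral_cnj)

text \<open>Apply \<open>integral_mult_cum\<close> to \<open>f'\<close> and the conjugate of
  \<open>g'\<close>; the boundary values enter as the constants of integration of \<open>f\<close>
  and \<open>g\<close>. Energy identities, multipliers and moments below are all instances of
  it.\<close>

theorem W_by_parts:
  assumes f: "W \<alpha> \<beta> f f' fa fb" and g: "W \<alpha> \<beta> g g' ga gb"
  shows "ip f' g + ip f g' = fb * cnj gb - fa * cnj ga"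
proof -
  define F where "F = fn f'"
  define G where "G = (\<lambda>x. cnj (fn g' x))"
  have s: "supp {\<alpha><..<\<beta>} f'" "supp {\<alpha><..<\<beta>} g'" using assms by (auto simp: W_def)
  have F: "integrable lborel F" and G: "integrable lborel G"
    using s[THEN integrable_fn_supp] by (auto simp: F_def G_def)
  have [measurable]: "F \<in> borel_measurable borel" "G \<in> borel_measurable borel" using F G by auto
  have [measurable]: "cum F \<in> borel_measurable borel" "cum G \<in> borel_measurable borel"
    using continuous_on_cum[OF F] continuous_on_cum[OF G] by (auto intro: borel_measurable_continuous_onI)
  have sF: "AE x in lborel. x \<notin> {\<alpha><..<\<beta>} \<longrightarrow> F x = 0" using s by (simp add: supp_def F_def)
  have "AE x in lborel. x \<notin> {\<alpha><..<\<beta>} \<longrightarrow> fn g' x = 0" using s by (simp add: supp_def)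
  then have sG: "AE x in lborel. x \<notin> {\<alpha><..<\<beta>} \<longrightarrow> G x = 0"
    by eventually_elim (simp add: G_def)
  have f1: "AE x in lborel. x \<in> {\<alpha><..<\<beta>} \<longrightarrow> fn f x = fa + cum F x"
    and g1: "AE x in lborel. x \<in> {\<alpha><..<\<beta>} \<longrightarrow> fn g x = ga + cum (fn g') x"
    using assms by (auto simp: W_def F_def)
  have "ip f' g = (LINT x|lborel. cnj ga * F x + F x * cum G x)"
    unfolding ip_def F_def[symmetric]
  proof (rule integral_cong_AE)
    show "AE x in lborel. F x * cnj (fn g x) = cnj ga * F x + F x * cum G x"
      using sF g1 by eventually_elim (auto simp: G_def cum_cnj algebra_simps)
  qed measurable
  also have "\<dots> = cnj ga * (LINT x|lborel. F x) + (LINT x|lborel. F x * cum G x)"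
    using F integrable_mult_cum[OF F G] by simp
  finally have 1: "ip f' g = cnj ga * (LINT x|lborel. F x) + (LINT x|lborel. F x * cum G x)" .
  have "ip f g' = (LINT x|lborel. fa * G x + G x * cum F x)"
    unfolding ip_def
  proof (rule integral_cong_AE)
    show "AE x in lborel. fn f x * cnj (fn g' x) = fa * G x + G x * cum F x"
      using sG f1 by eventually_elim (auto simp: G_def algebra_simps)
  qed measurable
  also have "\<dots> = fa * (LINT x|lborel. G x) + (LINT x|lborel. cum F x * G x)"
    using G integrable_mult_cum[OF G F] by (simp add: mult.commute)
  finally have 2: "ip f g' = fa * (LINT x|lborel. G x) + (LINT x|lborel. cum F x * G x)" .
  have fb: "fb = fa + (LINT x|lborel. F x)"
    using f cum_fn_end[OF s(1)] by (simp add: W_def F_def)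
  have "gb = ga + (LINT x|lborel. fn g' x)"
    using g cum_fn_end[OF s(2)] by (simp add: W_def)
  then have gb: "cnj gb = cnj ga + (LINT x|lborel. G x)"
    by (simp add: G_def)
  show ?thesis
    unfolding 1 2 fb gb using integral_mult_cum[OF F G] by (simp add: algebra_simps)
qed

section \<open>Multiplication by bounded functions\<close>

definition bdd_mult :: "(real \<Rightarrow> real) \<Rightarrow> real \<Rightarrow> bool" where
  "bdd_mult q C \<longleftrightarrow> q \<in> borel_measurable borel \<and> (\<forall>x. \<bar>q x\<bar> \<le> C)"

text \<open>The multiplier is real valued, which makes the operator symmetric for \<open>ip\<close>
  and for the real inner product.\<close>

definition mulf :: "(real \<Rightarrow> real) \<Rightarrow> l2 \<Rightarrow> l2" where
  "mulf q f = mk (\<lambda>x. q x *\<^sub>R fn f x)"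

lemma bdd_mult_indicator: "S \<in> sets borel \<Longrightarrow> bdd_mult (indicator S) 1"
  by (auto simp: bdd_mult_def indicator_def)

lemma sqi_mult: "bdd_mult q C \<Longrightarrow> sqi f \<Longrightarrow> sqi (\<lambda>x. q x *\<^sub>R f x)"
  by (rule sqi_bound[of f _ C]) (auto simp: bdd_mult_def sqi_def intro!: mult_right_mono)

lemma fn_mulf: "bdd_mult q C \<Longrightarrow> AE x in lborel. fn (mulf q f) x = q x *\<^sub>R fn f x"
  unfolding mulf_def by (intro fn_mk sqi_mult sqi_fn)

lemma mulf_add: assumes "bdd_mult q C" shows "mulf q (f + g) = mulf q f + mulf q g"
proof (rule l2_eqI)
  show "AE x in lborel. fn (mulf q (f + g)) x = fn (mulf q f + mulf q g) x"
    using fn_mulf[OF assms, of f] fn_mulf[OF assms, of g] fn_mulf[OF assms, of "f + g"]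
      fn_add[of f g] fn_add[of "mulf q f" "mulf q g"]
    by eventually_elim (simp add: scaleR_right_distrib)
qed

lemma mulf_csc: assumes "bdd_mult q C" shows "mulf q (csc c f) = csc c (mulf q f)"
proof (rule l2_eqI)
  show "AE x in lborel. fn (mulf q (csc c f)) x = fn (csc c (mulf q f)) x"
    using fn_mulf[OF assms, of f] fn_mulf[OF assms, of "csc c f"] fn_csc[of c f] fn_csc[of c "mulf q f"]
    by eventually_elim simp
qed

lemma mulf_scaleR: "bdd_mult q C \<Longrightarrow> mulf q (r *\<^sub>R f) = r *\<^sub>R mulf q f"
  using mulf_csc[of q C "complex_of_real r" f] by (simp add: csc_of_real)

lemma ip_mulf: assumes "bdd_mult q C" shows "ip (mulf q f) g = ip f (mulf q g)"
  unfolding ip_def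
proof (rule integral_cong_AE)
  show "AE x in lborel. fn (mulf q f) x * cnj (fn g x) = fn f x * cnj (fn (mulf q g) x)"
    using fn_mulf[OF assms, of f] fn_mulf[OF assms, of g]
    by eventually_elim (simp add: scaleR_conv_of_real)
qed measurable

lemma inner_mulf: "bdd_mult q C \<Longrightarrow> inner (mulf q f) g = inner f (mulf q g)"
  by (simp add: inner_ip ip_mulf)

lemma power2_norm_fn: "(norm f)\<^sup>2 = (LINT x|lborel. (cmod (fn f x))\<^sup>2)"
proof -
  have "ip f f = complex_of_real (LINT x|lborel. (cmod (fn f x))\<^sup>2)"
    by (simp add: ip_def complex_norm_square[symmetric] del: of_real_power)
  then show ?thesis by (simp add: power2_norm_eq_inner inner_ip)
qed

lemma norm_mulf: assumes "bdd_mult q C" shows "norm (mulf q f) \<le> C * norm f"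
proof (rule power2_le_imp_le)
  have C: "0 \<le> C" using assms by (auto simp: bdd_mult_def intro: order_trans[OF abs_ge_zero])
  have "(norm (mulf q f))\<^sup>2 \<le> (LINT x|lborel. C\<^sup>2 * (cmod (fn f x))\<^sup>2)"
    unfolding power2_norm_fn
  proof (rule integral_mono_AE)
    show "AE x in lborel. (cmod (fn (mulf q f) x))\<^sup>2 \<le> C\<^sup>2 * (cmod (fn f x))\<^sup>2"
      using fn_mulf[OF assms, of f]
    proof eventually_elim
      fix x assume "fn (mulf q f) x = q x *\<^sub>R fn f x"
      moreover have "(q x)\<^sup>2 \<le> C\<^sup>2"
        using assms power_mono[of "\<bar>q x\<bar>" C 2] by (simp add: bdd_mult_def)
      ultimately show "(cmod (fn (mulf q f) x))\<^sup>2 \<le> C\<^sup>2 * (cmod (fn f x))\<^sup>2"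
        by (simp add: power_mult_distrib mult_right_mono)
    qed
  qed (use sqi_fn in \<open>auto simp: sqi_def\<close>)
  also have "\<dots> = (C * norm f)\<^sup>2" by (simp add: power2_norm_fn power_mult_distrib)
  finally show "(norm (mulf q f))\<^sup>2 \<le> (C * norm f)\<^sup>2" .
  show "0 \<le> C * norm f" using C by simp
qed

lemma bounded_linear_mulf: "bdd_mult q C \<Longrightarrow> bounded_linear (mulf q)"
  by (rule bounded_linear_intro[where K = C])
     (auto simp: mulf_add mulf_scaleR norm_mulf mult.commute)

lemma supp_mulf: assumes "bdd_mult q C" "supp S f" shows "supp S (mulf q f)"
  using assms(2) fn_mulf[OF assms(1), of f] unfolding supp_def by eventually_elim simp

lemma supp_mulf_indicator: assumes "S \<in> sets borel" shows "supp S (mulf (indicator S) f)"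
  using fn_mulf[OF bdd_mult_indicator[OF assms], of f] unfolding supp_def by eventually_elim simp

lemma mulf_indicator_id: assumes "S \<in> sets borel" "supp S f" shows "mulf (indicator S) f = f"
proof (rule l2_eqI)
  show "AE x in lborel. fn (mulf (indicator S) f) x = fn f x"
    using assms(2) fn_mulf[OF bdd_mult_indicator[OF assms(1)], of f] unfolding supp_def
    by eventually_elim (simp add: indicator_def)
qed

lemma ip_disjoint: assumes "supp S f" "supp T g" "S \<inter> T = {}" shows "ip f g = 0"
proof -
  have "ip f g = (LINT x::real|lborel. 0)"
    unfolding ip_def
  proof (rule integral_cong_AE)
    show "AE x in lborel. fn f x * cnj (fn g x) = 0"
      using assms(1,2) unfolding supp_def by eventually_elim (use assms(3) in auto)
  qed measurable
  then show ?thesis by simp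
qed

section \<open>Continuously differentiable functions\<close>

definition mkI :: "real \<Rightarrow> real \<Rightarrow> (real \<Rightarrow> complex) \<Rightarrow> l2" where
  "mkI \<alpha> \<beta> F = mk (\<lambda>x. indicator {\<alpha><..<\<beta>} x *\<^sub>R F x)"

lemma sqi_continuous:
  assumes "continuous_on {\<alpha>..\<beta>} F"
  shows "sqi (\<lambda>x. indicator {\<alpha><..<\<beta>} x *\<^sub>R F x)"
proof -
  have "compact (F ` {\<alpha>..\<beta>})" using assms by (simp add: compact_continuous_image)
  then obtain C where C: "\<And>x. x \<in> {\<alpha>..\<beta>} \<Longrightarrow> cmod (F x) \<le> C"
    using compact_imp_bounded bounded_iff by (metis imageI)
  show ?thesis
  proof (rule sqi_bound[OF sqi_indicator[of "{\<alpha><..<\<beta>}"], where C = C])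
    show "(\<lambda>x. indicator {\<alpha><..<\<beta>} x *\<^sub>R F x) \<in> borel_measurable borel"
      by (rule borel_measurable_continuous_on_indicator)
        (auto intro: continuous_on_subset[OF assms])
  qed (use C in \<open>auto simp: indicator_def\<close>)
qed

lemma fn_mkI:
  "continuous_on {\<alpha>..\<beta>} F \<Longrightarrow> AE x in lborel. fn (mkI \<alpha> \<beta> F) x = indicator {\<alpha><..<\<beta>} x *\<^sub>R F x"
  unfolding mkI_def by (intro fn_mk sqi_continuous)

lemma supp_mkI:
  assumes "continuous_on {\<alpha>..\<beta>} F" shows "supp {\<alpha><..<\<beta>} (mkI \<alpha> \<beta> F)"
  using fn_mkI[OF assms] unfolding supp_def by eventually_elim simp

lemma W_mkI:
  assumes "\<alpha> \<le> \<beta>" "\<And>x. x \<in> {\<alpha>..\<beta>} \<Longrightarrow> (F has_vector_derivative F' x) (at x within {\<alpha>..\<beta>})"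
    and F': "continuous_on {\<alpha>..\<beta>} F'"
  shows "W \<alpha> \<beta> (mkI \<alpha> \<beta> F) (mkI \<alpha> \<beta> F') (F \<alpha>) (F \<beta>)"
proof -
  have F: "continuous_on {\<alpha>..\<beta>} F"
    using assms(2) by (meson continuous_on_eq_continuous_within has_vector_derivative_continuous)
  have cum: "cum (fn (mkI \<alpha> \<beta> F')) x = F x - F \<alpha>" if x: "x \<in> {\<alpha>..\<beta>}" for x
  proof -
    have m: "(\<lambda>s. indicator {\<alpha><..<\<beta>} s *\<^sub>R F' s) \<in> borel_measurable borel"
      using sqi_continuous[OF F'] by (simp add: sqi_def)
    have "cum (fn (mkI \<alpha> \<beta> F')) x = cum (\<lambda>s. indicator {\<alpha><..<\<beta>} s *\<^sub>R F' s) x"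
      by (rule cum_cong_AE[OF fn_mkI[OF F']]) (use m in simp_all)
    also have "\<dots> = (LINT s|lborel. indicator {\<alpha>..x} s *\<^sub>R F' s)"
      unfolding cum_def
    proof (rule integral_cong_AE)
      show "AE s in lborel. indicator {..x} s *\<^sub>R indicator {\<alpha><..<\<beta>} s *\<^sub>R F' s = indicator {\<alpha>..x} s *\<^sub>R F' s"
        using AE_lborel_singleton[of \<alpha>] AE_lborel_singleton[of \<beta>]
        by eventually_elim (use x in \<open>auto simp: indicator_def\<close>)
      show "(\<lambda>s. indicator {\<alpha>..x} s *\<^sub>R F' s) \<in> borel_measurable lborel"
        using borel_measurable_continuous_on_indicator[OF _ continuous_on_subset[OF F'], of "{\<alpha>..x}"] x
        by simp
    qed (use m in measurable)
    also have "\<dots> = F x - F \<alpha>"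
    proof (rule integral_FTC_atLeastAtMost)
      show "(F has_vector_derivative F' s) (at s within {\<alpha>..x})" if "\<alpha> \<le> s" "s \<le> x" for s
        using has_vector_derivative_within_subset[OF assms(2), of s "{\<alpha>..x}"] that x by auto
      show "continuous_on {\<alpha>..x} F'" using x by (auto intro: continuous_on_subset[OF F'])
    qed (use x in auto)
    finally show ?thesis .
  qed
  have "AE x in lborel. x \<in> {\<alpha><..<\<beta>} \<longrightarrow> fn (mkI \<alpha> \<beta> F) x = F \<alpha> + cum (fn (mkI \<alpha> \<beta> F')) x"
    using fn_mkI[OF F] by eventually_elim (auto simp: cum)
  then show ?thesis
    using assms(1) supp_mkI[OF F] supp_mkI[OF F'] by (simp add: W_def cum)
qed

definition one :: "real \<Rightarrow> real \<Rightarrow> l2" where "one \<alpha> \<beta> = mkI \<alpha> \<beta> (\<lambda>_. 1)"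

lemma mkI_zero: "mkI \<alpha> \<beta> (\<lambda>_. 0) = 0"
proof (rule l2_eqI)
  show "AE x in lborel. fn (mkI \<alpha> \<beta> (\<lambda>_. 0)) x = fn 0 x"
    using fn_mkI[of \<alpha> \<beta> "\<lambda>_. 0"] fn_zero by (auto elim: eventually_elim2)
qed

lemma W_one: "\<alpha> \<le> \<beta> \<Longrightarrow> W \<alpha> \<beta> (one \<alpha> \<beta>) 0 1 1"
  using W_mkI[of \<alpha> \<beta> "\<lambda>_. 1" "\<lambda>_. 0"] by (simp add: one_def mkI_zero)

lemma norm_one: "\<alpha> \<le> \<beta> \<Longrightarrow> ip (one \<alpha> \<beta>) (one \<alpha> \<beta>) = complex_of_real (\<beta> - \<alpha>)"
proof -
  assume le: "\<alpha> \<le> \<beta>"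
  have "ip (one \<alpha> \<beta>) (one \<alpha> \<beta>) = (LINT x|lborel. indicator {\<alpha><..<\<beta>} x *\<^sub>R 1)"
    unfolding ip_def one_def
  proof (rule integral_cong_AE)
    show "AE x in lborel. fn (mkI \<alpha> \<beta> (\<lambda>_. 1)) x * cnj (fn (mkI \<alpha> \<beta> (\<lambda>_. 1)) x)
      = indicator {\<alpha><..<\<beta>} x *\<^sub>R 1"
      using fn_mkI[of \<alpha> \<beta> "\<lambda>_. 1"] by (auto elim!: eventually_mono simp: indicator_def)
  qed measurable
  then show ?thesis using le by (simp add: scaleR_conv_of_real)
qed

section \<open>Multiplication by affine functions\<close>

text \<open>The cut-off by the indicator turns \<open>x - c\<close> into a bounded multiplier on the
  whole line, without any effect on functions supported in the interval.\<close>

definition aff :: "real \<Rightarrow> real \<Rightarrow> real \<Rightarrow> real \<Rightarrow> real" where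
  "aff \<alpha> \<beta> c = (\<lambda>x. indicator {\<alpha><..<\<beta>} x * (x - c))"

lemma bdd_mult_aff: "bdd_mult (aff \<alpha> \<beta> c) (\<bar>\<alpha>\<bar> + \<bar>\<beta>\<bar> + \<bar>c\<bar>)"
  by (auto simp: bdd_mult_def aff_def indicator_def)

lemma bdd_mult_aff':
  assumes "\<alpha> \<le> c" "c \<le> \<beta>" shows "bdd_mult (aff \<alpha> \<beta> c) (\<beta> - \<alpha>)"
  using assms by (auto simp: bdd_mult_def aff_def indicator_def)

text \<open>The product rule for \<open>(x - c) * f\<close>. It is again
  \<open>integral_mult_cum\<close>, now with the derivative of \<open>f\<close> and the constant 1,
  both truncated at the point where the antiderivative is evaluated.\<close>

lemma W_aff:
  assumes f: "W \<alpha> \<beta> f f' fa fb" and le: "\<alpha> \<le> \<beta>"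
  shows "W \<alpha> \<beta> (mulf (aff \<alpha> \<beta> c) f) (f + mulf (aff \<alpha> \<beta> c) f') ((\<alpha> - c) *\<^sub>R fa) ((\<beta> - c) *\<^sub>R fb)"
proof -
  note q = bdd_mult_aff[of \<alpha> \<beta> c]
  have s: "supp {\<alpha><..<\<beta>} f" "supp {\<alpha><..<\<beta>} f'" using f by (auto simp: W_def)
  define D where "D = fn f'"
  have D: "integrable lborel D" unfolding D_def by (rule integrable_fn_supp[OF s(2)])
  then have [measurable]: "D \<in> borel_measurable borel" by auto
  have [measurable]: "cum D \<in> borel_measurable borel"
    using continuous_on_cum[OF D] by (rule borel_measurable_continuous_onI)
  have f1: "AE x in lborel. x \<in> {\<alpha><..<\<beta>} \<longrightarrow> fn f x = fa + cum D x"
    and s0: "AE x in lborel. x \<notin> {\<alpha><..<\<beta>} \<longrightarrow> fn f x = 0" "AE x in lborel. x \<notin> {\<alpha><..<\<beta>} \<longrightarrow> D x = 0"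
    using f by (auto simp: W_def D_def supp_def)
  have key: "(x - c) *\<^sub>R (fa + cum D x) = (\<alpha> - c) *\<^sub>R fa + cum (fn (f + mulf (aff \<alpha> \<beta> c) f')) x"
    if x: "x \<in> {\<alpha>..\<beta>}" for x
  proof -
    \<comment> \<open>Truncation at \<open>x\<close> turns the integrals over the line in
      \<open>integral_mult_cum\<close> into integrals up to \<open>x\<close>; for \<open>s\<close>
      in [\<alpha>, \<open>x\<close>] one gets \<open>cum G s = s - \<alpha>\<close>, which supplies
      the affine factor.\<close>
    define F where "F = (\<lambda>s. indicat_real {..x} s *\<^sub>R D s)"
    define G :: "real \<Rightarrow> complex" where "G = (\<lambda>s. indicat_real {\<alpha>..x} s *\<^sub>R 1)"
    have F: "integrable lborel F" unfolding F_def using D by (intro integrable_mult_indicator) auto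
    have G: "integrable lborel G" unfolding G_def using x
      by (intro integrable_mult_indicator integrable_real_indicator integrable_scaleR_left) auto
    have [measurable]: "F \<in> borel_measurable borel" "G \<in> borel_measurable borel" using F G by auto
    have [measurable]: "cum G \<in> borel_measurable borel" "cum F \<in> borel_measurable borel"
      using continuous_on_cum[OF G] continuous_on_cum[OF F] by (auto intro: borel_measurable_continuous_onI)
    have iG: "(LINT s|lborel. G s) = complex_of_real (x - \<alpha>)"
      using x by (simp add: G_def scaleR_conv_of_real)
    have cG: "cum G s = complex_of_real (s - \<alpha>)" if "s \<in> {\<alpha>..x}" for s
    proof -
      have "cum G s = (LINT t|lborel. complex_of_real (indicator {\<alpha>..s} t))"
        unfolding cum_def G_def using that
        by (intro Bochner_Integration.integral_cong) (auto simp: indicator_def)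
      then show ?thesis using that by simp
    qed
    have cF: "cum F s = cum D s" if "s \<le> x" for s
      unfolding cum_def F_def using that
      by (intro Bochner_Integration.integral_cong) (auto simp: indicator_def)
    have 1: "(LINT s|lborel. F s * cum G s) + (LINT s|lborel. cum F s * G s) = cum D x * complex_of_real (x - \<alpha>)"
      using integral_mult_cum[OF F G] iG by (simp add: F_def cum_def)
    have "cum (fn (f + mulf (aff \<alpha> \<beta> c) f')) x
      = (LINT s|lborel. fa * G s + cum F s * G s + F s * cum G s + complex_of_real (\<alpha> - c) * F s)"
      unfolding cum_def[of "fn _"]
    proof (rule integral_cong_AE)
      show "AE s in lborel. indicator {..x} s *\<^sub>R fn (f + mulf (aff \<alpha> \<beta> c) f') s
        = fa * G s + cum F s * G s + F s * cum G s + complex_of_real (\<alpha> - c) * F s"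
        using f1 s0 fn_add[of f "mulf (aff \<alpha> \<beta> c) f'"] fn_mulf[OF q, of f']
          AE_lborel_singleton[of \<alpha>] AE_lborel_singleton[of \<beta>] AE_lborel_singleton[of x]
      proof eventually_elim
        fix s
        assume h: "s \<in> {\<alpha><..<\<beta>} \<longrightarrow> fn f s = fa + cum D s" "s \<notin> {\<alpha><..<\<beta>} \<longrightarrow> fn f s = 0"
          "s \<notin> {\<alpha><..<\<beta>} \<longrightarrow> D s = 0"
          "fn (f + mulf (aff \<alpha> \<beta> c) f') s = fn f s + fn (mulf (aff \<alpha> \<beta> c) f') s"
          "fn (mulf (aff \<alpha> \<beta> c) f') s = aff \<alpha> \<beta> c s *\<^sub>R fn f' s" "s \<noteq> \<alpha>" "s \<noteq> \<beta>" "s \<noteq> x"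
        consider "s \<notin> {\<alpha><..<\<beta>}" | "s \<in> {\<alpha><..<\<beta>}" "x < s" | "s \<in> {\<alpha><..<x}"
          using h x by fastforce
        then show "indicator {..x} s *\<^sub>R fn (f + mulf (aff \<alpha> \<beta> c) f') s
          = fa * G s + cum F s * G s + F s * cum G s + complex_of_real (\<alpha> - c) * F s"
        proof cases
          case 1
          then have "s \<notin> {\<alpha>..x}" using x h by auto
          then show ?thesis using 1 h by (simp add: F_def G_def aff_def)
        next
          case 2
          then show ?thesis by (simp add: F_def G_def)
        next
          case 3
          then have "s \<in> {\<alpha><..<\<beta>}" using x by auto
          moreover have "F s = D s" "G s = 1" using 3 by (auto simp: F_def G_def)
          ultimately show ?thesis using 3 h
            by (simp add: cF cG aff_def D_def[symmetric] scaleR_conv_of_real algebra_simps)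
        qed
      qed
    qed measurable
    also have "\<dots> = fa * (LINT s|lborel. G s) + (LINT s|lborel. cum F s * G s)
      + (LINT s|lborel. F s * cum G s) + complex_of_real (\<alpha> - c) * (LINT s|lborel. F s)"
      using F G integrable_mult_cum[OF F G] integrable_mult_cum[OF G F]
      by (simp add: mult.commute[of "cum F _"])
    also have "(LINT s|lborel. F s) = cum D x" by (simp add: F_def cum_def)
    finally show ?thesis
      using 1 iG by (simp add: scaleR_conv_of_real algebra_simps)
  qed
  have "AE x in lborel. x \<in> {\<alpha><..<\<beta>} \<longrightarrow> fn (mulf (aff \<alpha> \<beta> c) f) x
      = (\<alpha> - c) *\<^sub>R fa + cum (fn (f + mulf (aff \<alpha> \<beta> c) f')) x"
    using f1 fn_mulf[OF q, of f]
  proof eventually_elim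
    fix x assume h: "x \<in> {\<alpha><..<\<beta>} \<longrightarrow> fn f x = fa + cum D x"
      "fn (mulf (aff \<alpha> \<beta> c) f) x = aff \<alpha> \<beta> c x *\<^sub>R fn f x"
    show "x \<in> {\<alpha><..<\<beta>} \<longrightarrow> fn (mulf (aff \<alpha> \<beta> c) f) x
      = (\<alpha> - c) *\<^sub>R fa + cum (fn (f + mulf (aff \<alpha> \<beta> c) f')) x"
    proof
      assume x: "x \<in> {\<alpha><..<\<beta>}"
      then have "fn (mulf (aff \<alpha> \<beta> c) f) x = (x - c) *\<^sub>R (fa + cum D x)"
        using h by (simp add: aff_def)
      then show "fn (mulf (aff \<alpha> \<beta> c) f) x
        = (\<alpha> - c) *\<^sub>R fa + cum (fn (f + mulf (aff \<alpha> \<beta> c) f')) x"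
        using key[of x] x by simp
    qed
  qed
  moreover have "(\<beta> - c) *\<^sub>R fb = (\<alpha> - c) *\<^sub>R fa + cum (fn (f + mulf (aff \<alpha> \<beta> c) f')) \<beta>"
    using key[of \<beta>] le f by (simp add: W_def D_def)
  ultimately show ?thesis
    using s supp_mulf[OF q] by (simp add: W_def supp_add)
qed

section \<open>Weak derivatives on an interval\<close>

lemma AE_not_in_open:
  fixes U :: "real set"
  assumes "open U" "AE x in lborel. x \<notin> U"
  shows "U = {}"
proof -
  have "{x \<in> space lborel. \<not> x \<notin> U} = U" by auto
  then have "emeasure lborel U = 0"
    using AE_iff_measurable[of U lborel "\<lambda>x. x \<notin> U"] assms by auto
  then have "U \<in> null_sets lborel" using assms(1) by auto
  then have "negligible U"
    by (simp add: negligible_iff_null_sets null_sets_completionI)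
  then show ?thesis using open_not_negligible[OF assms(1)] by blast
qed

lemma AE_eq_continuous_on_open:
  fixes f g :: "real \<Rightarrow> complex"
  assumes "open S" "continuous_on S f" "continuous_on S g" "AE x in lborel. x \<in> S \<longrightarrow> f x = g x"
    and x: "x \<in> S"
  shows "f x = g x"
proof -
  define U where "U = S \<inter> (\<lambda>x. f x - g x) -` (- {0})"
  have "open U"
    unfolding U_def
    by (rule continuous_open_preimage) (auto intro!: continuous_intros assms)
  moreover have "AE x in lborel. x \<notin> U"
    using assms(4) by eventually_elim (auto simp: U_def)
  ultimately have "U = {}" by (rule AE_not_in_open)
  then show ?thesis using x by (auto simp: U_def)
qed

text \<open>The difference of the two descriptions represents the zero function, so a continuous
  function vanishes almost everywhere on the interval, hence everywhere on its closure. Its value at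
  \<alpha> gives the trace, and then all indefinite integrals of the difference of the derivatives
  vanish.\<close>

lemma W_unique:
  assumes "\<alpha> < \<beta>" "W \<alpha> \<beta> f g fa fb" "W \<alpha> \<beta> f g' fa' fb'"
  shows "g = g'" "fa = fa'" "fb = fb'"
proof -
  define h where "h = g - g'"
  define ha where "ha = fa - fa'"
  define hb where "hb = fb - fb'"
  have w: "W \<alpha> \<beta> 0 h ha hb"
    using W_diff[OF assms(2,3)] by (simp add: h_def ha_def hb_def)
  have s: "supp {\<alpha><..<\<beta>} h" using w by (simp add: W_def)
  have cont: "continuous_on UNIV (cum (fn h))"
    by (intro continuous_on_cum integrable_fn_supp[OF s])
  have ae: "AE x in lborel. x \<in> {\<alpha><..<\<beta>} \<longrightarrow> ha + cum (fn h) x = 0"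
    using w[unfolded W_def] fn_zero by (auto elim: eventually_elim2)
  have in0: "ha + cum (fn h) x = 0" if "x \<in> {\<alpha><..<\<beta>}" for x
    by (rule AE_eq_continuous_on_open[OF _ _ _ ae that])
      (auto intro!: continuous_intros continuous_on_subset[OF cont])
  have "closure {\<alpha><..<\<beta>} \<subseteq> {x. ha + cum (fn h) x = 0}"
    by (rule closure_minimal) (use in0 in \<open>auto intro!: closed_Collect_eq continuous_intros cont\<close>)
  then have cl: "ha + cum (fn h) x = 0" if "x \<in> {\<alpha>..\<beta>}" for x
    using assms(1) that by (auto simp: closure_greaterThanLessThan)
  have ha: "ha = 0" using cl[of \<alpha>] assms(1) cum_fn_start[OF s, of \<alpha>] by simp
  have c0: "cum (fn h) x = 0" for x
  proof -
    consider "x \<le> \<alpha>" | "x \<in> {\<alpha>..\<beta>}" | "\<beta> \<le> x" by fastforce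
    then show ?thesis
    proof cases
      case 3
      have s': "supp {\<alpha><..<x} h"
        using s unfolding supp_def by eventually_elim (use 3 in auto)
      show ?thesis
        using cum_fn_end[OF s'] cum_fn_end[OF s] cl[of \<beta>] ha assms(1) by simp
    qed (use cum_fn_start[OF s] cl ha in auto)
  qed
  have "AE x in lborel. fn h x = 0"
    by (rule AE_zero_of_cum[OF integrable_fn_supp[OF s] c0])
  then have "AE x in lborel. fn h x = fn 0 x" using fn_zero by eventually_elim simp
  then have h0: "h = 0" by (rule l2_eqI)
  show "g = g'" using h0 by (simp add: h_def)
  show "fa = fa'" using ha by (simp add: ha_def)
  show "fb = fb'" using w ha c0 by (simp add: W_def hb_def)
qed

definition anti :: "real \<Rightarrow> real \<Rightarrow> complex \<Rightarrow> l2 \<Rightarrow> l2" where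
  "anti \<alpha> \<beta> c g = mkI \<alpha> \<beta> (\<lambda>x. c + cum (fn g) x)"

lemma W_anti:
  assumes "supp {\<alpha><..<\<beta>} g"
  shows "W \<alpha> \<beta> (anti \<alpha> \<beta> c g) g c (c + cum (fn g) \<beta>)"
proof -
  have cont: "continuous_on {\<alpha>..\<beta>} (\<lambda>x. c + cum (fn g) x)"
    by (intro continuous_intros continuous_on_subset[OF continuous_on_cum] integrable_fn_supp[OF assms]) auto
  have "AE x in lborel. x \<in> {\<alpha><..<\<beta>} \<longrightarrow> fn (anti \<alpha> \<beta> c g) x = c + cum (fn g) x"
    using fn_mkI[OF cont] unfolding anti_def by eventually_elim auto
  then show ?thesis
    using assms supp_mkI[OF cont] by (simp add: W_def anti_def)
qed

lemma test_function_zero_off: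
  assumes "test_function S \<phi> \<phi>'" "x \<notin> S" shows "\<phi> x = 0" "\<phi>' x = 0"
proof -
  obtain K where K: "compact K" "K \<subseteq> S" "\<And>x. x \<notin> K \<Longrightarrow> \<phi> x = 0"
    using assms by (auto simp: test_function_def)
  show "\<phi> x = 0" using K assms by auto
  have "open (- K)" using K by (simp add: compact_imp_closed open_Compl)
  moreover have "x \<in> - K" using K assms by auto
  ultimately have "eventually (\<lambda>y. y \<in> - K) (nhds x)" by (rule eventually_nhds_in_open)
  then have ev: "eventually (\<lambda>y. \<phi> y = 0) (nhds x)"
    by (rule eventually_mono) (use K in auto)
  have "(\<phi> has_real_derivative \<phi>' x) (at x)" using assms by (auto simp: test_function_def)
  then have "((\<lambda>_. 0) has_real_derivative \<phi>' x) (at x)"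
    using DERIV_cong_ev[OF refl ev refl] by simp
  then show "\<phi>' x = 0" using DERIV_unique DERIV_const by blast
qed

text \<open>Only the end points have to avoid \<open>S\<close>. The same statement therefore covers
  a test function on a union of two intervals, restricted to one of them: no splitting into test
  functions on the components is needed.\<close>

lemma W_test_function:
  assumes "test_function S \<phi> \<phi>'" "\<alpha> < \<beta>" "\<alpha> \<notin> S" "\<beta> \<notin> S"
  shows "W \<alpha> \<beta> (mkI \<alpha> \<beta> (\<lambda>x. complex_of_real (\<phi> x))) (mkI \<alpha> \<beta> (\<lambda>x. complex_of_real (\<phi>' x))) 0 0"
proof -
  have "((\<lambda>x. complex_of_real (\<phi> x)) has_vector_derivative complex_of_real (\<phi>' x)) (at x within {\<alpha>..\<beta>})" for x
    using assms(1)
    by (intro has_vector_derivative_of_real)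
      (auto simp: test_function_def has_real_derivative_iff_has_vector_derivative
        intro: has_vector_derivative_at_within)
  moreover have "continuous_on {\<alpha>..\<beta>} (\<lambda>x. complex_of_real (\<phi>' x))"
    using assms(1) by (intro continuous_intros) (auto simp: test_function_def intro: continuous_on_subset)
  ultimately show ?thesis
    using W_mkI[of \<alpha> \<beta> "\<lambda>x. complex_of_real (\<phi> x)" "\<lambda>x. complex_of_real (\<phi>' x)"] assms(2)
      test_function_zero_off[OF assms(1,3)] test_function_zero_off[OF assms(1,4)] by auto
qed

lemma ip_mkI_of_real:
  assumes "continuous_on {\<alpha>..\<beta>} \<phi>" "supp {\<alpha><..<\<beta>} f" "\<phi> \<in> borel_measurable borel"
  shows "ip f (mkI \<alpha> \<beta> (\<lambda>x. complex_of_real (\<phi> x))) = (LINT x|lborel. \<phi> x *\<^sub>R fn f x)"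
  unfolding ip_def
proof (rule integral_cong_AE)
  have c: "continuous_on {\<alpha>..\<beta>} (\<lambda>x. complex_of_real (\<phi> x))" using assms by (intro continuous_intros)
  show "AE x in lborel. fn f x * cnj (fn (mkI \<alpha> \<beta> (\<lambda>x. complex_of_real (\<phi> x))) x) = \<phi> x *\<^sub>R fn f x"
    using fn_mkI[OF c] assms(2)[unfolded supp_def]
    by eventually_elim (auto simp: indicator_def scaleR_conv_of_real)
  note assms(3)[measurable]
  show "(\<lambda>x. \<phi> x *\<^sub>R fn f x) \<in> borel_measurable lborel" by measurable
qed measurable

lemma test_function_continuous:
  assumes "test_function S \<phi> \<phi>'"
  shows "continuous_on A \<phi>" "continuous_on A \<phi>'"
proof -
  have "continuous_on UNIV \<phi>"
    using assms by (auto simp: test_function_def intro!: continuous_at_imp_continuous_on DERIV_isCont)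
  then show "continuous_on A \<phi>" by (rule continuous_on_subset) simp
  show "continuous_on A \<phi>'" using assms by (auto simp: test_function_def intro: continuous_on_subset)
qed

lemma W_weak:
  assumes "W \<alpha> \<beta> f g fa fb" "test_function S \<phi> \<phi>'" "\<alpha> < \<beta>" "\<alpha> \<notin> S" "\<beta> \<notin> S"
  shows "(LINT x|lborel. \<phi>' x *\<^sub>R fn f x) = - (LINT x|lborel. \<phi> x *\<^sub>R fn g x)"
proof -
  note c = test_function_continuous[OF assms(2), of "{\<alpha>..\<beta>}"] test_function_measurable[OF assms(2)]
  show ?thesis
    using W_by_parts[OF assms(1) W_test_function[OF assms(2-5)]] W_supp[OF assms(1)]
    by (simp add: ip_mkI_of_real[OF c(1) _ c(3), symmetric] ip_mkI_of_real[OF c(2) _ c(4), symmetric]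
        eq_neg_iff_add_eq_0 add.commute)
qed

text \<open>A continuous trapezoid that increases to the indicator of (\<alpha>, \<beta>): it
  vanishes within distance \<open>1 / n\<close> of the end points, rises with slope
  \<open>n\<close>, and equals 1 beyond distance \<open>2 / n\<close>. For \<open>n = 0\<close> the
  factor \<open>real n\<close> makes it zero.\<close>

definition tent :: "real \<Rightarrow> real \<Rightarrow> nat \<Rightarrow> real \<Rightarrow> real" where
  "tent \<alpha> \<beta> n s = min 1 (real n * max 0 (min (s - \<alpha> - 1 / real n) (\<beta> - s - 1 / real n)))"

lemma continuous_on_tent: "continuous_on A (tent \<alpha> \<beta> n)"
  unfolding tent_def by (intro continuous_intros)

lemma tent_bounds: "0 \<le> tent \<alpha> \<beta> n s" "tent \<alpha> \<beta> n s \<le> 1"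
  by (auto simp: tent_def)

lemma tent_zero: "s \<notin> {\<alpha> + 1 / real n..\<beta> - 1 / real n} \<Longrightarrow> tent \<alpha> \<beta> n s = 0"
  by (auto simp: tent_def max_def min_def)

lemma tent_zero': "s \<notin> {\<alpha><..<\<beta>} \<Longrightarrow> tent \<alpha> \<beta> n s = 0"
proof (cases "n = 0")
  case False
  assume s: "s \<notin> {\<alpha><..<\<beta>}"
  define e where "e = 1 / real n"
  have "0 < e" using False by (simp add: e_def)
  then have "s \<notin> {\<alpha> + e..\<beta> - e}" using s by auto
  then show ?thesis by (simp add: tent_zero e_def)
qed (simp add: tent_def)

lemma tent_tendsto: "(\<lambda>n. tent \<alpha> \<beta> n s) \<longlonglongrightarrow> indicator {\<alpha><..<\<beta>} s"
proof (cases "s \<in> {\<alpha><..<\<beta>}")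
  case True
  define d where "d = min (s - \<alpha>) (\<beta> - s)"
  have d: "d > 0" using True by (auto simp: d_def)
  \<comment> \<open>The plateau of the trapezoid begins at distance \<open>2 / n\<close> from the
    end points, and \<open>d\<close> is the distance of \<open>s\<close> from them.\<close>
  obtain N where N: "2 / d < real N" using reals_Archimedean2 by blast
  have "tent \<alpha> \<beta> n s = 1" if "n \<ge> N" for n
  proof -
    have n: "2 / d < real n" using N that by linarith
    then have n0: "real n > 0" using d by (smt (verit) divide_pos_pos)
    have "2 < d * real n" using n d by (simp add: pos_divide_less_eq mult.commute)
    then have "1 \<le> real n * (d - 1 / real n)" using n0 by (simp add: algebra_simps)
    moreover have "d - 1 / real n = min (s - \<alpha> - 1 / real n) (\<beta> - s - 1 / real n)"
      by (simp add: d_def min_def)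
    ultimately have "1 \<le> real n * max 0 (min (s - \<alpha> - 1 / real n) (\<beta> - s - 1 / real n))"
      using n0 by (smt (verit) mult_left_mono)
    then show ?thesis by (simp add: tent_def)
  qed
  then have "eventually (\<lambda>n. tent \<alpha> \<beta> n s = indicator {\<alpha><..<\<beta>} s) sequentially"
    using True by (auto simp: eventually_sequentially)
  then show ?thesis by (rule tendsto_eventually)
next
  case False
  then have "tent \<alpha> \<beta> n s = 0" for n by (rule tent_zero')
  then show ?thesis using False by simp
qed

lemma tent_integral_tendsto:
  fixes h :: "real \<Rightarrow> 'a::{banach, second_countable_topology}"
  assumes h: "integrable lborel h"
  shows "(\<lambda>n. LINT s|lborel. tent \<alpha> \<beta> n s *\<^sub>R h s) \<longlonglongrightarrow> (LINT s|lborel. indicator {\<alpha><..<\<beta>} s *\<^sub>R h s)"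
proof (rule integral_dominated_convergence[where w = "\<lambda>x. norm (h x)"])
  have [measurable]: "h \<in> borel_measurable borel" using h by auto
  have m[measurable]: "tent \<alpha> \<beta> i \<in> borel_measurable borel" for i
    by (intro borel_measurable_continuous_onI continuous_on_tent)
  show "AE x in lborel. (\<lambda>i. tent \<alpha> \<beta> i x *\<^sub>R h x) \<longlonglongrightarrow> indicator {\<alpha><..<\<beta>} x *\<^sub>R h x"
    by (intro AE_I2 tendsto_scaleR tent_tendsto tendsto_const)
  show "\<And>i. AE x in lborel. norm (tent \<alpha> \<beta> i x *\<^sub>R h x) \<le> norm (h x)"
    by (intro AE_I2) (use tent_bounds in \<open>auto intro!: mult_left_le_one_le simp: abs_of_nonneg\<close>)
  show "(\<lambda>s. tent \<alpha> \<beta> i s *\<^sub>R h s) \<in> borel_measurable lborel" for i by measurable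
  show "(\<lambda>s. indicat_real {\<alpha><..<\<beta>} s *\<^sub>R h s) \<in> borel_measurable lborel" by measurable
qed (use h in auto)

text \<open>The antiderivative is constant on each side of the support; mean zero makes both
  constants vanish, so the support stays compact.\<close>

lemma test_function_antiderivative:
  fixes \<psi> :: "real \<Rightarrow> real"
  assumes cont: "continuous_on UNIV \<psi>" and z: "\<And>x. x \<notin> {c..d} \<Longrightarrow> \<psi> x = 0"
    and I: "(LINT x|lborel. \<psi> x) = 0" and cd: "\<alpha> < c" "d < \<beta>"
  shows "\<exists>\<phi>. test_function {\<alpha><..<\<beta>} \<phi> \<psi>"
proof -
  obtain F where F: "\<And>x. x \<in> {\<alpha>..\<beta>} \<Longrightarrow> (F has_vector_derivative \<psi> x) (at x within {\<alpha>..\<beta>})"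
    using antiderivative_continuous[OF continuous_on_subset[OF cont]] by (metis subset_UNIV)
  define \<phi> where "\<phi> x = (if x \<in> {\<alpha>..\<beta>} then F x - F \<alpha> else 0)" for x
  have ftc: "(LINT s|lborel. indicator {x..y} s *\<^sub>R \<psi> s) = F y - F x" if "x \<le> y" "\<alpha> \<le> x" "y \<le> \<beta>" for x y
    by (rule integral_FTC_atLeastAtMost[OF that(1)])
      (use that in \<open>auto intro: has_vector_derivative_within_subset[OF F] continuous_on_subset[OF cont]\<close>)
  have zero: "\<phi> x = 0" if x: "x \<notin> {c..d}" for x
  proof (cases "x \<in> {\<alpha>..\<beta>}")
    case True
    show ?thesis
    proof (cases "x < c")
      case lt: True
      have "(LINT s|lborel. indicator {\<alpha>..x} s *\<^sub>R \<psi> s) = (LINT s::real|lborel. (0::real))"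
        by (rule Bochner_Integration.integral_cong) (use lt z in \<open>auto simp: indicator_def\<close>)
      then show ?thesis using ftc[of \<alpha> x] True by (simp add: \<phi>_def)
    next
      case False
      then have x: "d < x" using x by auto
      have "(LINT s|lborel. indicator {\<alpha>..x} s *\<^sub>R \<psi> s) = (LINT s|lborel. \<psi> s)"
      proof (rule Bochner_Integration.integral_cong)
        fix s
        have "\<psi> s \<noteq> 0 \<Longrightarrow> s \<in> {c..d}" using z by blast
        then show "indicator {\<alpha>..x} s *\<^sub>R \<psi> s = \<psi> s" using x cd by (auto simp: indicator_def)
      qed simp
      then show ?thesis using ftc[of \<alpha> x] True I by (simp add: \<phi>_def)
    qed
  qed (auto simp: \<phi>_def)
  moreover have "(\<phi> has_real_derivative \<psi> x) (at x)" for x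
  proof (cases "x \<in> {\<alpha><..<\<beta>}")
    case True
    have "((\<lambda>x. F x - F \<alpha>) has_real_derivative \<psi> x) (at x)"
      using F[of x] True at_within_Icc_at[of \<alpha> x \<beta>]
      by (auto simp: has_real_derivative_iff_has_vector_derivative intro!: derivative_eq_intros)
    moreover have "eventually (\<lambda>y. \<phi> y = F y - F \<alpha>) (nhds x)"
      using eventually_nhds_in_open[of "{\<alpha><..<\<beta>}" x] True by (auto elim!: eventually_mono simp: \<phi>_def)
    ultimately show ?thesis by (simp add: DERIV_cong_ev)
  next
    case False
    then have "x \<in> - {c..d}" using cd by auto
    then have "eventually (\<lambda>y. y \<in> - {c..d}) (nhds x)" by (intro eventually_nhds_in_open) auto
    then have "eventually (\<lambda>y. \<phi> y = 0) (nhds x)"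
      by (rule eventually_mono) (use zero in auto)
    moreover have "\<psi> x = 0" using z \<open>x \<in> - {c..d}\<close> by auto
    ultimately show ?thesis by (simp add: DERIV_cong_ev)
  qed
  ultimately have "test_function {\<alpha><..<\<beta>} \<phi> \<psi>"
    unfolding test_function_def using cont cd
    by (intro conjI allI exI[of _ "{c..d}"]) auto
  then show ?thesis by blast
qed

text \<open>The du Bois-Reymond argument. Subtracting an antiderivative of \<open>g\<close> leaves
  \<open>D\<close> with weak derivative zero, so \<open>D\<close> annihilates every continuous
  function with mean zero and compact support in the interval. Comparing trapezoids with one fixed
  trapezoid shows that the integral of \<open>D\<close> over (\<alpha>, \<open>b\<close>) is linear
  in \<open>b\<close>, hence that \<open>D\<close> is constant.\<close>

theorem W_of_weak_derivative:
  assumes ab: "\<alpha> < \<beta>" and sf: "supp {\<alpha><..<\<beta>} f" and sg: "supp {\<alpha><..<\<beta>} g"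
    and weak: "\<And>\<phi> \<phi>'. test_function {\<alpha><..<\<beta>} \<phi> \<phi>' \<Longrightarrow>
      (LINT x|lborel. \<phi>' x *\<^sub>R fn f x) = - (LINT x|lborel. \<phi> x *\<^sub>R fn g x)"
  shows "\<exists>fa fb. W \<alpha> \<beta> f g fa fb"
proof -
  define G where "G = anti \<alpha> \<beta> 0 g"
  define D where "D = f - G"
  have wG: "W \<alpha> \<beta> G g 0 (0 + cum (fn g) \<beta>)" unfolding G_def by (rule W_anti[OF sg])
  have sD: "supp {\<alpha><..<\<beta>} D"
    using supp_add[OF sf supp_csc[of _ G "-1"]] W_supp(1)[OF wG]
    by (simp add: D_def csc_of_real[of "-1", simplified])
  have iD: "integrable lborel (fn D)" by (rule integrable_fn_supp[OF sD])
  have test: "(LINT x|lborel. \<phi>' x *\<^sub>R fn D x) = 0" if t: "test_function {\<alpha><..<\<beta>} \<phi> \<phi>'" for \<phi> \<phi>'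
  proof -
    note c = test_function_continuous[OF t, of "{\<alpha>..\<beta>}"] test_function_measurable[OF t]
    have "(LINT x|lborel. \<phi>' x *\<^sub>R fn f x) = (LINT x|lborel. \<phi>' x *\<^sub>R fn G x)"
      using weak[OF t] W_weak[OF wG t ab] by simp
    then show ?thesis
      by (simp add: ip_mkI_of_real[OF c(2) _ c(4), symmetric] sD sf W_supp(1)[OF wG])
        (simp add: D_def ip.diff_left)
  qed
  have tent0: "(LINT x|lborel. \<psi> x *\<^sub>R fn D x) = 0"
    if "continuous_on UNIV \<psi>" "\<And>x. x \<notin> {c..d} \<Longrightarrow> \<psi> x = 0" "(LINT x|lborel. \<psi> x) = 0" "\<alpha> < c" "d < \<beta>"
    for \<psi> c d
    using test_function_antiderivative[OF that] test by blast
  have it: "integrable lborel (\<lambda>x. tent \<alpha> b n x)" if "b \<le> \<beta>" for b n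
  proof (rule Bochner_Integration.integrable_bound[of lborel "indicat_real {\<alpha>..\<beta>}"])
    show "tent \<alpha> b n \<in> borel_measurable lborel"
      by (auto intro: borel_measurable_continuous_onI continuous_on_tent)
    show "AE x in lborel. norm (tent \<alpha> b n x) \<le> norm (indicat_real {\<alpha>..\<beta>} x)"
    proof (rule AE_I2)
      fix x
      show "norm (tent \<alpha> b n x) \<le> norm (indicat_real {\<alpha>..\<beta>} x)"
        using tent_zero'[of x \<alpha> b n] tent_bounds[of \<alpha> b n x] that by (auto simp: indicator_def)
    qed
  qed (simp add: ab less_imp_le)
  have itD: "integrable lborel (\<lambda>x. tent \<alpha> b n x *\<^sub>R fn D x)" for b n
  proof (rule Bochner_Integration.integrable_bound[OF iD])
    have [measurable]: "tent \<alpha> b n \<in> borel_measurable borel"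
      by (auto intro: borel_measurable_continuous_onI continuous_on_tent)
    show "(\<lambda>x. tent \<alpha> b n x *\<^sub>R fn D x) \<in> borel_measurable lborel" by measurable
    show "AE x in lborel. norm (tent \<alpha> b n x *\<^sub>R fn D x) \<le> norm (fn D x)"
      by (intro AE_I2) (use tent_bounds in \<open>auto intro!: mult_left_le_one_le simp: abs_of_nonneg\<close>)
  qed
  define I where "I = (\<lambda>b n. LINT x|lborel. tent \<alpha> b n x)"
  define J where "J = (\<lambda>b n. LINT x|lborel. tent \<alpha> b n x *\<^sub>R fn D x)"
  have Ilim: "(\<lambda>n. I b n) \<longlonglongrightarrow> b - \<alpha>" if "b \<in> {\<alpha>..\<beta>}" for b
  proof -
    have i: "integrable lborel (indicat_real {\<alpha>..\<beta>})" using ab by simp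
    have e1: "tent \<alpha> b n x * indicat_real {\<alpha>..\<beta>} x = tent \<alpha> b n x" for n x
    proof (cases "x \<in> {\<alpha>..\<beta>}")
      case False
      then have "x \<notin> {\<alpha><..<b}" using that by auto
      then show ?thesis by (simp add: tent_zero')
    qed simp
    have e2: "indicat_real {\<alpha><..<b} x * indicat_real {\<alpha>..\<beta>} x = indicat_real {\<alpha><..<b} x" for x
      using that by (auto simp: indicator_def)
    show ?thesis
      using tent_integral_tendsto[OF i, of \<alpha> b, unfolded real_scaleR_def e1 e2] that by (simp add: I_def)
  qed
  have Jlim: "(\<lambda>n. J b n) \<longlonglongrightarrow> (LINT x|lborel. indicator {\<alpha><..<b} x *\<^sub>R fn D x)" for b
    unfolding J_def by (rule tent_integral_tendsto[OF iD])
  have "eventually (\<lambda>n. I \<beta> n > 0) sequentially"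
    using order_tendstoD(1)[OF Ilim[of \<beta>], of 0] ab by auto
  \<comment> \<open>The reference trapezoid; its mass must be nonzero, because it is divided by in
    the normalisation that defines the constant \<open>C\<close>.\<close>
  then obtain N where N: "I \<beta> N > 0" "N > 0"
    by (metis (mono_tags, lifting) eventually_sequentially le_Suc_eq zero_less_Suc order_refl)
  define C where "C = (1 / I \<beta> N) *\<^sub>R J \<beta> N"
  have JI: "J b n = I b n *\<^sub>R C" if b: "b \<in> {\<alpha>..\<beta>}" and n: "n > 0" for b n
  proof -
    \<comment> \<open>The ratio of the masses, chosen so that the difference of the two trapezoids
      has mean zero.\<close>
    define \<kappa> where "\<kappa> = I b n / I \<beta> N"
    \<comment> \<open>Together with \<open>d\<close> this bounds a compact interval inside
      (\<alpha>, \<beta>) that contains the supports of both trapezoids.\<close>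
    define c where "c = \<alpha> + min (1 / real n) (1 / real N)"
    define d where "d = \<beta> - min (1 / real n) (1 / real N)"
    have "(LINT x|lborel. (tent \<alpha> b n x - \<kappa> * tent \<alpha> \<beta> N x) *\<^sub>R fn D x) = 0"
    proof (rule tent0)
      show "continuous_on UNIV (\<lambda>x. tent \<alpha> b n x - \<kappa> * tent \<alpha> \<beta> N x)"
        by (intro continuous_intros continuous_on_tent)
      show "tent \<alpha> b n x - \<kappa> * tent \<alpha> \<beta> N x = 0" if x: "x \<notin> {c..d}" for x
      proof -
        have "x \<notin> {\<alpha> + 1 / real n..b - 1 / real n}" "x \<notin> {\<alpha> + 1 / real N..\<beta> - 1 / real N}"
          using x b by (auto simp: c_def d_def min_def split: if_splits)
        then show ?thesis by (simp add: tent_zero)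
      qed
      show "(LINT x|lborel. tent \<alpha> b n x - \<kappa> * tent \<alpha> \<beta> N x) = 0"
        using it[of b n] it[of \<beta> N] b N by (simp add: \<kappa>_def I_def)
      show "\<alpha> < c" "d < \<beta>" using n N by (auto simp: c_def d_def)
    qed
    then have "J b n - \<kappa> *\<^sub>R J \<beta> N = 0"
      using itD[of b n] itD[of \<beta> N] by (simp add: J_def scaleR_left_diff_distrib flip: scaleR_scaleR)
    then show ?thesis by (simp add: \<kappa>_def C_def)
  qed
  have main: "(LINT x|lborel. indicator {\<alpha><..<b} x *\<^sub>R fn D x) = (b - \<alpha>) *\<^sub>R C" if b: "b \<in> {\<alpha>..\<beta>}" for b
  proof (rule LIMSEQ_unique[OF Jlim])
    have "(\<lambda>n. I b n *\<^sub>R C) \<longlonglongrightarrow> (b - \<alpha>) *\<^sub>R C" by (intro tendsto_scaleR Ilim b tendsto_const)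
    moreover have "eventually (\<lambda>n. I b n *\<^sub>R C = J b n) sequentially"
      using eventually_gt_at_top[of 0] by eventually_elim (rule JI[OF b, symmetric])
    ultimately show "(\<lambda>n. J b n) \<longlonglongrightarrow> (b - \<alpha>) *\<^sub>R C" by (rule Lim_transform_eventually)
  qed
  have wC: "W \<alpha> \<beta> (csc C (one \<alpha> \<beta>)) 0 C C"
    using W_csc[OF W_one[OF less_imp_le[OF ab]], of C] by simp
  define h where "h = D - csc C (one \<alpha> \<beta>)"
  have sh: "supp {\<alpha><..<\<beta>} h"
    using supp_add[OF sD supp_csc[of _ "csc C (one \<alpha> \<beta>)" "-1"]] W_supp(1)[OF wC]
    by (simp add: h_def csc_of_real[of "-1", simplified])
  have sone: "AE x in lborel. fn (csc C (one \<alpha> \<beta>)) x = indicator {\<alpha><..<\<beta>} x *\<^sub>R C"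
    using fn_csc[of C "one \<alpha> \<beta>"] fn_mkI[of \<alpha> \<beta> "\<lambda>_. 1"] unfolding one_def
    by (auto elim!: eventually_elim2 simp: indicator_def)
  have "cum (fn h) b = 0" if b: "b \<in> {\<alpha>..\<beta>}" for b
  proof -
    have "cum (fn h) b = (LINT x|lborel. indicator {\<alpha><..<b} x *\<^sub>R fn D x - indicator {\<alpha><..<b} x *\<^sub>R C)"
      unfolding cum_def
    proof (rule integral_cong_AE)
      show "AE x in lborel. indicat_real {..b} x *\<^sub>R fn h x
        = indicator {\<alpha><..<b} x *\<^sub>R fn D x - indicator {\<alpha><..<b} x *\<^sub>R C"
        using fn_diff[of D "csc C (one \<alpha> \<beta>)"] sone sD[unfolded supp_def] AE_lborel_singleton[of b]
        unfolding h_def[symmetric]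
        by eventually_elim (use b in \<open>auto simp: indicator_def\<close>)
    qed measurable
    also have "\<dots> = (LINT x|lborel. indicator {\<alpha><..<b} x *\<^sub>R fn D x) - (LINT x|lborel. indicator {\<alpha><..<b} x *\<^sub>R C)"
      using b by (intro Bochner_Integration.integral_diff integrable_mult_indicator iD
          integrable_scaleR_left integrable_real_indicator) auto
    also have "\<dots> = 0" using main[OF b] b by simp
    finally show ?thesis .
  qed
  then have c0: "cum (fn h) x = 0" for x
  proof -
    consider "x \<le> \<alpha>" | "x \<in> {\<alpha>..\<beta>}" | "\<beta> \<le> x" by fastforce
    then show ?thesis
    proof cases
      case 3
      have s': "supp {\<alpha><..<x} h"
        using sh unfolding supp_def by eventually_elim (use 3 in auto)
      show ?thesis
        using cum_fn_end[OF s'] cum_fn_end[OF sh] \<open>\<And>b. b \<in> {\<alpha>..\<beta>} \<Longrightarrow> cum (fn h) b = 0\<close>[of \<beta>] ab by simp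
    qed (use cum_fn_start[OF sh] \<open>\<And>b. b \<in> {\<alpha>..\<beta>} \<Longrightarrow> cum (fn h) b = 0\<close> in auto)
  qed
  have "AE x in lborel. fn h x = 0"
    by (rule AE_zero_of_cum[OF integrable_fn_supp[OF sh] c0])
  then have "AE x in lborel. fn h x = fn 0 x" using fn_zero by eventually_elim simp
  then have "h = 0" by (rule l2_eqI)
  then have "f = G + csc C (one \<alpha> \<beta>)" by (simp add: h_def D_def algebra_simps)
  then show ?thesis using W_add[OF wG wC] by auto
qed

section \<open>Sobolev spaces and traces\<close>

text \<open>Two continuous representatives agree everywhere on the open set \<open>S\<close>, and a
  limit within \<open>S\<close> sees only these values.\<close>

lemma has_trace_unique:
  assumes "open S" "p islimpt S" "has_trace S f p c" "has_trace S f p c'"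
  shows "c = c'"
proof -
  obtain g where g: "continuous_on S g" "AE x in lborel. x \<in> S \<longrightarrow> rep_l0 f x = g x" "(g \<longlongrightarrow> c) (at p within S)"
    using assms(3) unfolding has_trace_rep by blast
  obtain h where h: "continuous_on S h" "AE x in lborel. x \<in> S \<longrightarrow> rep_l0 f x = h x" "(h \<longlongrightarrow> c') (at p within S)"
    using assms(4) unfolding has_trace_rep by blast
  have "AE x in lborel. x \<in> S \<longrightarrow> g x = h x" using g(2) h(2) by eventually_elim simp
  then have eq: "g x = h x" if "x \<in> S" for x
    by (rule AE_eq_continuous_on_open[OF assms(1) g(1) h(1) _ that])
  have "(g \<longlongrightarrow> c') (at p within S)"
    using h(3) by (rule Lim_transform_within[of _ _ _ _ 1]) (auto simp: eq)
  then show ?thesis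
    using tendsto_unique g(3) assms(2) by (metis trivial_limit_within)
qed

lemma trace_eqI: "open S \<Longrightarrow> p islimpt S \<Longrightarrow> has_trace S f p c \<Longrightarrow> trace S f p = c"
  unfolding trace_def using has_trace_unique by blast

lemma supp_el: assumes "f \<in> Lsq S" shows "supp S (el f)"
  using assms unfolding supp_def fn_el[OF assms] by (simp add: Lsq_iff_sqi)

lemma el_inj: "f \<in> Lsq S \<Longrightarrow> g \<in> Lsq S \<Longrightarrow> el f = el g \<Longrightarrow> f = g"
  by (metis Rep_el)

lemma Rep_l2_Lsq: "supp S f \<Longrightarrow> Rep_l2 f \<in> Lsq S"
  using sqi_fn[of f] by (simp add: Lsq_iff_sqi supp_def fn_def)

lemma el_add: "f \<in> Lsq S \<Longrightarrow> g \<in> Lsq S \<Longrightarrow> el (f + g) = el f + el g"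
  by (simp add: plus_l2_def Rep_el)

lemma el_diff: "f \<in> Lsq S \<Longrightarrow> g \<in> Lsq S \<Longrightarrow> el (f - g) = el f - el g"
  by (simp add: minus_l2_def Rep_el)

lemma el_scale: "f \<in> Lsq S \<Longrightarrow> el (scale_l0 c f) = csc c (el f)"
  by (simp add: csc_def Rep_el)

lemma el_zero: "el 0 = 0" by (simp add: zero_l2_def)

lemma l2_inner_el: "f \<in> Lsq S \<Longrightarrow> g \<in> Lsq S \<Longrightarrow> l2_inner f g = ip (el f) (el g)"
  by (simp add: ip_Rep Rep_el)

lemma has_weak_derivative_interval_iff:
  assumes "\<alpha> < \<beta>"
  shows "has_weak_derivative {\<alpha><..<\<beta>} f g \<longleftrightarrow>
    f \<in> Lsq {\<alpha><..<\<beta>} \<and> g \<in> Lsq {\<alpha><..<\<beta>} \<and> (\<exists>fa fb. W \<alpha> \<beta> (el f) (el g) fa fb)"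
proof safe
  assume "has_weak_derivative {\<alpha><..<\<beta>} f g"
  then show f: "f \<in> Lsq {\<alpha><..<\<beta>}" and g: "g \<in> Lsq {\<alpha><..<\<beta>}"
    and "\<exists>fa fb. W \<alpha> \<beta> (el f) (el g) fa fb"
    unfolding has_weak_derivative_def weak_derivative_identity_rep
    by (auto simp: fn_el intro!: W_of_weak_derivative[OF assms supp_el supp_el])
next
  fix fa fb assume "f \<in> Lsq {\<alpha><..<\<beta>}" "g \<in> Lsq {\<alpha><..<\<beta>}" "W \<alpha> \<beta> (el f) (el g) fa fb"
  then show "has_weak_derivative {\<alpha><..<\<beta>} f g"
    using W_weak[OF _ _ assms, of "el f" "el g" fa fb "{\<alpha><..<\<beta>}"]
    by (simp add: has_weak_derivative_def weak_derivative_identity_rep fn_el)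
qed

lemma has_trace_interval:
  assumes "\<alpha> < \<beta>" "f \<in> Lsq {\<alpha><..<\<beta>}" "W \<alpha> \<beta> (el f) g fa fb"
  shows "has_trace {\<alpha><..<\<beta>} f \<alpha> fa" "has_trace {\<alpha><..<\<beta>} f \<beta> fb"
proof -
  let ?g = "\<lambda>x. fa + cum (fn g) x"
  have cont: "continuous_on UNIV ?g"
    using W_supp(2)[OF assms(3)] by (intro continuous_intros continuous_on_cum integrable_fn_supp)
  have ae: "AE x in lborel. x \<in> {\<alpha><..<\<beta>} \<longrightarrow> rep_l0 f x = ?g x"
    using assms(2,3) by (simp add: W_def fn_el)
  have tr: "has_trace {\<alpha><..<\<beta>} f p (?g p)" for p
  proof -
    have "(?g \<longlongrightarrow> ?g p) (at p within {\<alpha><..<\<beta>})"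
      using cont by (meson UNIV_I continuous_on_def subset_UNIV tendsto_within_subset)
    then show ?thesis
      unfolding has_trace_rep using ae continuous_on_subset[OF cont subset_UNIV] by blast
  qed
  show "has_trace {\<alpha><..<\<beta>} f \<alpha> fa"
    using tr[of \<alpha>] cum_fn_start[OF W_supp(2)[OF assms(3)], of \<alpha>] by simp
  show "has_trace {\<alpha><..<\<beta>} f \<beta> fb"
    using tr[of \<beta>] assms(3) by (simp add: W_def)
qed

text \<open>Together with the elimination rule that follows, this replaces the definite descriptions
  behind \<open>wderiv\<close> and \<open>trace\<close> by the relation \<open>W\<close>; later
  arguments use only \<open>W\<close>.\<close>

theorem Sob1_intervalI:
  assumes "\<alpha> < \<beta>" "f \<in> Lsq {\<alpha><..<\<beta>}" "g \<in> Lsq {\<alpha><..<\<beta>}" "W \<alpha> \<beta> (el f) (el g) fa fb"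
  shows "f \<in> Sob1 {\<alpha><..<\<beta>}" "wderiv {\<alpha><..<\<beta>} f = g"
    "trace {\<alpha><..<\<beta>} f \<alpha> = fa" "trace {\<alpha><..<\<beta>} f \<beta> = fb"
proof -
  have h: "has_weak_derivative {\<alpha><..<\<beta>} f g"
    using assms by (auto simp: has_weak_derivative_interval_iff)
  then show "f \<in> Sob1 {\<alpha><..<\<beta>}" by (auto simp: Sob1_def)
  show "wderiv {\<alpha><..<\<beta>} f = g"
    unfolding wderiv_def
  proof (rule the_equality)
    show "has_weak_derivative {\<alpha><..<\<beta>} f g" by (rule h)
  next
    fix g' assume "has_weak_derivative {\<alpha><..<\<beta>} f g'"
    then obtain fa' fb' where "g' \<in> Lsq {\<alpha><..<\<beta>}" "W \<alpha> \<beta> (el f) (el g') fa' fb'"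
      by (auto simp: has_weak_derivative_interval_iff[OF assms(1)])
    then show "g' = g"
      using W_unique(1)[OF assms(1,4)] el_inj[OF _ assms(3)] by metis
  qed
  show "trace {\<alpha><..<\<beta>} f \<alpha> = fa" "trace {\<alpha><..<\<beta>} f \<beta> = fb"
    using has_trace_interval[OF assms(1,2,4)] islimpt_greaterThanLessThan1[OF assms(1)]
      islimpt_greaterThanLessThan2[OF assms(1)]
    by (simp_all add: trace_eqI)
qed

theorem Sob1_intervalE:
  assumes "\<alpha> < \<beta>" "f \<in> Sob1 {\<alpha><..<\<beta>}"
  shows "f \<in> Lsq {\<alpha><..<\<beta>}" "wderiv {\<alpha><..<\<beta>} f \<in> Lsq {\<alpha><..<\<beta>}"
    "W \<alpha> \<beta> (el f) (el (wderiv {\<alpha><..<\<beta>} f)) (trace {\<alpha><..<\<beta>} f \<alpha>) (trace {\<alpha><..<\<beta>} f \<beta>)"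
proof -
  obtain g fa fb where *: "f \<in> Lsq {\<alpha><..<\<beta>}" "g \<in> Lsq {\<alpha><..<\<beta>}" "W \<alpha> \<beta> (el f) (el g) fa fb"
    using assms by (auto simp: Sob1_def has_weak_derivative_interval_iff)
  show "f \<in> Lsq {\<alpha><..<\<beta>}" by fact
  show "wderiv {\<alpha><..<\<beta>} f \<in> Lsq {\<alpha><..<\<beta>}"
    "W \<alpha> \<beta> (el f) (el (wderiv {\<alpha><..<\<beta>} f)) (trace {\<alpha><..<\<beta>} f \<alpha>) (trace {\<alpha><..<\<beta>} f \<beta>)"
    using Sob1_intervalI(2-4)[OF assms(1) *] * by auto
qed

definition cut :: "real \<Rightarrow> real \<Rightarrow> l2 \<Rightarrow> l2" where
  "cut \<alpha> \<beta> = mulf (indicator {\<alpha><..<\<beta>})"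

lemma fn_cut: "AE x in lborel. fn (cut \<alpha> \<beta> f) x = indicator {\<alpha><..<\<beta>} x *\<^sub>R fn f x"
  unfolding cut_def by (rule fn_mulf[OF bdd_mult_indicator]) simp

lemma supp_cut: "supp {\<alpha><..<\<beta>} (cut \<alpha> \<beta> f)"
  unfolding cut_def by (rule supp_mulf_indicator) simp

lemma cut_id: "supp {\<alpha><..<\<beta>} f \<Longrightarrow> cut \<alpha> \<beta> f = f"
  unfolding cut_def by (rule mulf_indicator_id) auto

lemma cut_add: "cut \<alpha> \<beta> (f + g) = cut \<alpha> \<beta> f + cut \<alpha> \<beta> g"
  unfolding cut_def by (rule mulf_add[OF bdd_mult_indicator]) simp

lemma cut_csc: "cut \<alpha> \<beta> (csc c f) = csc c (cut \<alpha> \<beta> f)"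
  unfolding cut_def by (rule mulf_csc[OF bdd_mult_indicator]) simp

lemma cut_disjoint:
  assumes "supp S f" "S \<inter> {\<alpha><..<\<beta>} = {}" shows "cut \<alpha> \<beta> f = 0"
proof (rule l2_eqI)
  show "AE x in lborel. fn (cut \<alpha> \<beta> f) x = fn 0 x"
    using fn_cut[of \<alpha> \<beta> f] assms(1) fn_zero unfolding supp_def
    by eventually_elim (use assms(2) in \<open>auto simp: indicator_def\<close>)
qed

lemma supp_Un: assumes "supp S f" "S \<subseteq> T" shows "supp T f"
  using assms(1) unfolding supp_def by eventually_elim (use assms(2) in auto)

lemma cut_Un:
  assumes "supp ({\<alpha><..<\<beta>} \<union> {\<gamma><..<\<delta>}) f" "\<beta> \<le> \<gamma>"
  shows "cut \<alpha> \<beta> f + cut \<gamma> \<delta> f = f"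
proof (rule l2_eqI)
  show "AE x in lborel. fn (cut \<alpha> \<beta> f + cut \<gamma> \<delta> f) x = fn f x"
    using fn_cut[of \<alpha> \<beta> f] fn_cut[of \<gamma> \<delta> f] fn_add[of "cut \<alpha> \<beta> f" "cut \<gamma> \<delta> f"] assms(1)
    unfolding supp_def by eventually_elim (use assms(2) in \<open>auto simp: indicator_def\<close>)
qed

lemma ip_cut_Un:
  assumes "supp ({\<alpha><..<\<beta>} \<union> {\<gamma><..<\<delta>}) f" "supp ({\<alpha><..<\<beta>} \<union> {\<gamma><..<\<delta>}) g" "\<beta> \<le> \<gamma>"
  shows "ip f g = ip (cut \<alpha> \<beta> f) (cut \<alpha> \<beta> g) + ip (cut \<gamma> \<delta> f) (cut \<gamma> \<delta> g)"
proof -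
  have disj: "{\<alpha><..<\<beta>} \<inter> {\<gamma><..<\<delta>} = {}" "{\<gamma><..<\<delta>} \<inter> {\<alpha><..<\<beta>} = {}" using assms(3) by auto
  have "ip f g = ip (cut \<alpha> \<beta> f + cut \<gamma> \<delta> f) (cut \<alpha> \<beta> g + cut \<gamma> \<delta> g)"
    using cut_Un[OF assms(1,3)] cut_Un[OF assms(2,3)] by simp
  also have "\<dots> = ip (cut \<alpha> \<beta> f) (cut \<alpha> \<beta> g) + ip (cut \<gamma> \<delta> f) (cut \<gamma> \<delta> g)"
    using ip_disjoint[OF supp_cut supp_cut disj(1)] ip_disjoint[OF supp_cut supp_cut disj(2)]
    by (simp add: ip_add_left ip_add_right)
  finally show ?thesis .
qed

text \<open>The strict gap between \<beta> and \<gamma> makes traces one-sided: near each boundary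
  point only one of the two components is seen.\<close>

locale two_intervals =
  fixes \<alpha> \<beta> \<gamma> \<delta> :: real
  assumes ord: "\<alpha> < \<beta>" "\<beta> < \<gamma>" "\<gamma> < \<delta>"
begin

abbreviation "S \<equiv> {\<alpha><..<\<beta>} \<union> {\<gamma><..<\<delta>}"

lemma integral_cut:
  assumes "supp S f" "q \<in> borel_measurable borel" "continuous_on UNIV q"
  shows "(LINT x|lborel. q x *\<^sub>R fn f x) =
    (LINT x|lborel. q x *\<^sub>R fn (cut \<alpha> \<beta> f) x) + (LINT x|lborel. q x *\<^sub>R fn (cut \<gamma> \<delta> f) x)"
proof -
  note assms(2)[measurable]
  have i: "integrable lborel (\<lambda>x. q x *\<^sub>R fn (cut a b f) x)" for a b
  proof -
    have c: "continuous_on {a..b} q" using assms(3) by (rule continuous_on_subset) simp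
    have "compact (q ` {a..b})" using c by (simp add: compact_continuous_image)
    then obtain C where C: "\<And>x. x \<in> {a..b} \<Longrightarrow> \<bar>q x\<bar> \<le> C"
      using compact_imp_bounded bounded_iff by (metis imageI real_norm_def)
    show ?thesis
    proof (rule Bochner_Integration.integrable_bound[where f = "\<lambda>x. C *\<^sub>R fn (cut a b f) x"])
      show "integrable lborel (\<lambda>x. C *\<^sub>R fn (cut a b f) x)"
        using integrable_fn_supp[OF supp_cut] by auto
      show "AE x in lborel. norm (q x *\<^sub>R fn (cut a b f) x) \<le> norm (C *\<^sub>R fn (cut a b f) x)"
        using supp_cut[of a b f] unfolding supp_def
      proof eventually_elim
        fix x assume z: "x \<notin> {a<..<b} \<longrightarrow> fn (cut a b f) x = 0"
        show "norm (q x *\<^sub>R fn (cut a b f) x) \<le> norm (C *\<^sub>R fn (cut a b f) x)"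
        proof (cases "x \<in> {a<..<b}")
          case True
          then have "\<bar>q x\<bar> \<le> \<bar>C\<bar>" using C[of x] by auto
          then show ?thesis by (simp add: mult_right_mono)
        qed (use z in simp)
      qed
    qed measurable
  qed
  have "(LINT x|lborel. q x *\<^sub>R fn f x)
    = (LINT x|lborel. q x *\<^sub>R fn (cut \<alpha> \<beta> f) x + q x *\<^sub>R fn (cut \<gamma> \<delta> f) x)"
  proof (rule integral_cong_AE)
    show "AE x in lborel. q x *\<^sub>R fn f x = q x *\<^sub>R fn (cut \<alpha> \<beta> f) x + q x *\<^sub>R fn (cut \<gamma> \<delta> f) x"
      using fn_add[of "cut \<alpha> \<beta> f" "cut \<gamma> \<delta> f"] cut_Un[OF assms(1)] ord
      by (auto elim!: eventually_mono simp flip: scaleR_right_distrib)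
  qed measurable
  then show ?thesis using i by simp
qed

text \<open>One direction extends a test function on a component by zero. For the other, a test
  function on \<open>S\<close> vanishes at the end points of each component, so integrating by parts
  over each of them separately leaves no boundary terms.\<close>

lemma has_weak_derivative_iff:
  "has_weak_derivative S f g \<longleftrightarrow> f \<in> Lsq S \<and> g \<in> Lsq S \<and>
    (\<exists>fa fb. W \<alpha> \<beta> (cut \<alpha> \<beta> (el f)) (cut \<alpha> \<beta> (el g)) fa fb) \<and>
    (\<exists>fa fb. W \<gamma> \<delta> (cut \<gamma> \<delta> (el f)) (cut \<gamma> \<delta> (el g)) fa fb)"
proof (intro iffI conjI)
  assume h: "has_weak_derivative S f g"
  then show f: "f \<in> Lsq S" and g: "g \<in> Lsq S" by (auto simp: has_weak_derivative_def)
  have weak: "(LINT x|lborel. \<phi>' x *\<^sub>R fn (el f) x) = - (LINT x|lborel. \<phi> x *\<^sub>R fn (el g) x)"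
    if "test_function S \<phi> \<phi>'" for \<phi> \<phi>'
    using h that by (simp add: has_weak_derivative_def weak_derivative_identity_rep fn_el[OF f] fn_el[OF g])
  have piece: "\<exists>fa fb. W a b (cut a b (el f)) (cut a b (el g)) fa fb"
    if ab: "a < b" "{a<..<b} \<subseteq> S" for a b
  proof (rule W_of_weak_derivative[OF ab(1) supp_cut supp_cut])
    fix \<phi> \<phi>' assume t: "test_function {a<..<b} \<phi> \<phi>'"
    have t': "test_function S \<phi> \<phi>'"
      using t ab(2) by (auto simp: test_function_def)
    note [measurable] = test_function_measurable[OF t]
    have eq: "(LINT x|lborel. q x *\<^sub>R fn (cut a b h) x) = (LINT x|lborel. q x *\<^sub>R fn h x)"
      if [measurable]: "q \<in> borel_measurable borel" and z: "\<And>x. x \<notin> {a<..<b} \<Longrightarrow> q x = 0" for q h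
    proof (rule integral_cong_AE)
      show "AE x in lborel. q x *\<^sub>R fn (cut a b h) x = q x *\<^sub>R fn h x"
        using fn_cut[of a b h] by eventually_elim (use z in \<open>auto simp: indicator_def\<close>)
    qed measurable
    show "(LINT x|lborel. \<phi>' x *\<^sub>R fn (cut a b (el f)) x) = - (LINT x|lborel. \<phi> x *\<^sub>R fn (cut a b (el g)) x)"
      using weak[OF t'] eq[OF test_function_measurable(1)[OF t] test_function_zero_off(1)[OF t]]
        eq[OF test_function_measurable(2)[OF t] test_function_zero_off(2)[OF t]] by simp
  qed
  show "\<exists>fa fb. W \<alpha> \<beta> (cut \<alpha> \<beta> (el f)) (cut \<alpha> \<beta> (el g)) fa fb"
    "\<exists>fa fb. W \<gamma> \<delta> (cut \<gamma> \<delta> (el f)) (cut \<gamma> \<delta> (el g)) fa fb"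
    using ord by (auto intro!: piece)
next
  assume "f \<in> Lsq S \<and> g \<in> Lsq S \<and>
    (\<exists>fa fb. W \<alpha> \<beta> (cut \<alpha> \<beta> (el f)) (cut \<alpha> \<beta> (el g)) fa fb) \<and>
    (\<exists>fa fb. W \<gamma> \<delta> (cut \<gamma> \<delta> (el f)) (cut \<gamma> \<delta> (el g)) fa fb)"
  then obtain fa fb fc fd where f: "f \<in> Lsq S" and g: "g \<in> Lsq S"
    and w1: "W \<alpha> \<beta> (cut \<alpha> \<beta> (el f)) (cut \<alpha> \<beta> (el g)) fa fb"
    and w2: "W \<gamma> \<delta> (cut \<gamma> \<delta> (el f)) (cut \<gamma> \<delta> (el g)) fc fd" by blast
  have "(LINT x|lborel. \<phi>' x *\<^sub>R fn (el f) x) = - (LINT x|lborel. \<phi> x *\<^sub>R fn (el g) x)"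
    if t: "test_function S \<phi> \<phi>'" for \<phi> \<phi>'
    using W_weak[OF w1 t] W_weak[OF w2 t] ord
      integral_cut[OF supp_el[OF f] test_function_measurable(2)[OF t] test_function_continuous(2)[OF t]]
      integral_cut[OF supp_el[OF g] test_function_measurable(1)[OF t] test_function_continuous(1)[OF t]]
    by simp
  then show "has_weak_derivative S f g"
    using f g by (auto simp: has_weak_derivative_def weak_derivative_identity_rep fn_el)
qed

lemma has_trace_two:
  assumes "f \<in> Lsq S" "W \<alpha> \<beta> (cut \<alpha> \<beta> (el f)) g fa fb" "W \<gamma> \<delta> (cut \<gamma> \<delta> (el f)) h fc fd"
  shows "has_trace S f \<alpha> fa" "has_trace S f \<beta> fb" "has_trace S f \<gamma> fc" "has_trace S f \<delta> fd"
proof -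
  define g1 where "g1 = (\<lambda>x. fa + cum (fn g) x)"
  define g2 where "g2 = (\<lambda>x. fc + cum (fn h) x)"
  \<comment> \<open>Any point of the gap would do: the two continuous representatives are glued
    there, away from \<open>S\<close>.\<close>
  define m where "m = (\<beta> + \<gamma>) / 2"
  define G where "G = (\<lambda>x. if x < m then g1 x else g2 x)"
  have m: "\<beta> < m" "m < \<gamma>" using ord by (auto simp: m_def)
  have c1: "continuous_on UNIV g1" unfolding g1_def
    using W_supp(2)[OF assms(2)] by (intro continuous_intros continuous_on_cum integrable_fn_supp)
  have c2: "continuous_on UNIV g2" unfolding g2_def
    using W_supp(2)[OF assms(3)] by (intro continuous_intros continuous_on_cum integrable_fn_supp)
  have ae1: "AE x in lborel. x \<in> {\<alpha><..<\<beta>} \<longrightarrow> fn (cut \<alpha> \<beta> (el f)) x = g1 x"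
    and ae2: "AE x in lborel. x \<in> {\<gamma><..<\<delta>} \<longrightarrow> fn (cut \<gamma> \<delta> (el f)) x = g2 x"
    using assms(2,3) by (simp_all add: W_def g1_def g2_def)
  have ae: "AE x in lborel. x \<in> S \<longrightarrow> rep_l0 f x = G x"
    using ae1 ae2 fn_cut[of \<alpha> \<beta> "el f"] fn_cut[of \<gamma> \<delta> "el f"] unfolding fn_el[OF assms(1)]
    by eventually_elim (use m in \<open>auto simp: G_def indicator_def\<close>)
  have "continuous_on {\<alpha><..<\<beta>} G"
    by (rule continuous_on_eq[OF continuous_on_subset[OF c1]]) (use m in \<open>auto simp: G_def\<close>)
  moreover have "continuous_on {\<gamma><..<\<delta>} G"
    by (rule continuous_on_eq[OF continuous_on_subset[OF c2]]) (use m in \<open>auto simp: G_def\<close>)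
  ultimately have cG: "continuous_on S G" by (intro continuous_on_open_Un) auto
  have "(G \<longlongrightarrow> g1 p) (at p within S)" if "p < m" for p
  proof (rule Lim_transform_within[of g1 _ _ _ "m - p"])
    show "(g1 \<longlongrightarrow> g1 p) (at p within S)"
      using c1 by (meson UNIV_I continuous_on_def subset_UNIV tendsto_within_subset)
  qed (use that in \<open>auto simp: G_def dist_real_def\<close>)
  then have tr1: "has_trace S f p (g1 p)" if "p < m" for p
    using that cG ae unfolding has_trace_rep by blast
  have "(G \<longlongrightarrow> g2 p) (at p within S)" if "m < p" for p
  proof (rule Lim_transform_within[of g2 _ _ _ "p - m"])
    show "(g2 \<longlongrightarrow> g2 p) (at p within S)"
      using c2 by (meson UNIV_I continuous_on_def subset_UNIV tendsto_within_subset)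
  qed (use that in \<open>auto simp: G_def dist_real_def\<close>)
  then have tr2: "has_trace S f p (g2 p)" if "m < p" for p
    using that cG ae unfolding has_trace_rep by blast
  show "has_trace S f \<alpha> fa"
    using tr1[of \<alpha>] m ord cum_fn_start[OF W_supp(2)[OF assms(2)], of \<alpha>] by (simp add: g1_def)
  show "has_trace S f \<beta> fb"
    using tr1[of \<beta>] m ord assms(2) by (simp add: g1_def W_def)
  show "has_trace S f \<gamma> fc"
    using tr2[of \<gamma>] m ord cum_fn_start[OF W_supp(2)[OF assms(3)], of \<gamma>] by (simp add: g2_def)
  show "has_trace S f \<delta> fd"
    using tr2[of \<delta>] m ord assms(3) by (simp add: g2_def W_def)
qed

theorem Sob1_I:
  assumes f: "f \<in> Lsq S" and g: "g \<in> Lsq S"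
    and w1: "W \<alpha> \<beta> (cut \<alpha> \<beta> (el f)) (cut \<alpha> \<beta> (el g)) fa fb"
    and w2: "W \<gamma> \<delta> (cut \<gamma> \<delta> (el f)) (cut \<gamma> \<delta> (el g)) fc fd"
  shows "f \<in> Sob1 S" "wderiv S f = g"
    "trace S f \<alpha> = fa" "trace S f \<beta> = fb" "trace S f \<gamma> = fc" "trace S f \<delta> = fd"
proof -
  have h: "has_weak_derivative S f g" using assms by (auto simp: has_weak_derivative_iff)
  then show "f \<in> Sob1 S" by (auto simp: Sob1_def)
  show "wderiv S f = g"
    unfolding wderiv_def
  proof (rule the_equality)
    show "has_weak_derivative S f g" by (rule h)
  next
    fix g' assume "has_weak_derivative S f g'"
    then have g': "g' \<in> Lsq S" "\<exists>fa fb. W \<alpha> \<beta> (cut \<alpha> \<beta> (el f)) (cut \<alpha> \<beta> (el g')) fa fb"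
      "\<exists>fa fb. W \<gamma> \<delta> (cut \<gamma> \<delta> (el f)) (cut \<gamma> \<delta> (el g')) fa fb"
      by (auto simp: has_weak_derivative_iff)
    then have "cut \<alpha> \<beta> (el g') = cut \<alpha> \<beta> (el g)" "cut \<gamma> \<delta> (el g') = cut \<gamma> \<delta> (el g)"
      using W_unique(1)[OF ord(1) w1] W_unique(1)[OF ord(3) w2] by metis+
    then have "el g' = el g"
      using cut_Un[OF supp_el[OF g]] cut_Un[OF supp_el[OF g'(1)]] ord by (metis less_imp_le)
    then show "g' = g" using el_inj[OF g'(1) g] by blast
  qed
  have l: "p islimpt S" if "p \<in> {\<alpha>, \<beta>, \<gamma>, \<delta>}" for p
    using that islimpt_greaterThanLessThan1[OF ord(1)] islimpt_greaterThanLessThan2[OF ord(1)]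
      islimpt_greaterThanLessThan1[OF ord(3)] islimpt_greaterThanLessThan2[OF ord(3)]
    by (auto simp: islimpt_Un)
  have o: "open S" by auto
  show "trace S f \<alpha> = fa" "trace S f \<beta> = fb" "trace S f \<gamma> = fc" "trace S f \<delta> = fd"
    by (simp_all add: trace_eqI[OF o l] has_trace_two[OF f w1 w2])
qed

theorem Sob1_E:
  assumes "f \<in> Sob1 S"
  shows "f \<in> Lsq S" "wderiv S f \<in> Lsq S"
    "W \<alpha> \<beta> (cut \<alpha> \<beta> (el f)) (cut \<alpha> \<beta> (el (wderiv S f))) (trace S f \<alpha>) (trace S f \<beta>)"
    "W \<gamma> \<delta> (cut \<gamma> \<delta> (el f)) (cut \<gamma> \<delta> (el (wderiv S f))) (trace S f \<gamma>) (trace S f \<delta>)"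
proof -
  obtain g fa fb fc fd where *: "f \<in> Lsq S" "g \<in> Lsq S"
    "W \<alpha> \<beta> (cut \<alpha> \<beta> (el f)) (cut \<alpha> \<beta> (el g)) fa fb"
    "W \<gamma> \<delta> (cut \<gamma> \<delta> (el f)) (cut \<gamma> \<delta> (el g)) fc fd"
    using assms unfolding Sob1_def has_weak_derivative_iff by blast
  show "f \<in> Lsq S" by fact
  show "wderiv S f \<in> Lsq S"
    "W \<alpha> \<beta> (cut \<alpha> \<beta> (el f)) (cut \<alpha> \<beta> (el (wderiv S f))) (trace S f \<alpha>) (trace S f \<beta>)"
    "W \<gamma> \<delta> (cut \<gamma> \<delta> (el f)) (cut \<gamma> \<delta> (el (wderiv S f))) (trace S f \<gamma>) (trace S f \<delta>)"
    using Sob1_I(2-6)[OF *] * by auto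
qed

end

lemma Sob1_interval_add:
  assumes "\<alpha> < \<beta>" "f \<in> Sob1 {\<alpha><..<\<beta>}" "g \<in> Sob1 {\<alpha><..<\<beta>}"
  shows "f + g \<in> Sob1 {\<alpha><..<\<beta>}"
    "wderiv {\<alpha><..<\<beta>} (f + g) = wderiv {\<alpha><..<\<beta>} f + wderiv {\<alpha><..<\<beta>} g"
    "trace {\<alpha><..<\<beta>} (f + g) \<alpha> = trace {\<alpha><..<\<beta>} f \<alpha> + trace {\<alpha><..<\<beta>} g \<alpha>"
    "trace {\<alpha><..<\<beta>} (f + g) \<beta> = trace {\<alpha><..<\<beta>} f \<beta> + trace {\<alpha><..<\<beta>} g \<beta>"
proof -
  note f = Sob1_intervalE[OF assms(1,2)] and g = Sob1_intervalE[OF assms(1,3)]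
  have "W \<alpha> \<beta> (el (f + g)) (el (wderiv {\<alpha><..<\<beta>} f + wderiv {\<alpha><..<\<beta>} g))
    (trace {\<alpha><..<\<beta>} f \<alpha> + trace {\<alpha><..<\<beta>} g \<alpha>) (trace {\<alpha><..<\<beta>} f \<beta> + trace {\<alpha><..<\<beta>} g \<beta>)"
    using W_add[OF f(3) g(3)] by (simp add: el_add[OF f(1) g(1)] el_add[OF f(2) g(2)])
  note * = Sob1_intervalI[OF assms(1) Lsq_add[OF f(1) g(1)] Lsq_add[OF f(2) g(2)] this]
  show "f + g \<in> Sob1 {\<alpha><..<\<beta>}"
    "wderiv {\<alpha><..<\<beta>} (f + g) = wderiv {\<alpha><..<\<beta>} f + wderiv {\<alpha><..<\<beta>} g"
    "trace {\<alpha><..<\<beta>} (f + g) \<alpha> = trace {\<alpha><..<\<beta>} f \<alpha> + trace {\<alpha><..<\<beta>} g \<alpha>"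
    "trace {\<alpha><..<\<beta>} (f + g) \<beta> = trace {\<alpha><..<\<beta>} f \<beta> + trace {\<alpha><..<\<beta>} g \<beta>"
    using * by auto
qed

lemma Sob1_interval_scale:
  assumes "\<alpha> < \<beta>" "f \<in> Sob1 {\<alpha><..<\<beta>}"
  shows "scale_l0 c f \<in> Sob1 {\<alpha><..<\<beta>}"
    "wderiv {\<alpha><..<\<beta>} (scale_l0 c f) = scale_l0 c (wderiv {\<alpha><..<\<beta>} f)"
    "trace {\<alpha><..<\<beta>} (scale_l0 c f) \<alpha> = c * trace {\<alpha><..<\<beta>} f \<alpha>"
    "trace {\<alpha><..<\<beta>} (scale_l0 c f) \<beta> = c * trace {\<alpha><..<\<beta>} f \<beta>"
proof -
  note f = Sob1_intervalE[OF assms]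
  have "W \<alpha> \<beta> (el (scale_l0 c f)) (el (scale_l0 c (wderiv {\<alpha><..<\<beta>} f)))
    (c * trace {\<alpha><..<\<beta>} f \<alpha>) (c * trace {\<alpha><..<\<beta>} f \<beta>)"
    using W_csc[OF f(3)] by (simp add: el_scale[OF f(1)] el_scale[OF f(2)])
  note * = Sob1_intervalI[OF assms(1) Lsq_scale[OF f(1)] Lsq_scale[OF f(2)] this]
  show "scale_l0 c f \<in> Sob1 {\<alpha><..<\<beta>}"
    "wderiv {\<alpha><..<\<beta>} (scale_l0 c f) = scale_l0 c (wderiv {\<alpha><..<\<beta>} f)"
    "trace {\<alpha><..<\<beta>} (scale_l0 c f) \<alpha> = c * trace {\<alpha><..<\<beta>} f \<alpha>"
    "trace {\<alpha><..<\<beta>} (scale_l0 c f) \<beta> = c * trace {\<alpha><..<\<beta>} f \<beta>"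
    using * by auto
qed

context two_intervals
begin

lemma Sob1_add:
  assumes "f \<in> Sob1 S" "g \<in> Sob1 S"
  shows "f + g \<in> Sob1 S" "wderiv S (f + g) = wderiv S f + wderiv S g"
    "trace S (f + g) \<alpha> = trace S f \<alpha> + trace S g \<alpha>" "trace S (f + g) \<beta> = trace S f \<beta> + trace S g \<beta>"
    "trace S (f + g) \<gamma> = trace S f \<gamma> + trace S g \<gamma>" "trace S (f + g) \<delta> = trace S f \<delta> + trace S g \<delta>"
proof -
  note f = Sob1_E[OF assms(1)] and g = Sob1_E[OF assms(2)]
  have 1: "W \<alpha> \<beta> (cut \<alpha> \<beta> (el (f + g))) (cut \<alpha> \<beta> (el (wderiv S f + wderiv S g)))
    (trace S f \<alpha> + trace S g \<alpha>) (trace S f \<beta> + trace S g \<beta>)"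
    using W_add[OF f(3) g(3)] by (simp add: el_add[OF f(1) g(1)] el_add[OF f(2) g(2)] cut_add)
  have 2: "W \<gamma> \<delta> (cut \<gamma> \<delta> (el (f + g))) (cut \<gamma> \<delta> (el (wderiv S f + wderiv S g)))
    (trace S f \<gamma> + trace S g \<gamma>) (trace S f \<delta> + trace S g \<delta>)"
    using W_add[OF f(4) g(4)] by (simp add: el_add[OF f(1) g(1)] el_add[OF f(2) g(2)] cut_add)
  note * = Sob1_I[OF Lsq_add[OF f(1) g(1)] Lsq_add[OF f(2) g(2)] 1 2]
  show "f + g \<in> Sob1 S" "wderiv S (f + g) = wderiv S f + wderiv S g"
    "trace S (f + g) \<alpha> = trace S f \<alpha> + trace S g \<alpha>" "trace S (f + g) \<beta> = trace S f \<beta> + trace S g \<beta>"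
    "trace S (f + g) \<gamma> = trace S f \<gamma> + trace S g \<gamma>" "trace S (f + g) \<delta> = trace S f \<delta> + trace S g \<delta>"
    using * by auto
qed

lemma Sob1_scale:
  assumes "f \<in> Sob1 S"
  shows "scale_l0 c f \<in> Sob1 S" "wderiv S (scale_l0 c f) = scale_l0 c (wderiv S f)"
    "trace S (scale_l0 c f) \<alpha> = c * trace S f \<alpha>" "trace S (scale_l0 c f) \<beta> = c * trace S f \<beta>"
    "trace S (scale_l0 c f) \<gamma> = c * trace S f \<gamma>" "trace S (scale_l0 c f) \<delta> = c * trace S f \<delta>"
proof -
  note f = Sob1_E[OF assms(1)]
  have 1: "W \<alpha> \<beta> (cut \<alpha> \<beta> (el (scale_l0 c f))) (cut \<alpha> \<beta> (el (scale_l0 c (wderiv S f))))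
    (c * trace S f \<alpha>) (c * trace S f \<beta>)"
    using W_csc[OF f(3)] by (simp add: el_scale[OF f(1)] el_scale[OF f(2)] cut_csc)
  have 2: "W \<gamma> \<delta> (cut \<gamma> \<delta> (el (scale_l0 c f))) (cut \<gamma> \<delta> (el (scale_l0 c (wderiv S f))))
    (c * trace S f \<gamma>) (c * trace S f \<delta>)"
    using W_csc[OF f(4)] by (simp add: el_scale[OF f(1)] el_scale[OF f(2)] cut_csc)
  note * = Sob1_I[OF Lsq_scale[OF f(1)] Lsq_scale[OF f(2)] 1 2]
  show "scale_l0 c f \<in> Sob1 S" "wderiv S (scale_l0 c f) = scale_l0 c (wderiv S f)"
    "trace S (scale_l0 c f) \<alpha> = c * trace S f \<alpha>" "trace S (scale_l0 c f) \<beta> = c * trace S f \<beta>"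
    "trace S (scale_l0 c f) \<gamma> = c * trace S f \<gamma>" "trace S (scale_l0 c f) \<delta> = c * trace S f \<delta>"
    using * by auto
qed

end

section \<open>Coordinates of states\<close>

locale transmission =
  fixes L1 L2 L3 a b m k :: real
  assumes L: "0 < L1" "L1 < L2" "L2 < L3" and pos: "0 < a" "0 < b" "0 < m" "0 < k"
begin

sublocale J: two_intervals 0 L1 L2 L3
  by standard (use L in auto)

abbreviation "I \<equiv> {L1<..<L2}"
abbreviation "J \<equiv> {0<..<L1} \<union> {L2<..<L3}"
abbreviation "H \<equiv> HF L1 L2 L3"
abbreviation "N \<equiv> normF L1 L2 L3 a b"
abbreviation "D \<equiv> domAF L1 L2 L3 a b m"
abbreviation "A \<equiv> opAF L1 L2 L3 a b m k"

text \<open>\<open>u\<close>, \<open>t\<close>, \<open>w\<close> stand for \<open>u\<^sup>1\<close>, \<open>\<theta>\<close>, \<open>u\<^sup>2\<close> and \<open>v\<close>, \<open>z\<close> for \<open>v\<^sup>1\<close>, \<open>v\<^sup>2\<close>; a further \<open>x\<close> marks the weak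
  derivative, \<open>l\<close> and \<open>r\<close> the two components of \<open>J\<close>.\<close>

fun pu :: "state \<Rightarrow> l2" where "pu (u1, v1, \<theta>, u2, v2) = el u1"
fun pux :: "state \<Rightarrow> l2" where "pux (u1, v1, \<theta>, u2, v2) = el (wderiv I u1)"
fun pt :: "state \<Rightarrow> l2" where "pt (u1, v1, \<theta>, u2, v2) = el \<theta>"
fun ptx :: "state \<Rightarrow> l2" where "ptx (u1, v1, \<theta>, u2, v2) = el (wderiv I \<theta>)"
fun pw :: "state \<Rightarrow> l2" where "pw (u1, v1, \<theta>, u2, v2) = el u2"
fun vl :: "state \<Rightarrow> l2" where "vl (u1, v1, \<theta>, u2, v2) = cut 0 L1 (el v1)"
fun vr :: "state \<Rightarrow> l2" where "vr (u1, v1, \<theta>, u2, v2) = cut L2 L3 (el v1)"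
fun vxl :: "state \<Rightarrow> l2" where "vxl (u1, v1, \<theta>, u2, v2) = cut 0 L1 (el (wderiv J v1))"
fun vxr :: "state \<Rightarrow> l2" where "vxr (u1, v1, \<theta>, u2, v2) = cut L2 L3 (el (wderiv J v1))"
fun zl :: "state \<Rightarrow> l2" where "zl (u1, v1, \<theta>, u2, v2) = cut 0 L1 (el v2)"
fun zr :: "state \<Rightarrow> l2" where "zr (u1, v1, \<theta>, u2, v2) = cut L2 L3 (el v2)"
fun t1 :: "state \<Rightarrow> complex" where "t1 (u1, v1, \<theta>, u2, v2) = trace I u1 L1"
fun t2 :: "state \<Rightarrow> complex" where "t2 (u1, v1, \<theta>, u2, v2) = trace I u1 L2"

lemma HF_iff: "(u1, v1, \<theta>, u2, v2) \<in> H \<longleftrightarrow>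
    u1 \<in> Sob1 I \<and> v1 \<in> Sob1 J \<and> \<theta> \<in> Lsq I \<and> u2 \<in> Lsq I \<and> v2 \<in> Lsq J \<and>
    trace J v1 0 = 0 \<and> trace J v1 L3 = 0 \<and> trace I u1 L1 = trace J v1 L1 \<and> trace I u1 L2 = trace J v1 L2"
  by (simp add: HF_def intI_def setJ_def Let_def)

text \<open>The Dirichlet conditions and the continuity of the displacement are stored in the
  boundary values: zeros at the outer ends, and the same \<open>t1 U\<close>, \<open>t2 U\<close> on
  both sides of an interface.\<close>

lemma H_W:
  assumes "U \<in> H"
  shows "W L1 L2 (pu U) (pux U) (t1 U) (t2 U)" "W 0 L1 (vl U) (vxl U) 0 (t1 U)"
    "W L2 L3 (vr U) (vxr U) (t2 U) 0" "supp I (pt U)" "supp I (pw U)"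
    "supp {0<..<L1} (zl U)" "supp {L2<..<L3} (zr U)"
proof -
  obtain u1 v1 \<theta> u2 v2 where U: "U = (u1, v1, \<theta>, u2, v2)" by (cases U)
  have h: "u1 \<in> Sob1 I" "v1 \<in> Sob1 J" "\<theta> \<in> Lsq I" "u2 \<in> Lsq I" "v2 \<in> Lsq J"
    "trace J v1 0 = 0" "trace J v1 L3 = 0" "trace I u1 L1 = trace J v1 L1" "trace I u1 L2 = trace J v1 L2"
    using assms by (auto simp: U HF_iff)
  show "W L1 L2 (pu U) (pux U) (t1 U) (t2 U)"
    using Sob1_intervalE(3)[OF L(2) h(1)] by (simp add: U)
  show "W 0 L1 (vl U) (vxl U) 0 (t1 U)" "W L2 L3 (vr U) (vxr U) (t2 U) 0"
    using J.Sob1_E(3,4)[OF h(2)] h by (simp_all add: U)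
  show "supp I (pt U)" "supp I (pw U)" using h by (simp_all add: U supp_el)
  show "supp {0<..<L1} (zl U)" "supp {L2<..<L3} (zr U)" by (simp_all add: U supp_cut)
qed

lemma Re_innerF:
  assumes "U \<in> H"
  shows "Re (innerF L1 L2 L3 a b U U) = a * (norm (pux U))\<^sup>2 + (norm (pw U))\<^sup>2 + (norm (pt U))\<^sup>2
    + b * ((norm (vxl U))\<^sup>2 + (norm (vxr U))\<^sup>2) + (norm (zl U))\<^sup>2 + (norm (zr U))\<^sup>2"
proof -
  obtain u1 v1 \<theta> u2 v2 where U: "U = (u1, v1, \<theta>, u2, v2)" by (cases U)
  have h: "u1 \<in> Sob1 I" "v1 \<in> Sob1 J" "\<theta> \<in> Lsq I" "u2 \<in> Lsq I" "v2 \<in> Lsq J"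
    using assms by (auto simp: U HF_iff)
  note i = Sob1_intervalE[OF L(2) h(1)] and j = J.Sob1_E[OF h(2)]
  have n: "Re (ip f f) = (norm f)\<^sup>2" for f by (simp add: ip_self)
  show ?thesis
    using L by (simp add: U Let_def intI_def setJ_def l2_inner_el[OF i(2) i(2)] l2_inner_el[OF h(4) h(4)]
        l2_inner_el[OF h(3) h(3)] l2_inner_el[OF j(2) j(2)] l2_inner_el[OF h(5) h(5)] n
        ip_cut_Un[OF supp_el[OF j(2)] supp_el[OF j(2)]] ip_cut_Un[OF supp_el[OF h(5)] supp_el[OF h(5)]])
qed

lemma N_nonneg: "U \<in> H \<Longrightarrow> 0 \<le> N U"
  using pos by (simp add: normF_def Re_innerF)

lemma N_sq:
  assumes "U \<in> H"
  shows "(N U)\<^sup>2 = a * (norm (pux U))\<^sup>2 + (norm (pw U))\<^sup>2 + (norm (pt U))\<^sup>2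
    + b * ((norm (vxl U))\<^sup>2 + (norm (vxr U))\<^sup>2) + (norm (zl U))\<^sup>2 + (norm (zr U))\<^sup>2"
  using pos by (simp add: normF_def Re_innerF[OF assms])

lemma H_add:
  assumes "U \<in> H" "V \<in> H"
  shows "U + V \<in> H" "pu (U + V) = pu U + pu V" "pux (U + V) = pux U + pux V"
    "pt (U + V) = pt U + pt V" "pw (U + V) = pw U + pw V" "vl (U + V) = vl U + vl V"
    "vr (U + V) = vr U + vr V" "vxl (U + V) = vxl U + vxl V" "vxr (U + V) = vxr U + vxr V"
    "zl (U + V) = zl U + zl V" "zr (U + V) = zr U + zr V" "t1 (U + V) = t1 U + t1 V" "t2 (U + V) = t2 U + t2 V"
proof -
  obtain u1 v1 \<theta> u2 v2 where U: "U = (u1, v1, \<theta>, u2, v2)" by (cases U)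
  obtain u1' v1' \<theta>' u2' v2' where V: "V = (u1', v1', \<theta>', u2', v2')" by (cases V)
  have h: "u1 \<in> Sob1 I" "v1 \<in> Sob1 J" "\<theta> \<in> Lsq I" "u2 \<in> Lsq I" "v2 \<in> Lsq J"
    using assms by (auto simp: U HF_iff)
  have h': "u1' \<in> Sob1 I" "v1' \<in> Sob1 J" "\<theta>' \<in> Lsq I" "u2' \<in> Lsq I" "v2' \<in> Lsq J"
    using assms by (auto simp: V HF_iff)
  note i = Sob1_intervalE[OF L(2) h(1)] and j = J.Sob1_E[OF h(2)]
  note i' = Sob1_intervalE[OF L(2) h'(1)] and j' = J.Sob1_E[OF h'(2)]
  note s = Sob1_interval_add[OF L(2) h(1) h'(1)] J.Sob1_add[OF h(2) h'(2)]
  show "U + V \<in> H"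
    using assms h h' by (simp add: U V HF_iff s Lsq_add)
  show "pu (U + V) = pu U + pu V" "pux (U + V) = pux U + pux V"
    "pt (U + V) = pt U + pt V" "pw (U + V) = pw U + pw V" "vl (U + V) = vl U + vl V"
    "vr (U + V) = vr U + vr V" "vxl (U + V) = vxl U + vxl V" "vxr (U + V) = vxr U + vxr V"
    "zl (U + V) = zl U + zl V" "zr (U + V) = zr U + zr V" "t1 (U + V) = t1 U + t1 V" "t2 (U + V) = t2 U + t2 V"
    by (simp_all add: U V s el_add[OF i(1) i'(1)] el_add[OF i(2) i'(2)] el_add[OF j(1) j'(1)]
        el_add[OF j(2) j'(2)] el_add[OF h(3) h'(3)] el_add[OF h(4) h'(4)] el_add[OF h(5) h'(5)] cut_add)
qed

lemma H_scale:
  assumes "U \<in> H"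
  shows "scale_state c U \<in> H" "pu (scale_state c U) = csc c (pu U)" "pux (scale_state c U) = csc c (pux U)"
    "pt (scale_state c U) = csc c (pt U)" "pw (scale_state c U) = csc c (pw U)"
    "vl (scale_state c U) = csc c (vl U)" "vr (scale_state c U) = csc c (vr U)"
    "vxl (scale_state c U) = csc c (vxl U)" "vxr (scale_state c U) = csc c (vxr U)"
    "zl (scale_state c U) = csc c (zl U)" "zr (scale_state c U) = csc c (zr U)"
    "t1 (scale_state c U) = c * t1 U" "t2 (scale_state c U) = c * t2 U"
proof -
  obtain u1 v1 \<theta> u2 v2 where U: "U = (u1, v1, \<theta>, u2, v2)" by (cases U)
  have h: "u1 \<in> Sob1 I" "v1 \<in> Sob1 J" "\<theta> \<in> Lsq I" "u2 \<in> Lsq I" "v2 \<in> Lsq J"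
    using assms by (auto simp: U HF_iff)
  note i = Sob1_intervalE[OF L(2) h(1)] and j = J.Sob1_E[OF h(2)]
  note s = Sob1_interval_scale[OF L(2) h(1)] J.Sob1_scale[OF h(2)]
  show "scale_state c U \<in> H"
    using assms h by (simp add: U HF_iff s Lsq_scale)
  show "pu (scale_state c U) = csc c (pu U)" "pux (scale_state c U) = csc c (pux U)"
    "pt (scale_state c U) = csc c (pt U)" "pw (scale_state c U) = csc c (pw U)"
    "vl (scale_state c U) = csc c (vl U)" "vr (scale_state c U) = csc c (vr U)"
    "vxl (scale_state c U) = csc c (vxl U)" "vxr (scale_state c U) = csc c (vxr U)"
    "zl (scale_state c U) = csc c (zl U)" "zr (scale_state c U) = csc c (zr U)"
    "t1 (scale_state c U) = c * t1 U" "t2 (scale_state c U) = c * t2 U"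
    by (simp_all add: U s el_scale[OF i(1)] el_scale[OF i(2)] el_scale[OF j(1)]
        el_scale[OF j(2)] el_scale[OF h(3)] el_scale[OF h(4)] el_scale[OF h(5)] cut_csc)
qed

lemma uminus_state: "- U = scale_state (- 1) U"
  by (cases U) (simp add: uminus_l0_scale)

lemma H_uminus: "U \<in> H \<Longrightarrow> - U \<in> H"
  by (simp add: uminus_state H_scale)

lemma H_diff: "U \<in> H \<Longrightarrow> V \<in> H \<Longrightarrow> U - V \<in> H"
  using H_add(1)[OF _ H_uminus, of U V] by simp

text \<open>An isometry of the carrier \<open>H\<close> with norm \<open>N\<close> into a product of
  copies of \<open>l2\<close>. It transports the triangle inequality and the differentiation of
  inner products to a set that is not itself a type of the required classes.\<close>

definition emb :: "state \<Rightarrow> l2 \<times> l2 \<times> l2 \<times> l2 \<times> l2 \<times> l2 \<times> l2" where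
  "emb U = (sqrt a *\<^sub>R pux U, pw U, pt U, sqrt b *\<^sub>R vxl U, sqrt b *\<^sub>R vxr U, zl U, zr U)"

lemma norm_emb: assumes "U \<in> H" shows "norm (emb U) = N U"
proof -
  have "(norm (emb U))\<^sup>2 = (N U)\<^sup>2"
    unfolding N_sq[OF assms] using pos
    by (simp add: emb_def norm_Pair power_mult_distrib algebra_simps)
  then show ?thesis using N_nonneg[OF assms] by (simp add: power2_eq_iff_nonneg)
qed

lemma emb_add: "U \<in> H \<Longrightarrow> V \<in> H \<Longrightarrow> emb (U + V) = emb U + emb V"
  by (simp add: emb_def H_add scaleR_right_distrib)

lemma emb_scaleR: "U \<in> H \<Longrightarrow> emb (scale_state (complex_of_real r) U) = r *\<^sub>R emb U"
  by (simp add: emb_def H_scale csc_of_real scaleR_Pair)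

end

section \<open>The equation \<open>A U = V\<close> in coordinates\<close>

context transmission
begin

text \<open>\<open>stepd U V\<close> lists what \<open>A U = V\<close> says about the coordinates: \<open>s1\<close>, \<open>s2\<close> are the values of the
  stress \<open>a u\<^sub>x - m \<theta>\<close> at the interfaces.\<close>

definition stepd :: "state \<Rightarrow> state \<Rightarrow> l2 \<Rightarrow> l2 \<Rightarrow> l2 \<Rightarrow> l2 \<Rightarrow> l2 \<Rightarrow> complex \<Rightarrow> complex \<Rightarrow> complex \<Rightarrow>
    complex \<Rightarrow> complex \<Rightarrow> complex \<Rightarrow> complex \<Rightarrow> complex \<Rightarrow> bool" where
  "stepd U V \<theta>x \<theta>xx uxx vxxl vxxr p1 p2 h1 h2 s1 s2 e0 e3 \<longleftrightarrow>
    W L1 L2 (pux U) uxx p1 p2 \<and> W L1 L2 (pt U) \<theta>x h1 h2 \<and> W L1 L2 \<theta>x \<theta>xx 0 0 \<and>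
    W 0 L1 (vxl U) vxxl e0 (s1 / complex_of_real b) \<and> W L2 L3 (vxr U) vxxr (s2 / complex_of_real b) e3 \<and>
    s1 = complex_of_real a * p1 - complex_of_real m * h1 \<and> s2 = complex_of_real a * p2 - complex_of_real m * h2 \<and>
    pt V = k\<^sup>2 *\<^sub>R \<theta>xx - m *\<^sub>R pux V \<and> pw V = a *\<^sub>R uxx - m *\<^sub>R \<theta>x \<and>
    zl V = b *\<^sub>R vxxl \<and> zr V = b *\<^sub>R vxxr \<and> pu V = pw U \<and> vl V = zl U \<and> vr V = zr U"

text \<open>A relational form of \<open>A\<close> that does not mention \<open>wderiv\<close> or
  \<open>trace\<close> of second derivatives. The lemmas \<open>dom_step\<close> and
  \<open>step_dom\<close> show that it describes the graph of \<open>A\<close>, with the temperature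
  gradient as a third entry.\<close>

definition step :: "state \<Rightarrow> state \<Rightarrow> l2 \<Rightarrow> bool" where
  "step U V \<theta>x \<longleftrightarrow> U \<in> H \<and> V \<in> H \<and> (\<exists>\<theta>xx uxx vxxl vxxr p1 p2 h1 h2 s1 s2 e0 e3.
    stepd U V \<theta>x \<theta>xx uxx vxxl vxxr p1 p2 h1 h2 s1 s2 e0 e3)"

lemma domAF_iff: "(u1, v1, \<theta>, u2, v2) \<in> D \<longleftrightarrow> (u1, v1, \<theta>, u2, v2) \<in> H \<and>
    wderiv I u1 \<in> Sob1 I \<and> wderiv J v1 \<in> Sob1 J \<and> \<theta> \<in> Sob1 I \<and> wderiv I \<theta> \<in> Sob1 I \<and> u2 \<in> Sob1 I \<and> v2 \<in> Sob1 J \<and>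
    trace J v2 0 = 0 \<and> trace J v2 L3 = 0 \<and>
    trace I u2 L1 = trace J v2 L1 \<and> trace I u2 L2 = trace J v2 L2 \<and>
    a * trace I (wderiv I u1) L1 - m * trace I \<theta> L1 = b * trace J (wderiv J v1) L1 \<and>
    a * trace I (wderiv I u1) L2 - m * trace I \<theta> L2 = b * trace J (wderiv J v1) L2 \<and>
    trace I (wderiv I \<theta>) L1 = 0 \<and> trace I (wderiv I \<theta>) L2 = 0"
  by (auto simp: domAF_def Sob2_def intI_def setJ_def Let_def HF_iff)

lemma D_subset_H: "U \<in> D \<Longrightarrow> U \<in> H"
  by (cases U) (auto simp: domAF_iff)

lemma opAF_eq: "A (u1, v1, \<theta>, u2, v2) = (u2, v2,
    scale_l0 (complex_of_real (k\<^sup>2)) (wderiv I (wderiv I \<theta>)) - scale_l0 (complex_of_real m) (wderiv I u2),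
    scale_l0 (complex_of_real a) (wderiv I (wderiv I u1)) - scale_l0 (complex_of_real m) (wderiv I \<theta>),
    scale_l0 (complex_of_real b) (wderiv J (wderiv J v1)))"
  by (simp add: intI_def setJ_def Let_def)

lemma dom_step:
  assumes "U \<in> D"
  shows "A U \<in> H" "step U (A U) (ptx U)"
proof -
  obtain u1 v1 \<theta> u2 v2 where U: "U = (u1, v1, \<theta>, u2, v2)" by (cases U)
  have d: "(u1, v1, \<theta>, u2, v2) \<in> H" "wderiv I u1 \<in> Sob1 I" "wderiv J v1 \<in> Sob1 J" "\<theta> \<in> Sob1 I"
    "wderiv I \<theta> \<in> Sob1 I" "u2 \<in> Sob1 I" "v2 \<in> Sob1 J"
    "trace J v2 0 = 0" "trace J v2 L3 = 0" "trace I u2 L1 = trace J v2 L1" "trace I u2 L2 = trace J v2 L2"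
    "a * trace I (wderiv I u1) L1 - m * trace I \<theta> L1 = b * trace J (wderiv J v1) L1"
    "a * trace I (wderiv I u1) L2 - m * trace I \<theta> L2 = b * trace J (wderiv J v1) L2"
    "trace I (wderiv I \<theta>) L1 = 0" "trace I (wderiv I \<theta>) L2 = 0"
    using assms by (auto simp: U domAF_iff)
  note ux = Sob1_intervalE[OF L(2) d(2)] and vx = J.Sob1_E[OF d(3)] and th = Sob1_intervalE[OF L(2) d(4)]
    and thx = Sob1_intervalE[OF L(2) d(5)] and u2 = Sob1_intervalE[OF L(2) d(6)] and v2 = J.Sob1_E[OF d(7)]
  show AH: "A U \<in> H"
    unfolding U opAF_eq HF_iff using d ux(2) thx u2 vx(2)
    by (auto intro!: Lsq_diff Lsq_scale)
  have tr: "trace J (wderiv J v1) L1 = (a * trace I (wderiv I u1) L1 - m * trace I \<theta> L1) / b"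
    "trace J (wderiv J v1) L2 = (a * trace I (wderiv I u1) L2 - m * trace I \<theta> L2) / b"
    using d(12,13) pos by (simp_all add: field_simps)
    have "W L1 L2 (pux U) (el (wderiv I (wderiv I u1))) (trace I (wderiv I u1) L1) (trace I (wderiv I u1) L2)"
      using ux(3) by (simp add: U)
    moreover have "W L1 L2 (pt U) (ptx U) (trace I \<theta> L1) (trace I \<theta> L2)" using th(3) by (simp add: U)
    moreover have "W L1 L2 (ptx U) (el (wderiv I (wderiv I \<theta>))) 0 0" using thx(3) d by (simp add: U)
    moreover have "W 0 L1 (vxl U) (cut 0 L1 (el (wderiv J (wderiv J v1)))) (trace J (wderiv J v1) 0)
        ((a * trace I (wderiv I u1) L1 - m * trace I \<theta> L1) / b)"
      using vx(3) unfolding tr(1) by (simp add: U)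
    moreover have "W L2 L3 (vxr U) (cut L2 L3 (el (wderiv J (wderiv J v1))))
        ((a * trace I (wderiv I u1) L2 - m * trace I \<theta> L2) / b) (trace J (wderiv J v1) L3)"
      using vx(4) unfolding tr(2) by (simp add: U)
    moreover have "pt (A U) = k\<^sup>2 *\<^sub>R el (wderiv I (wderiv I \<theta>)) - m *\<^sub>R pux (A U)"
      unfolding U opAF_eq pt.simps pux.simps
      by (simp only: el_diff[OF Lsq_scale[OF thx(2)] Lsq_scale[OF u2(2)]] el_scale[OF thx(2)] el_scale[OF u2(2)] csc_of_real)
    moreover have "pw (A U) = a *\<^sub>R el (wderiv I (wderiv I u1)) - m *\<^sub>R ptx U"
      unfolding U opAF_eq pw.simps ptx.simps
      by (simp only: el_diff[OF Lsq_scale[OF ux(2)] Lsq_scale[OF th(2)]] el_scale[OF ux(2)] el_scale[OF th(2)] csc_of_real)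
    moreover have "zl (A U) = b *\<^sub>R cut 0 L1 (el (wderiv J (wderiv J v1)))"
      "zr (A U) = b *\<^sub>R cut L2 L3 (el (wderiv J (wderiv J v1)))"
      unfolding U opAF_eq zl.simps zr.simps by (simp_all only: el_scale[OF vx(2)] cut_csc csc_of_real[symmetric])
    moreover have "pu (A U) = pw U" "vl (A U) = zl U" "vr (A U) = zr U"
      by (simp_all only: U opAF_eq pu.simps pw.simps vl.simps zl.simps vr.simps zr.simps)
    ultimately have "stepd U (A U) (ptx U) (el (wderiv I (wderiv I \<theta>))) (el (wderiv I (wderiv I u1)))
      (cut 0 L1 (el (wderiv J (wderiv J v1)))) (cut L2 L3 (el (wderiv J (wderiv J v1))))
      (trace I (wderiv I u1) L1) (trace I (wderiv I u1) L2) (trace I \<theta> L1) (trace I \<theta> L2)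
      (a * trace I (wderiv I u1) L1 - m * trace I \<theta> L1) (a * trace I (wderiv I u1) L2 - m * trace I \<theta> L2)
      (trace J (wderiv J v1) 0) (trace J (wderiv J v1) L3)"
      unfolding stepd_def by - (intro conjI; (assumption | rule refl))
    then show "step U (A U) (ptx U)"
      unfolding step_def using AH D_subset_H[OF assms] by blast
qed

lemma D_add:
  assumes "U \<in> D" "V \<in> D"
  shows "U + V \<in> D" "A (U + V) = A U + A V" "ptx (U + V) = ptx U + ptx V"
proof -
  obtain u1 v1 \<theta> u2 v2 where U: "U = (u1, v1, \<theta>, u2, v2)" by (cases U)
  obtain u1' v1' \<theta>' u2' v2' where V: "V = (u1', v1', \<theta>', u2', v2')" by (cases V)
  have d: "(u1, v1, \<theta>, u2, v2) \<in> H" "wderiv I u1 \<in> Sob1 I" "wderiv J v1 \<in> Sob1 J" "\<theta> \<in> Sob1 I"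
    "wderiv I \<theta> \<in> Sob1 I" "u2 \<in> Sob1 I" "v2 \<in> Sob1 J" "u1 \<in> Sob1 I" "v1 \<in> Sob1 J"
    using assms(1) by (auto simp: U domAF_iff HF_iff)
  have d': "(u1', v1', \<theta>', u2', v2') \<in> H" "wderiv I u1' \<in> Sob1 I" "wderiv J v1' \<in> Sob1 J" "\<theta>' \<in> Sob1 I"
    "wderiv I \<theta>' \<in> Sob1 I" "u2' \<in> Sob1 I" "v2' \<in> Sob1 J" "u1' \<in> Sob1 I" "v1' \<in> Sob1 J"
    using assms(2) by (auto simp: V domAF_iff HF_iff)
  note s = Sob1_interval_add[OF L(2) d(2) d'(2)] J.Sob1_add[OF d(3) d'(3)] Sob1_interval_add[OF L(2) d(4) d'(4)]
    Sob1_interval_add[OF L(2) d(5) d'(5)] Sob1_interval_add[OF L(2) d(6) d'(6)] J.Sob1_add[OF d(7) d'(7)]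
    Sob1_interval_add[OF L(2) d(8) d'(8)] J.Sob1_add[OF d(9) d'(9)]
  have sc: "scale_l0 c (f + g) = scale_l0 c f + scale_l0 c g" for c f g
  proof (rule l0_eqI)
    show "AE x in lborel. rep_l0 (scale_l0 c (f + g)) x = rep_l0 (scale_l0 c f + scale_l0 c g) x"
      using rep_l0_add[of f g] rep_l0_scale[of c "f + g"] rep_l0_add[of "scale_l0 c f" "scale_l0 c g"]
        rep_l0_scale[of c f] rep_l0_scale[of c g]
      by eventually_elim (simp add: algebra_simps)
  qed
  have "U + V \<in> H" using assms by (intro H_add(1) D_subset_H)
  then show "U + V \<in> D"
    using assms by (simp add: U V domAF_iff s) (simp add: algebra_simps add_divide_distrib)
  show "A (U + V) = A U + A V"
    by (simp only: U V add_Pair opAF_eq s sc) (simp add: algebra_simps)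
  show "ptx (U + V) = ptx U + ptx V"
    using Sob1_intervalE(2)[OF L(2) d(4)] Sob1_intervalE(2)[OF L(2) d'(4)]
    by (simp add: U V s el_add)
qed

lemma D_scale:
  assumes "U \<in> D"
  shows "scale_state c U \<in> D" "A (scale_state c U) = scale_state c (A U)" "ptx (scale_state c U) = csc c (ptx U)"
proof -
  obtain u1 v1 \<theta> u2 v2 where U: "U = (u1, v1, \<theta>, u2, v2)" by (cases U)
  have d: "(u1, v1, \<theta>, u2, v2) \<in> H" "wderiv I u1 \<in> Sob1 I" "wderiv J v1 \<in> Sob1 J" "\<theta> \<in> Sob1 I"
    "wderiv I \<theta> \<in> Sob1 I" "u2 \<in> Sob1 I" "v2 \<in> Sob1 J" "u1 \<in> Sob1 I" "v1 \<in> Sob1 J"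
    using assms(1) by (auto simp: U domAF_iff HF_iff)
  note s = Sob1_interval_scale[OF L(2) d(2)] J.Sob1_scale[OF d(3)] Sob1_interval_scale[OF L(2) d(4)]
    Sob1_interval_scale[OF L(2) d(5)] Sob1_interval_scale[OF L(2) d(6)] J.Sob1_scale[OF d(7)]
    Sob1_interval_scale[OF L(2) d(8)] J.Sob1_scale[OF d(9)]
  have sc: "scale_l0 e (scale_l0 c f) = scale_l0 c (scale_l0 e f)" for e f
  proof (rule l0_eqI)
    show "AE x in lborel. rep_l0 (scale_l0 e (scale_l0 c f)) x = rep_l0 (scale_l0 c (scale_l0 e f)) x"
      using rep_l0_scale[of e "scale_l0 c f"] rep_l0_scale[of c f] rep_l0_scale[of c "scale_l0 e f"]
        rep_l0_scale[of e f]
      by eventually_elim simp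
  qed
  have sd: "scale_l0 c f - scale_l0 c g = scale_l0 c (f - g)" for f g
  proof (rule l0_eqI)
    show "AE x in lborel. rep_l0 (scale_l0 c f - scale_l0 c g) x = rep_l0 (scale_l0 c (f - g)) x"
      using rep_l0_diff[of f g] rep_l0_scale[of c "f - g"] rep_l0_diff[of "scale_l0 c f" "scale_l0 c g"]
        rep_l0_scale[of c f] rep_l0_scale[of c g]
      by eventually_elim (simp add: right_diff_distrib)
  qed
  have e: "a * (c * x) - m * (c * y) = b * (c * z) \<longleftrightarrow> c = 0 \<or> a * x - m * y = b * z" for x y z :: complex
  proof -
    have "a * (c * x) - m * (c * y) = b * (c * z) \<longleftrightarrow> c * (a * x - m * y) = c * (b * z)"
      by (simp add: algebra_simps)
    then show ?thesis by simp
  qed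
  have "scale_state c U \<in> H" using assms by (intro H_scale(1) D_subset_H)
  then show "scale_state c U \<in> D"
    using assms by (simp add: U domAF_iff s e)
  show "A (scale_state c U) = scale_state c (A U)"
    by (simp only: U scale_state.simps opAF_eq s sc[of "complex_of_real _"] sd)
  show "ptx (scale_state c U) = csc c (ptx U)"
    using Sob1_intervalE(2)[OF L(2) d(4)] by (simp add: U s el_scale)
qed

lemma D_diff:
  assumes "U \<in> D" "V \<in> D"
  shows "U - V \<in> D" "A (U - V) = A U - A V"
proof -
  have V: "- V \<in> D" "A (- V) = - A V"
    using D_scale[OF assms(2), of "-1"] by (simp_all add: uminus_state)
  show "U - V \<in> D" "A (U - V) = A U - A V"
    using D_add[OF assms(1) V(1)] V(2) by simp_all
qed

lemma stepd_E:
  assumes "stepd U V \<theta>x \<theta>xx uxx vxxl vxxr p1 p2 h1 h2 s1 s2 e0 e3"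
  shows "W L1 L2 (pux U) uxx p1 p2" "W L1 L2 (pt U) \<theta>x h1 h2" "W L1 L2 \<theta>x \<theta>xx 0 0"
    "W 0 L1 (vxl U) vxxl e0 (s1 / complex_of_real b)" "W L2 L3 (vxr U) vxxr (s2 / complex_of_real b) e3"
    "s1 = complex_of_real a * p1 - complex_of_real m * h1" "s2 = complex_of_real a * p2 - complex_of_real m * h2"
    "pt V = k\<^sup>2 *\<^sub>R \<theta>xx - m *\<^sub>R pux V" "pw V = a *\<^sub>R uxx - m *\<^sub>R \<theta>x"
    "zl V = b *\<^sub>R vxxl" "zr V = b *\<^sub>R vxxr" "pu V = pw U" "vl V = zl U" "vr V = zr U"
  using assms unfolding stepd_def by - (elim conjE, assumption)+

text \<open>This converse of \<open>dom_step\<close> allows a preimage under \<open>A\<close> to be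
  assembled from its coordinates, without verifying the Sobolev conditions of the domain one by
  one.\<close>

lemma step_dom:
  assumes "step U V \<theta>x"
  shows "U \<in> D" "A U = V" "ptx U = \<theta>x"
proof -
  obtain u1 v1 \<theta> u2 v2 where U: "U = (u1, v1, \<theta>, u2, v2)" by (cases U)
  obtain u1' v1' \<theta>' u2' v2' where V: "V = (u1', v1', \<theta>', u2', v2')" by (cases V)
  obtain \<theta>xx uxx vxxl vxxr p1 p2 h1 h2 s1 s2 e0 e3
    where sd: "stepd U V \<theta>x \<theta>xx uxx vxxl vxxr p1 p2 h1 h2 s1 s2 e0 e3"
    and UH: "U \<in> H" and VH: "V \<in> H"
    using assms unfolding step_def by blast
  note st = stepd_E[OF sd]
  have h: "u1 \<in> Sob1 I" "v1 \<in> Sob1 J" "\<theta> \<in> Lsq I" "u2 \<in> Lsq I" "v2 \<in> Lsq J"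
    using UH by (auto simp: U HF_iff)
  have h': "u1' \<in> Sob1 I" "v1' \<in> Sob1 J" "\<theta>' \<in> Lsq I" "u2' \<in> Lsq I" "v2' \<in> Lsq J"
    using VH by (auto simp: V HF_iff)
  note i = Sob1_intervalE[OF L(2) h(1)] and j = J.Sob1_E[OF h(2)]
  note i' = Sob1_intervalE[OF L(2) h'(1)] and j' = J.Sob1_E[OF h'(2)]
  have "el u2 = el u1'" using st(12) by (simp add: U V)
  then have u2: "u2 = u1'" by (rule el_inj[OF h(4) i'(1)])
  have cut_eq: "f = g" if "f \<in> Lsq J" "g \<in> Lsq J" "cut 0 L1 (el f) = cut 0 L1 (el g)" "cut L2 L3 (el f) = cut L2 L3 (el g)" for f g
  proof (rule el_inj[OF that(1,2)])
    have "el f = cut 0 L1 (el f) + cut L2 L3 (el f)" "el g = cut 0 L1 (el g) + cut L2 L3 (el g)"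
      using cut_Un[OF supp_el[OF that(1)]] cut_Un[OF supp_el[OF that(2)]] L by simp_all
    then show "el f = el g" using that(3,4) by metis
  qed
  have v2: "v2 = v1'" using st(13,14) by (intro cut_eq[OF h(5) j'(1)]) (simp_all add: U V)
  have Lq: "Rep_l2 uxx \<in> Lsq I" "Rep_l2 \<theta>x \<in> Lsq I" "Rep_l2 \<theta>xx \<in> Lsq I"
    using W_supp[OF st(1)] W_supp[OF st(3)] by (simp_all add: Rep_l2_Lsq)
  have sl: "supp {0<..<L1} vxxl" "supp {L2<..<L3} vxxr" using W_supp(2)[OF st(4)] W_supp(2)[OF st(5)] by simp_all
  then have sJ: "supp J (vxxl + vxxr)"
    by (intro supp_add supp_Un[OF sl(1), of J] supp_Un[OF sl(2), of J]) auto
  have "{L2<..<L3} \<inter> {0<..<L1} = {}" "{0<..<L1} \<inter> {L2<..<L3} = {}" using L by auto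
  then have cuts: "cut 0 L1 (vxxl + vxxr) = vxxl" "cut L2 L3 (vxxl + vxxr) = vxxr"
    using sl by (simp_all add: cut_add cut_id cut_disjoint[OF sl(1)] cut_disjoint[OF sl(2)])
  have ux: "wderiv I u1 \<in> Sob1 I" "wderiv I (wderiv I u1) = Rep_l2 uxx" "trace I (wderiv I u1) L1 = p1"
    "trace I (wderiv I u1) L2 = p2"
    using Sob1_intervalI[OF L(2) i(2) Lq(1), of p1 p2] st(1) by (simp_all add: U)
  have th: "\<theta> \<in> Sob1 I" "wderiv I \<theta> = Rep_l2 \<theta>x" "trace I \<theta> L1 = h1" "trace I \<theta> L2 = h2"
    using Sob1_intervalI[OF L(2) h(3) Lq(2), of h1 h2] st(2) by (simp_all add: U)
  have thx: "Rep_l2 \<theta>x \<in> Sob1 I" "wderiv I (Rep_l2 \<theta>x) = Rep_l2 \<theta>xx" "trace I (Rep_l2 \<theta>x) L1 = 0" "trace I (Rep_l2 \<theta>x) L2 = 0"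
    using Sob1_intervalI[OF L(2) Lq(2,3), of 0 0] st(3) by simp_all
  have vx: "wderiv J v1 \<in> Sob1 J" "wderiv J (wderiv J v1) = Rep_l2 (vxxl + vxxr)"
    "trace J (wderiv J v1) L1 = s1 / b" "trace J (wderiv J v1) L2 = s2 / b"
    using J.Sob1_I[OF j(2) Rep_l2_Lsq[OF sJ], of e0 "s1 / b" "s2 / b" e3] st(4,5) by (simp_all add: U cuts)
  show "U \<in> D"
    unfolding U domAF_iff using UH VH ux(1,3,4) vx(1,3,4) th thx h' pos st(6,7)
    by (simp add: U V u2 v2 HF_iff)
  show "ptx U = \<theta>x" by (simp add: U th)
  have eI: "f = g" if "f \<in> Lsq I" "g \<in> Lsq I" "el f = el g" for f g by (rule el_inj[OF that])
  have 1: "scale_l0 (complex_of_real (k\<^sup>2)) (wderiv I (wderiv I \<theta>)) - scale_l0 (complex_of_real m) (wderiv I u2) = \<theta>'"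
  proof (rule eI)
    show "scale_l0 (complex_of_real (k\<^sup>2)) (wderiv I (wderiv I \<theta>)) - scale_l0 (complex_of_real m) (wderiv I u2) \<in> Lsq I"
      unfolding th thx u2 by (intro Lsq_diff Lsq_scale Lq i')
    have e: "el \<theta>' = k\<^sup>2 *\<^sub>R \<theta>xx - m *\<^sub>R el (wderiv I u1')" using st(8) by (simp add: V)
    show "el (scale_l0 (complex_of_real (k\<^sup>2)) (wderiv I (wderiv I \<theta>)) - scale_l0 (complex_of_real m) (wderiv I u2)) = el \<theta>'"
      unfolding th thx u2 e
      by (simp only: el_diff[OF Lsq_scale[OF Lq(3)] Lsq_scale[OF i'(2)]] el_scale[OF Lq(3)] el_scale[OF i'(2)] csc_of_real el_Rep)
  qed (rule h')
  have 2: "scale_l0 (complex_of_real a) (wderiv I (wderiv I u1)) - scale_l0 (complex_of_real m) (wderiv I \<theta>) = u2'"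
  proof (rule eI)
    show "scale_l0 (complex_of_real a) (wderiv I (wderiv I u1)) - scale_l0 (complex_of_real m) (wderiv I \<theta>) \<in> Lsq I"
      unfolding th ux by (intro Lsq_diff Lsq_scale Lq)
    have e: "el u2' = a *\<^sub>R uxx - m *\<^sub>R \<theta>x" using st(9) by (simp add: V)
    show "el (scale_l0 (complex_of_real a) (wderiv I (wderiv I u1)) - scale_l0 (complex_of_real m) (wderiv I \<theta>)) = el u2'"
      unfolding th ux e
      by (simp only: el_diff[OF Lsq_scale[OF Lq(1)] Lsq_scale[OF Lq(2)]] el_scale[OF Lq(1)] el_scale[OF Lq(2)] csc_of_real el_Rep)
  qed (rule h')
  have 3: "scale_l0 (complex_of_real b) (wderiv J (wderiv J v1)) = v2'"
  proof (rule cut_eq)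
    note LJ = Rep_l2_Lsq[OF sJ]
    show "scale_l0 (complex_of_real b) (wderiv J (wderiv J v1)) \<in> Lsq J"
      unfolding vx by (intro Lsq_scale LJ)
    have z: "cut 0 L1 (el v2') = zl V" "cut L2 L3 (el v2') = zr V" by (simp_all add: V)
    show "cut 0 L1 (el (scale_l0 (complex_of_real b) (wderiv J (wderiv J v1)))) = cut 0 L1 (el v2')"
      "cut L2 L3 (el (scale_l0 (complex_of_real b) (wderiv J (wderiv J v1)))) = cut L2 L3 (el v2')"
      unfolding vx z st by (simp_all only: el_scale[OF LJ] el_Rep cut_csc cuts csc_of_real[symmetric])
  qed (rule h')
  show "A U = V" unfolding U V opAF_eq 1 2 3 by (simp add: u2 v2)
qed

end

text \<open>Integration by parts against the constant function 1, that is, the fundamental theorem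
  of calculus.\<close>

lemma one_integral:
  assumes "\<alpha> \<le> \<beta>" "W \<alpha> \<beta> f g fa fb" shows "fb = fa + ip g (one \<alpha> \<beta>)"
  using W_by_parts[OF assms(2) W_one[OF assms(1)]] by (simp add: ip.zero_right)

lemma ex_W:
  assumes "\<alpha> \<le> \<beta>" "supp {\<alpha><..<\<beta>} g"
  shows "\<exists>f. W \<alpha> \<beta> f g c (c + ip g (one \<alpha> \<beta>))"
  using W_anti[OF assms(2), of c] one_integral[OF assms(1) W_anti[OF assms(2), of c]] by metis

lemma supp_scaleR: "supp S f \<Longrightarrow> supp S (r *\<^sub>R f)"
  using supp_csc[of S f "complex_of_real r"] by (simp add: csc_of_real)

section \<open>The conserved functional and the stationary problem\<close>

context transmission
begin

text \<open>Integrating the heat equation over \<open>I\<close> shows that \<open>ell\<close> is conserved; the range of \<open>A\<close> turns out to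
  be exactly its null space.\<close>

definition ell :: "state \<Rightarrow> complex" where
  "ell U = ip (pt U) (one L1 L2) + complex_of_real m * (t2 U - t1 U)"

text \<open>Since \<open>\<theta>x\<close> vanishes at both interfaces, \<open>\<theta>xx\<close>
  has mean zero, and the integral of the coupling term is exactly cancelled by the boundary term of
  \<open>ell\<close>.\<close>

lemma step_ell: assumes "step U V \<theta>x" shows "ell V = 0"
proof -
  obtain \<theta>xx uxx vxxl vxxr p1 p2 h1 h2 s1 s2 e0 e3
    where sd: "stepd U V \<theta>x \<theta>xx uxx vxxl vxxr p1 p2 h1 h2 s1 s2 e0 e3" and VH: "V \<in> H"
    using assms unfolding step_def by blast
  note st = stepd_E[OF sd]
  have le: "L1 \<le> L2" using L by simp
  have 1: "ip \<theta>xx (one L1 L2) = 0" using one_integral[OF le st(3)] by simp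
  have 2: "ip (pux V) (one L1 L2) = t2 V - t1 V" using one_integral[OF le H_W(1)[OF VH]] by simp
  show ?thesis
    unfolding ell_def st(8)
    by (simp add: ip.diff_left ip.scaleR_left 1 2 scaleR_conv_of_real)
qed

lemma ex_state:
  assumes "W L1 L2 u ux \<tau>1 \<tau>2" "W 0 L1 wl wxl 0 \<tau>1" "W L2 L3 wr wxr \<tau>2 0" "supp I \<theta>" "supp I w"
    "supp {0<..<L1} yl" "supp {L2<..<L3} yr"
  shows "\<exists>U\<in>H. pu U = u \<and> pux U = ux \<and> t1 U = \<tau>1 \<and> t2 U = \<tau>2 \<and> vl U = wl \<and> vr U = wr \<and> vxl U = wxl \<and>
    vxr U = wxr \<and> pt U = \<theta> \<and> pw U = w \<and> zl U = yl \<and> zr U = yr"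
proof -
  have disj: "{L2<..<L3} \<inter> {0<..<L1} = {}" "{0<..<L1} \<inter> {L2<..<L3} = {}" using L by auto
  have J: "supp J (f + g)" "cut 0 L1 (f + g) = f" "cut L2 L3 (f + g) = g"
    if s: "supp {0<..<L1} f" "supp {L2<..<L3} g" for f g
    using s by (auto intro!: supp_add supp_Un[OF s(1), of J] supp_Un[OF s(2), of J]
        simp: cut_add cut_id cut_disjoint[OF s(1) disj(2)] cut_disjoint[OF s(2) disj(1)])
  note Jw = J[OF W_supp(1)[OF assms(2)] W_supp(1)[OF assms(3)]]
  note Jx = J[OF W_supp(2)[OF assms(2)] W_supp(2)[OF assms(3)]]
  note Jy = J[OF assms(6,7)]
  note i = Sob1_intervalI[OF L(2) Rep_l2_Lsq[OF W_supp(1)[OF assms(1)]] Rep_l2_Lsq[OF W_supp(2)[OF assms(1)]],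
      of \<tau>1 \<tau>2, simplified, OF assms(1)]
  have j: "Rep_l2 (wl + wr) \<in> Sob1 J" "wderiv J (Rep_l2 (wl + wr)) = Rep_l2 (wxl + wxr)"
    "trace J (Rep_l2 (wl + wr)) 0 = 0" "trace J (Rep_l2 (wl + wr)) L1 = \<tau>1"
    "trace J (Rep_l2 (wl + wr)) L2 = \<tau>2" "trace J (Rep_l2 (wl + wr)) L3 = 0"
    using J.Sob1_I[OF Rep_l2_Lsq[OF Jw(1)] Rep_l2_Lsq[OF Jx(1)], of 0 \<tau>1 \<tau>2 0] assms(2,3)
    by (simp_all add: Jw Jx)
  show ?thesis
  proof (rule bexI[of _ "(Rep_l2 u, Rep_l2 (wl + wr), Rep_l2 \<theta>, Rep_l2 w, Rep_l2 (yl + yr))"])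
    show "(Rep_l2 u, Rep_l2 (wl + wr), Rep_l2 \<theta>, Rep_l2 w, Rep_l2 (yl + yr)) \<in> H"
      unfolding HF_iff using i j assms(4,5) Jy(1) by (simp add: Rep_l2_Lsq)
  qed (simp add: i j Jw Jx Jy)
qed

text \<open>The equations are integrated one after another; \<open>ell V = 0\<close> is the
  compatibility condition of the Neumann problem for the temperature. The value \<open>c\<close> of
  the temperature at \<open>L1\<close> stays free, and this freedom produces the kernel: see
  \<open>ex_kernel\<close>, where \<open>V = 0\<close> and \<open>c = 1\<close>.\<close>

theorem solve:
  assumes V: "V \<in> H" and ell: "ell V = 0"
  shows "\<exists>U\<in>D. A U = V \<and> (\<exists>h2. W L1 L2 (pt U) (ptx U) c h2)"
proof -
  have le: "L1 \<le> L2" "0 \<le> L1" "L2 \<le> L3" using L by auto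
  note hV = H_W[OF V]
  define \<theta>xx where "\<theta>xx = (1 / k\<^sup>2) *\<^sub>R (pt V + m *\<^sub>R pux V)"
  have s\<theta>xx: "supp I \<theta>xx"
    unfolding \<theta>xx_def by (intro supp_scaleR supp_add hV W_supp(2)[OF hV(1)])
  have "ip (pux V) (one L1 L2) = t2 V - t1 V" using one_integral[OF le(1) hV(1)] by simp
  then have "ip \<theta>xx (one L1 L2) = 0"
    using ell by (simp add: \<theta>xx_def ell_def ip.scaleR_left ip.add_left scaleR_conv_of_real)
  then obtain \<theta>x where \<theta>x: "W L1 L2 \<theta>x \<theta>xx 0 0" using ex_W[OF le(1) s\<theta>xx, of 0] by auto
  obtain \<theta> h2 where \<theta>: "W L1 L2 \<theta> \<theta>x c h2" using ex_W[OF le(1) W_supp(1)[OF \<theta>x], of c] by auto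
  define uxx where "uxx = (1 / a) *\<^sub>R (pw V + m *\<^sub>R \<theta>x)"
  have suxx: "supp I uxx" unfolding uxx_def by (intro supp_scaleR supp_add hV W_supp(1)[OF \<theta>x])
  obtain g \<gamma> where g: "W L1 L2 g uxx 0 \<gamma>" using ex_W[OF le(1) suxx, of 0] by auto
  have sl: "supp {0<..<L1} ((1 / b) *\<^sub>R zl V)" "supp {L2<..<L3} ((1 / b) *\<^sub>R zr V)"
    by (intro supp_scaleR hV)+
  obtain gl \<gamma>l where gl: "W 0 L1 gl ((1 / b) *\<^sub>R zl V) 0 \<gamma>l" using ex_W[OF le(2) sl(1), of 0] by auto
  obtain gr \<gamma>r where gr: "W L2 L3 gr ((1 / b) *\<^sub>R zr V) 0 \<gamma>r" using ex_W[OF le(3) sl(2), of 0] by auto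
  \<comment> \<open>With the Dirichlet condition at 0 and the interface conditions imposed, the
    displacement at \<open>L3\<close> is affine in the unknown \<open>p1\<close>: its slope is
    \<open>q\<close>, and its value at \<open>p1 = 0\<close> is \<open>R\<close>. Since
    \<open>q\<close> is a positive number, \<open>p1 = - R / q\<close> gives the last Dirichlet
    condition.\<close>
  define q where "q = complex_of_real (a * L1 / b + (L2 - L1) + a * (L3 - L2) / b)"
  have "0 < a * L1 / b + (L2 - L1) + a * (L3 - L2) / b"
    using L pos by (intro add_pos_pos) auto
  then have q0: "q \<noteq> 0" unfolding q_def by (simp only: of_real_eq_0_iff)
  define R where "R = ip gl (one 0 L1) + (- m * c / b - \<gamma>l) * L1 + ip g (one L1 L2) + ip gr (one L2 L3)
    + ((a * \<gamma> - m * h2) / b) * (L3 - L2)"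
  define p1 where "p1 = - R / q"
  define p2 where "p2 = \<gamma> + p1"
  define s1 where "s1 = complex_of_real a * p1 - complex_of_real m * c"
  define s2 where "s2 = complex_of_real a * p2 - complex_of_real m * h2"
  define ux where "ux = g + csc p1 (one L1 L2)"
  have ux: "W L1 L2 ux uxx p1 p2"
    using W_add[OF g W_csc[OF W_one[OF le(1)], of p1]] by (simp add: ux_def p2_def)
  \<comment> \<open>The constant is adjusted so that the value at \<open>L1\<close> becomes
    \<open>s1 / b\<close>, as continuity of the stress demands; on the right component the condition
    sits at the left end, so no \<open>\<gamma>r\<close> appears in the constant.\<close>
  define wxl where "wxl = gl + csc (s1 / b - \<gamma>l) (one 0 L1)"
  have wxl: "W 0 L1 wxl ((1 / b) *\<^sub>R zl V) (s1 / b - \<gamma>l) (s1 / b)"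
    using W_add[OF gl W_csc[OF W_one[OF le(2)], of "s1 / b - \<gamma>l"]] by (simp add: wxl_def)
  define wxr where "wxr = gr + csc (s2 / b) (one L2 L3)"
  have wxr: "W L2 L3 wxr ((1 / b) *\<^sub>R zr V) (s2 / b) (\<gamma>r + s2 / b)"
    using W_add[OF gr W_csc[OF W_one[OF le(3)], of "s2 / b"]] by (simp add: wxr_def)
  define \<tau>1 where "\<tau>1 = ip wxl (one 0 L1)"
  define \<tau>2 where "\<tau>2 = \<tau>1 + ip ux (one L1 L2)"
  obtain wl where wl: "W 0 L1 wl wxl 0 \<tau>1" using ex_W[OF le(2) W_supp(1)[OF wxl], of 0] by (auto simp: \<tau>1_def)
  obtain u where u: "W L1 L2 u ux \<tau>1 \<tau>2" using ex_W[OF le(1) W_supp(1)[OF ux], of \<tau>1] by (auto simp: \<tau>2_def)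
  have "\<tau>2 + ip wxr (one L2 L3) = 0"
  proof -
    have "\<tau>2 + ip wxr (one L2 L3) = R + q * p1"
      unfolding \<tau>2_def \<tau>1_def wxl_def wxr_def ux_def R_def q_def s1_def s2_def p2_def
      using le pos by (simp add: ip_add_left ip_csc_left norm_one field_simps)
    then show ?thesis using q0 by (simp add: p1_def)
  qed
  then obtain wr where wr: "W L2 L3 wr wxr \<tau>2 0" using ex_W[OF le(3) W_supp(1)[OF wxr], of \<tau>2] by auto
  obtain U where U: "U \<in> H" "pu U = u" "pux U = ux" "vl U = wl" "vr U = wr" "vxl U = wxl" "vxr U = wxr"
    "pt U = \<theta>" "pw U = pu V" "zl U = vl V" "zr U = vr V"
    using ex_state[OF u wl wr W_supp(1)[OF \<theta>] W_supp(1)[OF hV(1)] W_supp(1)[OF hV(2)] W_supp(1)[OF hV(3)]]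
    by metis
  have "stepd U V \<theta>x \<theta>xx uxx ((1 / b) *\<^sub>R zl V) ((1 / b) *\<^sub>R zr V) p1 p2 c h2 s1 s2 (s1 / b - \<gamma>l) (\<gamma>r + s2 / b)"
    unfolding stepd_def U using ux \<theta> \<theta>x wxl wxr s1_def s2_def pos
    by (simp add: \<theta>xx_def uxx_def)
  then have "step U V \<theta>x" unfolding step_def using U(1) V by blast
  from step_dom[OF this] show ?thesis using \<theta> U(8) by metis
qed

end

section \<open>Inequalities on an interval\<close>

lemma young: "0 < e \<Longrightarrow> x * y \<le> e * x\<^sup>2 + (1 / (4 * e)) * y\<^sup>2" for x y e :: real
proof -
  assume e: "0 < e"
  have "0 \<le> (2 * e * x - y)\<^sup>2 / (4 * e)" using e by simp
  also have "\<dots> = e * x\<^sup>2 + (1 / (4 * e)) * y\<^sup>2 - x * y"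
    using e by (simp add: power2_diff power_mult_distrib field_simps power2_eq_square)
  finally show ?thesis by simp
qed

lemma inner_young:
  fixes x y :: "'a::real_inner"
  assumes "0 < e"
  shows "\<bar>inner x y\<bar> \<le> e * (norm x)\<^sup>2 + (1 / (4 * e)) * (norm y)\<^sup>2"
  using Cauchy_Schwarz_ineq2[of x y] young[OF assms, of "norm x" "norm y"] by linarith

lemma norm_add_sq: "(norm (x + y))\<^sup>2 \<le> 2 * (norm x)\<^sup>2 + 2 * (norm y)\<^sup>2" for x y :: "'a::real_normed_vector"
proof -
  have "(norm (x + y))\<^sup>2 \<le> (norm x + norm y)\<^sup>2" by (intro power_mono norm_triangle_ineq) simp
  also have "\<dots> \<le> 2 * (norm x)\<^sup>2 + 2 * (norm y)\<^sup>2"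
    using sum_squares_bound[of "norm x" "norm y"] by (simp add: power2_sum)
  finally show ?thesis .
qed

lemma norm_diff_sq: "(norm (x - y))\<^sup>2 \<le> 2 * (norm x)\<^sup>2 + 2 * (norm y)\<^sup>2" for x y :: "'a::real_normed_vector"
  using norm_add_sq[of x "- y"] by simp

lemma W_inner:
  assumes "W \<alpha> \<beta> f f' fa fb" "W \<alpha> \<beta> g g' ga gb"
  shows "inner f' g + inner f g' = inner fb gb - inner fa ga"
  using arg_cong[OF W_by_parts[OF assms], of Re] by (simp add: inner_ip inner_complex_def)

text \<open>Integrates the derivative of \<open>(x - c) * |f|^2\<close>. The choice of
  \<open>c\<close> decides which end points survive; the Poincare and trace inequalities and the
  boundary multipliers all come from this identity.\<close>

lemma W_mult_id:
  assumes "W \<alpha> \<beta> f f' fa fb" "\<alpha> \<le> \<beta>"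
  shows "(\<beta> - c) * (norm fb)\<^sup>2 - (\<alpha> - c) * (norm fa)\<^sup>2 = (norm f)\<^sup>2 + 2 * inner (mulf (aff \<alpha> \<beta> c) f) f'"
proof -
  have "inner (f + mulf (aff \<alpha> \<beta> c) f') f + inner (mulf (aff \<alpha> \<beta> c) f) f'
    = (\<beta> - c) * (norm fb)\<^sup>2 - (\<alpha> - c) * (norm fa)\<^sup>2"
    using W_inner[OF W_aff[OF assms, of c] assms(1)] by (simp add: power2_norm_eq_inner)
  moreover have "inner (mulf (aff \<alpha> \<beta> c) f') f = inner (mulf (aff \<alpha> \<beta> c) f) f'"
    using inner_mulf[OF bdd_mult_aff, of \<alpha> \<beta> c f' f] by (simp add: inner_commute)
  ultimately show ?thesis by (simp add: inner_add_left power2_norm_eq_inner)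
qed

lemma inner_aff_le:
  assumes "\<alpha> \<le> \<beta>" "c \<in> {\<alpha>..\<beta>}"
  shows "\<bar>inner (mulf (aff \<alpha> \<beta> c) f) g\<bar> \<le> (\<beta> - \<alpha>) * (norm f * norm g)"
proof -
  have "\<bar>inner (mulf (aff \<alpha> \<beta> c) f) g\<bar> \<le> norm (mulf (aff \<alpha> \<beta> c) f) * norm g"
    by (rule Cauchy_Schwarz_ineq2)
  also have "\<dots> \<le> ((\<beta> - \<alpha>) * norm f) * norm g"
    using norm_mulf[OF bdd_mult_aff'[of \<alpha> c \<beta>], of f] assms by (intro mult_right_mono) auto
  finally show ?thesis by (simp add: mult.assoc)
qed

text \<open>With \<open>c\<close> at one end only the trace at the other end remains in
  \<open>W_mult_id\<close>; the cross term is split by Young's inequality, and half of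
  \<open>(norm f)^2\<close> is absorbed.\<close>

lemma poincare:
  assumes w: "W \<alpha> \<beta> f f' fa fb" and le: "\<alpha> \<le> \<beta>"
  shows "(norm f)\<^sup>2 \<le> 2 * (\<beta> - \<alpha>) * (norm fa)\<^sup>2 + 4 * (\<beta> - \<alpha>)\<^sup>2 * (norm f')\<^sup>2"
    and "(norm f)\<^sup>2 \<le> 2 * (\<beta> - \<alpha>) * (norm fb)\<^sup>2 + 4 * (\<beta> - \<alpha>)\<^sup>2 * (norm f')\<^sup>2"
proof -
  have *: "2 * \<bar>inner (mulf (aff \<alpha> \<beta> c) f) f'\<bar> \<le> (norm f)\<^sup>2 / 2 + 2 * (\<beta> - \<alpha>)\<^sup>2 * (norm f')\<^sup>2" if "c \<in> {\<alpha>..\<beta>}" for c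
  proof -
    \<comment> \<open>The weight \<open>1/4\<close> is what leaves exactly half of
      \<open>(norm f)^2\<close> after doubling.\<close>
    have "norm f * ((\<beta> - \<alpha>) * norm f') \<le> (norm f)\<^sup>2 / 4 + (\<beta> - \<alpha>)\<^sup>2 * (norm f')\<^sup>2"
      using young[of "1/4" "norm f" "(\<beta> - \<alpha>) * norm f'"] by (simp add: power_mult_distrib)
    moreover have "\<bar>inner (mulf (aff \<alpha> \<beta> c) f) f'\<bar> \<le> norm f * ((\<beta> - \<alpha>) * norm f')"
      using inner_aff_le[OF le that, of f f'] by (simp add: mult.left_commute)
    ultimately show ?thesis by linarith
  qed
  have "(\<beta> - \<alpha>) * (norm fa)\<^sup>2 = (norm f)\<^sup>2 + 2 * inner (mulf (aff \<alpha> \<beta> \<beta>) f) f'"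
    using W_mult_id[OF w le, of \<beta>] by (simp add: algebra_simps)
  moreover have "2 * \<bar>inner (mulf (aff \<alpha> \<beta> \<beta>) f) f'\<bar> \<le> (norm f)\<^sup>2 / 2 + 2 * (\<beta> - \<alpha>)\<^sup>2 * (norm f')\<^sup>2"
    by (rule *) (use le in simp)
  ultimately have "(norm f)\<^sup>2 \<le> 2 * ((\<beta> - \<alpha>) * (norm fa)\<^sup>2) + 2 * (2 * (\<beta> - \<alpha>)\<^sup>2 * (norm f')\<^sup>2)"
    by linarith
  then show "(norm f)\<^sup>2 \<le> 2 * (\<beta> - \<alpha>) * (norm fa)\<^sup>2 + 4 * (\<beta> - \<alpha>)\<^sup>2 * (norm f')\<^sup>2"
    by (simp add: algebra_simps)
  have "(\<beta> - \<alpha>) * (norm fb)\<^sup>2 = (norm f)\<^sup>2 + 2 * inner (mulf (aff \<alpha> \<beta> \<alpha>) f) f'"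
    using W_mult_id[OF w le, of \<alpha>] by (simp add: algebra_simps)
  moreover have "2 * \<bar>inner (mulf (aff \<alpha> \<beta> \<alpha>) f) f'\<bar> \<le> (norm f)\<^sup>2 / 2 + 2 * (\<beta> - \<alpha>)\<^sup>2 * (norm f')\<^sup>2"
    by (rule *) (use le in simp)
  ultimately have "(norm f)\<^sup>2 \<le> 2 * ((\<beta> - \<alpha>) * (norm fb)\<^sup>2) + 2 * (2 * (\<beta> - \<alpha>)\<^sup>2 * (norm f')\<^sup>2)"
    by linarith
  then show "(norm f)\<^sup>2 \<le> 2 * (\<beta> - \<alpha>) * (norm fb)\<^sup>2 + 4 * (\<beta> - \<alpha>)\<^sup>2 * (norm f')\<^sup>2"
    by (simp add: algebra_simps)
qed

lemma trace_bound:
  assumes w: "W \<alpha> \<beta> f f' fa fb" and lt: "\<alpha> < \<beta>"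
  shows "(norm fa)\<^sup>2 \<le> (1 / (\<beta> - \<alpha>) + 1) * ((norm f)\<^sup>2 + (norm f')\<^sup>2)"
    and "(norm fb)\<^sup>2 \<le> (1 / (\<beta> - \<alpha>) + 1) * ((norm f)\<^sup>2 + (norm f')\<^sup>2)"
proof -
  have le: "\<alpha> \<le> \<beta>" and l: "0 < \<beta> - \<alpha>" using lt by auto
  have *: "2 * \<bar>inner (mulf (aff \<alpha> \<beta> c) f) f'\<bar> \<le> (\<beta> - \<alpha>) * ((norm f)\<^sup>2 + (norm f')\<^sup>2)" if "c \<in> {\<alpha>..\<beta>}" for c
  proof -
    have "2 * (norm f * norm f') \<le> (norm f)\<^sup>2 + (norm f')\<^sup>2"
      using sum_squares_bound[of "norm f" "norm f'"] by simp
    then have "(\<beta> - \<alpha>) * (2 * (norm f * norm f')) \<le> (\<beta> - \<alpha>) * ((norm f)\<^sup>2 + (norm f')\<^sup>2)"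
      using l by (intro mult_left_mono) auto
    then show ?thesis using inner_aff_le[OF le that, of f f'] by simp
  qed
  have fin: "x \<le> (1 / (\<beta> - \<alpha>) + 1) * (y + z)"
    if "(\<beta> - \<alpha>) * x \<le> y + (\<beta> - \<alpha>) * (y + z)" "0 \<le> z" for x y z :: real
  proof -
    have "x \<le> (y + (\<beta> - \<alpha>) * (y + z)) / (\<beta> - \<alpha>)"
      using that l by (simp add: pos_le_divide_eq mult.commute)
    also have "\<dots> = y / (\<beta> - \<alpha>) + (y + z)" using l by (simp add: add_divide_distrib)
    also have "\<dots> \<le> (1 / (\<beta> - \<alpha>) + 1) * (y + z)"
      using that(2) l by (simp add: distrib_right add_divide_distrib)
    finally show ?thesis .
  qed
  have "(\<beta> - \<alpha>) * (norm fa)\<^sup>2 = (norm f)\<^sup>2 + 2 * inner (mulf (aff \<alpha> \<beta> \<beta>) f) f'"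
    using W_mult_id[OF w le, of \<beta>] by (simp add: algebra_simps)
  then show "(norm fa)\<^sup>2 \<le> (1 / (\<beta> - \<alpha>) + 1) * ((norm f)\<^sup>2 + (norm f')\<^sup>2)"
    by (intro fin) (use *[of \<beta>] le in auto)
  have "(\<beta> - \<alpha>) * (norm fb)\<^sup>2 = (norm f)\<^sup>2 + 2 * inner (mulf (aff \<alpha> \<beta> \<alpha>) f) f'"
    using W_mult_id[OF w le, of \<alpha>] by (simp add: algebra_simps)
  then show "(norm fb)\<^sup>2 \<le> (1 / (\<beta> - \<alpha>) + 1) * ((norm f)\<^sup>2 + (norm f')\<^sup>2)"
    by (intro fin) (use *[of \<alpha>] le in auto)
qed

text \<open>A function of mean zero is orthogonal to constants, so subtracting its trace can only
  increase its norm, and the difference vanishes at \<alpha>.\<close>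

lemma poincare_mean:
  assumes w: "W \<alpha> \<beta> f f' fa fb" and le: "\<alpha> \<le> \<beta>" and mean: "ip f (one \<alpha> \<beta>) = 0"
  shows "(norm f)\<^sup>2 \<le> 4 * (\<beta> - \<alpha>)\<^sup>2 * (norm f')\<^sup>2"
proof -
  let ?g = "csc fa (one \<alpha> \<beta>)"
  have g: "W \<alpha> \<beta> (f - ?g) f' 0 (fb - fa)"
    using W_diff[OF w W_csc[OF W_one[OF le], of fa]] by simp
  have "inner f ?g = 0" using mean by (simp add: inner_ip ip_csc_right)
  then have "(norm (f - ?g))\<^sup>2 = (norm f)\<^sup>2 + (norm ?g)\<^sup>2"
    by (simp add: power2_norm_eq_inner inner_diff_left inner_diff_right inner_commute)
  moreover have "(norm (f - ?g))\<^sup>2 \<le> 4 * (\<beta> - \<alpha>)\<^sup>2 * (norm f')\<^sup>2"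
    using poincare(1)[OF g le] by simp
  ultimately show ?thesis using zero_le_power2[of "norm ?g"] by linarith
qed

lemma ip_one_sq: "\<alpha> \<le> \<beta> \<Longrightarrow> (cmod (ip f (one \<alpha> \<beta>)))\<^sup>2 \<le> (\<beta> - \<alpha>) * (norm f)\<^sup>2"
proof -
  assume le: "\<alpha> \<le> \<beta>"
  have n: "(norm (one \<alpha> \<beta>))\<^sup>2 = \<beta> - \<alpha>"
    using arg_cong[OF norm_one[OF le], of Re] by (simp add: ip_self)
  have "(cmod (ip f (one \<alpha> \<beta>)))\<^sup>2 \<le> (norm f * norm (one \<alpha> \<beta>))\<^sup>2"
    by (intro power_mono norm_ip_le) simp
  then show ?thesis by (simp add: power_mult_distrib n mult.commute)
qed

section \<open>Estimates for states\<close>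

context transmission
begin

fun p1 :: "state \<Rightarrow> complex" where "p1 (u1, v1, \<theta>, u2, v2) = trace I (wderiv I u1) L1"
fun p2 :: "state \<Rightarrow> complex" where "p2 (u1, v1, \<theta>, u2, v2) = trace I (wderiv I u1) L2"
fun h1 :: "state \<Rightarrow> complex" where "h1 (u1, v1, \<theta>, u2, v2) = trace I \<theta> L1"
fun h2 :: "state \<Rightarrow> complex" where "h2 (u1, v1, \<theta>, u2, v2) = trace I \<theta> L2"

definition s1 :: "state \<Rightarrow> complex" where "s1 U = complex_of_real a * p1 U - complex_of_real m * h1 U"
definition s2 :: "state \<Rightarrow> complex" where "s2 U = complex_of_real a * p2 U - complex_of_real m * h2 U"
text \<open>The quantity whose space derivative is the acceleration; it is continuous across the
  interfaces up to the factor \<open>b\<close>, which makes interface terms cancel.\<close>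

definition stress :: "state \<Rightarrow> l2" where "stress U = a *\<^sub>R pux U - m *\<^sub>R pt U"

text \<open>Uniqueness of traces lets the interface values be named as functions of the state, while
  the second derivatives stay existential. Every identity below starts from these relations.\<close>

lemma dom_W:
  assumes "U \<in> D"
  obtains \<theta>xx uxx vxxl vxxr e0 e3 where
    "W L1 L2 (pux U) uxx (p1 U) (p2 U)" "W L1 L2 (pt U) (ptx U) (h1 U) (h2 U)" "W L1 L2 (ptx U) \<theta>xx 0 0"
    "W 0 L1 (vxl U) vxxl e0 (s1 U / complex_of_real b)" "W L2 L3 (vxr U) vxxr (s2 U / complex_of_real b) e3"
    "pt (A U) = k\<^sup>2 *\<^sub>R \<theta>xx - m *\<^sub>R pux (A U)" "pw (A U) = a *\<^sub>R uxx - m *\<^sub>R ptx U"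
    "zl (A U) = b *\<^sub>R vxxl" "zr (A U) = b *\<^sub>R vxxr"
    "pu (A U) = pw U" "vl (A U) = zl U" "vr (A U) = zr U"
    "W L1 L2 (stress U) (pw (A U)) (s1 U) (s2 U)"
proof -
  obtain \<theta>xx uxx vxxl vxxr p1' p2' h1' h2' s1' s2' e0 e3
    where sd: "stepd U (A U) (ptx U) \<theta>xx uxx vxxl vxxr p1' p2' h1' h2' s1' s2' e0 e3"
    using dom_step(2)[OF assms] unfolding step_def by blast
  note st = stepd_E[OF sd]
  obtain u1 v1 \<theta> u2 v2 where U: "U = (u1, v1, \<theta>, u2, v2)" by (cases U)
  have d: "wderiv I u1 \<in> Sob1 I" "\<theta> \<in> Sob1 I" using assms by (auto simp: U domAF_iff)
  have "W L1 L2 (pux U) (el (wderiv I (wderiv I u1))) (p1 U) (p2 U)"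
    using Sob1_intervalE(3)[OF L(2) d(1)] by (simp add: U)
  then have p: "p1' = p1 U" "p2' = p2 U" using W_unique[OF L(2) st(1)] by blast+
  have "W L1 L2 (pt U) (ptx U) (h1 U) (h2 U)"
    using Sob1_intervalE(3)[OF L(2) d(2)] by (simp add: U)
  then have h: "h1' = h1 U" "h2' = h2 U" using W_unique[OF L(2) st(2)] by blast+
  have s: "s1' = s1 U" "s2' = s2 U" using st(6,7) by (simp_all add: s1_def s2_def p h)
  have "W L1 L2 (stress U) (pw (A U)) (s1 U) (s2 U)"
    using W_diff[OF W_scaleR[OF st(1), of a] W_scaleR[OF st(2), of m]] st(9)
    by (simp add: stress_def s1_def s2_def p h scaleR_conv_of_real)
  with st show ?thesis unfolding p h s by (intro that)
qed

lemma norm_sq_le_N: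
  assumes "U \<in> H"
  shows "a * (norm (pux U))\<^sup>2 \<le> (N U)\<^sup>2" "(norm (pw U))\<^sup>2 \<le> (N U)\<^sup>2" "(norm (pt U))\<^sup>2 \<le> (N U)\<^sup>2"
    "b * (norm (vxl U))\<^sup>2 \<le> (N U)\<^sup>2" "b * (norm (vxr U))\<^sup>2 \<le> (N U)\<^sup>2"
    "(norm (zl U))\<^sup>2 \<le> (N U)\<^sup>2" "(norm (zr U))\<^sup>2 \<le> (N U)\<^sup>2"
proof -
  have "0 \<le> a * (norm (pux U))\<^sup>2" "0 \<le> b * (norm (vxl U))\<^sup>2" "0 \<le> b * (norm (vxr U))\<^sup>2"
    "0 \<le> (norm (pw U))\<^sup>2" "0 \<le> (norm (pt U))\<^sup>2" "0 \<le> (norm (zl U))\<^sup>2" "0 \<le> (norm (zr U))\<^sup>2"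
    using pos by auto
  then show "a * (norm (pux U))\<^sup>2 \<le> (N U)\<^sup>2" "(norm (pw U))\<^sup>2 \<le> (N U)\<^sup>2" "(norm (pt U))\<^sup>2 \<le> (N U)\<^sup>2"
    "b * (norm (vxl U))\<^sup>2 \<le> (N U)\<^sup>2" "b * (norm (vxr U))\<^sup>2 \<le> (N U)\<^sup>2"
    "(norm (zl U))\<^sup>2 \<le> (N U)\<^sup>2" "(norm (zr U))\<^sup>2 \<le> (N U)\<^sup>2"
    unfolding N_sq[OF assms] distrib_left by linarith+
qed

end

text \<open>Only the existence of a constant uniform over \<open>X\<close> is recorded, since no
  explicit decay rate is claimed.\<close>

definition lesssim :: "'s set \<Rightarrow> ('s \<Rightarrow> real) \<Rightarrow> ('s \<Rightarrow> real) \<Rightarrow> bool" where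
  "lesssim X R S \<longleftrightarrow> (\<exists>C\<ge>0. \<forall>U\<in>X. R U \<le> C * S U)"

lemma lesssimI: "0 \<le> C \<Longrightarrow> (\<And>U. U \<in> X \<Longrightarrow> R U \<le> C * S U) \<Longrightarrow> lesssim X R S"
  unfolding lesssim_def by blast

lemma lesssim_trans: "lesssim X R S \<Longrightarrow> lesssim X S S' \<Longrightarrow> lesssim X R S'"
proof -
  assume "lesssim X R S" "lesssim X S S'"
  then obtain C C' where C: "0 \<le> C" "\<And>U. U \<in> X \<Longrightarrow> R U \<le> C * S U" "0 \<le> C'" "\<And>U. U \<in> X \<Longrightarrow> S U \<le> C' * S' U"
    unfolding lesssim_def by blast
  show ?thesis
  proof (rule lesssimI[of "C * C'"])
    fix U assume "U \<in> X"
    then show "R U \<le> C * C' * S' U"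
      using C(2)[of U] mult_left_mono[OF C(4) C(1), of U] by (simp add: mult.assoc)
  qed (use C in simp)
qed

lemma lesssim_add: "lesssim X R S \<Longrightarrow> lesssim X R' S \<Longrightarrow> lesssim X (\<lambda>U. R U + R' U) S"
proof -
  assume "lesssim X R S" "lesssim X R' S"
  then obtain C C' where C: "0 \<le> C" "\<And>U. U \<in> X \<Longrightarrow> R U \<le> C * S U" "0 \<le> C'" "\<And>U. U \<in> X \<Longrightarrow> R' U \<le> C' * S U"
    unfolding lesssim_def by blast
  show ?thesis
    by (rule lesssimI[of "C + C'"]) (use C in \<open>auto simp: distrib_right intro: add_mono\<close>)
qed

lemma lesssim_scale: "lesssim X R S \<Longrightarrow> 0 \<le> c \<Longrightarrow> lesssim X (\<lambda>U. c * R U) S"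
proof -
  assume "lesssim X R S" and c: "0 \<le> c"
  then obtain C where C: "0 \<le> C" "\<And>U. U \<in> X \<Longrightarrow> R U \<le> C * S U"
    unfolding lesssim_def by blast
  show ?thesis
    by (rule lesssimI[of "c * C"]) (use C c in \<open>auto simp: mult.assoc intro: mult_left_mono\<close>)
qed

lemma lesssim_mono: "lesssim X R S \<Longrightarrow> (\<And>U. U \<in> X \<Longrightarrow> R' U \<le> R U) \<Longrightarrow> lesssim X R' S"
  unfolding lesssim_def by (meson order_trans)

lemma lesssim_subset: "lesssim X R S \<Longrightarrow> Y \<subseteq> X \<Longrightarrow> lesssim Y R S"
  unfolding lesssim_def by blast

context transmission
begin

abbreviation "LS \<equiv> lesssim H"

lemma LS_coords:
  "LS (\<lambda>U. (norm (pux U))\<^sup>2) (\<lambda>U. (N U)\<^sup>2)" "LS (\<lambda>U. (norm (pw U))\<^sup>2) (\<lambda>U. (N U)\<^sup>2)"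
  "LS (\<lambda>U. (norm (pt U))\<^sup>2) (\<lambda>U. (N U)\<^sup>2)" "LS (\<lambda>U. (norm (vxl U))\<^sup>2) (\<lambda>U. (N U)\<^sup>2)"
  "LS (\<lambda>U. (norm (vxr U))\<^sup>2) (\<lambda>U. (N U)\<^sup>2)" "LS (\<lambda>U. (norm (zl U))\<^sup>2) (\<lambda>U. (N U)\<^sup>2)"
  "LS (\<lambda>U. (norm (zr U))\<^sup>2) (\<lambda>U. (N U)\<^sup>2)"
proof -
  show "LS (\<lambda>U. (norm (pux U))\<^sup>2) (\<lambda>U. (N U)\<^sup>2)"
    by (rule lesssimI[of "1 / a"]) (use pos norm_sq_le_N in \<open>auto simp: field_simps\<close>)
  show "LS (\<lambda>U. (norm (vxl U))\<^sup>2) (\<lambda>U. (N U)\<^sup>2)" "LS (\<lambda>U. (norm (vxr U))\<^sup>2) (\<lambda>U. (N U)\<^sup>2)"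
    by (rule lesssimI[of "1 / b"], use pos norm_sq_le_N in \<open>auto simp: field_simps\<close>)+
  show "LS (\<lambda>U. (norm (pw U))\<^sup>2) (\<lambda>U. (N U)\<^sup>2)" "LS (\<lambda>U. (norm (pt U))\<^sup>2) (\<lambda>U. (N U)\<^sup>2)"
    "LS (\<lambda>U. (norm (zl U))\<^sup>2) (\<lambda>U. (N U)\<^sup>2)" "LS (\<lambda>U. (norm (zr U))\<^sup>2) (\<lambda>U. (N U)\<^sup>2)"
    by (rule lesssimI[of 1], use norm_sq_le_N in auto)+
qed

definition pot :: "state \<Rightarrow> real" where
  "pot U = a * (norm (pux U))\<^sup>2 + b * ((norm (vxl U))\<^sup>2 + (norm (vxr U))\<^sup>2)"

lemma pot_nonneg: "0 \<le> pot U" using pos by (simp add: pot_def)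

text \<open>The estimates start at the outer ends, where the displacement vanishes: Poincare on the
  two components of \<open>J\<close>, then the trace inequality at the interfaces, and from there
  Poincare on \<open>I\<close>.\<close>

lemma LS_pot:
  "LS (\<lambda>U. (norm (pux U))\<^sup>2) pot" "LS (\<lambda>U. (norm (vl U))\<^sup>2) pot" "LS (\<lambda>U. (norm (vr U))\<^sup>2) pot"
  "LS (\<lambda>U. (norm (pu U))\<^sup>2) pot" "LS (\<lambda>U. (norm (t2 U - t1 U))\<^sup>2) pot"
  "LS (\<lambda>U. (norm (t1 U))\<^sup>2) pot" "LS (\<lambda>U. (norm (t2 U))\<^sup>2) pot"
proof -
  have nn: "0 \<le> a * (norm (pux U))\<^sup>2" "0 \<le> b * (norm (vxl U))\<^sup>2" "0 \<le> b * (norm (vxr U))\<^sup>2" for U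
    using pos by auto
  have "a * (norm (pux U))\<^sup>2 \<le> pot U" "b * (norm (vxl U))\<^sup>2 \<le> pot U" "b * (norm (vxr U))\<^sup>2 \<le> pot U" for U
    using nn[of U] unfolding pot_def distrib_left by linarith+
  then have "norm (pux U) ^ 2 \<le> 1 / a * pot U" "norm (vxl U) ^ 2 \<le> 1 / b * pot U" "norm (vxr U) ^ 2 \<le> 1 / b * pot U" for U
    using pos by (simp_all add: pos_le_divide_eq mult.commute)
  note le = this
  have ux: "LS (\<lambda>U. (norm (pux U))\<^sup>2) pot"
    by (rule lesssimI[of "1 / a"]) (use le pos in auto)
  have xl: "LS (\<lambda>U. (norm (vxl U))\<^sup>2) pot"
    by (rule lesssimI[of "1 / b"]) (use le pos in auto)
  have xr: "LS (\<lambda>U. (norm (vxr U))\<^sup>2) pot"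
    by (rule lesssimI[of "1 / b"]) (use le pos in auto)
  show "LS (\<lambda>U. (norm (pux U))\<^sup>2) pot" by (rule ux)
  show l: "LS (\<lambda>U. (norm (vl U))\<^sup>2) pot"
    by (rule lesssim_mono[OF lesssim_scale[OF xl, of "4 * L1\<^sup>2"]])
      (use poincare(1)[OF H_W(2)] L in auto)
  show r: "LS (\<lambda>U. (norm (vr U))\<^sup>2) pot"
    by (rule lesssim_mono[OF lesssim_scale[OF xr, of "4 * (L3 - L2)\<^sup>2"]])
      (use poincare(2)[OF H_W(3)] L in auto)
  show 1: "LS (\<lambda>U. (norm (t1 U))\<^sup>2) pot"
    by (rule lesssim_mono[OF lesssim_scale[OF lesssim_add[OF l xl], of "1 / L1 + 1"]])
      (use trace_bound(2)[OF H_W(2)] L in auto)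
  show 2: "LS (\<lambda>U. (norm (t2 U))\<^sup>2) pot"
    by (rule lesssim_mono[OF lesssim_scale[OF lesssim_add[OF r xr], of "1 / (L3 - L2) + 1"]])
      (use trace_bound(1)[OF H_W(3)] L in auto)
  show "LS (\<lambda>U. (norm (t2 U - t1 U))\<^sup>2) pot"
  proof (rule lesssim_mono[OF lesssim_scale[OF lesssim_add[OF 2 1], of 2]])
    fix U show "(norm (t2 U - t1 U))\<^sup>2 \<le> 2 * ((norm (t2 U))\<^sup>2 + (norm (t1 U))\<^sup>2)"
      using norm_diff_sq[of "t2 U" "t1 U"] by simp
  qed simp
  show "LS (\<lambda>U. (norm (pu U))\<^sup>2) pot"
    by (rule lesssim_mono[OF lesssim_add[OF lesssim_scale[OF 1, of "2 * (L2 - L1)"]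
          lesssim_scale[OF ux, of "4 * (L2 - L1)\<^sup>2"]]]) (use poincare(1)[OF H_W(1)] L in auto)
qed

lemma pot_le_N: "LS pot (\<lambda>U. (N U)\<^sup>2)"
  by (rule lesssimI[of 1]) (auto simp: pot_def N_sq)

end

section \<open>Lower bound for \<open>A\<close> and the energy identity\<close>

context transmission
begin

lemma L12: "L1 \<le> L2" "0 \<le> L1" "L2 \<le> L3" using L by auto

text \<open>The temperature gradient vanishes at the interfaces, so it is bounded by
  \<open>\<theta>xx\<close>, which the heat equation expresses through entries of
  \<open>A U\<close>.\<close>

lemma LS_ptx: "lesssim D (\<lambda>U. (norm (ptx U))\<^sup>2) (\<lambda>U. (N (A U))\<^sup>2)"
proof -
  obtain C where C: "0 \<le> C" "\<And>U. U \<in> H \<Longrightarrow> (norm (pux U))\<^sup>2 \<le> C * (N U)\<^sup>2"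
    using LS_coords(1) unfolding lesssim_def by blast
  define c where "c = 4 * (L2 - L1)\<^sup>2 / (k\<^sup>2)\<^sup>2"
  show ?thesis
  proof (rule lesssimI[of "c * (2 + 2 * m\<^sup>2 * C)"])
    show "0 \<le> c * (2 + 2 * m\<^sup>2 * C)" using C by (simp add: c_def)
    fix U assume U: "U \<in> D"
    obtain \<theta>xx where th: "W L1 L2 (ptx U) \<theta>xx 0 0" "pt (A U) = k\<^sup>2 *\<^sub>R \<theta>xx - m *\<^sub>R pux (A U)"
      by (rule dom_W[OF U]) blast
    have AH: "A U \<in> H" by (rule dom_step(1)[OF U])
    have "(k\<^sup>2)\<^sup>2 * (norm \<theta>xx)\<^sup>2 = (norm (pt (A U) + m *\<^sub>R pux (A U)))\<^sup>2"
      by (simp add: th(2) power_mult_distrib)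
    also have "\<dots> \<le> 2 * (norm (pt (A U)))\<^sup>2 + 2 * (m\<^sup>2 * (norm (pux (A U)))\<^sup>2)"
      using norm_add_sq[of "pt (A U)" "m *\<^sub>R pux (A U)"] by (simp add: power_mult_distrib)
    also have "\<dots> \<le> 2 * (N (A U))\<^sup>2 + 2 * (m\<^sup>2 * (C * (N (A U))\<^sup>2))"
      using norm_sq_le_N(3)[OF AH] C(2)[OF AH] by (intro add_mono mult_left_mono) auto
    finally have *: "(k\<^sup>2)\<^sup>2 * (norm \<theta>xx)\<^sup>2 \<le> (2 + 2 * m\<^sup>2 * C) * (N (A U))\<^sup>2"
      by (simp add: algebra_simps)
    have "(norm (ptx U))\<^sup>2 \<le> 4 * (L2 - L1)\<^sup>2 * (norm \<theta>xx)\<^sup>2"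
      using poincare(1)[OF th(1) L12(1)] by simp
    also have "\<dots> = c * ((k\<^sup>2)\<^sup>2 * (norm \<theta>xx)\<^sup>2)" using pos by (simp add: c_def)
    also have "\<dots> \<le> c * ((2 + 2 * m\<^sup>2 * C) * (N (A U))\<^sup>2)"
      using * by (intro mult_left_mono) (auto simp: c_def)
    finally show "(norm (ptx U))\<^sup>2 \<le> c * (2 + 2 * m\<^sup>2 * C) * (N (A U))\<^sup>2" by (simp add: mult.assoc)
  qed
qed

text \<open>Testing the stationary equation with the displacement; the interface terms cancel by the
  transmission conditions.\<close>

lemma static_energy:
  assumes "U \<in> D"
  shows "pot U = m * inner (pt U) (pux U)
    - inner (pw (A U)) (pu U) - inner (zl (A U)) (vl U) - inner (zr (A U)) (vr U)"
proof -
  note h = H_W[OF D_subset_H[OF assms]]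
  obtain vxxl vxxr e0 e3 where w:
    "W 0 L1 (vxl U) vxxl e0 (s1 U / complex_of_real b)" "W L2 L3 (vxr U) vxxr (s2 U / complex_of_real b) e3"
    "zl (A U) = b *\<^sub>R vxxl" "zr (A U) = b *\<^sub>R vxxr"
    "W L1 L2 (stress U) (pw (A U)) (s1 U) (s2 U)"
    by (rule dom_W[OF assms]) blast
  have b: "b *\<^sub>R (z / complex_of_real b) = z" for z :: complex
    using pos by (simp add: scaleR_conv_of_real)
  have 1: "inner (pw (A U)) (pu U) + inner (stress U) (pux U) = inner (s2 U) (t2 U) - inner (s1 U) (t1 U)"
    by (rule W_inner[OF w(5) h(1)])
  have 2: "inner (zl (A U)) (vl U) + b * inner (vxl U) (vxl U) = inner (s1 U) (t1 U)"
    using W_inner[OF W_scaleR[OF w(1), of b] h(2)] by (simp add: w(3) b)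
  have 3: "inner (zr (A U)) (vr U) + b * inner (vxr U) (vxr U) = - inner (s2 U) (t2 U)"
    using W_inner[OF W_scaleR[OF w(2), of b] h(3)] by (simp add: w(4) b)
  have 4: "inner (stress U) (pux U) = a * inner (pux U) (pux U) - m * inner (pt U) (pux U)"
    by (simp add: stress_def inner_diff_left)
  show ?thesis
    unfolding pot_def power2_norm_eq_inner using 1 2 3 4 by (simp add: algebra_simps)
qed

text \<open>For \<open>ell U = 0\<close> this is \<open>\<theta>\<close> minus its mean.\<close>

definition osc :: "state \<Rightarrow> l2" where
  "osc U = pt U + csc (complex_of_real (m / (L2 - L1)) * (t2 U - t1 U)) (one L1 L2)"

lemma osc_mean: "ell U = 0 \<Longrightarrow> ip (osc U) (one L1 L2) = 0"
  using L by (simp add: osc_def ell_def ip_add_left ip_csc_left norm_one[OF L12(1)])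

lemma W_osc:
  assumes "W L1 L2 (pt U) \<theta>x \<tau>1 \<tau>2"
  shows "\<exists>\<tau>1 \<tau>2. W L1 L2 (osc U) \<theta>x \<tau>1 \<tau>2"
  using W_add[OF assms W_csc[OF W_one[OF L12(1)]]] unfolding osc_def by auto

lemma norm_osc_le:
  assumes "U \<in> D" "ell U = 0"
  shows "(norm (osc U))\<^sup>2 \<le> 4 * (L2 - L1)\<^sup>2 * (norm (ptx U))\<^sup>2"
proof -
  have "\<exists>\<tau>1 \<tau>2. W L1 L2 (pt U) (ptx U) \<tau>1 \<tau>2"
    by (rule dom_W[OF assms(1)]) blast
  then obtain \<tau>1 \<tau>2 where "W L1 L2 (osc U) (ptx U) \<tau>1 \<tau>2" using W_osc by blast
  then show ?thesis by (rule poincare_mean[OF _ L12(1) osc_mean[OF assms(2)]])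
qed

lemma inner_pt_pux:
  assumes "U \<in> H"
  shows "inner (pt U) (pux U) = inner (osc U) (pux U) - m / (L2 - L1) * (norm (t2 U - t1 U))\<^sup>2"
proof -
  let ?q = "complex_of_real (m / (L2 - L1)) * (t2 U - t1 U)"
  have "ip (pux U) (one L1 L2) = t2 U - t1 U"
    using one_integral[OF L12(1) H_W(1)[OF assms]] by simp
  then have "ip (one L1 L2) (pux U) = cnj (t2 U - t1 U)" by (metis ip_commute)
  then have "ip (csc ?q (one L1 L2)) (pux U) = complex_of_real (m / (L2 - L1)) * ((t2 U - t1 U) * cnj (t2 U - t1 U))"
    by (simp add: ip_csc_left)
  also have "\<dots> = complex_of_real (m / (L2 - L1) * (norm (t2 U - t1 U))\<^sup>2)"
    by (simp only: complex_norm_square[symmetric] of_real_mult of_real_power)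
  finally have "inner (csc ?q (one L1 L2)) (pux U) = m / (L2 - L1) * (norm (t2 U - t1 U))\<^sup>2"
    by (simp only: inner_ip Re_complex_of_real)
  then show ?thesis by (simp add: osc_def inner_add_left)
qed

lemma pot_le:
  assumes "U \<in> D" "ell U = 0"
  shows "pot U \<le> m * inner (osc U) (pux U)
    - inner (pw (A U)) (pu U) - inner (zl (A U)) (vl U) - inner (zr (A U)) (vr U)"
proof -
  have "0 \<le> m * (m / (L2 - L1) * (norm (t2 U - t1 U))\<^sup>2)" using pos L by simp
  then show ?thesis
    unfolding static_energy[OF assms(1)] inner_pt_pux[OF D_subset_H[OF assms(1)]]
    by (simp add: right_diff_distrib)
qed

text \<open>The part of the domain on which \<open>A\<close> is injective: kernel elements are
  detected by \<open>ell\<close>.\<close>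

definition D0 :: "state set" where "D0 = {U \<in> D. ell U = 0}"

lemma LS_osc: "lesssim D0 (\<lambda>U. (norm (osc U))\<^sup>2) (\<lambda>U. (N (A U))\<^sup>2)"
  by (rule lesssim_mono[OF lesssim_scale[OF lesssim_subset[OF LS_ptx], of D0 "4 * (L2 - L1)\<^sup>2"]])
    (auto simp: D0_def norm_osc_le)

lemma AH: "U \<in> D \<Longrightarrow> A U \<in> H" by (rule dom_step(1))

lemma LS_A: "LS R (\<lambda>U. (N U)\<^sup>2) \<Longrightarrow> lesssim D (\<lambda>U. R (A U)) (\<lambda>U. (N (A U))\<^sup>2)"
  unfolding lesssim_def using AH by blast

lemma LS_pot_A: "lesssim D0 pot (\<lambda>U. (N (A U))\<^sup>2)"
proof -
  let ?F = "\<lambda>U. (N (A U))\<^sup>2"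
  let ?B = "\<lambda>U. (norm (pux U))\<^sup>2 + ((norm (pu U))\<^sup>2 + ((norm (vl U))\<^sup>2 + (norm (vr U))\<^sup>2))"
  let ?G = "\<lambda>U. m\<^sup>2 * (norm (osc U))\<^sup>2 + ((norm (pw (A U)))\<^sup>2 + ((norm (zl (A U)))\<^sup>2 + (norm (zr (A U)))\<^sup>2))"
  have "LS ?B pot" by (intro lesssim_add LS_pot)
  then obtain C where C: "0 \<le> C" "\<And>U. U \<in> H \<Longrightarrow> ?B U \<le> C * pot U" unfolding lesssim_def by blast
  have D0: "D0 \<subseteq> D" by (auto simp: D0_def)
  have "lesssim D0 ?G ?F"
    by (intro lesssim_add lesssim_scale LS_osc lesssim_subset[OF LS_A D0] LS_coords) simp
  then obtain C' where C': "0 \<le> C'" "\<And>U. U \<in> D0 \<Longrightarrow> ?G U \<le> C' * ?F U" unfolding lesssim_def by blast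
  \<comment> \<open>Small enough for the Young terms to cost at most half of \<open>pot U\<close>,
    which is then absorbed on the left; \<open>C + 1\<close> avoids a division by zero.\<close>
  define e where "e = 1 / (2 * (C + 1))"
  have e: "0 < e" "e * C \<le> 1 / 2" using C(1) by (auto simp: e_def field_simps)
  show ?thesis
  proof (rule lesssimI[of "2 * (1 / (4 * e)) * C'"])
    show "0 \<le> 2 * (1 / (4 * e)) * C'" using e C' by simp
    fix U assume U: "U \<in> D0"
    then have UD: "U \<in> D" and ell: "ell U = 0" by (auto simp: D0_def)
    have "pot U \<le> inner (m *\<^sub>R osc U) (pux U) - inner (pw (A U)) (pu U) - inner (zl (A U)) (vl U) - inner (zr (A U)) (vr U)"
      using pot_le[OF UD ell] by simp
    also have "\<dots> \<le> e * ?B U + (1 / (4 * e)) * ?G U"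
      using inner_young[OF e(1), of "pux U" "m *\<^sub>R osc U"] inner_young[OF e(1), of "pu U" "pw (A U)"]
        inner_young[OF e(1), of "vl U" "zl (A U)"] inner_young[OF e(1), of "vr U" "zr (A U)"]
      unfolding distrib_left by (simp add: inner_commute power_mult_distrib)
    also have "\<dots> \<le> e * (C * pot U) + (1 / (4 * e)) * (C' * ?F U)"
      using C(2)[OF D_subset_H[OF UD]] C'(2)[OF U] e(1) by (intro add_mono mult_left_mono) auto
    also have "e * (C * pot U) \<le> (1 / 2) * pot U"
      using mult_right_mono[OF e(2) pot_nonneg[of U]] by (simp add: mult.assoc)
    finally show "pot U \<le> 2 * (1 / (4 * e)) * C' * ?F U" by (simp add: mult.assoc)
  qed
qed

lemma norm_pt_le:
  "(norm (pt U))\<^sup>2 \<le> 2 * (norm (osc U))\<^sup>2 + 2 * (m\<^sup>2 / (L2 - L1)) * (norm (t2 U - t1 U))\<^sup>2"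
proof -
  define q where "q = complex_of_real (m / (L2 - L1)) * (t2 U - t1 U)"
  have n1: "(norm (one L1 L2))\<^sup>2 = L2 - L1"
    using arg_cong[OF norm_one[OF L12(1)], of Re] by (simp add: ip_self)
  have "(norm (pt U))\<^sup>2 = (norm (osc U - csc q (one L1 L2)))\<^sup>2" by (simp add: osc_def q_def)
  also have "\<dots> \<le> 2 * (norm (osc U))\<^sup>2 + 2 * (norm (csc q (one L1 L2)))\<^sup>2" by (rule norm_diff_sq)
  also have "(norm (csc q (one L1 L2)))\<^sup>2 = (cmod q)\<^sup>2 * (L2 - L1)"
    by (simp add: norm_csc power_mult_distrib n1)
  also have "(cmod q)\<^sup>2 * (L2 - L1) = m\<^sup>2 / (L2 - L1) * (norm (t2 U - t1 U))\<^sup>2"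
    using L pos by (simp add: q_def norm_mult power_mult_distrib power_divide norm_divide power2_eq_square del: of_real_diff)
  finally show ?thesis by simp
qed

text \<open>The velocities of \<open>U\<close> are the displacements of \<open>A U\<close>, so they
  are bounded by the potential energy of \<open>A U\<close>. For the potential part and the
  temperature, the static estimate \<open>LS_pot_A\<close> is used.\<close>

theorem a_priori: "lesssim D0 (\<lambda>U. (N U)\<^sup>2) (\<lambda>U. (N (A U))\<^sup>2)"
proof -
  let ?F = "\<lambda>U. (N (A U))\<^sup>2"
  have D0: "D0 \<subseteq> D" "D0 \<subseteq> H" using D_subset_H by (auto simp: D0_def)
  note via = lesssim_trans[OF lesssim_subset[OF _ D0(2)] LS_pot_A]
  have viaA: "lesssim D0 (\<lambda>U. R (A U)) ?F" if "LS R pot" for R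
    by (rule lesssim_subset[OF LS_A[OF lesssim_trans[OF that pot_le_N]] D0(1)])
  have w: "lesssim D0 (\<lambda>U. (norm (pw U))\<^sup>2) ?F"
    by (rule lesssim_mono[OF viaA[OF LS_pot(4)]]) (use D0 in \<open>auto elim!: dom_W\<close>)
  have l: "lesssim D0 (\<lambda>U. (norm (zl U))\<^sup>2) ?F"
    by (rule lesssim_mono[OF viaA[OF LS_pot(2)]]) (use D0 in \<open>auto elim!: dom_W\<close>)
  have r: "lesssim D0 (\<lambda>U. (norm (zr U))\<^sup>2) ?F"
    by (rule lesssim_mono[OF viaA[OF LS_pot(3)]]) (use D0 in \<open>auto elim!: dom_W\<close>)
  have t: "lesssim D0 (\<lambda>U. (norm (pt U))\<^sup>2) ?F"
  proof (rule lesssim_mono[OF lesssim_add[OF lesssim_scale[OF LS_osc, of 2]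
          lesssim_scale[OF via[OF LS_pot(5)], of "2 * (m\<^sup>2 / (L2 - L1))"]]])
    show "(norm (pt U))\<^sup>2 \<le> 2 * (norm (osc U))\<^sup>2 + 2 * (m\<^sup>2 / (L2 - L1)) * (norm (t2 U - t1 U))\<^sup>2" for U
      by (rule norm_pt_le)
  qed (use L in auto)
  show ?thesis
    by (rule lesssim_mono[OF lesssim_add[OF lesssim_add[OF LS_pot_A w] lesssim_add[OF t lesssim_add[OF l r]]]])
      (use D0 N_sq in \<open>auto simp: pot_def\<close>)
qed

definition innerR :: "state \<Rightarrow> state \<Rightarrow> real" where
  "innerR U V = inner (emb U) (emb V)"

text \<open>The interface terms of \<open>I\<close> and \<open>J\<close> cancel, since stress and
  velocity match there, and the coupling terms of the wave and the heat equation cancel each other.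
  Only the heat conduction term is left.\<close>

lemma dissipation:
  assumes "U \<in> D"
  shows "innerR (A U) U = - (k\<^sup>2 * (norm (ptx U))\<^sup>2)"
proof -
  note h = H_W[OF AH[OF assms]]
  obtain \<theta>xx uxx vxxl vxxr e0 e3 where w:
    "W L1 L2 (pt U) (ptx U) (h1 U) (h2 U)" "W L1 L2 (ptx U) \<theta>xx 0 0"
    "W 0 L1 (vxl U) vxxl e0 (s1 U / complex_of_real b)" "W L2 L3 (vxr U) vxxr (s2 U / complex_of_real b) e3"
    "pt (A U) = k\<^sup>2 *\<^sub>R \<theta>xx - m *\<^sub>R pux (A U)"
    "zl (A U) = b *\<^sub>R vxxl" "zr (A U) = b *\<^sub>R vxxr"
    "pu (A U) = pw U" "vl (A U) = zl U" "vr (A U) = zr U"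
    "W L1 L2 (stress U) (pw (A U)) (s1 U) (s2 U)"
    by (rule dom_W[OF assms]) blast
  have b: "b *\<^sub>R (z / complex_of_real b) = z" for z :: complex
    using pos by (simp add: scaleR_conv_of_real)
  have 1: "inner (pw (A U)) (pw U) + inner (stress U) (pux (A U)) = inner (s2 U) (t2 (A U)) - inner (s1 U) (t1 (A U))"
    using W_inner[OF w(11) h(1)] by (simp add: w(8))
  have 2: "inner (zl (A U)) (zl U) + b * inner (vxl U) (vxl (A U)) = inner (s1 U) (t1 (A U))"
    using W_inner[OF W_scaleR[OF w(3), of b] h(2)] by (simp add: w(6,9) b)
  have 3: "inner (zr (A U)) (zr U) + b * inner (vxr U) (vxr (A U)) = - inner (s2 U) (t2 (A U))"
    using W_inner[OF W_scaleR[OF w(4), of b] h(3)] by (simp add: w(7,10) b)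
  have 4: "inner (stress U) (pux (A U)) = a * inner (pux U) (pux (A U)) - m * inner (pt U) (pux (A U))"
    by (simp add: stress_def inner_diff_left)
  have 5: "inner (ptx U) (ptx U) + inner (pt U) \<theta>xx = 0"
    using W_inner[OF w(1,2)] by simp
  have 6: "inner (pt (A U)) (pt U) = k\<^sup>2 * inner (pt U) \<theta>xx - m * inner (pt U) (pux (A U))"
    by (simp add: w(5) inner_diff_left inner_diff_right inner_commute)
  have "k\<^sup>2 * (inner (ptx U) (ptx U) + inner (pt U) \<theta>xx) = 0" using 5 by simp
  then have 7: "k\<^sup>2 * inner (pt U) \<theta>xx = - (k\<^sup>2 * inner (ptx U) (ptx U))" by (simp add: distrib_left)
  have "innerR (A U) U = a * inner (pux U) (pux (A U)) + inner (pw (A U)) (pw U) + inner (pt (A U)) (pt U)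
    + b * inner (vxl U) (vxl (A U)) + b * inner (vxr U) (vxr (A U)) + inner (zl (A U)) (zl U) + inner (zr (A U)) (zr U)"
    using pos by (simp add: innerR_def emb_def inner_commute mult.assoc[symmetric])
  then show ?thesis
    unfolding power2_norm_eq_inner using 1 2 3 4 6 7 by linarith
qed

end

section \<open>A test function with three vanishing derivatives at the end points\<close>

text \<open>Moments against \<open>f0\<close> and against \<open>f1\<close> are each integrated by
  parts twice in space, which takes three functions with zero boundary values. The fourth power of
  \<open>(x - \<alpha>) * (\<beta> - x)\<close> provides them, and its integral is nonzero because
  it is positive inside the interval.\<close>

lemma ex_bump:
  assumes lt: "\<alpha> < \<beta>"
  obtains f0 f1 f2 f3 \<kappa> where "W \<alpha> \<beta> f0 f1 0 0" "W \<alpha> \<beta> f1 f2 0 0" "W \<alpha> \<beta> f2 f3 0 0"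
    "ip (one \<alpha> \<beta>) f0 = \<kappa>" "\<kappa> \<noteq> 0"
proof -
  define s where "s x = (x - \<alpha>) * (\<beta> - x)" for x
  define s' where "s' x = \<alpha> + \<beta> - 2 * x" for x
  have s: "(s has_real_derivative s' x) (at x within X)" for x X
    unfolding s_def s'_def by (auto intro!: derivative_eq_intros)
  have ds': "(s' has_real_derivative - 2) (at x within X)" for x X
    unfolding s'_def by (auto intro!: derivative_eq_intros)
  have z: "s \<alpha> = 0" "s \<beta> = 0" by (simp_all add: s_def)
  have c: "continuous_on X s" "continuous_on X s'" for X
    unfolding s_def s'_def by (intro continuous_intros)+
  have mk: "W \<alpha> \<beta> (mkI \<alpha> \<beta> (\<lambda>x. complex_of_real (F x))) (mkI \<alpha> \<beta> (\<lambda>x. complex_of_real (F' x))) 0 0"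
    if "\<And>x X. (F has_real_derivative F' x) (at x within X)" "continuous_on {\<alpha>..\<beta>} F'" "F \<alpha> = 0" "F \<beta> = 0" for F F'
  proof -
    have "((\<lambda>x. complex_of_real (F x)) has_vector_derivative complex_of_real (F' x)) (at x within {\<alpha>..\<beta>})" for x
      using that(1)[of x "{\<alpha>..\<beta>}"]
      by (intro has_vector_derivative_of_real) (simp add: has_real_derivative_iff_has_vector_derivative)
    moreover have "continuous_on {\<alpha>..\<beta>} (\<lambda>x. complex_of_real (F' x))"
      using that(2) by (intro continuous_intros)
    ultimately show ?thesis
      using W_mkI[of \<alpha> \<beta> "\<lambda>x. complex_of_real (F x)" "\<lambda>x. complex_of_real (F' x)"] that(3,4) lt by simp
  qed
  define F0 where "F0 x = s x ^ 4" for x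
  define F1 where "F1 x = 4 * s x ^ 3 * s' x" for x
  define F2 where "F2 x = 12 * s x ^ 2 * s' x ^ 2 - 8 * s x ^ 3" for x
  define F3 where "F3 x = 24 * s x * s' x ^ 3 - 72 * s x ^ 2 * s' x" for x
  have d0: "(F0 has_real_derivative F1 x) (at x within X)" for x X
    unfolding F0_def F1_def by (auto intro!: derivative_eq_intros s)
  have d1: "(F1 has_real_derivative F2 x) (at x within X)" for x X
    unfolding F1_def F2_def
    by (auto intro!: derivative_eq_intros s ds' simp: algebra_simps power2_eq_square)
  have d2: "(F2 has_real_derivative F3 x) (at x within X)" for x X
    unfolding F2_def F3_def
    by (auto intro!: derivative_eq_intros s ds' simp: algebra_simps power2_eq_square power3_eq_cube)
  have cont: "continuous_on {\<alpha>..\<beta>} F0" "continuous_on {\<alpha>..\<beta>} F1" "continuous_on {\<alpha>..\<beta>} F2" "continuous_on {\<alpha>..\<beta>} F3"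
    unfolding F0_def F1_def F2_def F3_def by (intro continuous_intros c)+
  have c0: "continuous_on UNIV F0" unfolding F0_def by (intro continuous_intros c)
  note c0m = borel_measurable_continuous_onI[OF c0]
  have ip: "ip (one \<alpha> \<beta>) (mkI \<alpha> \<beta> (\<lambda>x. complex_of_real (F0 x)))
    = complex_of_real (LINT x|lborel. indicator {\<alpha><..<\<beta>} x * F0 x)"
  proof -
    have "ip (one \<alpha> \<beta>) (mkI \<alpha> \<beta> (\<lambda>x. complex_of_real (F0 x))) = (LINT x|lborel. F0 x *\<^sub>R fn (one \<alpha> \<beta>) x)"
      unfolding one_def by (intro ip_mkI_of_real cont supp_mkI c0m) auto
    also have "\<dots> = (LINT x|lborel. complex_of_real (indicator {\<alpha><..<\<beta>} x * F0 x))"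
    proof (rule integral_cong_AE)
      show "AE x in lborel. F0 x *\<^sub>R fn (one \<alpha> \<beta>) x = complex_of_real (indicator {\<alpha><..<\<beta>} x * F0 x)"
        using fn_mkI[of \<alpha> \<beta> "\<lambda>_. 1"] unfolding one_def
        by (auto elim!: eventually_mono simp: indicator_def scaleR_conv_of_real)
    qed (use c0m in measurable)
    finally show ?thesis by (simp del: of_real_mult)
  qed
  have "(LINT x|lborel. indicator {\<alpha><..<\<beta>} x * F0 x) \<noteq> 0"
  proof
    assume 0: "(LINT x|lborel. indicator {\<alpha><..<\<beta>} x * F0 x) = 0"
    have "integrable lborel (\<lambda>x. indicator {\<alpha>..\<beta>} x *\<^sub>R F0 x)"
      by (rule borel_integrable_compact) (auto intro: cont)
    then have "integrable lborel (\<lambda>x. indicator {\<alpha><..<\<beta>} x * F0 x)"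
      by (rule Bochner_Integration.integrable_bound) (use c0m in \<open>auto simp: indicator_def\<close>)
    moreover have "AE x in lborel. 0 \<le> indicator {\<alpha><..<\<beta>} x * F0 x" by (simp add: F0_def)
    ultimately have "AE x in lborel. indicator {\<alpha><..<\<beta>} x * F0 x = 0"
      using 0 integral_nonneg_eq_0_iff_AE by blast
    then have ae: "AE x in lborel. x \<in> {\<alpha><..<\<beta>} \<longrightarrow> complex_of_real (F0 x) = 0"
      by eventually_elim (auto simp: indicator_def)
    have "complex_of_real (F0 ((\<alpha> + \<beta>) / 2)) = 0"
      by (rule AE_eq_continuous_on_open[OF _ _ _ ae])
        (use lt in \<open>auto intro!: continuous_intros continuous_on_subset[OF c0]\<close>)
    then show False using lt by (simp add: F0_def s_def)
  qed
  then show ?thesis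
    using that[OF mk[OF d0 cont(2)] mk[OF d1 cont(3)] mk[OF d2 cont(4)] ip]
    by (simp add: F0_def F1_def F2_def z)
qed

section \<open>Multiplier and moment identities\<close>

context transmission
begin

text \<open>The multiplier is a spatial antiderivative of the temperature entry of
  \<open>A U\<close>. As the gradient vanishes at the interfaces, its boundary values involve only
  the displacements \<open>t1 (A U)\<close>, \<open>t2 (A U)\<close>, which turn out to be
  small.\<close>

lemma multiplier_heat:
  assumes U: "U \<in> D" and V: "A U \<in> D"
  shows "inner (k\<^sup>2 *\<^sub>R ptx U - m *\<^sub>R pw U) (pw (A (A U)))
    = m * (inner (t1 (A U)) (s1 (A U)) - inner (t2 (A U)) (s2 (A U))) - inner (pt (A U)) (stress (A U))"
proof -
  note h = H_W[OF AH[OF U]]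
  obtain \<theta>xx where u: "W L1 L2 (ptx U) \<theta>xx 0 0"
    "pt (A U) = k\<^sup>2 *\<^sub>R \<theta>xx - m *\<^sub>R pux (A U)" "pu (A U) = pw U"
    by (rule dom_W[OF U]) blast
  have v: "W L1 L2 (stress (A U)) (pw (A (A U))) (s1 (A U)) (s2 (A U))" by (rule dom_W[OF V]) blast
  have "W L1 L2 (k\<^sup>2 *\<^sub>R ptx U - m *\<^sub>R pw U) (pt (A U)) (- (m *\<^sub>R t1 (A U))) (- (m *\<^sub>R t2 (A U)))"
    using W_diff[OF W_scaleR[OF u(1), of "k\<^sup>2"] W_scaleR[OF h(1), of m]] by (simp add: u(2,3))
  from W_inner[OF this v] show ?thesis by (simp add: algebra_simps)
qed

text \<open>Pairing the displacement with the acceleration. Along an orbit the left side is a time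
  derivative minus the kinetic energy, so this compares potential and kinetic energy on
  \<open>I\<close>.\<close>

lemma multiplier_equipartition:
  assumes V: "V \<in> D"
  shows "inner (pu V) (pw (A V)) = inner (t2 V) (s2 V) - inner (t1 V) (s1 V)
    - a * (norm (pux V))\<^sup>2 + m * inner (pux V) (pt V)"
proof -
  note h = H_W[OF D_subset_H[OF V]]
  have v: "W L1 L2 (stress V) (pw (A V)) (s1 V) (s2 V)" by (rule dom_W[OF V]) blast
  have "inner (pux V) (stress V) = a * (norm (pux V))\<^sup>2 - m * inner (pux V) (pt V)"
    by (simp add: stress_def inner_diff_right power2_norm_eq_inner)
  then show ?thesis using W_inner[OF h(1) v] by linarith
qed

text \<open>Centring the weight at the midpoint gives it opposite signs at the two ends, so that
  both boundary contributions are positive.\<close>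

definition mid :: real where "mid = (L1 + L2) / 2"
abbreviation "Mm \<equiv> mulf (aff L1 L2 mid)"

lemma multiplier_boundary:
  assumes V: "V \<in> D"
  shows "(L2 - L1) / 4 * (a * ((norm (p1 V))\<^sup>2 + (norm (p2 V))\<^sup>2) + ((norm (t1 (A V)))\<^sup>2 + (norm (t2 (A V)))\<^sup>2))
    = inner (Mm (pux (A V))) (pw V) + inner (Mm (pux V)) (pw (A V))
      + m * inner (Mm (pux V)) (ptx V) + a / 2 * (norm (pux V))\<^sup>2 + (norm (pw V))\<^sup>2 / 2"
proof -
  note h = H_W[OF AH[OF V]]
  obtain uxx where v: "W L1 L2 (pux V) uxx (p1 V) (p2 V)" "pw (A V) = a *\<^sub>R uxx - m *\<^sub>R ptx V" "pu (A V) = pw V"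
    by (rule dom_W[OF V]) blast
  define X where "X = (L2 - L1) / 2"
  have m: "L2 - mid = X" "L1 - mid = - X" by (simp_all add: mid_def X_def field_simps)
  have 1: "X * (norm (p2 V))\<^sup>2 + X * (norm (p1 V))\<^sup>2 = (norm (pux V))\<^sup>2 + 2 * inner (Mm (pux V)) uxx"
    using W_mult_id[OF v(1) L12(1), of mid] by (simp add: m)
  have 2: "X * (norm (t2 (A V)))\<^sup>2 + X * (norm (t1 (A V)))\<^sup>2 = (norm (pw V))\<^sup>2 + 2 * inner (Mm (pw V)) (pux (A V))"
    using W_mult_id[OF h(1) L12(1), of mid] by (simp add: m v(3))
  have 3: "inner (Mm (pux (A V))) (pw V) = inner (Mm (pw V)) (pux (A V))"
    using inner_mulf[OF bdd_mult_aff, of L1 L2 mid "pux (A V)" "pw V"] by (simp add: inner_commute)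
  have 4: "inner (Mm (pux V)) (pw (A V)) = a * inner (Mm (pux V)) uxx - m * inner (Mm (pux V)) (ptx V)"
    by (simp add: v(2) inner_diff_right)
  have "(L2 - L1) / 4 * (a * ((norm (p1 V))\<^sup>2 + (norm (p2 V))\<^sup>2) + ((norm (t1 (A V)))\<^sup>2 + (norm (t2 (A V)))\<^sup>2))
    = a / 2 * (X * (norm (p2 V))\<^sup>2 + X * (norm (p1 V))\<^sup>2) + (X * (norm (t2 (A V)))\<^sup>2 + X * (norm (t1 (A V)))\<^sup>2) / 2"
  proof -
    have e: "(L2 - L1) / 4 = X / 2" by (simp add: X_def)
    show ?thesis unfolding e by (simp add: algebra_simps)
  qed
  also have "\<dots> = a / 2 * (norm (pux V))\<^sup>2 + a * inner (Mm (pux V)) uxx + (norm (pw V))\<^sup>2 / 2 + inner (Mm (pw V)) (pux (A V))"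
    unfolding 1 2 by (simp add: algebra_simps)
  finally show ?thesis unfolding 3 4 by simp
qed

text \<open>This weight vanishes at the outer end 0, as \<open>Mr\<close> does at \<open>L3\<close>:
  the derivatives of the displacement at the outer ends, about which nothing is known, drop
  out.\<close>

abbreviation "Ml \<equiv> mulf (aff 0 L1 0)"
abbreviation "Mr \<equiv> mulf (aff L2 L3 L3)"

lemma multiplier_left:
  assumes V: "V \<in> D"
  shows "(norm (zl V))\<^sup>2 + b * (norm (vxl V))\<^sup>2 = L1 * (norm (t1 (A V)))\<^sup>2 + L1 / b * (norm (s1 V))\<^sup>2
    - 2 * (inner (Ml (vxl (A V))) (zl V) + inner (Ml (vxl V)) (zl (A V)))"
proof -
  note h = H_W[OF AH[OF V]]
  obtain vxxl e0 where v: "W 0 L1 (vxl V) vxxl e0 (s1 V / complex_of_real b)" "zl (A V) = b *\<^sub>R vxxl" "vl (A V) = zl V"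
    by (rule dom_W[OF V]) blast
  have n: "(norm (s1 V / complex_of_real b))\<^sup>2 = (norm (s1 V))\<^sup>2 / b\<^sup>2"
    by (simp add: norm_divide power_divide)
  have 1: "L1 * ((norm (s1 V))\<^sup>2 / b\<^sup>2) = (norm (vxl V))\<^sup>2 + 2 * inner (Ml (vxl V)) vxxl"
    using W_mult_id[OF v(1) L12(2), of 0] unfolding n by simp
  have 2: "L1 * (norm (t1 (A V)))\<^sup>2 = (norm (zl V))\<^sup>2 + 2 * inner (Ml (zl V)) (vxl (A V))"
    using W_mult_id[OF h(2) L12(2), of 0] by (simp add: v(3))
  have 3: "inner (Ml (vxl (A V))) (zl V) = inner (Ml (zl V)) (vxl (A V))"
    using inner_mulf[OF bdd_mult_aff, of 0 L1 0 "vxl (A V)" "zl V"] by (simp add: inner_commute)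
  have "L1 / b * (norm (s1 V))\<^sup>2 = b * (L1 * ((norm (s1 V))\<^sup>2 / b\<^sup>2))"
    using pos by (simp add: power2_eq_square)
  then show ?thesis unfolding 1 2 3 v(2) by (simp add: algebra_simps)
qed

lemma multiplier_right:
  assumes V: "V \<in> D"
  shows "(norm (zr V))\<^sup>2 + b * (norm (vxr V))\<^sup>2 = (L3 - L2) * (norm (t2 (A V)))\<^sup>2 + (L3 - L2) / b * (norm (s2 V))\<^sup>2
    - 2 * (inner (Mr (vxr (A V))) (zr V) + inner (Mr (vxr V)) (zr (A V)))"
proof -
  note h = H_W[OF AH[OF V]]
  obtain vxxr e3 where v: "W L2 L3 (vxr V) vxxr (s2 V / complex_of_real b) e3" "zr (A V) = b *\<^sub>R vxxr" "vr (A V) = zr V"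
    by (rule dom_W[OF V]) blast
  have n: "(norm (s2 V / complex_of_real b))\<^sup>2 = (norm (s2 V))\<^sup>2 / b\<^sup>2"
    by (simp add: norm_divide power_divide)
  have neg: "(L2 - L3) * y = - ((L3 - L2) * y)" for y by (simp add: algebra_simps)
  have 1: "(L3 - L2) * ((norm (s2 V))\<^sup>2 / b\<^sup>2) = (norm (vxr V))\<^sup>2 + 2 * inner (Mr (vxr V)) vxxr"
    using W_mult_id[OF v(1) L12(3), of L3] unfolding n neg by simp
  have 2: "(L3 - L2) * (norm (t2 (A V)))\<^sup>2 = (norm (zr V))\<^sup>2 + 2 * inner (Mr (zr V)) (vxr (A V))"
    using W_mult_id[OF h(3) L12(3), of L3] unfolding neg by (simp add: v(3))
  have 3: "inner (Mr (vxr (A V))) (zr V) = inner (Mr (zr V)) (vxr (A V))"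
    using inner_mulf[OF bdd_mult_aff, of L2 L3 L3 "vxr (A V)" "zr V"] by (simp add: inner_commute)
  have "(L3 - L2) / b * (norm (s2 V))\<^sup>2 = b * ((L3 - L2) * ((norm (s2 V))\<^sup>2 / b\<^sup>2))"
    using pos by (simp add: power2_eq_square)
  then show ?thesis unfolding 1 2 3 v(2) by (simp add: algebra_simps)
qed

text \<open>The deviation of the displacement from its affine interpolant is controlled by the dissipation
  of a solution and of its time derivative.\<close>

definition slope :: "state \<Rightarrow> complex" where "slope V = (t2 V - t1 V) / complex_of_real (L2 - L1)"
definition lin :: l2 where "lin = mulf (aff L1 L2 L1) (one L1 L2)"
definition dev :: "state \<Rightarrow> l2" where
  "dev V = pu V - (csc (t1 V) (one L1 L2) + csc (slope V) lin)"

lemma W_lin: "W L1 L2 lin (one L1 L2) 0 (complex_of_real (L2 - L1))"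
proof -
  have "mulf (aff L1 L2 L1) 0 = 0"
    using bounded_linear_mulf[OF bdd_mult_aff] by (rule linear_simps)
  then show ?thesis
    using W_aff[OF W_one[OF L12(1)] L12(1), of L1] by (simp add: lin_def scaleR_conv_of_real)
qed

lemma W_interp:
  "W L1 L2 (csc (t1 V) (one L1 L2) + csc (slope V) lin) (csc (slope V) (one L1 L2)) (t1 V) (t2 V)"
proof -
  have "t1 V + slope V * complex_of_real (L2 - L1) = t2 V" using L by (simp add: slope_def)
  then show ?thesis
    using W_add[OF W_csc[OF W_one[OF L12(1)], of "t1 V"] W_csc[OF W_lin, of "slope V"]] by simp
qed

lemma W_dev: "V \<in> H \<Longrightarrow> W L1 L2 (dev V) (pux V - csc (slope V) (one L1 L2)) 0 0"
  using W_diff[OF H_W(1)[of V] W_interp[of V]] by (simp add: dev_def)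

text \<open>The auxiliary \<open>\<Phi>\<close> vanishes at both ends, and its derivative is
  \<open>osc (A U)\<close>, which has mean zero and derivative \<open>ptx (A U)\<close>. Two
  applications of Poincare bound \<open>\<Phi>\<close>, and \<open>dev (A U)\<close> is recovered
  from \<open>\<Phi>\<close> and \<open>ptx U\<close>.\<close>

lemma dev_le:
  assumes U: "U \<in> D" and V: "A U \<in> D"
  shows "m\<^sup>2 * (norm (dev (A U)))\<^sup>2 \<le> 2 * (k\<^sup>2)\<^sup>2 * (norm (ptx U))\<^sup>2 + 2 * (4 * (L2 - L1)\<^sup>2 * (4 * (L2 - L1)\<^sup>2)) * (norm (ptx (A U)))\<^sup>2"
proof -
  obtain \<theta>xx where u: "W L1 L2 (ptx U) \<theta>xx 0 0" "pt (A U) = k\<^sup>2 *\<^sub>R \<theta>xx - m *\<^sub>R pux (A U)"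
    by (rule dom_W[OF U]) blast
  define \<Phi> where "\<Phi> = k\<^sup>2 *\<^sub>R ptx U - m *\<^sub>R dev (A U)"
  have e: "m *\<^sub>R csc (slope (A U)) (one L1 L2)
    = csc (complex_of_real (m / (L2 - L1)) * (t2 (A U) - t1 (A U))) (one L1 L2)"
  proof (rule l2_eqI)
    show "AE x in lborel. fn (m *\<^sub>R csc (slope (A U)) (one L1 L2)) x
      = fn (csc (complex_of_real (m / (L2 - L1)) * (t2 (A U) - t1 (A U))) (one L1 L2)) x"
      using fn_scaleR[of m "csc (slope (A U)) (one L1 L2)"] fn_csc[of "slope (A U)" "one L1 L2"]
        fn_csc[of "complex_of_real (m / (L2 - L1)) * (t2 (A U) - t1 (A U))" "one L1 L2"]
      by eventually_elim (simp add: slope_def scaleR_conv_of_real)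
  qed
  have osc_eq: "osc (A U) = pt (A U) + m *\<^sub>R csc (slope (A U)) (one L1 L2)"
    unfolding osc_def e ..
  have "W L1 L2 \<Phi> (osc (A U)) 0 0"
    using W_diff[OF W_scaleR[OF u(1), of "k\<^sup>2"] W_scaleR[OF W_dev[OF AH[OF U]], of m]]
    by (simp add: \<Phi>_def u(2) osc_eq scaleR_diff_right algebra_simps)
  then have 1: "(norm \<Phi>)\<^sup>2 \<le> 4 * (L2 - L1)\<^sup>2 * (norm (osc (A U)))\<^sup>2"
    using poincare(1)[OF _ L12(1)] by fastforce
  have "(norm (osc (A U)))\<^sup>2 \<le> 4 * (L2 - L1)\<^sup>2 * (norm (ptx (A U)))\<^sup>2"
    by (rule norm_osc_le[OF V step_ell[OF dom_step(2)[OF U]]])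
  then have 2: "(norm \<Phi>)\<^sup>2 \<le> 4 * (L2 - L1)\<^sup>2 * (4 * (L2 - L1)\<^sup>2 * (norm (ptx (A U)))\<^sup>2)"
    using 1 by (meson mult_left_mono order_trans zero_le_mult_iff zero_le_numeral zero_le_power2)
  have "m\<^sup>2 * (norm (dev (A U)))\<^sup>2 = (norm (k\<^sup>2 *\<^sub>R ptx U - \<Phi>))\<^sup>2"
    by (simp add: \<Phi>_def power_mult_distrib)
  also have "\<dots> \<le> 2 * (norm (k\<^sup>2 *\<^sub>R ptx U))\<^sup>2 + 2 * (norm \<Phi>)\<^sup>2" by (rule norm_diff_sq)
  finally show ?thesis using 2 by (simp add: power_mult_distrib mult.assoc)
qed

text \<open>Integrating by parts against \<open>f0\<close> removes the unknown stresses at the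
  interfaces. After the second integration \<open>f2\<close> annihilates affine functions, so the
  displacement enters only through \<open>dev\<close>.\<close>

lemma moment_second_derivative:
  assumes V: "V \<in> D" and f: "W L1 L2 f0 f1 0 0" "W L1 L2 f1 f2 0 0"
  shows "ip (pw (A V)) f0 = a *\<^sub>R ip (dev V) f2 - m *\<^sub>R ip (ptx V) f0"
proof -
  note h = H_W[OF D_subset_H[OF V]]
  have v: "W L1 L2 (stress V) (pw (A V)) (s1 V) (s2 V)" "W L1 L2 (pt V) (ptx V) (h1 V) (h2 V)"
    by (rule dom_W[OF V], blast)+
  have 1: "ip (pw (A V)) f0 = - ip (stress V) f1"
    using W_by_parts[OF v(1) f(1)] by (simp add: eq_neg_iff_add_eq_0)
  have 2: "ip (ptx V) f0 = - ip (pt V) f1"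
    using W_by_parts[OF v(2) f(1)] by (simp add: eq_neg_iff_add_eq_0)
  have 3: "ip (pux V) f1 = - ip (pu V) f2"
    using W_by_parts[OF h(1) f(2)] by (simp add: eq_neg_iff_add_eq_0)
  have 4: "ip (csc (t1 V) (one L1 L2) + csc (slope V) lin) f2 = - ip (csc (slope V) (one L1 L2)) f1"
    using W_by_parts[OF W_interp f(2)] by (simp add: eq_neg_iff_add_eq_0 add.commute)
  have 5: "ip (csc (slope V) (one L1 L2)) f1 = 0"
    using W_by_parts[OF W_one[OF L12(1)] f(1)] by (simp add: ip_csc_left ip.zero_left)
  have "ip (pu V) f2 = ip (dev V) f2" using 4 5 by (simp add: dev_def ip.diff_left)
  then show ?thesis
    unfolding 1 2 by (simp add: stress_def ip.diff_left ip.scaleR_left 3)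
qed

text \<open>The function \<open>f1\<close> annihilates constants and pairs with \<open>lin\<close>
  to \<open>- \<kappa>\<close>, so its moment yields the slope of the interpolant; the moment
  against \<open>f0\<close> then yields the value at \<open>L1\<close>.\<close>

lemma traces_by_moments:
  assumes f: "W L1 L2 f0 f1 0 0" "ip (one L1 L2) f0 = \<kappa>" "\<kappa> \<noteq> 0"
  shows "LS (\<lambda>V. (norm (t1 V))\<^sup>2 + (norm (t2 V))\<^sup>2) (\<lambda>V. (norm (ip (pu V) f0))\<^sup>2 + ((norm (ip (pu V) f1))\<^sup>2 + (norm (dev V))\<^sup>2))"
proof -
  let ?S = "\<lambda>V. (norm (ip (pu V) f0))\<^sup>2 + ((norm (ip (pu V) f1))\<^sup>2 + (norm (dev V))\<^sup>2)"
  have dec: "pu V = dev V + (csc (t1 V) (one L1 L2) + csc (slope V) lin)" for V by (simp add: dev_def)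
  have 1: "ip (one L1 L2) f1 = 0"
    using W_by_parts[OF W_one[OF L12(1)] f(1)] by (simp add: ip.zero_left)
  have 2: "ip lin f1 = - \<kappa>"
    using W_by_parts[OF W_lin f(1)] f(2) by (simp add: eq_neg_iff_add_eq_0 add.commute)
  have "ip (pu V) f1 = ip (dev V) f1 - slope V * \<kappa>" for V
    unfolding dec[of V] by (simp add: ip_add_left ip_csc_left 1 2)
  then have q: "slope V = (ip (dev V) f1 - ip (pu V) f1) / \<kappa>" for V
    using f(3) by (simp add: field_simps)
  have "ip (pu V) f0 = ip (dev V) f0 + (t1 V * \<kappa> + slope V * ip lin f0)" for V
    unfolding dec[of V] by (simp add: ip_add_left ip_csc_left f(2))
  then have t: "t1 V = ((ip (pu V) f0 - ip (dev V) f0) - slope V * ip lin f0) / \<kappa>" for V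
    using f(3) by (simp add: field_simps)
  have P0: "LS (\<lambda>V. (norm (ip (pu V) f0))\<^sup>2) ?S" by (rule lesssimI[of 1]) auto
  have P1: "LS (\<lambda>V. (norm (ip (pu V) f1))\<^sup>2) ?S" by (rule lesssimI[of 1]) auto
  have dv: "LS (\<lambda>V. (norm (ip (dev V) g))\<^sup>2) ?S" for g
  proof (rule lesssimI[of "(norm g)\<^sup>2"])
    fix V
    have "(norm (ip (dev V) g))\<^sup>2 \<le> (norm (dev V) * norm g)\<^sup>2" by (intro power_mono norm_ip_le) simp
    also have "\<dots> \<le> (norm g)\<^sup>2 * ?S V" by (simp add: power_mult_distrib mult.commute mult_left_mono)
    finally show "(norm (ip (dev V) g))\<^sup>2 \<le> (norm g)\<^sup>2 * ?S V" .
  qed simp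
  have diff: "LS (\<lambda>V. (norm (X V - Y V))\<^sup>2) ?S" if "LS (\<lambda>V. (norm (X V))\<^sup>2) ?S" "LS (\<lambda>V. (norm (Y V))\<^sup>2) ?S" for X Y :: "state \<Rightarrow> complex"
    by (rule lesssim_mono[OF lesssim_scale[OF lesssim_add[OF that], of 2]])
      (use norm_diff_sq in \<open>auto simp: distrib_left\<close>)
  have mult: "LS (\<lambda>V. (norm (X V * c))\<^sup>2) ?S" if "LS (\<lambda>V. (norm (X V))\<^sup>2) ?S" for X :: "state \<Rightarrow> complex" and c
    by (rule lesssim_mono[OF lesssim_scale[OF that, of "(norm c)\<^sup>2"]])
      (auto simp: norm_mult power_mult_distrib)
  have sl: "LS (\<lambda>V. (norm (slope V))\<^sup>2) ?S"
    unfolding q divide_inverse by (intro mult diff dv P1)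
  have tt: "LS (\<lambda>V. (norm (t1 V))\<^sup>2) ?S"
    by (subst t, unfold divide_inverse, intro mult diff dv P0 sl)
  have t2: "t2 V = t1 V - slope V * (- complex_of_real (L2 - L1))" for V
  proof -
    have "t1 V + slope V * complex_of_real (L2 - L1) = t2 V" using L by (simp add: slope_def)
    then show ?thesis by (simp only: mult_minus_right diff_minus_eq_add)
  qed
  have "LS (\<lambda>V. (norm (t2 V))\<^sup>2) ?S"
    by (subst t2, intro mult diff tt sl)
  then show ?thesis by (intro lesssim_add tt)
qed

end

section \<open>Orbits of the semigroup\<close>

context transmission
begin

declare opAF.simps [simp del]

lemma N_triangle: "U \<in> H \<Longrightarrow> V \<in> H \<Longrightarrow> N (U + V) \<le> N U + N V"
  using norm_triangle_ineq[of "emb U" "emb V"] by (simp add: norm_emb[symmetric] H_add emb_add)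

lemma N_scale: "U \<in> H \<Longrightarrow> N (scale_state (complex_of_real r) U) = \<bar>r\<bar> * N U"
  by (simp add: norm_emb[symmetric] H_scale emb_scaleR)

lemma N_uminus: "U \<in> H \<Longrightarrow> N (- U) = N U"
  using N_scale[of U "-1"] by (simp add: uminus_state)

lemma scale_state_mult: "scale_state c (scale_state d U) = scale_state (c * d) U"
proof -
  have "scale_l0 c (scale_l0 d f) = scale_l0 (c * d) f" for f
  proof (rule l0_eqI)
    show "AE x in lborel. rep_l0 (scale_l0 c (scale_l0 d f)) x = rep_l0 (scale_l0 (c * d) f) x"
      using rep_l0_scale[of c "scale_l0 d f"] rep_l0_scale[of d f] rep_l0_scale[of "c * d" f]
      by eventually_elim simp
  qed
  then show ?thesis by (cases U) simp
qed

end

locale thermoelastic_semigroup = transmission +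
  fixes T :: "real \<Rightarrow> state \<Rightarrow> state"
  assumes gen: "generates H scale_state N D A T"
begin

lemma T_H: "0 \<le> t \<Longrightarrow> x \<in> H \<Longrightarrow> T t x \<in> H"
  and T_add: "0 \<le> t \<Longrightarrow> x \<in> H \<Longrightarrow> y \<in> H \<Longrightarrow> T t (x + y) = T t x + T t y"
  and T_scale: "0 \<le> t \<Longrightarrow> x \<in> H \<Longrightarrow> T t (scale_state c x) = scale_state c (T t x)"
  and T_N: "0 \<le> t \<Longrightarrow> x \<in> H \<Longrightarrow> N (T t x) \<le> N x"
  and T_0: "x \<in> H \<Longrightarrow> T 0 x = x"
  and T_plus: "0 \<le> s \<Longrightarrow> 0 \<le> t \<Longrightarrow> x \<in> H \<Longrightarrow> T (s + t) x = T s (T t x)"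
  and T_lim: "x \<in> H \<Longrightarrow> ((\<lambda>t. N (T t x - x)) \<longlongrightarrow> 0) (at_right 0)"
  using gen unfolding generates_def contraction_semigroup_def by blast+

lemma T_diff: "0 \<le> t \<Longrightarrow> x \<in> H \<Longrightarrow> y \<in> H \<Longrightarrow> T t (x - y) = T t x - T t y"
proof -
  assume *: "0 \<le> t" "x \<in> H" "y \<in> H"
  have "T t (- y) = - T t y" unfolding uminus_state by (rule T_scale[OF *(1,3)])
  then show ?thesis using T_add[OF *(1,2) H_uminus[OF *(3)]] by simp
qed

abbreviation quot :: "real \<Rightarrow> state \<Rightarrow> state" where
  "quot h x \<equiv> scale_state (complex_of_real (1 / h)) (T h x - x)"

lemma gen_graph: "(x, y) \<in> generator_graph H scale_state N T \<longleftrightarrow> x \<in> D \<and> y = A x"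
proof -
  have "generator_graph H scale_state N T = {(x, A x) |x. x \<in> D}"
    using gen unfolding generates_def by (elim conjE)
  then show ?thesis by blast
qed

lemma gen_lim: "x \<in> D \<Longrightarrow> ((\<lambda>h. N (quot h x - A x)) \<longlongrightarrow> 0) (at_right 0)"
  using gen_graph[of x "A x"] unfolding generator_graph_def by simp

lemma gen_I:
  "x \<in> H \<Longrightarrow> y \<in> H \<Longrightarrow> ((\<lambda>h. N (quot h x - y)) \<longlongrightarrow> 0) (at_right 0) \<Longrightarrow> x \<in> D \<and> A x = y"
  using gen_graph[of x y] unfolding generator_graph_def by auto

lemma T_D:
  assumes t: "0 \<le> t" and x: "x \<in> D"
  shows "T t x \<in> D" "A (T t x) = T t (A x)"
proof -
  have xH: "x \<in> H" "A x \<in> H" using D_subset_H[OF x] AH[OF x] by auto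
  have "((\<lambda>h. N (quot h (T t x) - T t (A x))) \<longlongrightarrow> 0) (at_right 0)"
  proof (rule Lim_null_comparison[OF _ gen_lim[OF x]])
    have "norm (N (quot h (T t x) - T t (A x))) \<le> N (quot h x - A x)" if h: "0 < h" for h
    proof -
      have q: "quot h x \<in> H" using xH h by (intro H_scale H_diff T_H) auto
      have "T h (T t x) = T t (T h x)"
        using T_plus[of h t x] T_plus[of t h x] h t xH by (simp add: add.commute)
      then have "quot h (T t x) - T t (A x) = T t (quot h x - A x)"
        using t h xH q by (simp add: T_diff T_scale T_H H_diff)
      then show ?thesis using T_N[OF t H_diff[OF q xH(2)]] N_nonneg[OF T_H[OF t H_diff[OF q xH(2)]]] by simp
    qed
    then show "\<forall>\<^sub>F h in at_right 0. norm (N (quot h (T t x) - T t (A x))) \<le> N (quot h x - A x)"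
      by (intro eventually_at_rightI[of 0 1]) auto
  qed
  then show "T t x \<in> D" "A (T t x) = T t (A x)"
    using gen_I[of "T t x" "T t (A x)"] T_H[OF t] xH by auto
qed

abbreviation err :: "state \<Rightarrow> real \<Rightarrow> real \<Rightarrow> state" where
  "err x t s \<equiv> scale_state (complex_of_real (1 / (s - t))) (T s x - T t x) - T t (A x)"

text \<open>The generator supplies only right derivatives. For \<open>s < t\<close> the error is
  written as the operator at time \<open>s\<close> applied to a difference of two errors at time 0,
  and contractivity gives a bound uniform in \<open>s\<close>.\<close>

lemma err_lim:
  assumes t: "0 \<le> t" and x: "x \<in> D"
  shows "((\<lambda>s. N (err x t s)) \<longlongrightarrow> 0) (at t within {0..})"
proof -
  have xH: "x \<in> H" "A x \<in> H" using D_subset_H[OF x] AH[OF x] by auto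
  define g where "g h = N (quot h x - A x) + N (T h (A x) - A x)" for h
  have g: "(g \<longlongrightarrow> 0) (at_right 0)"
    unfolding g_def using tendsto_add[OF gen_lim[OF x] T_lim[OF xH(2)]] by simp
  have fl: "filterlim (\<lambda>s. \<bar>s - t\<bar>) (at_right 0) (at t within {0..})"
    unfolding filterlim_at
  proof
    show "\<forall>\<^sub>F s in at t within {0..}. \<bar>s - t\<bar> \<in> {0<..} \<and> \<bar>s - t\<bar> \<noteq> 0"
      by (auto simp: eventually_at_filter)
    show "((\<lambda>s. \<bar>s - t\<bar>) \<longlongrightarrow> 0) (at t within {0..})"
      by (auto intro!: tendsto_eq_intros)
  qed
  have bound: "norm (N (err x t s)) \<le> g \<bar>s - t\<bar>" if s: "0 \<le> s" "s \<noteq> t" for s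
  proof -
    define h where "h = \<bar>s - t\<bar>"
    have h: "0 < h" using s by (simp add: h_def)
    have q: "quot h x \<in> H" using xH h by (intro H_scale H_diff T_H) auto
    have qd: "quot h x - A x \<in> H" by (intro H_diff q xH)
    have Td: "T h (A x) - A x \<in> H" using h by (intro H_diff T_H xH) auto
    have eH: "err x t s \<in> H" using s t xH by (intro H_diff H_scale T_H) auto
    consider "s = t + h" | "t = s + h" unfolding h_def by linarith
    then have "N (err x t s) \<le> g h"
    proof cases
      case 1
      have "T s x = T t (T h x)" using T_plus[of t h x] 1 t h xH by simp
      then have "err x t s = T t (quot h x - A x)"
        using 1 t h xH q by (simp add: T_diff T_scale T_H H_diff)
      then have "N (err x t s) \<le> N (quot h x - A x)" using T_N[OF t qd] by simp
      then show ?thesis using N_nonneg[OF Td] by (simp add: g_def)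
    next
      case 2
      have 3: "T t x = T s (T h x)" "T t (A x) = T s (T h (A x))"
        using T_plus[of s h] 2 s h xH by simp_all
      have st: "s - t = - h" using 2 by simp
      have m: "scale_state (complex_of_real (1 / - h)) (p - r) = scale_state (complex_of_real (1 / h)) (r - p)" for p r
      proof -
        have "scale_state (complex_of_real (1 / - h)) (p - r) = scale_state (complex_of_real (1 / h)) (scale_state (- 1) (p - r))"
          by (simp add: scale_state_mult)
        also have "scale_state (- 1) (p - r) = r - p" by (simp add: uminus_state[symmetric])
        finally show ?thesis .
      qed
      have "err x t s = scale_state (complex_of_real (1 / h)) (T t x - T s x) - T t (A x)"
        unfolding st m ..
      \<comment> \<open>Adding and subtracting \<open>A x\<close> inside compares the quotient at
        time 0 with \<open>A x\<close>, at the price of the continuity error of the orbit of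
        \<open>A x\<close>.\<close>
      also have "\<dots> = T s ((quot h x - A x) - (T h (A x) - A x))"
        unfolding 3 using s h xH q qd Td by (simp add: T_diff T_scale T_H H_diff)
      finally have "N (err x t s) \<le> N ((quot h x - A x) - (T h (A x) - A x))"
        using T_N[OF s(1) H_diff[OF qd Td]] by simp
      also have "\<dots> \<le> N (quot h x - A x) + N (T h (A x) - A x)"
        using N_triangle[OF qd H_uminus[OF Td]] N_uminus[OF Td] by simp
      finally show ?thesis by (simp add: g_def)
    qed
    then show ?thesis using N_nonneg[OF eH] by (simp add: h_def)
  qed
  show ?thesis
  proof (rule Lim_null_comparison)
    show "\<forall>\<^sub>F s in at t within {0..}. norm (N (err x t s)) \<le> g \<bar>s - t\<bar>"
      using bound by (auto simp: eventually_at_filter)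
    show "((\<lambda>s. g \<bar>s - t\<bar>) \<longlongrightarrow> 0) (at t within {0..})"
      by (rule filterlim_compose[OF g fl])
  qed
qed

lemma has_vector_derivative_of_err:
  fixes \<pi> :: "state \<Rightarrow> 'b::real_normed_vector"
  assumes "\<And>s. 0 \<le> s \<Longrightarrow> s \<noteq> t \<Longrightarrow> \<pi> (err x t s) = (1 / (s - t)) *\<^sub>R (\<pi> (T s x) - \<pi> (T t x)) - \<pi> (T t (A x))"
    and "((\<lambda>s. \<pi> (err x t s)) \<longlongrightarrow> 0) (at t within {0..})"
  shows "((\<lambda>s. \<pi> (T s x)) has_vector_derivative \<pi> (T t (A x))) (at t within {0..})"
proof -
  have "((\<lambda>s. norm (\<pi> (err x t s))) \<longlongrightarrow> 0) (at t within {0..})"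
    using tendsto_norm[OF assms(2)] by simp
  then have "((\<lambda>s. norm (\<pi> (T s x) - \<pi> (T t x) - (s - t) *\<^sub>R \<pi> (T t (A x))) / norm (s - t)) \<longlongrightarrow> 0) (at t within {0..})"
  proof (rule Lim_transform_eventually)
    show "\<forall>\<^sub>F s in at t within {0..}. norm (\<pi> (err x t s))
      = norm (\<pi> (T s x) - \<pi> (T t x) - (s - t) *\<^sub>R \<pi> (T t (A x))) / norm (s - t)"
      unfolding eventually_at_filter
    proof (intro always_eventually allI impI)
      fix s assume s: "s \<noteq> t" "s \<in> {0..}"
      have "\<pi> (err x t s) = (1 / (s - t)) *\<^sub>R (\<pi> (T s x) - \<pi> (T t x) - (s - t) *\<^sub>R \<pi> (T t (A x)))"
        using assms(1)[of s] s by (simp add: scaleR_diff_right)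
      then show "norm (\<pi> (err x t s)) = norm (\<pi> (T s x) - \<pi> (T t x) - (s - t) *\<^sub>R \<pi> (T t (A x))) / norm (s - t)"
        by (simp add: divide_inverse mult.commute)
    qed
  qed
  moreover have "norm ((1 / norm (s - t)) *\<^sub>R (\<pi> (T s x) - (\<pi> (T t x) + (s - t) *\<^sub>R \<pi> (T t (A x)))))
    = norm (\<pi> (T s x) - \<pi> (T t x) - (s - t) *\<^sub>R \<pi> (T t (A x))) / norm (s - t)" for s
    by (simp add: diff_diff_eq)
  ultimately have "((\<lambda>s. norm ((1 / norm (s - t)) *\<^sub>R (\<pi> (T s x) - (\<pi> (T t x) + (s - t) *\<^sub>R \<pi> (T t (A x)))))) \<longlongrightarrow> 0) (at t within {0..})"
    by presburger
  then have "((\<lambda>s. (1 / norm (s - t)) *\<^sub>R (\<pi> (T s x) - (\<pi> (T t x) + (s - t) *\<^sub>R \<pi> (T t (A x))))) \<longlongrightarrow> 0) (at t within {0..})"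
    by (rule tendsto_norm_zero_cancel)
  then show ?thesis
    unfolding has_vector_derivative_def has_derivative_within
    by (simp add: bounded_linear_scaleR_left inverse_eq_divide)
qed

lemma deriv_bounded:
  fixes \<pi> :: "state \<Rightarrow> 'b::real_normed_vector"
  assumes add: "\<And>U V. U \<in> H \<Longrightarrow> V \<in> H \<Longrightarrow> \<pi> (U + V) = \<pi> U + \<pi> V"
    and scale: "\<And>r U. U \<in> H \<Longrightarrow> \<pi> (scale_state (complex_of_real r) U) = r *\<^sub>R \<pi> U"
    and bound: "\<And>U. U \<in> H \<Longrightarrow> norm (\<pi> U) \<le> K * N U"
    and t: "0 \<le> t" and x: "x \<in> D"
  shows "((\<lambda>s. \<pi> (T s x)) has_vector_derivative \<pi> (T t (A x))) (at t within {0..})"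
proof (rule has_vector_derivative_of_err)
  have xH: "x \<in> H" "A x \<in> H" using D_subset_H[OF x] AH[OF x] by auto
  have neg: "\<pi> (- V) = - \<pi> V" if "V \<in> H" for V
    using scale[OF that, of "-1"] by (simp add: uminus_state)
  have diff: "\<pi> (U - V) = \<pi> U - \<pi> V" if "U \<in> H" "V \<in> H" for U V
    using add[OF that(1) H_uminus[OF that(2)]] neg[OF that(2)] by simp
  show "\<pi> (err x t s) = (1 / (s - t)) *\<^sub>R (\<pi> (T s x) - \<pi> (T t x)) - \<pi> (T t (A x))" if "0 \<le> s" "s \<noteq> t" for s
  proof -
    note e = T_H[OF that(1) xH(1)] T_H[OF t xH(1)] T_H[OF t xH(2)]
    show ?thesis
      by (simp only: diff[OF H_scale(1)[OF H_diff[OF e(1,2)]] e(3)] scale[OF H_diff[OF e(1,2)]] diff[OF e(1,2)])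
  qed
  show "((\<lambda>s. \<pi> (err x t s)) \<longlongrightarrow> 0) (at t within {0..})"
  proof (rule Lim_null_comparison)
    show "\<forall>\<^sub>F s in at t within {0..}. norm (\<pi> (err x t s)) \<le> K * N (err x t s)"
      unfolding eventually_at_filter
      using t xH by (intro always_eventually allI impI bound H_diff H_scale T_H) auto
    show "((\<lambda>s. K * N (err x t s)) \<longlongrightarrow> 0) (at t within {0..})"
      using tendsto_mult_right_zero[OF err_lim[OF t x]] by simp
  qed
qed

text \<open>The temperature gradient is not bounded by \<open>N\<close>, only by \<open>N\<close> of
  the image under \<open>A\<close>. Since \<open>A\<close> commutes with the difference quotients,
  one further power of \<open>A\<close> on the initial state is enough.\<close>

lemma deriv_graph_bounded:
  fixes \<pi> :: "state \<Rightarrow> 'b::real_normed_vector"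
  assumes add: "\<And>U V. U \<in> D \<Longrightarrow> V \<in> D \<Longrightarrow> \<pi> (U + V) = \<pi> U + \<pi> V"
    and scale: "\<And>r U. U \<in> D \<Longrightarrow> \<pi> (scale_state (complex_of_real r) U) = r *\<^sub>R \<pi> U"
    and bound: "\<And>U. U \<in> D \<Longrightarrow> norm (\<pi> U) \<le> K * N (A U)"
    and t: "0 \<le> t" and x: "x \<in> D" "A x \<in> D"
  shows "((\<lambda>s. \<pi> (T s x)) has_vector_derivative \<pi> (T t (A x))) (at t within {0..})"
proof (rule has_vector_derivative_of_err)
  have neg: "- V \<in> D" "\<pi> (- V) = - \<pi> V" if "V \<in> D" for V
    using scale[OF that, of "-1"] D_scale(1)[OF that] by (simp_all add: uminus_state)
  have diff: "\<pi> (U - V) = \<pi> U - \<pi> V" if "U \<in> D" "V \<in> D" for U V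
    using add[OF that(1) neg(1)[OF that(2)]] neg(2)[OF that(2)] by simp
  show "\<pi> (err x t s) = (1 / (s - t)) *\<^sub>R (\<pi> (T s x) - \<pi> (T t x)) - \<pi> (T t (A x))" if "0 \<le> s" "s \<noteq> t" for s
  proof -
    note e = T_D(1)[OF that(1) x(1)] T_D(1)[OF t x(1)] T_D(1)[OF t x(2)]
    show ?thesis
      by (simp only: diff[OF D_scale(1)[OF D_diff(1)[OF e(1,2)]] e(3)] scale[OF D_diff(1)[OF e(1,2)]] diff[OF e(1,2)])
  qed
  have Aerr: "A (err x t s) = err (A x) t s" if s: "0 \<le> s" for s
  proof -
    note e = T_D(1)[OF s x(1)] T_D(1)[OF t x(1)] T_D(1)[OF t x(2)]
    show ?thesis
      by (simp only: D_diff(2)[OF D_scale(1)[OF D_diff(1)[OF e(1,2)]] e(3)] D_scale(2)[OF D_diff(1)[OF e(1,2)]]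
          D_diff(2)[OF e(1,2)] T_D(2)[OF s x(1)] T_D(2)[OF t x(1)] T_D(2)[OF t x(2)])
  qed
  show "((\<lambda>s. \<pi> (err x t s)) \<longlongrightarrow> 0) (at t within {0..})"
  proof (rule Lim_null_comparison)
    show "\<forall>\<^sub>F s in at t within {0..}. norm (\<pi> (err x t s)) \<le> K * N (err (A x) t s)"
      unfolding eventually_at_filter
    proof (intro always_eventually allI impI)
      fix s assume s: "s \<noteq> t" "s \<in> {0..}"
      have "err x t s \<in> D" using s t x by (intro D_diff D_scale T_D) auto
      from bound[OF this] show "norm (\<pi> (err x t s)) \<le> K * N (err (A x) t s)"
        using Aerr[of s] s by simp
    qed
    show "((\<lambda>s. K * N (err (A x) t s)) \<longlongrightarrow> 0) (at t within {0..})"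
      using tendsto_mult_right_zero[OF err_lim[OF t x(2)]] by simp
  qed
qed

text \<open>The decaying solution is represented as \<open>A y\<close>, the time derivative of the solution through \<open>y\<close>,
  so that the dissipation of \<open>y\<close> is available besides that of \<open>A y\<close>.\<close>

definition Y :: "state set" where "Y = {y \<in> D0. A y \<in> D}"

lemma Y_D: "y \<in> Y \<Longrightarrow> y \<in> D" "y \<in> Y \<Longrightarrow> A y \<in> D" "y \<in> Y \<Longrightarrow> ell y = 0" "y \<in> Y \<Longrightarrow> ell (A y) = 0"
  "y \<in> Y \<Longrightarrow> y \<in> D0" "y \<in> Y \<Longrightarrow> A y \<in> D0"
  using step_ell[OF dom_step(2)] by (auto simp: Y_def D0_def)

text \<open>Null states of \<open>ell\<close> are images under \<open>A\<close>, and the semigroup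
  commutes with \<open>A\<close>, so no differentiation of \<open>ell\<close> along the orbit is
  required.\<close>

lemma T_ell: "0 \<le> t \<Longrightarrow> x \<in> H \<Longrightarrow> ell x = 0 \<Longrightarrow> ell (T t x) = 0"
proof -
  assume t: "0 \<le> t" and "x \<in> H" "ell x = 0"
  then obtain z where z: "z \<in> D" "A z = x" using solve[of x 0] by blast
  have "ell (A (T t z)) = 0" by (rule step_ell[OF dom_step(2)[OF T_D(1)[OF t z(1)]]])
  then show ?thesis using T_D(2)[OF t z(1)] z(2) by simp
qed

lemma T_Y: "0 \<le> t \<Longrightarrow> y \<in> Y \<Longrightarrow> T t y \<in> Y"
  using T_D[of t y] T_D[of t "A y"] T_ell[of t y] D_subset_H[of y] by (auto simp: Y_def D0_def)

text \<open>The bound is in terms of \<open>N (A y)\<close>, not \<open>N y\<close>, because the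
  energy to be estimated is that of \<open>A y\<close>.\<close>

definition good :: "(state \<Rightarrow> 'b::real_normed_vector) \<Rightarrow> (state \<Rightarrow> 'b) \<Rightarrow> bool" where
  "good \<pi> \<pi>' \<longleftrightarrow> (\<exists>K\<ge>0. \<forall>y\<in>Y. norm (\<pi> y) \<le> K * N (A y)) \<and>
    (\<forall>y\<in>Y. \<forall>t\<ge>0. ((\<lambda>s. \<pi> (T s y)) has_vector_derivative \<pi>' (T t y)) (at t within {0..}))"

lemma goodI:
  assumes "0 \<le> K" "\<And>y. y \<in> Y \<Longrightarrow> norm (\<pi> y) \<le> K * N (A y)"
    "\<And>y t. y \<in> Y \<Longrightarrow> 0 \<le> t \<Longrightarrow> ((\<lambda>s. \<pi> (T s y)) has_vector_derivative \<pi>' (T t y)) (at t within {0..})"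
  shows "good \<pi> \<pi>'"
  unfolding good_def using assms by blast

lemma good_bound: "good \<pi> \<pi>' \<Longrightarrow> \<exists>K\<ge>0. \<forall>y\<in>Y. norm (\<pi> y) \<le> K * N (A y)"
  by (simp add: good_def)

lemma good_deriv:
  "good \<pi> \<pi>' \<Longrightarrow> y \<in> Y \<Longrightarrow> 0 \<le> t \<Longrightarrow> ((\<lambda>s. \<pi> (T s y)) has_vector_derivative \<pi>' (T t y)) (at t within {0..})"
  unfolding good_def by blast

lemma LS_bound:
  assumes "LS (\<lambda>U. (norm (\<pi> U))\<^sup>2) (\<lambda>U. (N U)\<^sup>2)"
  shows "\<exists>K\<ge>0. \<forall>U\<in>H. norm (\<pi> U) \<le> K * N U"
proof -
  obtain C where C: "0 \<le> C" "\<And>U. U \<in> H \<Longrightarrow> (norm (\<pi> U))\<^sup>2 \<le> C * (N U)\<^sup>2"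
    using assms unfolding lesssim_def by blast
  have "norm (\<pi> U) \<le> sqrt C * N U" if "U \<in> H" for U
  proof (rule power2_le_imp_le)
    show "(norm (\<pi> U))\<^sup>2 \<le> (sqrt C * N U)\<^sup>2"
      using C(1) C(2)[OF that] by (simp add: power_mult_distrib)
    show "0 \<le> sqrt C * N U" using C(1) N_nonneg[OF that] by simp
  qed
  then show ?thesis using C(1) real_sqrt_ge_zero by blast
qed

lemma a_priori_N: "\<exists>K\<ge>0. \<forall>y\<in>D0. N y \<le> K * N (A y)"
proof -
  obtain C where C: "0 \<le> C" "\<And>U. U \<in> D0 \<Longrightarrow> (N U)\<^sup>2 \<le> C * (N (A U))\<^sup>2"
    using a_priori unfolding lesssim_def by blast
  have "N U \<le> sqrt C * N (A U)" if "U \<in> D0" for U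
  proof (rule power2_le_imp_le)
    show "(N U)\<^sup>2 \<le> (sqrt C * N (A U))\<^sup>2"
      using C(1) C(2)[OF that] by (simp add: power_mult_distrib)
    have "U \<in> D" using that by (simp add: D0_def)
    then show "0 \<le> sqrt C * N (A U)" using C(1) N_nonneg[OF AH] by simp
  qed
  then show ?thesis using C(1) real_sqrt_ge_zero by blast
qed

text \<open>Of the two conclusions the first speaks of the coordinate of \<open>y\<close> itself and
  rests on the lower bound for \<open>A\<close>; the second speaks of that of \<open>A y\<close>,
  where the bound by \<open>N\<close> is immediate.\<close>

lemma good_linear:
  fixes \<pi> :: "state \<Rightarrow> 'b::real_normed_vector"
  assumes add: "\<And>U V. U \<in> H \<Longrightarrow> V \<in> H \<Longrightarrow> \<pi> (U + V) = \<pi> U + \<pi> V"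
    and scale: "\<And>r U. U \<in> H \<Longrightarrow> \<pi> (scale_state (complex_of_real r) U) = r *\<^sub>R \<pi> U"
    and LS: "LS (\<lambda>U. (norm (\<pi> U))\<^sup>2) (\<lambda>U. (N U)\<^sup>2)"
  shows "good \<pi> (\<lambda>y. \<pi> (A y))" "good (\<lambda>y. \<pi> (A y)) (\<lambda>y. \<pi> (A (A y)))"
proof -
  obtain K where K: "0 \<le> K" "\<And>U. U \<in> H \<Longrightarrow> norm (\<pi> U) \<le> K * N U" using LS_bound[OF LS] by blast
  obtain K' where K': "0 \<le> K'" "\<And>U. U \<in> D0 \<Longrightarrow> N U \<le> K' * N (A U)" using a_priori_N by blast
  have der: "((\<lambda>s. \<pi> (T s x)) has_vector_derivative \<pi> (T t (A x))) (at t within {0..})"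
    if "0 \<le> t" "x \<in> D" for t x
    by (rule deriv_bounded[OF add scale K(2) that])
  have "norm (\<pi> y) \<le> (K * K') * N (A y)" if y: "y \<in> Y" for y
    using K(2)[OF D_subset_H[OF Y_D(1)[OF y]]] mult_left_mono[OF K'(2)[OF Y_D(5)[OF y]] K(1)]
    by (simp add: mult.assoc)
  moreover have "((\<lambda>s. \<pi> (T s y)) has_vector_derivative \<pi> (A (T t y))) (at t within {0..})"
    if "y \<in> Y" "0 \<le> t" for y t
    using der[OF that(2) Y_D(1)[OF that(1)]] T_D(2)[OF that(2) Y_D(1)[OF that(1)]] by simp
  ultimately show "good \<pi> (\<lambda>y. \<pi> (A y))"
    using K(1) K'(1) by (intro goodI[of "K * K'"]) simp_all
  have "((\<lambda>s. \<pi> (A (T s y))) has_vector_derivative \<pi> (A (A (T t y)))) (at t within {0..})"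
    if y: "y \<in> Y" and t: "0 \<le> t" for y t
  proof -
    have "((\<lambda>s. \<pi> (T s (A y))) has_vector_derivative \<pi> (T t (A (A y)))) (at t within {0..})"
      by (rule der[OF t Y_D(2)[OF y]])
    moreover have "A (A (T t y)) = T t (A (A y))"
      using T_D[OF t Y_D(1)[OF y]] T_D[OF t Y_D(2)[OF y]] by simp
    ultimately have "((\<lambda>s. \<pi> (T s (A y))) has_vector_derivative \<pi> (A (A (T t y)))) (at t within {0..})" by simp
    then show ?thesis
      by (rule has_vector_derivative_transform[rotated 2]) (use T_D(2)[OF _ Y_D(1)[OF y]] t in simp_all)
  qed
  then show "good (\<lambda>y. \<pi> (A y)) (\<lambda>y. \<pi> (A (A y)))"
    using K AH Y_D(1) by (intro goodI[of K]) simp_all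
qed

lemma good_ptx: "good ptx (\<lambda>y. ptx (A y))"
proof -
  obtain C where C: "0 \<le> C" "\<And>U. U \<in> D \<Longrightarrow> (norm (ptx U))\<^sup>2 \<le> C * (N (A U))\<^sup>2"
    using LS_ptx unfolding lesssim_def by blast
  have K: "norm (ptx U) \<le> sqrt C * N (A U)" if "U \<in> D" for U
  proof (rule power2_le_imp_le)
    show "(norm (ptx U))\<^sup>2 \<le> (sqrt C * N (A U))\<^sup>2"
      using C(1) C(2)[OF that] by (simp add: power_mult_distrib)
    show "0 \<le> sqrt C * N (A U)" using C(1) N_nonneg[OF AH[OF that]] by simp
  qed
  have "((\<lambda>s. ptx (T s y)) has_vector_derivative ptx (A (T t y))) (at t within {0..})"
    if y: "y \<in> Y" and t: "0 \<le> t" for y t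
    unfolding T_D(2)[OF t Y_D(1)[OF y]]
    by (rule deriv_graph_bounded[OF D_add(3) _ K t Y_D(1,2)[OF y]])
      (auto simp: D_scale csc_of_real)
  then show ?thesis using K C(1) Y_D(1) by (intro goodI[of "sqrt C"]) simp_all
qed

lemma good_bounded_linear:
  assumes f: "bounded_linear f" and g: "good \<pi> \<pi>'"
  shows "good (\<lambda>y. f (\<pi> y)) (\<lambda>y. f (\<pi>' y))"
proof -
  obtain B where B: "0 < B" "\<And>x. norm (f x) \<le> norm x * B" using bounded_linear.pos_bounded[OF f] by blast
  obtain K where K: "0 \<le> K" "\<And>y. y \<in> Y \<Longrightarrow> norm (\<pi> y) \<le> K * N (A y)" using good_bound[OF g] by blast
  have "norm (f (\<pi> y)) \<le> (K * B) * N (A y)" if "y \<in> Y" for y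
  proof -
    have "norm (f (\<pi> y)) \<le> norm (\<pi> y) * B" by (rule B(2))
    also have "\<dots> \<le> (K * N (A y)) * B" using K(2)[OF that] B(1) by (intro mult_right_mono) auto
    finally show ?thesis by (simp add: ac_simps)
  qed
  then show ?thesis
    using bounded_linear.has_vector_derivative[OF f good_deriv[OF g]] B(1) K(1)
    by (intro goodI[of "K * B"]) simp_all
qed

lemma good_diff: "good \<pi> \<pi>' \<Longrightarrow> good \<rho> \<rho>' \<Longrightarrow> good (\<lambda>y. \<pi> y - \<rho> y) (\<lambda>y. \<pi>' y - \<rho>' y)"
proof -
  assume g: "good \<pi> \<pi>'" "good \<rho> \<rho>'"
  obtain K where K: "0 \<le> K" "\<And>y. y \<in> Y \<Longrightarrow> norm (\<pi> y) \<le> K * N (A y)" using g unfolding good_def by blast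
  obtain K' where K': "0 \<le> K'" "\<And>y. y \<in> Y \<Longrightarrow> norm (\<rho> y) \<le> K' * N (A y)" using good_bound[OF g(2)] by blast
  have "norm (\<pi> y - \<rho> y) \<le> (K + K') * N (A y)" if "y \<in> Y" for y
    using norm_triangle_ineq4[of "\<pi> y" "\<rho> y"] K(2)[OF that] K'(2)[OF that] by (simp add: distrib_right)
  then show ?thesis
    using has_vector_derivative_diff[OF good_deriv[OF g(1)] good_deriv[OF g(2)]] K(1) K'(1)
    by (intro goodI[of "K + K'"]) simp_all
qed

text \<open>The derivative is again a function of the state, so it can be combined pointwise on
  \<open>Y\<close>; the bound by the energy is what keeps such terms harmless in the final
  functional.\<close>

definition lyap :: "(state \<Rightarrow> real) \<Rightarrow> (state \<Rightarrow> real) \<Rightarrow> bool" where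
  "lyap Q Q' \<longleftrightarrow> (\<exists>K\<ge>0. \<forall>y\<in>Y. \<bar>Q y\<bar> \<le> K * (N (A y))\<^sup>2) \<and>
    (\<forall>y\<in>Y. \<forall>t\<ge>0. ((\<lambda>s. Q (T s y)) has_real_derivative Q' (T t y)) (at t within {0..}))"

lemma lyapI:
  assumes "0 \<le> K" "\<And>y. y \<in> Y \<Longrightarrow> \<bar>Q y\<bar> \<le> K * (N (A y))\<^sup>2"
    "\<And>y t. y \<in> Y \<Longrightarrow> 0 \<le> t \<Longrightarrow> ((\<lambda>s. Q (T s y)) has_real_derivative Q' (T t y)) (at t within {0..})"
  shows "lyap Q Q'"
  unfolding lyap_def using assms by blast

lemma lyap_bound: "lyap Q Q' \<Longrightarrow> \<exists>K\<ge>0. \<forall>y\<in>Y. \<bar>Q y\<bar> \<le> K * (N (A y))\<^sup>2"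
  by (simp add: lyap_def)

lemma lyap_deriv:
  "lyap Q Q' \<Longrightarrow> y \<in> Y \<Longrightarrow> 0 \<le> t \<Longrightarrow> ((\<lambda>s. Q (T s y)) has_real_derivative Q' (T t y)) (at t within {0..})"
  unfolding lyap_def by blast

lemma lyap_inner:
  fixes \<pi> \<rho> :: "state \<Rightarrow> 'b::real_inner"
  assumes g: "good \<pi> \<pi>'" "good \<rho> \<rho>'"
  shows "lyap (\<lambda>y. inner (\<pi> y) (\<rho> y)) (\<lambda>y. inner (\<pi>' y) (\<rho> y) + inner (\<pi> y) (\<rho>' y))"
proof -
  obtain K where K: "0 \<le> K" "\<And>y. y \<in> Y \<Longrightarrow> norm (\<pi> y) \<le> K * N (A y)" using g unfolding good_def by blast
  obtain K' where K': "0 \<le> K'" "\<And>y. y \<in> Y \<Longrightarrow> norm (\<rho> y) \<le> K' * N (A y)" using good_bound[OF g(2)] by blast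
  have "\<bar>inner (\<pi> y) (\<rho> y)\<bar> \<le> (K * K') * (N (A y))\<^sup>2" if y: "y \<in> Y" for y
  proof -
    have "\<bar>inner (\<pi> y) (\<rho> y)\<bar> \<le> norm (\<pi> y) * norm (\<rho> y)" by (rule Cauchy_Schwarz_ineq2)
    also have "\<dots> \<le> (K * N (A y)) * (K' * N (A y))"
      using K K' y N_nonneg[OF AH[OF Y_D(1)[OF y]]] by (intro mult_mono) auto
    finally show ?thesis by (simp add: power2_eq_square ac_simps)
  qed
  moreover have "((\<lambda>s. inner (\<pi> (T s y)) (\<rho> (T s y))) has_real_derivative
      (inner (\<pi>' (T t y)) (\<rho> (T t y)) + inner (\<pi> (T t y)) (\<rho>' (T t y)))) (at t within {0..})"
    if "y \<in> Y" "0 \<le> t" for y t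
  proof -
    have "((\<lambda>s. \<pi> (T s y)) has_vector_derivative \<pi>' (T t y)) (at t within {0..})"
      "((\<lambda>s. \<rho> (T s y)) has_vector_derivative \<rho>' (T t y)) (at t within {0..})"
      by (rule good_deriv[OF g(1) that] good_deriv[OF g(2) that])+
    from bounded_bilinear.has_vector_derivative[OF bounded_bilinear_inner this]
    show ?thesis by (simp add: has_real_derivative_iff_has_vector_derivative add.commute)
  qed
  ultimately show ?thesis using K(1) K'(1) by (intro lyapI[of "K * K'"]) simp_all
qed

lemma lyap_add: "lyap Q Q' \<Longrightarrow> lyap R R' \<Longrightarrow> lyap (\<lambda>y. Q y + R y) (\<lambda>y. Q' y + R' y)"
proof -
  assume l: "lyap Q Q'" "lyap R R'"
  obtain K where K: "0 \<le> K" "\<And>y. y \<in> Y \<Longrightarrow> \<bar>Q y\<bar> \<le> K * (N (A y))\<^sup>2" using lyap_bound[OF l(1)] by blast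
  obtain K' where K': "0 \<le> K'" "\<And>y. y \<in> Y \<Longrightarrow> \<bar>R y\<bar> \<le> K' * (N (A y))\<^sup>2" using lyap_bound[OF l(2)] by blast
  have "\<bar>Q y + R y\<bar> \<le> (K + K') * (N (A y))\<^sup>2" if "y \<in> Y" for y
    using K(2)[OF that] K'(2)[OF that] by (simp add: distrib_right)
  then show ?thesis
    using DERIV_add[OF lyap_deriv[OF l(1)] lyap_deriv[OF l(2)]] K(1) K'(1)
    by (intro lyapI[of "K + K'"]) simp_all
qed

lemma lyap_scale: "lyap Q Q' \<Longrightarrow> lyap (\<lambda>y. c * Q y) (\<lambda>y. c * Q' y)"
proof -
  assume l: "lyap Q Q'"
  obtain K where K: "0 \<le> K" "\<And>y. y \<in> Y \<Longrightarrow> \<bar>Q y\<bar> \<le> K * (N (A y))\<^sup>2" using lyap_bound[OF l] by blast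
  have "\<bar>c * Q y\<bar> \<le> (\<bar>c\<bar> * K) * (N (A y))\<^sup>2" if "y \<in> Y" for y
    using mult_left_mono[OF K(2)[OF that], of "\<bar>c\<bar>"] by (simp add: abs_mult mult.assoc)
  then show ?thesis
    using DERIV_cmult[OF lyap_deriv[OF l]] K(1) by (intro lyapI[of "\<bar>c\<bar> * K"]) simp_all
qed

lemma lyap_zero: "lyap (\<lambda>y. 0) (\<lambda>y. 0)"
  by (rule lyapI[of 0]) simp_all

end

section \<open>Quantities controlled by the dissipation\<close>

context thermoelastic_semigroup
begin

abbreviation "E y \<equiv> (N (A y))\<^sup>2"
abbreviation "Dis y \<equiv> (norm (ptx y))\<^sup>2 + (norm (ptx (A y)))\<^sup>2"
abbreviation "LY \<equiv> lesssim Y"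

text \<open>Up to the time derivative of a bounded functional, \<open>bdd\<close> quantities are dominated by energy and
  dissipation, and \<open>ctrl\<close> quantities by the dissipation and an arbitrarily small part of the energy.\<close>

definition bdd :: "(state \<Rightarrow> real) \<Rightarrow> bool" where
  "bdd R \<longleftrightarrow> (\<exists>Q Q' C. lyap Q Q' \<and> 0 \<le> C \<and> (\<forall>y\<in>Y. R y \<le> Q' y + C * (E y + Dis y)))"

definition ctrl :: "(state \<Rightarrow> real) \<Rightarrow> bool" where
  "ctrl R \<longleftrightarrow> (\<forall>e>0. \<exists>Q Q' C. lyap Q Q' \<and> 0 \<le> C \<and> (\<forall>y\<in>Y. R y \<le> Q' y + e * E y + C * Dis y))"

lemma bddI: "lyap Q Q' \<Longrightarrow> 0 \<le> C \<Longrightarrow> (\<And>y. y \<in> Y \<Longrightarrow> R y \<le> Q' y + C * (E y + Dis y)) \<Longrightarrow> bdd R"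
  unfolding bdd_def by blast

lemma bdd_mono: "bdd S \<Longrightarrow> (\<And>y. y \<in> Y \<Longrightarrow> R y \<le> S y) \<Longrightarrow> bdd R"
  unfolding bdd_def by (meson order_trans)

lemma ctrl_mono: "ctrl S \<Longrightarrow> (\<And>y. y \<in> Y \<Longrightarrow> R y \<le> S y) \<Longrightarrow> ctrl R"
  unfolding ctrl_def by (meson order_trans)

lemma bdd_add: assumes "bdd R" "bdd S" shows "bdd (\<lambda>y. R y + S y)"
proof -
  obtain Q Q' C where 1: "lyap Q Q'" "0 \<le> C" "\<And>y. y \<in> Y \<Longrightarrow> R y \<le> Q' y + C * (E y + Dis y)"
    using assms(1) unfolding bdd_def by blast
  obtain P P' B where 2: "lyap P P'" "0 \<le> B" "\<And>y. y \<in> Y \<Longrightarrow> S y \<le> P' y + B * (E y + Dis y)"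
    using assms(2) unfolding bdd_def by blast
  show ?thesis
  proof (rule bddI[OF lyap_add[OF 1(1) 2(1)], of "C + B"])
    fix y assume "y \<in> Y"
    then show "R y + S y \<le> Q' y + P' y + (C + B) * (E y + Dis y)"
      using add_mono[OF 1(3) 2(3)] by (simp only: distrib_right) (simp add: ac_simps)
  qed (use 1 2 in simp)
qed

lemma ctrl_add: assumes "ctrl R" "ctrl S" shows "ctrl (\<lambda>y. R y + S y)"
  unfolding ctrl_def
proof (intro allI impI)
  fix e :: real assume "0 < e"
  then have e: "0 < e / 2" by simp
  obtain Q Q' C where 1: "lyap Q Q'" "0 \<le> C" "\<And>y. y \<in> Y \<Longrightarrow> R y \<le> Q' y + e / 2 * E y + C * Dis y"
    using assms(1) e unfolding ctrl_def by blast
  obtain P P' B where 2: "lyap P P'" "0 \<le> B" "\<And>y. y \<in> Y \<Longrightarrow> S y \<le> P' y + e / 2 * E y + B * Dis y"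
    using assms(2) e unfolding ctrl_def by blast
  have "R y + S y \<le> Q' y + P' y + e * E y + (C + B) * Dis y" if "y \<in> Y" for y
  proof -
    have "R y + S y \<le> (Q' y + e / 2 * E y + C * Dis y) + (P' y + e / 2 * E y + B * Dis y)"
      by (rule add_mono[OF 1(3)[OF that] 2(3)[OF that]])
    also have "\<dots> = Q' y + P' y + e * E y + (C + B) * Dis y" by (simp add: algebra_simps)
    finally show ?thesis .
  qed
  then show "\<exists>Q Q' C. lyap Q Q' \<and> 0 \<le> C \<and> (\<forall>y\<in>Y. R y + S y \<le> Q' y + e * E y + C * Dis y)"
    using lyap_add[OF 1(1) 2(1)] 1(2) 2(2) by (meson add_nonneg_nonneg)
qed

lemma bdd_scale: assumes "bdd R" "0 \<le> c" shows "bdd (\<lambda>y. c * R y)"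
proof -
  obtain Q Q' C where 1: "lyap Q Q'" "0 \<le> C" "\<And>y. y \<in> Y \<Longrightarrow> R y \<le> Q' y + C * (E y + Dis y)"
    using assms(1) unfolding bdd_def by blast
  show ?thesis
  proof (rule bddI[OF lyap_scale[OF 1(1), of c], of "c * C"])
    fix y assume "y \<in> Y"
    then show "c * R y \<le> c * Q' y + c * C * (E y + Dis y)"
      using mult_left_mono[OF 1(3) assms(2)] by (simp only: distrib_left mult.assoc)
  qed (use 1 assms in simp)
qed

lemma ctrl_scale: assumes "ctrl R" "0 \<le> c" shows "ctrl (\<lambda>y. c * R y)"
  unfolding ctrl_def
proof (intro allI impI)
  fix e :: real assume e: "0 < e"
  define d where "d = e / (c + 1)"
  have d: "0 < d" "c * d \<le> e" using e assms(2) by (auto simp: d_def field_simps)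
  obtain Q Q' C where 1: "lyap Q Q'" "0 \<le> C" "\<And>y. y \<in> Y \<Longrightarrow> R y \<le> Q' y + d * E y + C * Dis y"
    using assms(1) d(1) unfolding ctrl_def by blast
  have "c * R y \<le> c * Q' y + e * E y + (c * C) * Dis y" if "y \<in> Y" for y
  proof -
    have "c * R y \<le> c * (Q' y + d * E y + C * Dis y)"
      by (rule mult_left_mono[OF 1(3)[OF that] assms(2)])
    also have "\<dots> = c * Q' y + (c * d) * E y + (c * C) * Dis y" by (simp only: distrib_left mult.assoc)
    also have "\<dots> \<le> c * Q' y + e * E y + (c * C) * Dis y"
      using mult_right_mono[OF d(2), of "E y"] by simp
    finally show ?thesis .
  qed
  then show "\<exists>Q Q' C. lyap Q Q' \<and> 0 \<le> C \<and> (\<forall>y\<in>Y. c * R y \<le> Q' y + e * E y + C * Dis y)"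
    using lyap_scale[OF 1(1), of c] 1(2) assms(2) by (meson mult_nonneg_nonneg)
qed

lemma bdd_E: "bdd E"
  by (rule bddI[OF lyap_zero, of 1]) auto

lemma ctrl_Dis: "ctrl Dis"
  unfolding ctrl_def
proof (intro allI impI)
  fix e :: real assume "0 < e"
  then have "\<forall>y\<in>Y. Dis y \<le> 0 + e * E y + 1 * Dis y" by simp
  then show "\<exists>Q Q' C. lyap Q Q' \<and> 0 \<le> C \<and> (\<forall>y\<in>Y. Dis y \<le> Q' y + e * E y + C * Dis y)"
    using lyap_zero zero_le_one by blast
qed

text \<open>Time derivatives of bounded functionals cost nothing, and by \<open>lyap_scale\<close>
  this holds with either sign. It is what makes integration by parts in time available.\<close>

lemma ctrl_dot: assumes "lyap Q Q'" shows "ctrl Q'"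
  unfolding ctrl_def
proof (intro allI impI)
  fix e :: real assume "0 < e"
  then have "\<forall>y\<in>Y. Q' y \<le> Q' y + e * E y + 0 * Dis y" by simp
  then show "\<exists>P P' C. lyap P P' \<and> 0 \<le> C \<and> (\<forall>y\<in>Y. Q' y \<le> P' y + e * E y + C * Dis y)"
    using assms by blast
qed

lemma ctrl_neg_dot: assumes "lyap Q Q'" shows "ctrl (\<lambda>y. - Q' y)"
  using ctrl_dot[OF lyap_scale[OF assms, of "-1"]] by simp

lemma bdd_ctrl: assumes "ctrl R" shows "bdd R"
proof -
  obtain Q Q' C where 1: "lyap Q Q'" "0 \<le> C" "\<And>y. y \<in> Y \<Longrightarrow> R y \<le> Q' y + 1 * E y + C * Dis y"
    using assms unfolding ctrl_def by (metis zero_less_one)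
  show ?thesis
  proof (rule bddI[OF 1(1), of "C + 1"])
    fix y assume "y \<in> Y"
    have "1 * E y + C * Dis y \<le> (C + 1) * E y + (C + 1) * Dis y"
      using 1(2) by (intro add_mono mult_right_mono) auto
    then show "R y \<le> Q' y + (C + 1) * (E y + Dis y)"
      using 1(3)[OF \<open>y \<in> Y\<close>] unfolding distrib_left[of "C + 1" "E y"] by linarith
  qed (use 1 in simp)
qed

lemma bdd_LS: "LY R S \<Longrightarrow> bdd S \<Longrightarrow> bdd R"
  unfolding lesssim_def using bdd_mono[OF bdd_scale] by metis

lemma ctrl_LS: "LY R S \<Longrightarrow> ctrl S \<Longrightarrow> ctrl R"
  unfolding lesssim_def using ctrl_mono[OF ctrl_scale] by metis

text \<open>The rule behind every product estimate: a bounded quantity with an arbitrarily small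
  coefficient plus a controlled one with a large coefficient is controlled.\<close>

lemma ctrl_young:
  assumes R: "\<And>e. 0 < e \<Longrightarrow> \<exists>C\<ge>0. \<forall>y\<in>Y. R y \<le> e * B y + C * S y" and B: "bdd B" and S: "ctrl S"
  shows "ctrl R"
  unfolding ctrl_def
proof (intro allI impI)
  fix e :: real assume e: "0 < e"
  obtain Q Q' C where 1: "lyap Q Q'" "0 \<le> C" "\<And>y. y \<in> Y \<Longrightarrow> B y \<le> Q' y + C * (E y + Dis y)"
    using B unfolding bdd_def by blast
  \<comment> \<open>Half of the permitted energy is spent on the bounded term.\<close>
  define d where "d = e / (2 * (C + 1))"
  have d: "0 < d" "d * C \<le> e / 2" using e 1(2) by (auto simp: d_def field_simps)
  obtain K where K: "0 \<le> K" "\<And>y. y \<in> Y \<Longrightarrow> R y \<le> d * B y + K * S y" using R[OF d(1)] by blast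
  \<comment> \<open>The other half; it can be fixed only now, since \<open>K\<close> depends on
    \<open>d\<close>.\<close>
  define f where "f = e / (2 * (K + 1))"
  have f: "0 < f" "K * f \<le> e / 2" using e K(1) by (auto simp: f_def field_simps)
  obtain P P' G where 2: "lyap P P'" "0 \<le> G" "\<And>y. y \<in> Y \<Longrightarrow> S y \<le> P' y + f * E y + G * Dis y"
    using S f(1) unfolding ctrl_def by blast
  have "R y \<le> (d * Q' y + K * P' y) + e * E y + (d * C + K * G) * Dis y" if y: "y \<in> Y" for y
  proof -
    have "R y \<le> d * (Q' y + C * (E y + Dis y)) + K * (P' y + f * E y + G * Dis y)"
      using K(2)[OF y] mult_left_mono[OF 1(3)[OF y], of d] mult_left_mono[OF 2(3)[OF y] K(1)] d(1) by linarith
    also have "\<dots> = (d * Q' y + K * P' y) + (d * C + K * f) * E y + (d * C + K * G) * Dis y"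
      by (simp add: algebra_simps)
    also have "\<dots> \<le> (d * Q' y + K * P' y) + e * E y + (d * C + K * G) * Dis y"
      using d(2) f(2) by (intro add_mono mult_right_mono order_refl) auto
    finally show ?thesis .
  qed
  moreover have "lyap (\<lambda>y. d * Q y + K * P y) (\<lambda>y. d * Q' y + K * P' y)"
    by (intro lyap_add lyap_scale 1(1) 2(1))
  moreover have "0 \<le> d * C + K * G" using d(1) 1(2) K(1) 2(2) by simp
  ultimately show "\<exists>Q Q' C. lyap Q Q' \<and> 0 \<le> C \<and> (\<forall>y\<in>Y. R y \<le> Q' y + e * E y + C * Dis y)"
    by blast
qed

lemma ctrl_inner:
  fixes f g :: "state \<Rightarrow> 'b::real_inner"
  assumes "bdd (\<lambda>y. (norm (f y))\<^sup>2)" "ctrl (\<lambda>y. (norm (g y))\<^sup>2)"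
  shows "ctrl (\<lambda>y. c * inner (f y) (g y))"
proof (rule ctrl_young[OF _ assms])
  fix e :: real assume e: "0 < e"
  have "c * inner (f y) (g y) \<le> e * (norm (f y))\<^sup>2 + (1 / (4 * e) * c\<^sup>2) * (norm (g y))\<^sup>2" for y
    using inner_young[OF e, of "f y" "c *\<^sub>R g y"] by (simp add: power_mult_distrib)
  moreover have "0 \<le> 1 / (4 * e) * c\<^sup>2" using e by simp
  ultimately show "\<exists>C\<ge>0. \<forall>y\<in>Y. c * inner (f y) (g y) \<le> e * (norm (f y))\<^sup>2 + C * (norm (g y))\<^sup>2"
    by blast
qed

section \<open>From the dissipation to the whole energy\<close>

lemma bdd_coord: "LS (\<lambda>U. (norm (\<pi> U))\<^sup>2) (\<lambda>U. (N U)\<^sup>2) \<Longrightarrow> bdd (\<lambda>y. (norm (\<pi> (A y)))\<^sup>2)"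
  by (rule bdd_LS[OF _ bdd_E]) (use AH Y_D(1) in \<open>auto simp: lesssim_def\<close>)

lemma ctrl_dev: "ctrl (\<lambda>y. (norm (dev (A y)))\<^sup>2)"
proof (rule ctrl_LS[OF _ ctrl_Dis])
  define K where "K = max (2 * (k\<^sup>2)\<^sup>2) (2 * (4 * (L2 - L1)\<^sup>2 * (4 * (L2 - L1)\<^sup>2)))"
  show "LY (\<lambda>y. (norm (dev (A y)))\<^sup>2) Dis"
  proof (rule lesssimI[of "K / m\<^sup>2"])
    show "0 \<le> K / m\<^sup>2" by (simp add: K_def le_max_iff_disj)
    fix y assume y: "y \<in> Y"
    have "m\<^sup>2 * (norm (dev (A y)))\<^sup>2 \<le> K * (norm (ptx y))\<^sup>2 + K * (norm (ptx (A y)))\<^sup>2"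
      by (rule order_trans[OF dev_le[OF Y_D(1,2)[OF y]]]) (intro add_mono mult_right_mono; simp add: K_def)
    then show "(norm (dev (A y)))\<^sup>2 \<le> K / m\<^sup>2 * Dis y"
    proof -
      have "0 < m\<^sup>2" using pos by simp
      then have "(norm (dev (A y)))\<^sup>2 \<le> (K * (norm (ptx y))\<^sup>2 + K * (norm (ptx (A y)))\<^sup>2) / m\<^sup>2"
        using \<open>m\<^sup>2 * (norm (dev (A y)))\<^sup>2 \<le> _\<close> by (simp only: pos_le_divide_eq mult.commute[of "m\<^sup>2"])
      then show ?thesis by (simp only: distrib_left times_divide_eq_left add_divide_distrib)
    qed
  qed
qed

lemma ctrl_ptx: "ctrl (\<lambda>y. (norm (ptx (A y)))\<^sup>2)"
  by (rule ctrl_mono[OF ctrl_Dis]) simp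

lemma LS_ip:
  assumes "LS (\<lambda>U. (norm (\<pi> U))\<^sup>2) (\<lambda>U. (N U)\<^sup>2)"
  shows "LS (\<lambda>U. (norm (ip (\<pi> U) f))\<^sup>2) (\<lambda>U. (N U)\<^sup>2)"
proof (rule lesssim_mono[OF lesssim_scale[OF assms, of "(norm f)\<^sup>2"]])
  fix U
  have "(norm (ip (\<pi> U) f))\<^sup>2 \<le> (norm (\<pi> U) * norm f)\<^sup>2" by (intro power_mono norm_ip_le) simp
  then show "(norm (ip (\<pi> U) f))\<^sup>2 \<le> (norm f)\<^sup>2 * (norm (\<pi> U))\<^sup>2"
    by (simp add: power_mult_distrib mult.commute)
qed simp

lemma LS_pu: "LS (\<lambda>U. (norm (pu U))\<^sup>2) (\<lambda>U. (N U)\<^sup>2)"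
  by (rule lesssim_trans[OF LS_pot(4) pot_le_N])

lemma LY_a_priori: "LS R (\<lambda>U. (N U)\<^sup>2) \<Longrightarrow> LY R E"
  by (rule lesssim_trans[OF lesssim_subset[of H] lesssim_subset[OF a_priori]])
    (auto simp: Y_D D_subset_H)

lemma pu_A: "U \<in> D \<Longrightarrow> pu (A U) = pw U"
  by (rule dom_W)

text \<open>For a moment \<open>p\<close> along an orbit, \<open>|p'|^2\<close> is the time
  derivative of \<open>p * p'\<close> minus \<open>p * p''\<close>, in the sense of inner products.
  So smallness of a derivative passes to the derivative one order lower if \<open>p\<close> is
  bounded. This is used twice; the second time with the moment of \<open>y\<close>, whose time
  derivative is the moment of \<open>A y\<close>.\<close>

lemma ctrl_moment:
  assumes f: "W L1 L2 f0 f1 0 0" "W L1 L2 f1 f2 0 0"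
  shows "ctrl (\<lambda>y. (norm (ip (pu (A y)) f0))\<^sup>2)"
proof -
  let ?\<pi> = "\<lambda>U. ip (pu U) f0" and ?\<rho> = "\<lambda>U. ip (pw U) f0"
  have g\<pi>: "good ?\<pi> (\<lambda>y. ?\<pi> (A y))" "good (\<lambda>y. ?\<pi> (A y)) (\<lambda>y. ?\<pi> (A (A y)))"
    by (intro good_linear LS_ip LS_pu; simp add: H_add H_scale ip_add_left csc_of_real ip_scaleR_left)+
  have g\<rho>: "good (\<lambda>y. ?\<rho> (A y)) (\<lambda>y. ?\<rho> (A (A y)))"
    by (intro good_linear LS_ip LS_coords; simp add: H_add H_scale ip_add_left csc_of_real ip_scaleR_left)
  have eq: "?\<pi> (A (A y)) = ?\<rho> (A y)" if "y \<in> Y" for y using pu_A[OF Y_D(2)[OF that]] by simp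
  have b: "bdd (\<lambda>y. (norm (?\<pi> (A y)))\<^sup>2)" by (rule bdd_coord[OF LS_ip[OF LS_pu]])
  have b0: "bdd (\<lambda>y. (norm (?\<pi> y))\<^sup>2)" by (rule bdd_LS[OF LY_a_priori[OF LS_ip[OF LS_pu]] bdd_E])
  have c2: "ctrl (\<lambda>y. (norm (?\<rho> (A (A y))))\<^sup>2)"
  proof (rule ctrl_mono[OF ctrl_add[OF ctrl_scale[OF ctrl_dev, of "2 * a\<^sup>2 * (norm f2)\<^sup>2"]
          ctrl_scale[OF ctrl_ptx, of "2 * m\<^sup>2 * (norm f0)\<^sup>2"]]])
    fix y assume y: "y \<in> Y"
    have "(norm (?\<rho> (A (A y))))\<^sup>2 \<le> 2 * (norm (a *\<^sub>R ip (dev (A y)) f2))\<^sup>2 + 2 * (norm (m *\<^sub>R ip (ptx (A y)) f0))\<^sup>2"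
      unfolding moment_second_derivative[OF Y_D(2)[OF y] f] by (rule norm_diff_sq)
    also have "\<dots> = 2 * a\<^sup>2 * (norm (ip (dev (A y)) f2))\<^sup>2 + 2 * m\<^sup>2 * (norm (ip (ptx (A y)) f0))\<^sup>2"
      by (simp add: power_mult_distrib)
    also have "\<dots> \<le> 2 * a\<^sup>2 * (norm (dev (A y)) * norm f2)\<^sup>2 + 2 * m\<^sup>2 * (norm (ptx (A y)) * norm f0)\<^sup>2"
      by (intro add_mono mult_left_mono power_mono norm_ip_le) auto
    finally show "(norm (?\<rho> (A (A y))))\<^sup>2 \<le> 2 * a\<^sup>2 * (norm f2)\<^sup>2 * (norm (dev (A y)))\<^sup>2 + 2 * m\<^sup>2 * (norm f0)\<^sup>2 * (norm (ptx (A y)))\<^sup>2"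
      by (simp add: power_mult_distrib ac_simps)
  qed auto
  \<comment> \<open>From the second derivative to the first: \<open>p\<close> is the moment of
    \<open>A y\<close>.\<close>
  have c1: "ctrl (\<lambda>y. (norm (?\<rho> (A y)))\<^sup>2)"
    by (rule ctrl_mono[OF ctrl_add[OF ctrl_dot[OF lyap_inner[OF g\<pi>(2) g\<rho>]] ctrl_inner[OF b c2, of "-1"]]])
      (simp add: eq power2_norm_eq_inner)
  \<comment> \<open>From the first derivative to the moment itself: \<open>p\<close> is now the
    moment of \<open>y\<close>, bounded by the lower bound for \<open>A\<close>.\<close>
  show ?thesis
    by (rule ctrl_mono[OF ctrl_add[OF ctrl_dot[OF lyap_inner[OF g\<pi>]] ctrl_inner[OF b0 c1, of "-1"]]])
      (simp add: eq power2_norm_eq_inner)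
qed

lemma ctrl_traces: "ctrl (\<lambda>y. (norm (t1 (A y)))\<^sup>2 + (norm (t2 (A y)))\<^sup>2)"
proof -
  obtain f0 f1 f2 f3 \<kappa> where f: "W L1 L2 f0 f1 0 0" "W L1 L2 f1 f2 0 0" "W L1 L2 f2 f3 0 0"
    "ip (one L1 L2) f0 = \<kappa>" "\<kappa> \<noteq> 0"
    by (rule ex_bump[OF L(2)])
  show ?thesis
    by (rule ctrl_LS[OF _ ctrl_add[OF ctrl_moment[OF f(1,2)] ctrl_add[OF ctrl_moment[OF f(2,3)] ctrl_dev]]])
      (use traces_by_moments[OF f(1,4,5)] AH Y_D(1) in \<open>auto simp: lesssim_def\<close>)
qed

lemma ctrl_t: "ctrl (\<lambda>y. (norm (t1 (A y)))\<^sup>2)" "ctrl (\<lambda>y. (norm (t2 (A y)))\<^sup>2)"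
  by (rule ctrl_mono[OF ctrl_traces]; simp)+

text \<open>The oscillation of the temperature is controlled by its gradient. Its mean is tied to
  \<open>t2 - t1\<close> by \<open>ell = 0\<close>, so the control of the interface displacements is
  what settles it.\<close>

lemma ctrl_pt: "ctrl (\<lambda>y. (norm (pt (A y)))\<^sup>2)"
proof (rule ctrl_mono[OF ctrl_add[OF ctrl_scale[OF ctrl_ptx, of "2 * (4 * (L2 - L1)\<^sup>2)"]
        ctrl_scale[OF ctrl_traces, of "2 * (m\<^sup>2 / (L2 - L1)) * 2"]]])
  fix y assume y: "y \<in> Y"
  have "(norm (osc (A y)))\<^sup>2 \<le> 4 * (L2 - L1)\<^sup>2 * (norm (ptx (A y)))\<^sup>2"
    by (rule norm_osc_le[OF Y_D(2,4)[OF y]])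
  moreover have "2 * (m\<^sup>2 / (L2 - L1)) * (norm (t2 (A y) - t1 (A y)))\<^sup>2
    \<le> 2 * (m\<^sup>2 / (L2 - L1)) * (2 * (norm (t2 (A y)))\<^sup>2 + 2 * (norm (t1 (A y)))\<^sup>2)"
    using L by (intro mult_left_mono norm_diff_sq) auto
  moreover have "2 * (m\<^sup>2 / (L2 - L1)) * (2 * (norm (t2 (A y)))\<^sup>2 + 2 * (norm (t1 (A y)))\<^sup>2)
    = 2 * (m\<^sup>2 / (L2 - L1)) * 2 * ((norm (t1 (A y)))\<^sup>2 + (norm (t2 (A y)))\<^sup>2)" by (simp add: algebra_simps)
  ultimately show "(norm (pt (A y)))\<^sup>2 \<le> 2 * (4 * (L2 - L1)\<^sup>2) * (norm (ptx (A y)))\<^sup>2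
    + 2 * (m\<^sup>2 / (L2 - L1)) * 2 * ((norm (t1 (A y)))\<^sup>2 + (norm (t2 (A y)))\<^sup>2)"
    using norm_pt_le[of "A y"] by linarith
qed (use L in auto)

lemma ctrl_h: "ctrl (\<lambda>y. (norm (h1 (A y)))\<^sup>2)" "ctrl (\<lambda>y. (norm (h2 (A y)))\<^sup>2)"
proof -
  have w: "W L1 L2 (pt (A y)) (ptx (A y)) (h1 (A y)) (h2 (A y))" if "y \<in> Y" for y
    by (rule dom_W[OF Y_D(2)[OF that]])
  show "ctrl (\<lambda>y. (norm (h1 (A y)))\<^sup>2)" "ctrl (\<lambda>y. (norm (h2 (A y)))\<^sup>2)"
    by (rule ctrl_mono[OF ctrl_scale[OF ctrl_add[OF ctrl_pt ctrl_ptx], of "1 / (L2 - L1) + 1"]];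
        use trace_bound[OF w L(2)] L in simp)+
qed

text \<open>Collects strains and velocities at the interfaces, which is what the centred multiplier
  produces. The velocities are not covered by \<open>ctrl_traces\<close>, which concerns
  displacements.\<close>

definition bt :: "state \<Rightarrow> real" where
  "bt V = a * ((norm (p1 V))\<^sup>2 + (norm (p2 V))\<^sup>2) + ((norm (t1 (A V)))\<^sup>2 + (norm (t2 (A V)))\<^sup>2)"

lemma bl_mult: "bounded_linear (mulf (aff \<alpha> \<beta> c))"
  by (rule bounded_linear_mulf[OF bdd_mult_aff])

lemma good_pux: "good (\<lambda>y. pux (A y)) (\<lambda>y. pux (A (A y)))"
  by (intro good_linear LS_coords; simp add: H_add H_scale csc_of_real)

lemma good_pw: "good pw (\<lambda>y. pw (A y))" "good (\<lambda>y. pw (A y)) (\<lambda>y. pw (A (A y)))"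
  by (intro good_linear LS_coords; simp add: H_add H_scale csc_of_real)+

lemma good_pu: "good (\<lambda>y. pu (A y)) (\<lambda>y. pu (A (A y)))"
  by (intro good_linear LS_pu; simp add: H_add H_scale csc_of_real)

lemma bdd_coords:
  "bdd (\<lambda>y. (norm (pux (A y)))\<^sup>2)" "bdd (\<lambda>y. (norm (pw (A y)))\<^sup>2)" "bdd (\<lambda>y. (norm (pt (A y)))\<^sup>2)"
  by (intro bdd_coord LS_coords)+

lemma lyap_boundary: "lyap (\<lambda>y. inner (Mm (pux (A y))) (pw (A y)))
  (\<lambda>y. inner (Mm (pux (A (A y)))) (pw (A y)) + inner (Mm (pux (A y))) (pw (A (A y))))"
  by (rule lyap_inner[OF good_bounded_linear[OF bl_mult good_pux] good_pw(2)])

lemma norm_Mm_sq: "(norm (mulf (aff \<alpha> \<beta> c) f))\<^sup>2 \<le> (\<bar>\<alpha>\<bar> + \<bar>\<beta>\<bar> + \<bar>c\<bar>)\<^sup>2 * (norm f)\<^sup>2"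
proof -
  have "(norm (mulf (aff \<alpha> \<beta> c) f))\<^sup>2 \<le> ((\<bar>\<alpha>\<bar> + \<bar>\<beta>\<bar> + \<bar>c\<bar>) * norm f)\<^sup>2"
    by (intro power_mono norm_mulf[OF bdd_mult_aff]) simp
  then show ?thesis by (simp add: power_mult_distrib)
qed

lemma bt_eq: "y \<in> Y \<Longrightarrow> bt (A y) = 4 / (L2 - L1) * (inner (Mm (pux (A (A y)))) (pw (A y)) + inner (Mm (pux (A y))) (pw (A (A y)))
      + (m * inner (Mm (pux (A y))) (ptx (A y)) + (a / 2 * (norm (pux (A y)))\<^sup>2 + 1 / 2 * (norm (pw (A y)))\<^sup>2)))"
proof -
  assume y: "y \<in> Y"
  have 1: "(L2 - L1) / 4 * bt (A y) = inner (Mm (pux (A (A y)))) (pw (A y)) + inner (Mm (pux (A y))) (pw (A (A y)))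
      + (m * inner (Mm (pux (A y))) (ptx (A y)) + (a / 2 * (norm (pux (A y)))\<^sup>2 + 1 / 2 * (norm (pw (A y)))\<^sup>2))"
    using multiplier_boundary[OF Y_D(2)[OF y]] by (simp add: bt_def)
  have "bt (A y) = 4 / (L2 - L1) * ((L2 - L1) / 4 * bt (A y))" using L by simp
  then show ?thesis unfolding 1 .
qed

text \<open>Proved once for an abstract level \<open>P\<close> and used for both. The time
  derivative and the term with \<open>ptx\<close> are controlled in any case; only the kinetic and
  the potential energy on \<open>I\<close> decide the level. Boundedness comes first and feeds
  \<open>ctrl_pw\<close> and \<open>ctrl_pux\<close>, which afterwards upgrade it to
  control.\<close>

lemma boundary_quantity_rule:
  assumes "\<And>R S c. P R \<Longrightarrow> P S \<Longrightarrow> P (\<lambda>y. R y + S y)" "\<And>R c. P R \<Longrightarrow> 0 \<le> c \<Longrightarrow> P (\<lambda>y. c * R y)"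
    "\<And>R S. P S \<Longrightarrow> (\<And>y. y \<in> Y \<Longrightarrow> R y \<le> S y) \<Longrightarrow> P R"
    and "\<And>R. ctrl R \<Longrightarrow> P R" "P (\<lambda>y. (norm (pux (A y)))\<^sup>2)" "P (\<lambda>y. (norm (pw (A y)))\<^sup>2)"
  shows "P (\<lambda>y. bt (A y))"
proof -
  have 1: "P (\<lambda>y. inner (Mm (pux (A (A y)))) (pw (A y)) + inner (Mm (pux (A y))) (pw (A (A y))))"
    by (rule assms(4)[OF ctrl_dot[OF lyap_boundary]])
  have "bdd (\<lambda>y. (norm (Mm (pux (A y))))\<^sup>2)"
    by (rule bdd_mono[OF bdd_scale[OF bdd_coords(1), of "(\<bar>L1\<bar> + \<bar>L2\<bar> + \<bar>mid\<bar>)\<^sup>2"]])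
      (simp_all only: norm_Mm_sq zero_le_power2)
  then have 2: "P (\<lambda>y. m * inner (Mm (pux (A y))) (ptx (A y)))"
    by (intro assms(4) ctrl_inner ctrl_ptx)
  have 3: "P (\<lambda>y. a / 2 * (norm (pux (A y)))\<^sup>2)"
    by (rule assms(2)[OF assms(5)]) (use pos in simp)
  have 4: "P (\<lambda>y. 1 / 2 * (norm (pw (A y)))\<^sup>2)"
    by (rule assms(2)[OF assms(6)]) simp
  have "0 \<le> 4 / (L2 - L1)" using L by simp
  note assms(2)[OF assms(1)[OF 1 assms(1)[OF 2 assms(1)[OF 3 4]]] this]
  then show ?thesis by (rule assms(3)) (simp only: bt_eq order_refl)
qed

lemma bdd_bt: "bdd (\<lambda>y. bt (A y))"
  by (rule boundary_quantity_rule[of bdd, OF bdd_add bdd_scale bdd_mono bdd_ctrl bdd_coords(1,2)])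

lemma ctrl_bt: "ctrl (\<lambda>y. (norm (pux (A y)))\<^sup>2) \<Longrightarrow> ctrl (\<lambda>y. (norm (pw (A y)))\<^sup>2) \<Longrightarrow> ctrl (\<lambda>y. bt (A y))"
  by (rule boundary_quantity_rule[of ctrl, OF ctrl_add ctrl_scale ctrl_mono])

lemma s_sq: "(norm (s1 V))\<^sup>2 \<le> 2 * a * bt V + 2 * m\<^sup>2 * (norm (h1 V))\<^sup>2"
  "(norm (s2 V))\<^sup>2 \<le> 2 * a * bt V + 2 * m\<^sup>2 * (norm (h2 V))\<^sup>2"
proof -
  have p: "a\<^sup>2 * (norm (p1 V))\<^sup>2 \<le> a * bt V" "a\<^sup>2 * (norm (p2 V))\<^sup>2 \<le> a * bt V"
    using pos by (auto simp: bt_def power2_eq_square distrib_left)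
  show "(norm (s1 V))\<^sup>2 \<le> 2 * a * bt V + 2 * m\<^sup>2 * (norm (h1 V))\<^sup>2"
    using norm_diff_sq[of "complex_of_real a * p1 V" "complex_of_real m * h1 V"] p(1)
    by (simp add: s1_def norm_mult power_mult_distrib)
  show "(norm (s2 V))\<^sup>2 \<le> 2 * a * bt V + 2 * m\<^sup>2 * (norm (h2 V))\<^sup>2"
    using norm_diff_sq[of "complex_of_real a * p2 V" "complex_of_real m * h2 V"] p(2)
    by (simp add: s2_def norm_mult power_mult_distrib)
qed

lemma bdd_s: "bdd (\<lambda>y. (norm (s1 (A y)))\<^sup>2)" "bdd (\<lambda>y. (norm (s2 (A y)))\<^sup>2)"
  using pos
  by (auto intro!: bdd_mono[OF bdd_add[OF bdd_scale[OF bdd_bt, of "2 * a"] bdd_scale[OF bdd_ctrl[OF ctrl_h(1)], of "2 * m\<^sup>2"]] s_sq(1)]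
      bdd_mono[OF bdd_add[OF bdd_scale[OF bdd_bt, of "2 * a"] bdd_scale[OF bdd_ctrl[OF ctrl_h(2)], of "2 * m\<^sup>2"]] s_sq(2)])

lemma bdd_stress: "bdd (\<lambda>y. (norm (stress (A y)))\<^sup>2)"
proof (rule bdd_mono[OF bdd_add[OF bdd_scale[OF bdd_coords(1), of "2 * a\<^sup>2"] bdd_scale[OF bdd_coords(3), of "2 * m\<^sup>2"]]])
  fix y
  show "(norm (stress (A y)))\<^sup>2 \<le> 2 * a\<^sup>2 * (norm (pux (A y)))\<^sup>2 + 2 * m\<^sup>2 * (norm (pt (A y)))\<^sup>2"
    using norm_diff_sq[of "a *\<^sub>R pux (A y)" "m *\<^sub>R pt (A y)"] by (simp add: stress_def power_mult_distrib)
qed auto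

text \<open>Differentiating the pairing of \<open>k^2 * ptx y - m * pw y\<close> with
  \<open>pw (A y)\<close> produces \<open>- m * (norm (pw (A y)))^2\<close>. By
  \<open>multiplier_heat\<close> the other terms are products with one bounded and one controlled
  factor; boundedness of the interface stresses is enough.\<close>

lemma ctrl_pw: "ctrl (\<lambda>y. (norm (pw (A y)))\<^sup>2)"
proof -
  have bl: "bounded_linear (\<lambda>x::l2. r *\<^sub>R x)" for r by (rule bounded_linear_scaleR_right)
  note g = good_diff[OF good_bounded_linear[OF bl good_ptx, of "k\<^sup>2"] good_bounded_linear[OF bl good_pw(1), of m]]
  note Q = lyap_inner[OF g good_pw(2)]
  have "ctrl (\<lambda>y. 1 / m * (- (inner (k\<^sup>2 *\<^sub>R ptx (A y) - m *\<^sub>R pw (A y)) (pw (A y)) + inner (k\<^sup>2 *\<^sub>R ptx y - m *\<^sub>R pw y) (pw (A (A y))))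
     + (k\<^sup>2 * inner (pw (A y)) (ptx (A y)) + (m * inner (s1 (A y)) (t1 (A y)) + (- m * inner (s2 (A y)) (t2 (A y))
       + (- 1) * inner (stress (A y)) (pt (A y)))))))"
    using pos by (intro ctrl_scale ctrl_add ctrl_neg_dot[OF Q] ctrl_inner bdd_coords bdd_s bdd_stress ctrl_ptx ctrl_t ctrl_pt) simp
  then show ?thesis
  proof (rule ctrl_mono)
    fix y assume y: "y \<in> Y"
    have "m * (norm (pw (A y)))\<^sup>2 = - (inner (k\<^sup>2 *\<^sub>R ptx (A y) - m *\<^sub>R pw (A y)) (pw (A y)) + inner (k\<^sup>2 *\<^sub>R ptx y - m *\<^sub>R pw y) (pw (A (A y))))
     + (k\<^sup>2 * inner (pw (A y)) (ptx (A y)) + (m * inner (s1 (A y)) (t1 (A y)) + (- m * inner (s2 (A y)) (t2 (A y))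
       + (- 1) * inner (stress (A y)) (pt (A y)))))"
      unfolding multiplier_heat[OF Y_D(1,2)[OF y]]
      by (simp add: inner_diff_left power2_norm_eq_inner inner_commute algebra_simps)
    then show "(norm (pw (A y)))\<^sup>2 \<le> 1 / m * (- (inner (k\<^sup>2 *\<^sub>R ptx (A y) - m *\<^sub>R pw (A y)) (pw (A y)) + inner (k\<^sup>2 *\<^sub>R ptx y - m *\<^sub>R pw y) (pw (A (A y))))
     + (k\<^sup>2 * inner (pw (A y)) (ptx (A y)) + (m * inner (s1 (A y)) (t1 (A y)) + (- m * inner (s2 (A y)) (t2 (A y))
       + (- 1) * inner (stress (A y)) (pt (A y))))))"
      using pos by (simp add: pos_le_divide_eq mult.commute)
  qed
qed

text \<open>Equipartition: once the kinetic energy on \<open>I\<close> is controlled, the potential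
  energy differs from it by a time derivative and products of a bounded with a controlled
  factor.\<close>

lemma ctrl_pux: "ctrl (\<lambda>y. (norm (pux (A y)))\<^sup>2)"
proof -
  note Q = lyap_inner[OF good_pu good_pw(2)]
  have "ctrl (\<lambda>y. 1 / a * (- (inner (pu (A (A y))) (pw (A y)) + inner (pu (A y)) (pw (A (A y))))
     + ((norm (pw (A y)))\<^sup>2 + (1 * inner (s2 (A y)) (t2 (A y)) + (- 1 * inner (s1 (A y)) (t1 (A y)) + m * inner (pux (A y)) (pt (A y)))))))"
    using pos by (intro ctrl_scale ctrl_add ctrl_neg_dot[OF Q] ctrl_inner bdd_coords bdd_s ctrl_pw ctrl_t ctrl_pt) simp
  then show ?thesis
  proof (rule ctrl_mono)
    fix y assume y: "y \<in> Y"
    have "a * (norm (pux (A y)))\<^sup>2 = - (inner (pu (A (A y))) (pw (A y)) + inner (pu (A y)) (pw (A (A y))))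
     + ((norm (pw (A y)))\<^sup>2 + (1 * inner (s2 (A y)) (t2 (A y)) + (- 1 * inner (s1 (A y)) (t1 (A y)) + m * inner (pux (A y)) (pt (A y)))))"
      unfolding multiplier_equipartition[OF Y_D(2)[OF y]] pu_A[OF Y_D(2)[OF y]]
      by (simp add: power2_norm_eq_inner inner_commute algebra_simps)
    then show "(norm (pux (A y)))\<^sup>2 \<le> 1 / a * (- (inner (pu (A (A y))) (pw (A y)) + inner (pu (A y)) (pw (A (A y))))
     + ((norm (pw (A y)))\<^sup>2 + (1 * inner (s2 (A y)) (t2 (A y)) + (- 1 * inner (s1 (A y)) (t1 (A y)) + m * inner (pux (A y)) (pt (A y))))))"
      using pos by (simp add: pos_le_divide_eq mult.commute)
  qed
qed

lemma ctrl_boundary: "ctrl (\<lambda>y. bt (A y))"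
  by (rule ctrl_bt[OF ctrl_pux ctrl_pw])

lemma ctrl_s: "ctrl (\<lambda>y. (norm (s1 (A y)))\<^sup>2)" "ctrl (\<lambda>y. (norm (s2 (A y)))\<^sup>2)"
  using pos
  by (auto intro!: ctrl_mono[OF ctrl_add[OF ctrl_scale[OF ctrl_boundary, of "2 * a"] ctrl_scale[OF ctrl_h(1), of "2 * m\<^sup>2"]] s_sq(1)]
      ctrl_mono[OF ctrl_add[OF ctrl_scale[OF ctrl_boundary, of "2 * a"] ctrl_scale[OF ctrl_h(2), of "2 * m\<^sup>2"]] s_sq(2)])

lemma ctrl_tt: "ctrl (\<lambda>y. (norm (t1 (A (A y))))\<^sup>2)" "ctrl (\<lambda>y. (norm (t2 (A (A y))))\<^sup>2)"
  using pos by (auto intro!: ctrl_mono[OF ctrl_boundary] simp: bt_def)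

text \<open>There is no damping on \<open>J\<close>; its energy is read off from velocity and stress
  at the interface, which the estimates on \<open>I\<close> have made controlled by now.\<close>

lemma ctrl_left: "ctrl (\<lambda>y. (norm (zl (A y)))\<^sup>2 + b * (norm (vxl (A y)))\<^sup>2)"
proof -
  have g: "good (\<lambda>y. vxl (A y)) (\<lambda>y. vxl (A (A y)))" "good (\<lambda>y. zl (A y)) (\<lambda>y. zl (A (A y)))"
    by (intro good_linear LS_coords; simp add: H_add H_scale csc_of_real)+
  note Q = lyap_scale[OF lyap_inner[OF good_bounded_linear[OF bl_mult[of 0 L1 0] g(1)] g(2)], of 2]
  show ?thesis
    by (rule ctrl_mono[OF ctrl_add[OF ctrl_add[OF ctrl_scale[OF ctrl_tt(1), of L1] ctrl_scale[OF ctrl_s(1), of "L1 / b"]]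
            ctrl_neg_dot[OF Q]]]) (use L pos multiplier_left[OF Y_D(2)] in auto)
qed

lemma ctrl_right: "ctrl (\<lambda>y. (norm (zr (A y)))\<^sup>2 + b * (norm (vxr (A y)))\<^sup>2)"
proof -
  have g: "good (\<lambda>y. vxr (A y)) (\<lambda>y. vxr (A (A y)))" "good (\<lambda>y. zr (A y)) (\<lambda>y. zr (A (A y)))"
    by (intro good_linear LS_coords; simp add: H_add H_scale csc_of_real)+
  note Q = lyap_scale[OF lyap_inner[OF good_bounded_linear[OF bl_mult[of L2 L3 L3] g(1)] g(2)], of 2]
  show ?thesis
    by (rule ctrl_mono[OF ctrl_add[OF ctrl_add[OF ctrl_scale[OF ctrl_tt(2), of "L3 - L2"] ctrl_scale[OF ctrl_s(2), of "(L3 - L2) / b"]]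
            ctrl_neg_dot[OF Q]]]) (use L pos multiplier_right[OF Y_D(2)] in auto)
qed

theorem ctrl_energy: "ctrl E"
proof (rule ctrl_mono[OF ctrl_add[OF ctrl_add[OF ctrl_scale[OF ctrl_pux, of a] ctrl_pw]
        ctrl_add[OF ctrl_pt ctrl_add[OF ctrl_left ctrl_right]]]])
  fix y assume "y \<in> Y"
  then show "E y \<le> a * (norm (pux (A y)))\<^sup>2 + (norm (pw (A y)))\<^sup>2 + ((norm (pt (A y)))\<^sup>2 +
    ((norm (zl (A y)))\<^sup>2 + b * (norm (vxl (A y)))\<^sup>2 + ((norm (zr (A y)))\<^sup>2 + b * (norm (vxr (A y)))\<^sup>2)))"
    using N_sq[OF AH[OF Y_D(1)]] by (simp add: algebra_simps)
qed (use pos in simp)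

end

section \<open>Kernel and range\<close>

context transmission
begin

lemma N_eq_0:
  assumes U: "U \<in> H" and 0: "N U = 0" shows "U = 0"
proof -
  obtain u1 v1 \<theta> u2 v2 where eq: "U = (u1, v1, \<theta>, u2, v2)" by (cases U)
  have h: "u1 \<in> Sob1 I" "v1 \<in> Sob1 J" "\<theta> \<in> Lsq I" "u2 \<in> Lsq I" "v2 \<in> Lsq J"
    using U by (auto simp: eq HF_iff)
  have z: "\<pi> U = 0" if "LS (\<lambda>U. (norm (\<pi> U))\<^sup>2) (\<lambda>U. (N U)\<^sup>2)" for \<pi> :: "state \<Rightarrow> l2"
    using that U 0 unfolding lesssim_def by fastforce
  have I0: "f = 0" if "f \<in> Lsq I" "el f = 0" for f
    by (rule el_inj[OF that(1) Lsq_zero]) (simp add: that(2) el_zero)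
  have J0: "f = 0" if "f \<in> Lsq J" "cut 0 L1 (el f) = 0" "cut L2 L3 (el f) = 0" for f
  proof (rule el_inj[OF that(1) Lsq_zero])
    show "el f = el 0" using cut_Un[OF supp_el[OF that(1)]] that L by (simp add: el_zero)
  qed
  have "u1 = 0" using z[OF lesssim_trans[OF LS_pot(4) pot_le_N]]
    by (intro I0 Sob1_intervalE(1)[OF L(2) h(1)]) (simp add: eq)
  moreover have "v1 = 0"
    using z[OF lesssim_trans[OF LS_pot(2) pot_le_N]] z[OF lesssim_trans[OF LS_pot(3) pot_le_N]]
    by (intro J0 J.Sob1_E(1)[OF h(2)]) (simp_all add: eq)
  moreover have "\<theta> = 0" "u2 = 0" using z[OF LS_coords(2)] z[OF LS_coords(3)] h by (auto intro: I0 simp: eq)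
  moreover have "v2 = 0" using z[OF LS_coords(6)] z[OF LS_coords(7)] by (intro J0 h) (simp_all add: eq)
  ultimately show ?thesis by (simp add: eq zero_prod_def)
qed

lemma ell_add: "U \<in> H \<Longrightarrow> V \<in> H \<Longrightarrow> ell (U + V) = ell U + ell V"
  by (simp add: ell_def H_add ip_add_left algebra_simps)

lemma ell_scale: "U \<in> H \<Longrightarrow> ell (scale_state c U) = c * ell U"
  by (simp add: ell_def H_scale ip_csc_left algebra_simps)

lemma ell_diff: "U \<in> H \<Longrightarrow> V \<in> H \<Longrightarrow> ell (U - V) = ell U - ell V"
proof -
  assume h: "U \<in> H" "V \<in> H"
  have "ell (- V) = - ell V" unfolding uminus_state using ell_scale[OF h(2), of "-1"] by simp
  then show ?thesis using ell_add[OF h(1) H_uminus[OF h(2)]] by simp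
qed

lemma zero_H: "0 \<in> H"
proof -
  have w: "W L1 L2 0 0 0 0" "W 0 L1 0 0 0 0" "W L2 L3 0 0 0 0"
    using W_scaleR[OF W_one[OF L12(1)], of 0] W_scaleR[OF W_one[OF L12(2)], of 0]
      W_scaleR[OF W_one[OF L12(3)], of 0] by simp_all
  obtain U where "U \<in> H"
    using ex_state[OF w supp_zero supp_zero supp_zero supp_zero] by blast
  from H_diff[OF this this] show ?thesis by simp
qed

lemma N_0: "N 0 = 0"
  using emb_add[OF zero_H zero_H] norm_emb[OF zero_H] by simp

lemma scale_state_zero: "scale_state c 0 = 0"
proof -
  have "scale_l0 c 0 = 0"
  proof (rule l0_eqI)
    show "AE x in lborel. rep_l0 (scale_l0 c 0) x = rep_l0 0 x"
      using rep_l0_scale[of c 0] rep_l0_zero by eventually_elim simp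
  qed
  then show ?thesis by (simp add: zero_prod_def)
qed

lemma ell_0: "ell 0 = 0"
  using ell_diff[OF zero_H zero_H] by simp

lemma D0_unique: "U \<in> D0 \<Longrightarrow> A U = 0 \<Longrightarrow> U = 0"
proof -
  assume U: "U \<in> D0" "A U = 0"
  obtain C where "(N U)\<^sup>2 \<le> C * (N (A U))\<^sup>2" using a_priori U(1) unfolding lesssim_def by blast
  then have "N U = 0" using U(2) by (simp add: N_0)
  then show "U = 0" using N_eq_0[of U] U(1) D_subset_H by (auto simp: D0_def)
qed

text \<open>The free constant in \<open>solve\<close> gives a stationary state whose temperature is
  1 at \<open>L1\<close>. If \<open>ell\<close> vanished on it, injectivity on \<open>D0\<close>
  would force it to be zero.\<close>

lemma ex_kernel: obtains \<kappa> where "\<kappa> \<in> D" "A \<kappa> = 0" "ell \<kappa> \<noteq> 0"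
proof -
  obtain \<kappa> h where \<kappa>: "\<kappa> \<in> D" "A \<kappa> = 0" "W L1 L2 (pt \<kappa>) (ptx \<kappa>) 1 h"
    using solve[OF zero_H ell_0, of 1] by blast
  have "ell \<kappa> \<noteq> 0"
  proof
    assume "ell \<kappa> = 0"
    then have "\<kappa> = 0" using D0_unique \<kappa> by (auto simp: D0_def)
    then have "pt \<kappa> = 0" using H_add(4)[OF zero_H zero_H] by simp
    moreover have "W L1 L2 0 0 0 0" using W_scaleR[OF W_one[OF L12(1)], of 0] by simp
    ultimately show False using W_unique(2)[OF L(2) \<kappa>(3), of 0 0 0] by simp
  qed
  with \<kappa> show ?thesis by (intro that)
qed

lemma range_iff: "rangeAF L1 L2 L3 a b m k = {V \<in> H. ell V = 0}"
proof -
  have "A U \<in> H \<and> ell (A U) = 0" if "U \<in> D" for U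
    using AH[OF that] step_ell[OF dom_step(2)[OF that]] by blast
  moreover have "\<exists>U\<in>D. A U = V" if "V \<in> H" "ell V = 0" for V using solve[OF that] by blast
  ultimately show ?thesis unfolding rangeAF_def by blast
qed

text \<open>A preimage may be changed by a kernel element, and a multiple of \<kappa> corrects the
  value of \<open>ell\<close> to zero.\<close>

lemma solve0: assumes "V \<in> H" "ell V = 0" shows "\<exists>U\<in>D0. A U = V"
proof -
  obtain U where U: "U \<in> D" "A U = V" using solve[OF assms] by blast
  obtain \<kappa> where \<kappa>: "\<kappa> \<in> D" "A \<kappa> = 0" "ell \<kappa> \<noteq> 0" by (rule ex_kernel)
  define K where "K = scale_state (ell U / ell \<kappa>) \<kappa>"
  have K: "K \<in> D" "A K = 0" "ell K = ell U"
    using D_scale[OF \<kappa>(1)] ell_scale[OF D_subset_H[OF \<kappa>(1)]] \<kappa> by (simp_all add: K_def scale_state_zero)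
  have "ell (U - K) = 0" using ell_diff[OF D_subset_H[OF U(1)] D_subset_H[OF K(1)]] K(3) by simp
  then have "U - K \<in> D0" using D_diff(1)[OF U(1) K(1)] by (simp add: D0_def)
  moreover have "A (U - K) = V" using D_diff(2)[OF U(1) K(1)] U(2) K(2) by simp
  ultimately show ?thesis by blast
qed

end

section \<open>Exponential decay\<close>

context thermoelastic_semigroup
begin

lemma lyap_energies:
  "lyap E (\<lambda>y. - (2 * k\<^sup>2 * (norm (ptx (A y)))\<^sup>2))"
  "lyap (\<lambda>y. (N y)\<^sup>2) (\<lambda>y. - (2 * k\<^sup>2 * (norm (ptx y))\<^sup>2))"
proof -
  have "LS (\<lambda>U. (norm (emb U))\<^sup>2) (\<lambda>U. (N U)\<^sup>2)"
    by (rule lesssimI[of 1]) (simp_all add: norm_emb)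
  note g = good_linear[of emb, OF emb_add emb_scaleR this]
  have eq: "inner (emb U) (emb U) = (N U)\<^sup>2" if "U \<in> H" for U
    using norm_emb[OF that] by (simp add: power2_norm_eq_inner[symmetric])
  have eq': "inner (emb (A U)) (emb U) + inner (emb U) (emb (A U)) = - (2 * k\<^sup>2 * (norm (ptx U))\<^sup>2)" if "U \<in> D" for U
    using dissipation[OF that] by (simp add: innerR_def inner_commute)
  \<comment> \<open>The identities for the energies hold only on \<open>Y\<close>; as orbits remain
    in \<open>Y\<close>, this is enough for the derivative along them.\<close>
  have cong: "lyap Q Q'" if l: "lyap R R'" and e: "\<And>y. y \<in> Y \<Longrightarrow> Q y = R y" "\<And>y. y \<in> Y \<Longrightarrow> Q' y = R' y" for Q Q' R R'
  proof -
    obtain K where K: "0 \<le> K" "\<And>y. y \<in> Y \<Longrightarrow> \<bar>R y\<bar> \<le> K * (N (A y))\<^sup>2" using lyap_bound[OF l] by blast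
    show ?thesis
    proof (rule lyapI[OF K(1)])
      show "\<bar>Q y\<bar> \<le> K * (N (A y))\<^sup>2" if "y \<in> Y" for y using K(2)[OF that] e(1)[OF that] by simp
      fix y t assume y: "y \<in> Y" and t: "0 \<le> (t::real)"
      have "((\<lambda>s. R (T s y)) has_real_derivative Q' (T t y)) (at t within {0..})"
        using lyap_deriv[OF l y t] e(2)[OF T_Y[OF t y]] by simp
      then show "((\<lambda>s. Q (T s y)) has_real_derivative Q' (T t y)) (at t within {0..})"
      proof (rule has_field_derivative_transform_within[OF _ zero_less_one])
        show "t \<in> {0..}" using t by simp
        show "R (T s y) = Q (T s y)" if "s \<in> {0..}" for s using e(1)[OF T_Y[OF _ y], of s] that by simp
      qed
    qed
  qed
  show "lyap E (\<lambda>y. - (2 * k\<^sup>2 * (norm (ptx (A y)))\<^sup>2))"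
    by (rule cong[OF lyap_inner[OF g(2) g(2)]]) (simp_all add: eq eq' AH Y_D)
  show "lyap (\<lambda>y. (N y)\<^sup>2) (\<lambda>y. - (2 * k\<^sup>2 * (norm (ptx y))\<^sup>2))"
    by (rule cong[OF lyap_inner[OF g(1) g(1)]]) (simp_all add: eq eq' Y_D D_subset_H)
qed

text \<open>The controlled energy estimate has the form \<open>E \<le> Q' + E / 2 + C * Dis\<close>.
  Subtracting \<open>Q\<close> from a large multiple of the two energies turns it into a
  differential inequality.\<close>

lemma ex_lyapunov:
  "\<exists>F F' K. lyap F F' \<and> 0 < K \<and> (\<forall>y\<in>Y. E y \<le> F y \<and> F y \<le> K * E y \<and> F' y \<le> - E y / 2)"
proof -
  obtain Q Q' C where Q: "lyap Q Q'" "0 \<le> C" "\<And>y. y \<in> Y \<Longrightarrow> E y \<le> Q' y + 1 / 2 * E y + C * Dis y"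
    using ctrl_energy unfolding ctrl_def by (elim allE[of _ "1 / 2"]) auto
  obtain B where B: "0 \<le> B" "\<And>y. y \<in> Y \<Longrightarrow> \<bar>Q y\<bar> \<le> B * (N (A y))\<^sup>2" using lyap_bound[OF Q(1)] by blast
  obtain G where G: "0 \<le> G" "\<And>y. y \<in> D0 \<Longrightarrow> (N y)\<^sup>2 \<le> G * E y" using a_priori unfolding lesssim_def by blast
  \<comment> \<open>The part \<open>B + 1\<close> outweighs \<open>Q\<close> and leaves one copy of
    \<open>E y\<close>; the part \<open>C / (2 * k^2)\<close> makes the two dissipations absorb
    \<open>C * Dis y\<close>.\<close>
  define M where "M = B + 1 + C / (2 * k\<^sup>2)"
  have k2: "0 < 2 * k\<^sup>2" using pos by simp
  have M: "0 \<le> M" "B + 1 \<le> M" "C \<le> M * (2 * k\<^sup>2)"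
  proof -
    have "0 \<le> C / (2 * k\<^sup>2)" using Q(2) k2 by simp
    then show "0 \<le> M" "B + 1 \<le> M" using B(1) by (simp_all add: M_def)
    have "C = C / (2 * k\<^sup>2) * (2 * k\<^sup>2)" using k2 by simp
    also have "\<dots> \<le> M * (2 * k\<^sup>2)" using B(1) k2 by (intro mult_right_mono) (auto simp: M_def)
    finally show "C \<le> M * (2 * k\<^sup>2)" .
  qed
  have l: "lyap (\<lambda>y. M * (E y + (N y)\<^sup>2) + (- 1) * Q y)
    (\<lambda>y. M * (- (2 * k\<^sup>2 * (norm (ptx (A y)))\<^sup>2) + - (2 * k\<^sup>2 * (norm (ptx y))\<^sup>2)) + (- 1) * Q' y)"
    by (intro lyap_add lyap_scale lyap_energies Q)
  show ?thesis
  proof (intro exI conjI ballI)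
    show "lyap (\<lambda>y. M * (E y + (N y)\<^sup>2) + (- 1) * Q y)
      (\<lambda>y. M * (- (2 * k\<^sup>2 * (norm (ptx (A y)))\<^sup>2) + - (2 * k\<^sup>2 * (norm (ptx y))\<^sup>2)) + (- 1) * Q' y)" by (rule l)
    show "0 < M * (1 + G) + B + 1" using M(1) G(1) B(1) by (simp add: add_nonneg_pos)
    fix y assume y: "y \<in> Y"
    have "(B + 1) * E y \<le> M * E y" using M(2) by (intro mult_right_mono) auto
    moreover have "0 \<le> M * (N y)\<^sup>2" using M(1) by simp
    ultimately show "E y \<le> M * (E y + (N y)\<^sup>2) + (- 1) * Q y"
      using B(2)[OF y] unfolding distrib_left distrib_right abs_le_iff by linarith
    \<comment> \<open>The energy of \<open>y\<close> is dominated by that of \<open>A y\<close>;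
      without this the functional would not be comparable with \<open>E y\<close>, and no
      exponential rate would result.\<close>
    have "M * (N y)\<^sup>2 \<le> M * (G * E y)" using G(2)[OF Y_D(5)[OF y]] M(1) by (rule mult_left_mono)
    moreover have "0 \<le> E y" by simp
    moreover have "(M * (1 + G) + B + 1) * E y = M * E y + M * (G * E y) + B * E y + E y"
      by (simp add: algebra_simps)
    moreover have "M * (E y + (N y)\<^sup>2) = M * E y + M * (N y)\<^sup>2" by (rule distrib_left)
    ultimately show "M * (E y + (N y)\<^sup>2) + (- 1) * Q y \<le> (M * (1 + G) + B + 1) * E y"
      using B(2)[OF y] unfolding abs_le_iff by linarith
    have "C * Dis y \<le> M * (2 * k\<^sup>2) * Dis y" using M(3) by (intro mult_right_mono) auto
    moreover have "M * (- (2 * k\<^sup>2 * (norm (ptx (A y)))\<^sup>2) + - (2 * k\<^sup>2 * (norm (ptx y))\<^sup>2)) = - (M * (2 * k\<^sup>2) * Dis y)"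
      by (simp add: algebra_simps)
    ultimately show "M * (- (2 * k\<^sup>2 * (norm (ptx (A y)))\<^sup>2) + - (2 * k\<^sup>2 * (norm (ptx y))\<^sup>2)) + (- 1) * Q' y \<le> - E y / 2"
      using Q(3)[OF y] by linarith
  qed
qed

lemma decay_Y: obtains K \<omega> where "0 < K" "0 < \<omega>" "\<And>y t. y \<in> Y \<Longrightarrow> 0 \<le> t \<Longrightarrow> N (T t (A y)) \<le> K * exp (- \<omega> * t) * N (A y)"
proof -
  obtain F F' K where l: "lyap F F'" and K: "0 < K"
    and "\<forall>y\<in>Y. E y \<le> F y \<and> F y \<le> K * E y \<and> F' y \<le> - E y / 2"
    using ex_lyapunov by (elim exE conjE)
  then have F: "lyap F F'" "0 < K" "\<And>y. y \<in> Y \<Longrightarrow> E y \<le> F y" "\<And>y. y \<in> Y \<Longrightarrow> F y \<le> K * E y"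
    "\<And>y. y \<in> Y \<Longrightarrow> F' y \<le> - E y / 2"
    by simp_all
  \<comment> \<open>From \<open>F' \<le> - E / 2\<close> and \<open>F \<le> K * E\<close> one gets
    \<open>F' \<le> - w * F\<close> with this rate; the norm, being a square root, decays at half of
    it.\<close>
  define w where "w = 1 / (2 * K)"
  have w: "0 < w" using F(2) by (simp add: w_def)
  have Fw: "F' y + w * F y \<le> 0" if "y \<in> Y" for y
  proof -
    have "w * F y \<le> w * (K * E y)" using F(4)[OF that] w by (intro mult_left_mono) auto
    also have "\<dots> = E y / 2" using F(2) by (simp add: w_def)
    finally show ?thesis using F(5)[OF that] by linarith
  qed
  have main: "F (T t y) \<le> exp (- w * t) * F y" if y: "y \<in> Y" and t: "0 \<le> t" for y t
  proof -
    define g where "g s = exp (w * s) * F (T s y)" for s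
    have der: "(g has_real_derivative exp (w * s) * (F' (T s y) + w * F (T s y))) (at s within {0..})" if s: "0 \<le> s" for s
    proof -
      have "((\<lambda>s. exp (w * s)) has_real_derivative w * exp (w * s)) (at s within {0..})"
        by (auto intro!: derivative_eq_intros)
      from DERIV_mult[OF this lyap_deriv[OF F(1) y s]] show ?thesis
        unfolding g_def by (rule DERIV_cong) (simp only: distrib_left ac_simps)
    qed
    have "g t \<le> g 0"
    proof (rule DERIV_nonpos_imp_decreasing_open[OF t])
      fix s assume s: "0 < s" "s < t"
      have "at s within {0..} = at s" using s by (intro at_within_interior) simp
      then have "(g has_real_derivative exp (w * s) * (F' (T s y) + w * F (T s y))) (at s)"
        using der[of s] s by simp
      moreover have "exp (w * s) * (F' (T s y) + w * F (T s y)) \<le> 0"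
        using Fw[OF T_Y[OF _ y], of s] s by (simp add: mult_nonneg_nonpos)
      ultimately show "\<exists>z. (g has_real_derivative z) (at s) \<and> z \<le> 0" by blast
    next
      have "continuous_on {0..} g"
        unfolding continuous_on_eq_continuous_within using DERIV_continuous[OF der] by simp
      then show "continuous_on {0..t} g" by (rule continuous_on_subset) auto
    qed
    then have "exp (w * t) * F (T t y) \<le> F y"
      using T_0[OF D_subset_H[OF Y_D(1)[OF y]]] by (simp add: g_def)
    then have "exp (- w * t) * (exp (w * t) * F (T t y)) \<le> exp (- w * t) * F y"
      by (intro mult_left_mono) auto
    then show ?thesis by (simp add: mult.assoc[symmetric] exp_add[symmetric])
  qed
  show ?thesis
  proof (rule that[of "sqrt K" "w / 2"])
    show "0 < sqrt K" "0 < w / 2" using F(2) w by auto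
    fix y t assume y: "y \<in> Y" and t: "0 \<le> (t::real)"
    have "E (T t y) \<le> F (T t y)" by (rule F(3)[OF T_Y[OF t y]])
    also have "\<dots> \<le> exp (- w * t) * F y" by (rule main[OF y t])
    also have "\<dots> \<le> exp (- w * t) * (K * E y)" using F(4)[OF y] by (intro mult_left_mono) auto
    finally have "(N (T t (A y)))\<^sup>2 \<le> exp (- w * t) * (K * (N (A y))\<^sup>2)"
      using T_D(2)[OF t Y_D(1)[OF y]] by simp
    also have "\<dots> = (sqrt K * exp (- (w / 2) * t) * N (A y))\<^sup>2"
      using F(2) by (simp add: power_mult_distrib exp_double[symmetric])
    finally show "N (T t (A y)) \<le> sqrt K * exp (- (w / 2) * t) * N (A y)"
      by (rule power2_le_imp_le) (use F(2) N_nonneg[OF AH[OF Y_D(1)[OF y]]] in simp)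
  qed
qed

text \<open>A state \<open>x\<close> in the range is \<open>A z\<close> with \<open>z\<close> only
  in the domain. The difference quotients of the orbit of \<open>z\<close> approximate
  \<open>x\<close> and have the regularity that \<open>decay_Y\<close> demands; contractivity
  handles the error.\<close>

lemma decay_range:
  obtains K \<omega> where "0 < K" "0 < \<omega>"
    "\<And>x t. x \<in> H \<Longrightarrow> ell x = 0 \<Longrightarrow> 0 \<le> t \<Longrightarrow> N (T t x) \<le> K * exp (- \<omega> * t) * N x"
proof -
  obtain K \<omega> where K: "0 < K" "0 < \<omega>" "\<And>y t. y \<in> Y \<Longrightarrow> 0 \<le> t \<Longrightarrow> N (T t (A y)) \<le> K * exp (- \<omega> * t) * N (A y)"
    by (rule decay_Y) blast
  have "N (T t x) \<le> K * exp (- \<omega> * t) * N x" if x: "x \<in> H" "ell x = 0" and t: "0 \<le> t" for x t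
  proof -
    define c where "c = K * exp (- \<omega> * t)"
    have c: "0 \<le> c" using K(1) by (simp add: c_def)
    obtain z where z: "z \<in> D0" "A z = x" using solve0[OF x] by blast
    have zD: "z \<in> D" "ell z = 0" "z \<in> H" using z D_subset_H by (auto simp: D0_def)
    have step: "N (T t x) \<le> c * N x + (c + 1) * N (quot h z - x)" if h: "0 < h" for h
    proof -
      \<comment> \<open>The quotient is a combination of two elements of the domain, whereas its
        limit \<open>x\<close> need not lie there.\<close>
      have qD: "quot h z \<in> D" using h zD by (intro D_scale D_diff T_D) auto
      note qH = D_subset_H[OF qD]
      have "ell (quot h z) = 0"
        using h zD T_ell[of h z] by (simp add: ell_scale ell_diff H_diff T_H)
      then obtain y where y: "y \<in> D0" "A y = quot h z" using solve0[OF qH] by blast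
      then have "y \<in> Y" using qD by (simp add: Y_def)
      then have 1: "N (T t (quot h z)) \<le> c * N (quot h z)" using K(3)[of y t] t y(2) by (simp add: c_def)
      have dH: "quot h z - x \<in> H" using qH x by (intro H_diff)
      have "T t x = T t (quot h z) + (- T t (quot h z - x))"
        using t qH x by (simp add: T_diff)
      then have "N (T t x) \<le> N (T t (quot h z)) + N (T t (quot h z - x))"
        using N_triangle[OF T_H[OF t qH] H_uminus[OF T_H[OF t dH]]] N_uminus[OF T_H[OF t dH]] by simp
      also have "\<dots> \<le> c * N (quot h z) + N (quot h z - x)" using 1 T_N[OF t dH] by linarith
      also have "N (quot h z) \<le> N x + N (quot h z - x)" using N_triangle[OF x(1) dH] by simp
      finally show ?thesis using c by (simp add: distrib_left distrib_right mult_left_mono)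
    qed
    have "((\<lambda>h. c * N x + (c + 1) * N (quot h z - x)) \<longlongrightarrow> c * N x + (c + 1) * 0) (at_right 0)"
      using gen_lim[OF zD(1)] unfolding z(2) by (intro tendsto_intros)
    then have "N (T t x) \<le> c * N x + (c + 1) * 0"
      by (rule tendsto_lowerbound) (use step in \<open>auto intro!: eventually_at_rightI[of 0 1]\<close>)
    then show ?thesis by (simp add: c_def)
  qed
  with K(1,2) show ?thesis by (rule that)
qed

text \<open>The orbit has derivative zero. This is read through the isometry \<open>emb\<close>,
  because the mean value theorem needs values in a normed space.\<close>

lemma T_kernel:
  assumes W: "w \<in> D" "A w = 0" and t: "0 \<le> t" shows "T t w = w"
proof -
  note wH = D_subset_H[OF W(1)]
  have z: "emb 0 = 0" using emb_add[OF zero_H zero_H] by simp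
  have T0: "T s 0 = 0" if "0 \<le> s" for s using T_add[OF that zero_H zero_H] by simp
  have der: "((\<lambda>s. emb (T s w)) has_vector_derivative 0) (at s within {0..})" if s: "s \<in> {0..}" for s
    using deriv_bounded[of emb 1 s w] W s z T0[of s] norm_emb emb_add emb_scaleR by simp
  obtain c where "\<And>s. s \<in> {0..} \<Longrightarrow> emb (T s w) = c"
    using has_vector_derivative_zero_constant[OF convex_real_interval(1)[of 0] der] by blast
  then have "emb (T t w) = emb (T 0 w)" using t by simp
  then have "emb (T t w - w) = 0"
    using T_0[OF wH] emb_add[OF T_H[OF t wH] H_uminus[OF wH]] emb_add[OF wH H_uminus[OF wH]] z by simp
  then have "N (T t w - w) = 0" using norm_emb[OF H_diff[OF T_H[OF t wH] wH]] by simp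
  then have "T t w - w = 0" by (rule N_eq_0[OF H_diff[OF T_H[OF t wH] wH]])
  then show ?thesis by simp
qed

end

section \<open>The direct sum and its bounded projection\<close>

context transmission
begin

abbreviation "ker \<equiv> kerAF L1 L2 L3 a b m k"
abbreviation "rng \<equiv> rangeAF L1 L2 L3 a b m k"

lemma ker_D0: "U \<in> ker \<Longrightarrow> ell U = 0 \<Longrightarrow> U = 0"
  using D0_unique[of U] by (simp add: kerAF_def D0_def)

lemma ker_scale: "U \<in> ker \<Longrightarrow> scale_state c U \<in> ker"
  using D_scale[of U c] scale_state_zero by (simp add: kerAF_def)

lemma ker_diff: "U \<in> ker \<Longrightarrow> V \<in> ker \<Longrightarrow> U - V \<in> ker"
  using D_diff[of U V] by (simp add: kerAF_def)

lemma ker_H: "U \<in> ker \<Longrightarrow> U \<in> H"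
  using D_subset_H by (simp add: kerAF_def)

lemma ker_eqI: "U \<in> ker \<Longrightarrow> V \<in> ker \<Longrightarrow> ell U = ell V \<Longrightarrow> U = V"
  using ker_D0[OF ker_diff, of U V] ell_diff[OF ker_H ker_H, of U V] by simp

text \<open>The functional \<open>ell\<close> is injective on the kernel and its null space is the
  range, so the kernel component is the multiple of \<kappa> with the same value of
  \<open>ell\<close>.\<close>

theorem direct_sum:
  assumes U: "U \<in> H"
  shows "\<exists>!(W0, V0). W0 \<in> ker \<and> V0 \<in> rng \<and> U = W0 + V0"
proof -
  obtain \<kappa> where \<kappa>: "\<kappa> \<in> D" "A \<kappa> = 0" "ell \<kappa> \<noteq> 0" by (rule ex_kernel)
  have \<kappa>k: "\<kappa> \<in> ker" using \<kappa> by (simp add: kerAF_def)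
  define w where "w = scale_state (ell U / ell \<kappa>) \<kappa>"
  have W: "w \<in> ker" "ell w = ell U"
    using ker_scale[OF \<kappa>k] ell_scale[OF ker_H[OF \<kappa>k]] \<kappa>(3) by (simp_all add: w_def)
  have V: "U - w \<in> rng"
    using H_diff[OF U ker_H[OF W(1)]] ell_diff[OF U ker_H[OF W(1)]] W(2) by (simp add: range_iff)
  show ?thesis
  proof (rule ex1I[of _ "(w, U - w)"])
    show "case (w, U - w) of (X, Y) \<Rightarrow> X \<in> ker \<and> Y \<in> rng \<and> U = X + Y" using W V by simp
    fix p assume p: "case p of (X, Y) \<Rightarrow> X \<in> ker \<and> Y \<in> rng \<and> U = X + Y"
    obtain W' V' where eq: "p = (W', V')" by (cases p)
    have p': "W' \<in> ker" "V' \<in> rng" "U = W' + V'" using p by (auto simp: eq)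
    have "ell U = ell W'" using ell_add[OF ker_H[OF p'(1)], of V'] p' by (auto simp: range_iff)
    then have "W' = w" using W by (intro ker_eqI p') auto
    then show "p = (w, U - w)" using p'(3) by (simp add: eq)
  qed
qed

text \<open>The kernel component depends on the state only through \<open>ell\<close>, which is
  bounded for \<open>N\<close>; hence so is the projection onto the range along the kernel. This
  makes the decay constant independent of the decomposition.\<close>

lemma projection_bound: obtains C where "0 \<le> C" "\<And>w v. w \<in> ker \<Longrightarrow> v \<in> rng \<Longrightarrow> N v \<le> C * N (w + v)"
proof -
  obtain \<kappa> where \<kappa>: "\<kappa> \<in> D" "A \<kappa> = 0" "ell \<kappa> \<noteq> 0" by (rule ex_kernel)
  have \<kappa>k: "\<kappa> \<in> ker" using \<kappa> by (simp add: kerAF_def)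
  have ip1: "LS (\<lambda>U. (norm (ip (pt U) (one L1 L2)))\<^sup>2) (\<lambda>U. (N U)\<^sup>2)"
    by (rule lesssim_mono[OF lesssim_scale[OF LS_coords(3), of "L2 - L1"]]) (use ip_one_sq[OF L12(1)] L in auto)
  have "LS (\<lambda>U. (norm (ell U))\<^sup>2) (\<lambda>U. (N U)\<^sup>2)"
  proof (rule lesssim_mono[OF lesssim_add[OF lesssim_scale[OF ip1, of 2]
          lesssim_scale[OF lesssim_trans[OF LS_pot(5) pot_le_N], of "2 * m\<^sup>2"]]])
    fix U
    show "(norm (ell U))\<^sup>2 \<le> 2 * (norm (ip (pt U) (one L1 L2)))\<^sup>2 + 2 * m\<^sup>2 * (norm (t2 U - t1 U))\<^sup>2"
      using norm_add_sq[of "ip (pt U) (one L1 L2)" "complex_of_real m * (t2 U - t1 U)"]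
      by (simp add: ell_def norm_mult power_mult_distrib)
  qed auto
  then obtain C where C: "0 \<le> C" "\<And>U. U \<in> H \<Longrightarrow> (norm (ell U))\<^sup>2 \<le> C * (N U)\<^sup>2"
    unfolding lesssim_def by blast
  have ell: "norm (ell U) \<le> sqrt C * N U" if "U \<in> H" for U
  proof (rule power2_le_imp_le)
    show "(norm (ell U))\<^sup>2 \<le> (sqrt C * N U)\<^sup>2" using C(1) C(2)[OF that] by (simp add: power_mult_distrib)
    show "0 \<le> sqrt C * N U" using C(1) N_nonneg[OF that] by simp
  qed
  \<comment> \<open>The coefficient \<open>ell w / ell \<kappa>\<close> is complex, so homogeneity
    of \<open>N\<close> for real scalars does not suffice.\<close>
  have Nsc: "N (scale_state c U) = cmod c * N U" if "U \<in> H" for c U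
  proof -
    have "(N (scale_state c U))\<^sup>2 = (cmod c * N U)\<^sup>2"
      unfolding power_mult_distrib N_sq[OF that] N_sq[OF H_scale(1)[OF that]]
      by (simp add: H_scale that norm_csc power_mult_distrib algebra_simps)
    then show ?thesis using N_nonneg[OF that] N_nonneg[OF H_scale(1)[OF that]] by (simp add: power2_eq_iff_nonneg)
  qed
  define G where "G = 1 + sqrt C / cmod (ell \<kappa>) * N \<kappa>"
  have \<kappa>N: "0 \<le> N \<kappa>" by (rule N_nonneg[OF ker_H[OF \<kappa>k]])
  show ?thesis
  proof (rule that[of G])
    show "0 \<le> G" using C(1) \<kappa>N by (simp add: G_def)
    fix w v assume W: "w \<in> ker" and V: "v \<in> rng"
    have vH: "v \<in> H" "ell v = 0" using V by (auto simp: range_iff)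
    note wH = ker_H[OF W]
    have UH: "w + v \<in> H" by (rule H_add(1)[OF wH vH(1)])
    have eU: "ell (w + v) = ell w" using ell_add[OF wH vH(1)] vH(2) by simp
    have "w = scale_state (ell w / ell \<kappa>) \<kappa>"
      using \<kappa>(3) ell_scale[OF ker_H[OF \<kappa>k]] by (intro ker_eqI W ker_scale \<kappa>k) simp
    then have "N w = cmod (ell w / ell \<kappa>) * N \<kappa>" using Nsc[OF ker_H[OF \<kappa>k]] by metis
    also have "\<dots> = cmod (ell (w + v)) / cmod (ell \<kappa>) * N \<kappa>" by (simp add: eU norm_divide)
    also have "\<dots> \<le> sqrt C * N (w + v) / cmod (ell \<kappa>) * N \<kappa>"
      using ell[OF UH] \<kappa>N by (intro mult_right_mono divide_right_mono) auto
    finally have "N w \<le> sqrt C / cmod (ell \<kappa>) * N \<kappa> * N (w + v)" by (simp add: ac_simps)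
    moreover have "N v \<le> N (w + v) + N w"
      using N_triangle[OF UH H_uminus[OF wH]] N_uminus[OF wH] by simp
    ultimately show "N v \<le> G * N (w + v)" by (simp add: G_def distrib_right)
  qed
qed

end

theorem theoremA1:
  fixes L1 L2 L3 a b m k :: real and T :: "real \<Rightarrow> state \<Rightarrow> state"
  assumes "0 < L1" "L1 < L2" "L2 < L3" "0 < a" "0 < b" "0 < m" "0 < k"
    and "generates (HF L1 L2 L3) scale_state (normF L1 L2 L3 a b)
           (domAF L1 L2 L3 a b m) (opAF L1 L2 L3 a b m k) T"
  shows "(\<forall>U0\<in>HF L1 L2 L3. \<exists>!(W0, V0).
            W0 \<in> kerAF L1 L2 L3 a b m k \<and> V0 \<in> rangeAF L1 L2 L3 a b m k \<and> U0 = W0 + V0) \<and>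
         (\<exists>M>0. \<exists>\<omega>>0. \<forall>U0\<in>HF L1 L2 L3.
            \<forall>W0\<in>kerAF L1 L2 L3 a b m k. \<forall>V0\<in>rangeAF L1 L2 L3 a b m k. U0 = W0 + V0 \<longrightarrow>
              (\<forall>t\<ge>0. normF L1 L2 L3 a b (T t U0 - W0)
                 \<le> M * exp (- \<omega> * t) * normF L1 L2 L3 a b U0))"
proof -
  interpret thermoelastic_semigroup L1 L2 L3 a b m k T
    by unfold_locales (fact assms)+
  obtain K \<omega> where K: "0 < K" "0 < \<omega>"
    "\<And>x t. x \<in> H \<Longrightarrow> ell x = 0 \<Longrightarrow> 0 \<le> t \<Longrightarrow> N (T t x) \<le> K * exp (- \<omega> * t) * N x"
    by (rule decay_range) blast
  obtain C where C: "0 \<le> C" "\<And>w v. w \<in> ker \<Longrightarrow> v \<in> rng \<Longrightarrow> N v \<le> C * N (w + v)"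
    by (rule projection_bound) blast
  \<comment> \<open>The kernel component is stationary, so only the range component decays. Taking
    \<open>C + 1\<close> instead of \<open>C\<close> keeps the constant strictly positive.\<close>
  have "N (T t U0 - W0) \<le> K * (C + 1) * exp (- \<omega> * t) * N U0"
    if W: "W0 \<in> ker" and V: "V0 \<in> rng" and U: "U0 = W0 + V0" and t: "0 \<le> t" for U0 W0 V0 t
  proof -
    have VH: "V0 \<in> H" "ell V0 = 0" using V by (auto simp: range_iff)
    note WH = ker_H[OF W]
    have UH: "U0 \<in> H" unfolding U by (rule H_add(1)[OF WH VH(1)])
    have "T t W0 = W0" using W t by (intro T_kernel) (auto simp: kerAF_def)
    then have "T t U0 - W0 = T t V0" using T_add[OF t WH VH(1)] U by simp
    then have "N (T t U0 - W0) \<le> K * exp (- \<omega> * t) * N V0" using K(3)[OF VH t] by simp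
    also have "\<dots> \<le> K * exp (- \<omega> * t) * ((C + 1) * N U0)"
      using C(2)[OF W V] N_nonneg[OF UH] K(1) unfolding U[symmetric]
      by (intro mult_left_mono) (auto simp: distrib_right)
    finally show ?thesis by (simp add: ac_simps)
  qed
  moreover have "0 < K * (C + 1)" using K(1) C(1) by simp
  ultimately show ?thesis using direct_sum K(2) by blast
qed

end
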